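(* Let $X=\{x_0,x_1\}$, $Y=\{y_k\}_{k\ge1}$, let ш and $*_{\mathrm{st}}$ denote the shuffle and stuffle (quasi-shuffle) products, and let $\zeta_{\text{ш}}$ and $\gamma_\bullet$ be the characters defined in the context. These characters extend algebraically to characters as follows: $$\zeta_{\text{ш}}:(\mathbb{C}\langle X\rangle\,\text{ш}\,\mathbb{C}^{\mathrm{rat}}_{\mathrm{exc}}\langle\langle X\rangle\rangle,\text{ш},1_{X^*})\longrightarrow(\mathbb{C},\cdot,1),\qquad (tx_0)^*,(tx_1)^*\longmapsto1_{\mathbb{C}}\quad\text{for all }t\in\mathbb{C},\ |t|<1,$$ and $$\gamma_\bullet:(\mathbb{C}\langle Y\rangle *_{\mathrm{st}}\mathbb{C}^{\mathrm{rat}}_{\mathrm{exc}}\langle\langle Y\rangle\rangle,*_{\mathrm{st}},1_{Y^*})\longrightarrow(\mathbb{C},\cdot,1),\qquad (t^ry_r)^*\longmapsto\Gamma_{y_r}^{-1}(1+t)\quad\text{for all }t\in\mathbb{C},\ |t|<1,\ r\ge1.$$ Moreover, the morphism $(\mathbb{C}[\{y_r^*\}_{r\ge1}],\text{ш},1_{Y^*})\longrightarrow\mathbb{C}[E]$ mapping $y_r^*$ to the function $z\mapsto\Gamma_{y_r}^{-1}(1+z)$ is injective, and, for $r\ge1$ (and $|t|<1$), $$\Gamma_{y_{2r}}(1+\sqrt[2r]{-1}\,t)=\Gamma_{y_r}(1+t)\,\Gamma_{y_r}(1+\sqrt[r]{-1}\,t).$$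
   Context: Eulerian functions: with $\zeta$ the Riemann zeta function and $\gamma$ Euler's constant, for $|z|<1$ put $\ell_1(z):=\gamma z-\sum_{k\ge2}\zeta(k)\frac{(-z)^k}{k}$, $\ell_r(z):=-\sum_{k\ge1}\zeta(kr)\frac{(-z^r)^k}{k}$ for $r\ge2$, and $\Gamma_{y_r}(1+z):=e^{-\ell_r(z)}$, so that the reciprocal $\Gamma_{y_r}^{-1}(1+z)=e^{\ell_r(z)}$. $E:=\mathrm{span}_{\mathbb{C}}\{e^{\ell_r}\}_{r\ge1}$ and $\mathbb{C}[E]$ is the algebra of functions it generates. $\sqrt[m]{-1}$ denotes an $m$-th root of $-1$. Words and products: $\mathcal{X}^*$ is the free monoid on an alphabet $\mathcal{X}$ ($X$ or $Y$), $\mathbb{C}\langle\mathcal{X}\rangle$ the noncommutative polynomials and $\mathbb{C}\langle\langle\mathcal{X}\rangle\rangle$ the noncommutative series. The stuffle product is defined by $1*_{\mathrm{st}}w=w*_{\mathrm{st}}1=w$ and $y_iu*_{\mathrm{st}}y_jv=y_i(u*_{\mathrm{st}}y_jv)+y_j(y_iu*_{\mathrm{st}}v)+y_{i+j}(u*_{\mathrm{st}}v)$. $S^*=\sum_{n\ge0}S^n$ is the Kleene star of a series with zero constant term. $\mathbb{C}^{\mathrm{rat}}\langle\langle\mathcal{X}\rangle\rangle$ is the closure of the homogeneous series of degree one under sum, concatenation and Kleene star; $\mathbb{C}^{\mathrm{rat}}_{\mathrm{exc}}\langle\langle\mathcal{X}\rangle\rangle$ is the set of rational series which are exchangeable (the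 coefficient of a word depends only on the number of occurrences of each letter in it). $\mathbb{C}[\{y_r^*\}_{r\ge1}]$ is the shuffle algebra generated by the $y_r^*$. Characters on polynomials: order $x_0<x_1$ and $y_1>y_2>\cdots$; the Lyndon words $\mathcal{L}yn\,X$ (resp. $\mathcal{L}yn\,Y$) freely generate the shuffle (resp. stuffle) algebra. Let $\pi_Y$ send $x_0^{s_1-1}x_1\cdots x_0^{s_m-1}x_1$ to $y_{s_1}\cdots y_{s_m}$; for a Lyndon word $l\in\mathcal{L}yn\,X\setminus X$ with $\pi_Yl=y_{s_1}\cdots y_{s_m}$, put $\zeta(l)=\sum_{n_1>\cdots>n_m>0}n_1^{-s_1}\cdots n_m^{-s_m}$. Then $\zeta_{\text{ш}}$ is the character of $(\mathbb{C}\langle X\rangle,\text{ш})$ with $\zeta_{\text{ш}}(x_0)=\zeta_{\text{ш}}(x_1)=0$ and $\zeta_{\text{ш}}(l)=\zeta(l)$ for $l\in\mathcal{L}yn\,X\setminus X$; and $\gamma_\bullet$ is the character of $(\mathbb{C}\langle Y\rangle,*_{\mathrm{st}})$ with $\gamma_{y_1}=\gamma$ and $\gamma_{\pi_Yl}=\zeta(l)$ for $l\in\mathcal{L}yn\,X\setminus X$. A character $\chi$ is evaluated on a series $S=\sum_nS_n$, $S_n=\sum_{|w|=n}\langle S|w\rangle w$, by $\chi_S=\sum_n\chi_{S_n}$ when this converges. *)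

theory Defs
  imports "HOL-Analysis.Analysis" "HOL-Library.Multiset"
begin

subsection \<open>Noncommutative series\<close>

text \<open>A series is its coefficient function: \<open>S w\<close> stands for $\langle S | w\rangle$.\<close>

type_synonym 'a series = "'a list \<Rightarrow> complex"

definition word_series :: "'a list \<Rightarrow> 'a series" where
  "word_series u = (\<lambda>w. if w = u then 1 else 0)"

definition add_series :: "'a series \<Rightarrow> 'a series \<Rightarrow> 'a series" where
  "add_series S T = (\<lambda>w. S w + T w)"

definition scale_series :: "complex \<Rightarrow> 'a series \<Rightarrow> 'a series" where
  "scale_series c S = (\<lambda>w. c * S w)"

definition polynomials :: "'a series set" where
  "polynomials = {P. finite {w. P w \<noteq> 0}}"

definition hom_part :: "nat \<Rightarrow> 'a series \<Rightarrow> 'a series" where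
  "hom_part n S = (\<lambda>w. if length w = n then S w else 0)"

definition conc :: "'a series \<Rightarrow> 'a series \<Rightarrow> 'a series" where
  "conc S T = (\<lambda>w. \<Sum>i\<le>length w. S (take i w) * T (drop i w))"

primrec conc_power :: "'a series \<Rightarrow> nat \<Rightarrow> 'a series" where
  "conc_power S 0 = word_series []"
| "conc_power S (Suc n) = conc S (conc_power S n)"

text \<open>Only used when \<open>S [] = 0\<close>; then \<open>conc_power S n w = 0\<close> for \<open>n > length w\<close>, so the
  series below has finitely many nonzero terms.\<close>

definition star :: "'a series \<Rightarrow> 'a series" where
  "star S = (\<lambda>w. \<Sum>n. conc_power S n w)"

text \<open>The closure is taken among complex vector spaces of series. Without the rule \<open>scale\<close> the
  constant terms would all be natural numbers. On an infinite alphabet the homogeneous series of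
  degree one are the possibly infinite linear combinations of letters.\<close>

inductive_set rational_series :: "'a series set" where
  degree_one: "(\<And>w. length w \<noteq> 1 \<Longrightarrow> S w = 0) \<Longrightarrow> S \<in> rational_series"
| scale: "S \<in> rational_series \<Longrightarrow> scale_series c S \<in> rational_series"
| add: "S \<in> rational_series \<Longrightarrow> T \<in> rational_series \<Longrightarrow> add_series S T \<in> rational_series"
| conc: "S \<in> rational_series \<Longrightarrow> T \<in> rational_series \<Longrightarrow> conc S T \<in> rational_series"
| star: "S \<in> rational_series \<Longrightarrow> S [] = 0 \<Longrightarrow> star S \<in> rational_series"

definition exchangeable :: "'a series \<Rightarrow> bool" where
  "exchangeable S \<longleftrightarrow> (\<forall>u v. mset u = mset v \<longrightarrow> S u = S v)"

definition rational_exchangeable :: "'a series set" where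
  "rational_exchangeable = {S \<in> rational_series. exchangeable S}"


subsection \<open>Shuffle and stuffle\<close>

definition lcons :: "'a \<Rightarrow> 'a series \<Rightarrow> 'a series" where
  "lcons a S = (\<lambda>w. case w of [] \<Rightarrow> 0 | b # w' \<Rightarrow> if b = a then S w' else 0)"

fun shuffle_words :: "'a list \<Rightarrow> 'a list \<Rightarrow> 'a series" where
  "shuffle_words [] v = word_series v"
| "shuffle_words u [] = word_series u"
| "shuffle_words (a # u) (b # v) =
     add_series (lcons a (shuffle_words u (b # v))) (lcons b (shuffle_words (a # u) v))"

typedef yletter = "{k::nat. 1 \<le> k}" morphisms index_of y
  by auto

fun stuffle_words :: "yletter list \<Rightarrow> yletter list \<Rightarrow> yletter series" where
  "stuffle_words [] v = word_series v"
| "stuffle_words u [] = word_series u"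
| "stuffle_words (a # u) (b # v) =
     add_series (lcons a (stuffle_words u (b # v)))
       (add_series (lcons b (stuffle_words (a # u) v))
         (lcons (y (index_of a + index_of b)) (stuffle_words u v)))"

text \<open>Bilinear extension to series. The index sets are finite, see \<open>finite_shuffle_words\<close> and
  \<open>finite_stuffle_words\<close>.\<close>

definition shuffle :: "'a series \<Rightarrow> 'a series \<Rightarrow> 'a series" where
  "shuffle S T = (\<lambda>w. \<Sum>(u, v) | shuffle_words u v w \<noteq> 0. S u * T v * shuffle_words u v w)"

definition stuffle :: "yletter series \<Rightarrow> yletter series \<Rightarrow> yletter series" where
  "stuffle S T = (\<lambda>w. \<Sum>(u, v) | stuffle_words u v w \<noteq> 0. S u * T v * stuffle_words u v w)"

lemma shuffle_words_support:
  "shuffle_words u v w \<noteq> 0 \<Longrightarrow> length u + length v = length w \<and> set u \<union> set v = set w"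
proof (induction u v arbitrary: w rule: shuffle_words.induct)
  case (3 a u b v)
  then obtain c w' where w: "w = c # w'"
    by (cases w) (auto simp: add_series_def lcons_def)
  then have "(c = a \<and> shuffle_words u (b # v) w' \<noteq> 0) \<or> (c = b \<and> shuffle_words (a # u) v w' \<noteq> 0)"
    using "3.prems" by (auto simp: add_series_def lcons_def split: if_splits)
  then show ?case using "3.IH"[of w'] w by fastforce
qed (auto simp: word_series_def split: if_splits)

lemma finite_shuffle_words: "finite {(u, v). shuffle_words u v w \<noteq> 0}"
proof (rule finite_subset)
  let ?L = "{u. set u \<subseteq> set w \<and> length u \<le> length w}"
  show "{(u, v). shuffle_words u v w \<noteq> 0} \<subseteq> ?L \<times> ?L"
    using shuffle_words_support by fastforce
  show "finite (?L \<times> ?L)"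
    by (intro finite_cartesian_product finite_lists_length_le) auto
qed

lemma index_of_pos: "1 \<le> index_of a"
  using index_of[of a] by simp

lemma stuffle_words_support:
  "stuffle_words u v w \<noteq> 0 \<Longrightarrow>
    sum_list (map index_of u) + sum_list (map index_of v) = sum_list (map index_of w)"
proof (induction u v arbitrary: w rule: stuffle_words.induct)
  case (3 a u b v)
  then obtain c w' where w: "w = c # w'"
    by (cases w) (auto simp: add_series_def lcons_def)
  then have "(c = a \<and> stuffle_words u (b # v) w' \<noteq> 0) \<or> (c = b \<and> stuffle_words (a # u) v w' \<noteq> 0)
      \<or> (c = y (index_of a + index_of b) \<and> stuffle_words u v w' \<noteq> 0)"
    using "3.prems" by (auto simp: add_series_def lcons_def split: if_splits)
  moreover have "index_of (y (index_of a + index_of b)) = index_of a + index_of b"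
    using index_of_pos[of a] by (simp add: y_inverse)
  ultimately show ?case using "3.IH"[of w'] w by fastforce
qed (auto simp: word_series_def split: if_splits)

lemma finite_stuffle_words: "finite {(u, v). stuffle_words u v w \<noteq> 0}"
proof (rule finite_subset)
  let ?n = "sum_list (map index_of w)"
  let ?L = "{u. set u \<subseteq> y ` {..?n} \<and> length u \<le> ?n}"
  have L: "u \<in> ?L" if "sum_list (map index_of u) \<le> ?n" for u
  proof -
    have "length u \<le> sum_list (map index_of u)"
    proof (induction u)
      case (Cons a u)
      then show ?case using index_of_pos[of a] by simp
    qed simp
    moreover have "a \<in> y ` {..?n}" if "a \<in> set u" for a
    proof -
      have "index_of a \<le> sum_list (map index_of u)"
        using that by (simp add: member_le_sum_list)
      then have "index_of a \<le> ?n" using \<open>sum_list (map index_of u) \<le> ?n\<close> by simp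
      then show ?thesis by (metis atMost_iff imageI index_of_inverse)
    qed
    ultimately show ?thesis using that by auto
  qed
  show "{(u, v). stuffle_words u v w \<noteq> 0} \<subseteq> ?L \<times> ?L"
  proof (rule subsetI, elim CollectE case_prodE)
    fix p u v
    assume p: "p = (u, v)" and "stuffle_words u v w \<noteq> 0"
    from this(2) have *: "sum_list (map index_of u) + sum_list (map index_of v) = ?n"
      by (rule stuffle_words_support)
    have "u \<in> ?L" by (rule L) (use * in linarith)
    moreover have "v \<in> ?L" by (rule L) (use * in linarith)
    ultimately show "p \<in> ?L \<times> ?L" unfolding p by (rule SigmaI)
  qed
  show "finite (?L \<times> ?L)"
    by (intro finite_cartesian_product finite_lists_length_le) auto
qed


subsection \<open>Algebras of series and their characters\<close>

text \<open>In the next three definitions \<open>m\<close> is the product, \<open>shuffle\<close> or \<open>stuffle\<close>; its unit is the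
  empty word.\<close>

definition product_span ::
    "('a series \<Rightarrow> 'a series \<Rightarrow> 'a series) \<Rightarrow> 'a series set \<Rightarrow> 'a series set \<Rightarrow> 'a series set" where
  "product_span m A B = {(\<lambda>w. \<Sum>i<n. m (P i) (S i) w) | (n::nat) P S. \<forall>i<n. P i \<in> A \<and> S i \<in> B}"

inductive_set generated_algebra ::
    "('a series \<Rightarrow> 'a series \<Rightarrow> 'a series) \<Rightarrow> 'a series set \<Rightarrow> 'a series set"
  for m :: "'a series \<Rightarrow> 'a series \<Rightarrow> 'a series" and G :: "'a series set" where
  one: "word_series [] \<in> generated_algebra m G"
| gen: "S \<in> G \<Longrightarrow> S \<in> generated_algebra m G"
| scale: "S \<in> generated_algebra m G \<Longrightarrow> scale_series c S \<in> generated_algebra m G"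
| add: "S \<in> generated_algebra m G \<Longrightarrow> T \<in> generated_algebra m G
    \<Longrightarrow> add_series S T \<in> generated_algebra m G"
| mult: "S \<in> generated_algebra m G \<Longrightarrow> T \<in> generated_algebra m G
    \<Longrightarrow> m S T \<in> generated_algebra m G"

definition character_on ::
    "'a series set \<Rightarrow> ('a series \<Rightarrow> 'a series \<Rightarrow> 'a series) \<Rightarrow> ('a series \<Rightarrow> complex) \<Rightarrow> bool" where
  "character_on A m \<phi> \<longleftrightarrow>
     \<phi> (word_series []) = 1 \<and>
     (\<forall>c. \<forall>S\<in>A. \<phi> (scale_series c S) = c * \<phi> S) \<and>
     (\<forall>S\<in>A. \<forall>T\<in>A. \<phi> (add_series S T) = \<phi> S + \<phi> T) \<and>
     (\<forall>S\<in>A. \<forall>T\<in>A. \<phi> (m S T) = \<phi> S * \<phi> T)"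


subsection \<open>The characters on polynomials\<close>

datatype xletter = X0 | X1

definition lyndon_X :: "xletter list set" where
  "lyndon_X = {l. l \<noteq> [] \<and> (\<forall>u v. l = u @ v \<and> u \<noteq> [] \<and> v \<noteq> [] \<longrightarrow> (l, v) \<in> lexord {(X0, X1)})}"

text \<open>\<open>pi_Y_acc n\<close> reads a word preceded by \<open>n\<close> letters \<open>X0\<close>. Only the values at words ending in
  \<open>X1\<close> matter.\<close>

fun pi_Y_acc :: "nat \<Rightarrow> xletter list \<Rightarrow> yletter list" where
  "pi_Y_acc n [] = []"
| "pi_Y_acc n (X0 # w) = pi_Y_acc (Suc n) w"
| "pi_Y_acc n (X1 # w) = y (Suc n) # pi_Y_acc 0 w"

definition pi_Y :: "xletter list \<Rightarrow> yletter list" where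
  "pi_Y = pi_Y_acc 0"

definition multi_zeta :: "nat list \<Rightarrow> complex" where
  "multi_zeta s =
     (\<Sum>\<^sub>\<infinity>n \<in> {n :: nat list. length n = length s \<and> sorted_wrt (>) n \<and> (\<forall>k\<in>set n. 0 < k)}.
        \<Prod>i<length s. 1 / of_nat (n ! i) ^ (s ! i))"

definition zeta_lyndon :: "xletter list \<Rightarrow> complex" where
  "zeta_lyndon l = multi_zeta (map index_of (pi_Y l))"

text \<open>Each of the next two predicates determines its character uniquely on polynomials, since the
  Lyndon words freely generate the shuffle algebra over \<open>X\<close> and their images under \<open>pi_Y\<close>,
  together with \<open>y 1\<close>, freely generate the stuffle algebra over \<open>Y\<close>.\<close>

definition is_zeta_shuffle :: "(xletter series \<Rightarrow> complex) \<Rightarrow> bool" where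
  "is_zeta_shuffle \<phi> \<longleftrightarrow>
     character_on polynomials shuffle \<phi> \<and>
     \<phi> (word_series [X0]) = 0 \<and> \<phi> (word_series [X1]) = 0 \<and>
     (\<forall>l \<in> lyndon_X - {[X0], [X1]}. \<phi> (word_series l) = zeta_lyndon l)"

definition is_gamma_stuffle :: "(yletter series \<Rightarrow> complex) \<Rightarrow> bool" where
  "is_gamma_stuffle \<phi> \<longleftrightarrow>
     character_on polynomials stuffle \<phi> \<and>
     \<phi> (word_series [y 1]) = euler_mascheroni \<and>
     (\<forall>l \<in> lyndon_X - {[X0], [X1]}. \<phi> (word_series (pi_Y l)) = zeta_lyndon l)"


subsection \<open>Eulerian functions\<close>

text \<open>The Riemann zeta function, needed only at integers \<open>k \<ge> 2\<close>.\<close>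

definition zeta_nat :: "nat \<Rightarrow> complex" where
  "zeta_nat k = (\<Sum>n. 1 / of_nat (Suc n) ^ k)"

definition ell :: "nat \<Rightarrow> complex \<Rightarrow> complex" where
  "ell r z =
     (if r = 1 then euler_mascheroni * z - (\<Sum>j. zeta_nat (j + 2) * (- z) ^ (j + 2) / of_nat (j + 2))
      else - (\<Sum>j. zeta_nat ((j + 1) * r) * (- (z ^ r)) ^ (j + 1) / of_nat (j + 1)))"

text \<open>The argument is \<open>1 + z\<close> with \<open>norm z < 1\<close>.\<close>

definition Gamma_y :: "nat \<Rightarrow> complex \<Rightarrow> complex" where
  "Gamma_y r w = exp (- ell r (w - 1))"

text \<open>Functions on the open unit disc are extensional functions, so that equality means equality
  on the disc.\<close>

abbreviation disc :: "complex set" where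
  "disc \<equiv> ball 0 1"

definition eulerian_span :: "(complex \<Rightarrow> complex) set" where
  "eulerian_span = {(\<lambda>z\<in>disc. \<Sum>r\<in>F. c r * exp (ell r z)) | F c. finite F \<and> F \<subseteq> {1..}}"

inductive_set eulerian_algebra :: "(complex \<Rightarrow> complex) set" where
  const: "(\<lambda>z\<in>disc. c) \<in> eulerian_algebra"
| span: "f \<in> eulerian_span \<Longrightarrow> f \<in> eulerian_algebra"
| add: "f \<in> eulerian_algebra \<Longrightarrow> g \<in> eulerian_algebra \<Longrightarrow> (\<lambda>z\<in>disc. f z + g z) \<in> eulerian_algebra"
| mult: "f \<in> eulerian_algebra \<Longrightarrow> g \<in> eulerian_algebra \<Longrightarrow> (\<lambda>z\<in>disc. f z * g z) \<in> eulerian_algebra"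

definition morphism_to_functions ::
    "'a series set \<Rightarrow> ('a series \<Rightarrow> 'a series \<Rightarrow> 'a series) \<Rightarrow> ('a series \<Rightarrow> complex \<Rightarrow> complex) \<Rightarrow> bool"
  where
  "morphism_to_functions A m \<Phi> \<longleftrightarrow>
     \<Phi> (word_series []) = (\<lambda>z\<in>disc. 1) \<and>
     (\<forall>c. \<forall>S\<in>A. \<Phi> (scale_series c S) = (\<lambda>z\<in>disc. c * \<Phi> S z)) \<and>
     (\<forall>S\<in>A. \<forall>T\<in>A. \<Phi> (add_series S T) = (\<lambda>z\<in>disc. \<Phi> S z + \<Phi> T z)) \<and>
     (\<forall>S\<in>A. \<forall>T\<in>A. \<Phi> (m S T) = (\<lambda>z\<in>disc. \<Phi> S z * \<Phi> T z))"

end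

theory Submission
  imports Defs "HOL-Complex_Analysis.Complex_Analysis" "HOL-Number_Theory.Cong"
    "HOL-Computational_Algebra.Polynomial_Factorial" "HOL-Real_Asymp.Real_Asymp"
    "HOL-Library.Function_Algebras"
begin

text \<open>
  An exchangeable series over \<open>X\<close> has homogeneous parts spanned by shuffles of powers of the two
  letters, on which \<open>zeta_sh\<close> vanishes in positive degree. So the values on homogeneous parts form a
  finite sum on each product of a polynomial with such a series, and this sum is a character.

  The stuffle character is a product of exponentials of derivations, one for each weight, attached to
  primitive elements. On an exchangeable series these derivations commute, and on a rational one they
  act on a finite-dimensional space of series, where their total is described by finitely many
  possibly divergent sums of complex numbers. These are evaluated by a linear functional on all
  sequences that extends convergent summation. By Newton's identity the sum belonging to the star of
  \<open>t ^ r\<close> times the letter \<open>y r\<close> is \<open>ell r t\<close>.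

  For the injectivity, \<open>exp (ell r z)\<close> is the product of the entire functions \<open>rGamma (1 - \<zeta> * z)\<close> over
  \<open>\<zeta> ^ r = -1\<close>. At \<open>z = - (n + 1 / 2)\<close> its logarithm grows like a constant times \<open>n\<close> for \<open>r \<ge> 2\<close>, and
  faster for \<open>r = 1\<close>. A Galois argument shows that the only rational relation between the growth
  constants is that the one for \<open>r = 6\<close> is twice the one for \<open>r = 2\<close>, and there a logarithmic term
  decides. So distinct monomials in the \<open>exp (ell r z)\<close> have different growth.
\<close>

subsection \<open>Galois conjugates of sums of roots of unity\<close>

text \<open>Over the alphabet \<open>Y\<close> a rational exchangeable series may be an arbitrary
  infinite combination of letters, so its homogeneous parts need not be polynomials; and the sum
  over weights attached to the star of c times a letter diverges when the modulus of c exceeds 1.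
  Summation alone therefore cannot define the stuffle extension, while assigning values product by
  product would leave all relations between such products to be checked. Instead, every
  approximation is a homomorphism on all series of exponential growth, built from finitely many
  words. On a given element of the span all sufficiently fine approximations agree, and their common
  value inherits additivity and multiplicativity. The summation functional is an arbitrary choice,
  harmless wherever the sums converge.

  In the injectivity, monomials are compared by size along one sequence of points. Two of them can
  tie in the leading rate only through an integer relation between growth constants; this is how
  cyclotomic arithmetic enters an analytic statement.\<close>

lemma freshman_dvd:
  fixes x y :: "'a::comm_ring_1"
  assumes "prime (p::nat)"
  shows "of_nat p dvd (x + y) ^ p - (x ^ p + y ^ p)"
proof -
  have p: "p \<ge> 2" using assms by (rule prime_ge_2_nat)
  have "(x + y) ^ p = (\<Sum>k\<le>p. of_nat (p choose k) * x ^ k * y ^ (p - k))"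
    by (rule binomial_ring)
  also have "{..p} = insert 0 (insert p {0<..<p})" using p by auto
  also have "(\<Sum>k\<in>\<dots>. of_nat (p choose k) * x ^ k * y ^ (p - k))
      = y ^ p + (x ^ p + (\<Sum>k\<in>{0<..<p}. of_nat (p choose k) * x ^ k * y ^ (p - k)))"
    using p by (subst sum.insert; simp)
  finally have "(x + y) ^ p - (x ^ p + y ^ p)
      = (\<Sum>k\<in>{0<..<p}. of_nat (p choose k) * x ^ k * y ^ (p - k))"
    by simp
  moreover have "of_nat p dvd (of_nat (p choose k) * x ^ k * y ^ (p - k) :: 'a)"
    if "k \<in> {0<..<p}" for k
  proof -
    have "p dvd p choose k" using that assms by (intro dvd_choose_prime) auto
    then obtain m where "p choose k = p * m" by auto
    then show ?thesis by (simp add: mult.assoc)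
  qed
  ultimately show ?thesis by (auto intro!: dvd_sum)
qed

lemma prime_dvd_power_minus_self:
  fixes a :: int
  assumes "prime (p::nat)"
  shows "int p dvd a ^ p - a"
proof -
  have nat: "int p dvd int n ^ p - int n" for n
  proof (induction n)
    case 0
    then show ?case using prime_gt_0_nat[OF assms] by (simp add: power_0_left)
  next
    case (Suc n)
    have "int p dvd (int n + 1) ^ p - (int n ^ p + 1 ^ p)"
      using freshman_dvd[OF assms, of "int n" 1] by simp
    then have "int p dvd ((int n + 1) ^ p - (int n ^ p + 1)) + (int n ^ p - int n)"
      using Suc by (intro dvd_add) auto
    then show ?case by (simp add: algebra_simps)
  qed
  define n where "n = nat (a mod int p)"
  have n: "int n = a mod int p" using prime_gt_0_nat[OF assms] by (simp add: n_def)
  have "[a ^ p - a = int n ^ p - int n] (mod int p)"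
    unfolding n by (intro cong_diff cong_pow) (auto simp: cong_def)
  then show ?thesis using nat[of n] by (simp add: cong_dvd_iff)
qed

text \<open>Horner's scheme: multiplication by \<open>monom 1 1\<close> and addition of a constant
  are compatible with p-th powers modulo p, by \<open>freshman_dvd\<close> and, for the constant, by
  Fermat's little theorem.\<close>

lemma poly_frobenius:
  fixes g :: "int poly"
  assumes "prime (p::nat)"
  shows "\<exists>h. g ^ p = pcompose g (monom 1 p) + smult (int p) h"
proof -
  have "of_nat p dvd g ^ p - pcompose g (monom 1 p)"
  proof (induction g)
    case 0
    then show ?case using prime_gt_0_nat[OF assms] by (simp add: power_0_left)
  next
    case (pCons a g)
    have eq: "pCons a g = [:a:] + monom 1 1 * g" by (simp add: monom_altdef)
    have 1: "of_nat p dvd (pCons a g) ^ p - ([:a:] ^ p + (monom 1 1 * g) ^ p)"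
      unfolding eq using assms by (rule freshman_dvd)
    have "int p dvd a ^ p - a" using assms by (rule prime_dvd_power_minus_self)
    then obtain b where b: "a ^ p = a + int p * b" by (metis dvdE add.commute diff_add_cancel)
    have "[:a:] ^ p - [:a:] = of_nat p * [:b:]"
      using poly_const_pow[of a p] b by (simp add: of_nat_poly)
    then have 2: "of_nat p dvd [:a:] ^ p - [:a:]" by (metis dvd_triv_left)
    have 3: "of_nat p dvd monom 1 p * (g ^ p - pcompose g (monom 1 p))"
      using pCons.IH by (rule dvd_mult)
    have "of_nat p dvd ((pCons a g) ^ p - ([:a:] ^ p + (monom 1 1 * g) ^ p)) + ([:a:] ^ p - [:a:])
        + monom 1 p * (g ^ p - pcompose g (monom 1 p))"
      by (intro dvd_add 1 2 3)
    also have "\<dots> = pCons a g ^ p - pcompose (pCons a g) (monom 1 p)"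
      by (simp add: pcompose_pCons power_mult_distrib monom_power algebra_simps)
    finally show ?case .
  qed
  then obtain h where "g ^ p - pcompose g (monom 1 p) = of_nat p * h" by auto
  then have "g ^ p = pcompose g (monom 1 p) + smult (int p) h"
    by (simp add: of_nat_poly algebra_simps)
  then show ?thesis by blast
qed

section \<open>Integer polynomials evaluated at complex numbers\<close>

abbreviation ev :: "int poly \<Rightarrow> complex \<Rightarrow> complex" where
  "ev H z \<equiv> poly (map_poly of_int H) z"

lemma ev_simps [simp]: "ev 0 z = 0" "ev 1 z = 1" "ev [:c:] z = of_int c"
  by (simp_all add: map_poly_pCons)

lemma ev_pCons [simp]: "ev (pCons a p) z = of_int a + z * ev p z"
  by (simp add: map_poly_pCons)

lemma ev_add: "ev (p + q) z = ev p z + ev q z"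
proof (induction p arbitrary: q)
  case (pCons a p)
  show ?case by (cases q) (simp add: pCons.IH distrib_left)
qed simp

lemma ev_smult: "ev (smult c p) z = of_int c * ev p z"
  by (induction p) (simp_all add: algebra_simps)

lemma ev_uminus: "ev (- p) z = - ev p z"
  by (induction p) simp_all

lemma ev_diff: "ev (p - q) z = ev p z - ev q z"
  using ev_add[of p "- q" z] by (simp add: ev_uminus)

lemma ev_mult: "ev (p * q) z = ev p z * ev q z"
  by (induction p) (simp_all add: ev_add ev_smult algebra_simps)

lemma ev_power: "ev (p ^ n) z = ev p z ^ n"
  by (induction n) (simp_all add: ev_mult)

lemma ev_monom: "ev (monom c n) z = of_int c * z ^ n"
  by (induction n) (simp_all add: monom_Suc monom_0)

lemma ev_pcompose: "ev (pcompose p q) z = ev p (ev q z)"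
  by (induction p) (simp_all add: pcompose_pCons ev_add ev_mult)

lemma ev_pderiv: "ev (pderiv (p * q)) z = ev (pderiv p) z * ev q z + ev p z * ev (pderiv q) z"
  by (simp add: pderiv_mult ev_add ev_mult algebra_simps)

text \<open>Pseudo-division by a polynomial of least degree gives divisibility only up to an integer
  factor \<open>a\<close>; Gauss's lemma on contents removes it because \<open>f\<close> is
  primitive. Divisibility over the integers, not just over the rationals, is what the congruence
  argument in \<open>conjugate_prime_power\<close> needs.\<close>

lemma primitive_minimal_poly:
  assumes "G \<noteq> 0" "ev G z = 0"
  obtains f where "f \<noteq> 0" "ev f z = 0" "content f = 1" "\<And>H. ev H z = 0 \<Longrightarrow> f dvd H"
    "\<And>H. ev H z = 0 \<Longrightarrow> degree H < degree f \<Longrightarrow> H = 0"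
proof -
  obtain f0 where f0: "f0 \<noteq> 0" "ev f0 z = 0"
    and min: "\<And>H. H \<noteq> 0 \<and> ev H z = 0 \<Longrightarrow> degree f0 \<le> degree H"
    using assms ex_has_least_nat[of "\<lambda>f. f \<noteq> 0 \<and> ev f z = 0" G degree] by blast
  define f where "f = primitive_part f0"
  have f0_eq: "f0 = smult (content f0) f" by (simp add: f_def)
  have f: "f \<noteq> 0" "content f = 1" "degree f = degree f0"
    using f0 by (simp_all add: f_def content_primitive_part)
  have evf: "ev f z = 0"
    using f0 f0_eq by (metis ev_smult mult_eq_0_iff of_int_eq_0_iff content_eq_zero_iff)
  have small: "H = 0" if "ev H z = 0" "degree H < degree f" for H
    using min[of H] that f by auto
  have "f dvd H" if H: "ev H z = 0" for H
  proof -
    define r where "r = pseudo_mod H f"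
    obtain a q where aq: "a \<noteq> 0" "smult a H = f * q + r"
      using pseudo_mod(1)[OF f(1), of H] unfolding r_def by blast
    have "ev r z = 0"
      using arg_cong[OF aq(2), of "\<lambda>p. ev p z"] H evf by (simp add: ev_add ev_mult ev_smult)
    then have "r = 0"
      using pseudo_mod(2)[OF f(1), of H] small unfolding r_def by auto
    then have eq: "smult a H = f * q" using aq by simp
    have "content q = normalize a * content H"
      using arg_cong[OF eq, of content] f by (simp add: content_mult)
    then have "a dvd content q" by (metis dvd_triv_left normalize_dvd_iff)
    then have "[:a:] dvd q" by (simp add: const_poly_dvd_iff_dvd_content)
    then obtain q' where "q = smult a q'" by (auto elim!: dvdE)
    then have "smult a H = smult a (f * q')" using eq by simp
    then have "H = f * q'" using aq(1) by (simp add: smult_cancel)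
    then show ?thesis by simp
  qed
  then show ?thesis using that f evf small by blast
qed

lemma monic_division:
  fixes f g :: "int poly"
  assumes "lead_coeff f = 1"
  obtains q r where "g = f * q + r" "r = 0 \<or> degree r < degree f"
proof -
  obtain q r where qr: "pseudo_divmod g f = (q, r)" by (cases "pseudo_divmod g f")
  have "f \<noteq> 0" using assms by auto
  from pseudo_divmod[OF this qr] assms that show ?thesis by auto
qed

text \<open>Dedekind's argument for the irreducibility of cyclotomic polynomials, carried out in the
  ring generated by z over the integers instead of over a finite field. Let X ^ L - 1 = f * g with f
  minimal for z. If f did not vanish at z ^ p, then g would, so g (z) ^ p would be p times an
  element of the ring, and differentiation at z would make p divide L ^ p.\<close>

lemma conjugate_prime_power:
  assumes z: "z ^ L = 1" and L: "L > 0" and p: "prime p" "\<not> p dvd L" and H: "ev H z = 0"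
  shows "ev H (z ^ p) = 0"
proof -
  define U :: "int poly" where "U = monom 1 L - 1"
  have U0: "U \<noteq> 0"
  proof
    assume "U = 0"
    then have "coeff U L = 0" by simp
    then show False using L by (simp add: U_def)
  qed
  have evU: "ev U w = w ^ L - 1" for w by (simp add: U_def ev_diff ev_monom)
  obtain f where f: "f \<noteq> 0" "ev f z = 0" "content f = 1" "\<And>H. ev H z = 0 \<Longrightarrow> f dvd H"
      "\<And>H. ev H z = 0 \<Longrightarrow> degree H < degree f \<Longrightarrow> H = 0"
    using primitive_minimal_poly[OF U0] z by (metis evU diff_self)
  have "ev f (z ^ p) = 0"
  proof (rule ccontr)
    assume nz: "ev f (z ^ p) \<noteq> 0"
    obtain g where g: "U = f * g" using f(4)[of U] z by (auto simp: evU)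
    have "ev U (z ^ p) = 0" using z by (simp add: evU flip: power_mult) (simp add: power_mult mult.commute)
    then have "ev g (z ^ p) = 0" using nz by (simp add: g ev_mult)
    moreover obtain h where h: "g ^ p = pcompose g (monom 1 p) + smult (int p) h"
      using poly_frobenius[OF p(1)] by blast
    ultimately have gp: "ev g z ^ p = of_nat p * ev h z"
      by (simp add: ev_add ev_pcompose ev_monom ev_smult flip: ev_power)
    \<comment> \<open>As f vanishes at z, the product rule leaves only the term containing g (z);
      multiplied by z it expresses L through g (z).\<close>
    have "ev (pderiv U) z = of_nat L * z ^ (L - 1)"
      by (simp add: U_def pderiv_diff pderiv_monom ev_monom)
    then have "of_nat L * z ^ (L - 1) = ev (pderiv f) z * ev g z"
      using f(2) by (simp add: g ev_pderiv)
    moreover have "z * z ^ (L - 1) = 1" using z L by (metis power_minus_mult mult.commute)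
    then have "of_nat L = z * (of_nat L * z ^ (L - 1))" by (simp only: mult.left_commute[of z] mult_1_right)
    ultimately have "of_nat L = z * ev (pderiv f) z * ev g z" by (simp only: mult.assoc)
    then have "of_nat L ^ p = (z * ev (pderiv f) z) ^ p * (of_nat p * ev h z)"
      by (simp add: power_mult_distrib gp)
    define K where "K = (monom 1 1 * pderiv f) ^ p * h"
    have evK: "of_nat L ^ p = of_nat p * ev K z"
      unfolding K_def ev_mult ev_power ev_monom using \<open>of_nat L ^ p = _\<close> by simp
    have "lead_coeff U = 1" 
    proof -
      have "degree U = L" using L degree_add_eq_left[of "-1" "monom (1::int) L"]
        by (simp add: U_def degree_monom_eq)
      then show ?thesis using L by (simp add: U_def)
    qed
    then have lc: "lead_coeff f * lead_coeff g = 1" by (simp add: g lead_coeff_mult)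
    \<comment> \<open>The leading coefficient of f divides that of X ^ L - 1, so it is 1 or -1.
      Multiplied by it, f is monic, and reduction modulo f stays integral.\<close>
    define s where "s = lead_coeff f"
    have s: "s * s = 1" using lc by (metis s_def zmult_eq_1_iff mult_1 mult_minus1 minus_minus mult.commute)
    obtain q r where qr: "K = smult s f * q + r" "r = 0 \<or> degree r < degree (smult s f)"
      by (rule monic_division[of "smult s f" K]) (use s in \<open>auto simp: s_def\<close>)
    have evr: "ev K z = ev r z" using f(2) by (simp add: qr(1) ev_add ev_mult ev_smult)
    have dr: "r = 0 \<or> degree r < degree f" using qr(2) by (auto split: if_splits)
    have "degree f > 0"
    proof (rule ccontr)
      assume "\<not> degree f > 0"
      then obtain c where "f = [:c:]" using degree_eq_zeroE by blast
      then show False using f(1,2) by auto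
    qed
    \<comment> \<open>A polynomial vanishing at z with degree below that of f is zero, so the
      divisibility by p can be read off the constant coefficient.\<close>
    define D where "D = [:int L ^ p:] - smult (int p) r"
    have "ev D z = 0" using evK evr by (simp add: D_def ev_diff ev_smult)
    moreover have "degree D < degree f"
      unfolding D_def using dr \<open>degree f > 0\<close> by (intro degree_diff_less) auto
    ultimately have "D = 0" using f(5) by blast
    then have "int L ^ p = int p * coeff r 0"
      unfolding D_def by (metis coeff_0 coeff_diff coeff_pCons_0 coeff_smult eq_iff_diff_eq_0)
    then have "int p dvd int L ^ p" by simp
    then have "p dvd L ^ p" by (metis of_nat_dvd_iff of_nat_power)
    then show False using p prime_dvd_power by blast
  qed
  then show ?thesis using f(4)[OF H] by (auto simp: ev_mult)
qed

lemma conjugate_coprime_power: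
  assumes "z ^ L = 1" "L > 0" "coprime a L" "a > 0" "ev H z = 0"
  shows "ev H (z ^ a) = 0"
  using assms
proof (induction a arbitrary: z rule: prime_divisors_induct)
  case (factor p a)
  have "ev H (z ^ p) = 0"
    using factor.prems factor.hyps
    by (intro conjugate_prime_power[of z L]) (auto simp: prime_imp_coprime_nat dest: coprime_common_divisor_nat intro: coprime_absorb_left)
  moreover have "(z ^ p) ^ L = 1" using factor.prems by (metis power_mult mult.commute power_one)
  ultimately have "ev H ((z ^ p) ^ a) = 0"
    using factor.prems by (intro factor.IH) auto
  then show ?case by (simp add: power_mult)
qed auto

text \<open>In effect an automorphism of the cyclotomic field applied to an integer relation; no
  Galois group is constructed, and z may be a root of unity of any order dividing L.\<close>

lemma sum_root_of_unity_conjugate: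
  fixes c :: "nat \<Rightarrow> int" and z :: complex
  assumes "z ^ L = 1" "L > 0" "coprime a L" "a > 0" "(\<Sum>t<L. of_int (c t) * z ^ t) = 0"
  shows "(\<Sum>t<L. of_int (c t) * z ^ (a * t)) = 0"
proof -
  define H where "H = (\<Sum>t<L. monom (c t) t)"
  have evH: "ev H w = (\<Sum>t<L. of_int (c t) * w ^ t)" for w
    unfolding H_def by (induction L) (simp_all add: ev_add ev_monom)
  show ?thesis
    using conjugate_coprime_power[OF assms(1-4), of H] assms(5) by (simp add: evH power_mult)
qed

subsection \<open>Vanishing sums with sawtooth coefficients\<close>

definition unity :: "nat \<Rightarrow> int \<Rightarrow> complex" where
  "unity L j = cis (2 * pi * of_int j / of_nat L)"

lemma unity_add: "unity L (i + j) = unity L i * unity L j"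
  by (simp add: unity_def cis_mult add_divide_distrib distrib_left)

lemma unity_0 [simp]: "unity L 0 = 1"
  by (simp add: unity_def)

lemma unity_sum: "unity L (\<Sum>x\<in>A. f x) = (\<Prod>x\<in>A. unity L (f x))"
  by (induction A rule: infinite_finite_induct) (simp_all add: unity_add)

lemma unity_mult_nat: "unity L (j * int n) = unity L j ^ n"
  by (induction n) (simp_all add: unity_add distrib_left)

lemma unity_eq_1_iff:
  assumes "L > 0"
  shows "unity L j = 1 \<longleftrightarrow> int L dvd j"
proof
  assume "unity L j = 1"
  then have "cos (2 * pi * of_int j / of_nat L) = 1" by (simp add: unity_def complex_eq_iff)
  then obtain n :: int where "2 * pi * of_int j / of_nat L = of_int n * 2 * pi"
    by (auto simp: cos_one_2pi_int)
  then have "of_int j = real_of_int (n * int L)" using assms by (simp add: field_simps)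
  then have "j = n * int L" by linarith
  then show "int L dvd j" by simp
next
  assume "int L dvd j"
  then obtain n where "j = int L * n" by auto
  then have "2 * pi * of_int j / of_nat L = 2 * pi * real_of_int n" using assms by simp
  then show "unity L j = 1" unfolding unity_def by (simp only: cis_multiple_2pi Ints_of_int)
qed

lemma sum_unity:
  assumes "L > 0"
  shows "(\<Sum>a<L. unity L (int a * j)) = (if int L dvd j then of_nat L else 0)"
proof -
  have eq: "(\<Sum>a<L. unity L (int a * j)) = (\<Sum>a<L. unity L j ^ a)"
    by (simp add: mult.commute flip: unity_mult_nat)
  have "unity L j ^ L = 1"
    using assms by (simp add: unity_eq_1_iff flip: unity_mult_nat)
  then show ?thesis
    using assms geometric_sum[of "unity L j" L] unity_eq_1_iff[OF assms, of j]
    by (auto simp: eq)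
qed

lemma unity_cong:
  assumes "L > 0" "[i = j] (mod int L)"
  shows "unity L i = unity L j"
proof -
  have "unity L (i - j) = 1" using assms by (simp add: unity_eq_1_iff cong_iff_dvd_diff)
  then show ?thesis using unity_add[of L "i - j" j] by simp
qed

text \<open>All Galois conjugates of the sum vanish, so the Fourier transform of \<open>H\<close> lives on frequencies
  sharing a prime with \<open>L\<close>, and the difference operator of that prime kills them.\<close>

lemma cube_vanishing:
  fixes H :: "int \<Rightarrow> int" and k :: "nat \<Rightarrow> int"
  assumes L: "L > 0" and per: "\<And>i j. [i = j] (mod int L) \<Longrightarrow> H i = H j"
    and zero: "(\<Sum>s<L. of_int (H (int s)) * unity L (int s)) = 0"
  defines "P \<equiv> prime_factors L"
  defines "\<sigma> \<equiv> \<lambda>T. \<Sum>p\<in>T. k p * int (L div p)"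
  shows "(\<Sum>T\<in>Pow P. (-1) ^ card T * H (t + \<sigma> T)) = 0"
proof -
  define F where "F a = (\<Sum>s<L. of_int (H (int s)) * unity L (int a * int s))" for a :: nat
  \<comment> \<open>Fourier inversion on the residues modulo L, with \<open>F a\<close> the
    transform at the frequency a.\<close>
  have inv: "of_nat L * of_int (H t) = (\<Sum>a<L. F a * unity L (int a * (- t)))" for t
  proof -
    have "(\<Sum>a<L. F a * unity L (int a * (- t)))
        = (\<Sum>a<L. \<Sum>s<L. of_int (H (int s)) * unity L (int a * (int s - t)))"
      by (simp add: F_def sum_distrib_right mult.assoc right_diff_distrib flip: unity_add)
    also have "\<dots> = (\<Sum>s<L. of_int (H (int s)) * (\<Sum>a<L. unity L (int a * (int s - t))))"
      by (subst sum.swap) (simp add: sum_distrib_left)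
    also have "\<dots> = (\<Sum>s<L. if s = nat (t mod int L) then of_int (H t) * of_nat L else 0)"
    proof (rule sum.cong, simp)
      fix s assume s: "s \<in> {..<L}"
      have "int L dvd int s - t \<longleftrightarrow> s = nat (t mod int L)"
        using s L by (auto simp: mod_eq_dvd_iff[symmetric] nat_eq_iff)
      moreover have "H (int s) = H t" if "int L dvd int s - t"
        by (rule per) (use that in \<open>simp add: cong_iff_dvd_diff\<close>)
      ultimately show "of_int (H (int s)) * (\<Sum>a<L. unity L (int a * (int s - t)))
          = (if s = nat (t mod int L) then of_int (H t) * of_nat L else 0)"
        using L by (simp add: sum_unity)
    qed
    also have "\<dots> = of_int (H t) * of_nat L"
      using L by (simp add: nat_less_iff)
    finally show ?thesis by simp
  qed
  have finP: "finite P" by (simp add: P_def)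
  \<comment> \<open>The alternating sum over the cube is an expanded product of difference
    operators, one for each prime divisor of L; on the character of frequency a each of them acts as
    a scalar.\<close>
  have cube: "(\<Sum>T\<in>Pow P. (-1) ^ card T * unity L (int a * (- \<sigma> T)))
      = (\<Prod>p\<in>P. 1 - unity L (int a * (- (k p * int (L div p)))))" for a
  proof -
    have "(\<Prod>p\<in>P. - unity L (int a * (- (k p * int (L div p)))) + 1)
        = (\<Sum>T\<in>Pow P. (\<Prod>p\<in>T. - unity L (int a * (- (k p * int (L div p))))))"
      using finP by (subst prod_add) simp_all
    also have "\<dots> = (\<Sum>T\<in>Pow P. (-1) ^ card T * unity L (int a * (- \<sigma> T)))"
      by (simp add: prod_uminus \<sigma>_def sum_distrib_left flip: unity_sum sum_negf)
    finally show ?thesis by simp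
  qed
  have prod0: "F a * (\<Prod>p\<in>P. 1 - unity L (int a * (- (k p * int (L div p))))) = 0" for a
  proof (cases "coprime a L")
    case True
    \<comment> \<open>The frequency 0 is coprime to L only if L = 1, and then the hypothesis
      \<open>zero\<close> is the claim; the conjugation lemma asks for a positive exponent.\<close>
    show ?thesis
    proof (cases "a = 0")
      case False
      have "(\<Sum>s<L. of_int (H (int s)) * unity L 1 ^ (a * s)) = 0"
        using L True False zero unity_mult_nat[of L 1]
        by (intro sum_root_of_unity_conjugate[where L = L]) (auto simp: unity_eq_1_iff simp flip: unity_mult_nat)
      then have "F a = 0" using unity_mult_nat[of L 1] by (simp add: F_def flip: of_nat_mult)
      then show ?thesis by simp
    qed (use True zero L in \<open>simp add: F_def\<close>)
  next
    case False
    then obtain p where p: "prime p" "p dvd a" "p dvd L"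
      using L by (metis prime_factor_nat coprime_iff_gcd_eq_1 gcd_greatest_iff)
    then obtain b c where bc: "a = p * b" "L = p * c" by (meson dvdE)
    have "p \<in> P" using p L by (auto simp: P_def prime_factors_dvd)
    moreover have "int a * (- (k p * int (L div p))) = int L * (- (int b * k p))"
      using p bc prime_gt_0_nat[OF p(1)] by simp
    then have "unity L (int a * (- (k p * int (L div p)))) = 1"
      by (metis unity_eq_1_iff[OF L] dvd_triv_left)
    ultimately show ?thesis using finP by (auto simp: prod_zero_iff)
  qed
  have "of_nat L * (\<Sum>T\<in>Pow P. (-1) ^ card T * of_int (H (t + \<sigma> T)) :: complex)
      = (\<Sum>T\<in>Pow P. (-1) ^ card T * (\<Sum>a<L. F a * unity L (int a * (- (t + \<sigma> T)))))"
    by (subst sum_distrib_left) (intro sum.cong refl, subst inv[symmetric], simp add: mult.left_commute)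
  also have "\<dots> = (\<Sum>a<L. F a * unity L (int a * (- t)) *
      (\<Sum>T\<in>Pow P. (-1) ^ card T * unity L (int a * (- \<sigma> T))))"
    by (simp add: sum_distrib_left)
       (subst sum.swap, simp add: unity_add[symmetric] algebra_simps flip: unity_add)
  also have "\<dots> = 0"
    unfolding cube using prod0 by (intro sum.neutral) (auto simp: mult_ac)
  finally have "of_int (\<Sum>T\<in>Pow P. (-1) ^ card T * H (t + \<sigma> T)) = (0::complex)"
    using L by simp
  then show ?thesis by (simp only: of_int_eq_0_iff)
qed

text \<open>By \<open>neg_growth_wedge\<close>, the growth constant of the \<open>r\<close>-th Eulerian function is a combination of
  \<open>L\<close>-th roots of unity whose coefficients are, up to a common factor, the values of \<open>wedge L r\<close>.\<close>

definition wedge :: "nat \<Rightarrow> nat \<Rightarrow> int \<Rightarrow> int" where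
  "wedge L r t =
     (if even r then
        if int L dvd 2 * int r * t \<and> odd (2 * int r * t div int L) then 2 * (t mod int L) - int (L div r) else 0
      else if int L dvd int r * t then
        if int L dvd t then int L - int (L div r) else 2 * (t mod int L) - int (L div r)
      else 0)"

lemma wedge_cong:
  assumes "[i = j] (mod int L)" "L > 0"
  shows "wedge L r i = wedge L r j"
proof -
  obtain c where c: "i = j + int L * c" using assms(1) by (metis cong_iff_lin cong_sym mult.commute)
  have "int L dvd int r * i \<longleftrightarrow> int L dvd int r * j" "int L dvd i \<longleftrightarrow> int L dvd j" "i mod int L = j mod int L"
    using c by (simp_all add: distrib_left mult.left_commute dvd_add_left_iff)
  moreover have "2 * int r * i = 2 * int r * j + int L * (2 * int r * c)" using c by (simp add: algebra_simps)
  then have "int L dvd 2 * int r * i \<longleftrightarrow> int L dvd 2 * int r * j"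
    "2 * int r * i div int L = 2 * int r * j div int L + 2 * int r * c"
    using assms(2) by (simp_all add: dvd_add_left_iff)
  ultimately show ?thesis by (simp add: wedge_def)
qed

text \<open>Divide arguments by L: \<open>wedge L r\<close> lives on fractions with denominator r
  for odd r, and on odd multiples of 1 / (2 * r) for even r. The base point u / n is in lowest terms
  and stays so under the shifts at primes of n, while a shift at any other prime enlarges the
  denominator. Hence only subsets of the primes of n contribute, and only multiples r of s0 of the
  same parity, that is r = s0 by \<open>top\<close>. On the remaining vertices \<open>wedge\<close>
  is affine in the residue modulo n.\<close>

lemma cube_top:
  fixes m :: "nat \<Rightarrow> int" and k :: "nat \<Rightarrow> int" and u :: int
  assumes L: "L > 0" "\<And>r. r \<in> {2..R} \<Longrightarrow> 2 * r dvd L"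
    and zero: "(\<Sum>s<L. of_int (\<Sum>r=2..R. m r * wedge L r (int s)) * unity L (int s)) = 0"
    and s0: "s0 \<in> {2..R}"
    and top: "\<And>r. r \<in> {2..R} \<Longrightarrow> m r \<noteq> 0 \<Longrightarrow> s0 dvd r \<Longrightarrow> (odd r \<longleftrightarrow> odd s0) \<Longrightarrow> r = s0"
  defines "n \<equiv> if even s0 then 2 * s0 else s0"
  defines "\<sigma> \<equiv> \<lambda>T. \<Sum>p\<in>T. k p * int (n div p)"
  assumes k: "\<And>p. p \<in> prime_factors n \<Longrightarrow> \<not> int p dvd k p"
    and cop: "\<And>T. T \<subseteq> prime_factors n \<Longrightarrow> coprime (u + \<sigma> T) (int n)"
  shows "m s0 * (\<Sum>T\<in>Pow (prime_factors n). (-1) ^ card T * ((u + \<sigma> T) mod int n)) = 0"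
proof -
  define P where "P = prime_factors L"
  define P0 where "P0 = prime_factors n"
  define k' where "k' p = (if p \<in> P0 then k p else 1)" for p
  define \<tau> where "\<tau> T = (\<Sum>p\<in>T. k' p * int (L div p))" for T
  define H where "H t = (\<Sum>r=2..R. m r * wedge L r t)" for t
  have n: "n > 0" "n dvd L" using s0 L(2)[OF s0] by (auto simp: n_def dvd_def)
  then obtain d where d: "L = n * d" by auto
  have d0: "d > 0" using d L by (cases d) auto
  have finP: "finite P" "finite P0" by (auto simp: P_def P0_def)
  have P0P: "P0 \<subseteq> P" using n L by (auto simp: P_def P0_def prime_factors_dvd)
  have pL: "prime p" "p dvd L" if "p \<in> P" for p using that by (auto simp: P_def)
  have pn: "prime p" "p dvd n" if "p \<in> P0" for p using that by (auto simp: P0_def)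
  have notn: "\<not> p dvd n" if "p \<in> P - P0" for p using that n by (auto simp: P_def P0_def prime_factors_dvd)
  have k': "\<not> int p dvd k' p" if "p \<in> P" for p
    using k that pL(1)[OF that] by (auto simp: k'_def P0_def)
  have cube0: "(\<Sum>T\<in>Pow P. (-1) ^ card T * H (int d * u + \<tau> T)) = 0"
    unfolding P_def \<tau>_def
    by (rule cube_vanishing) (use L zero wedge_cong in \<open>auto simp: H_def intro!: sum.cong\<close>)
  have split: "\<tau> T = int d * \<sigma> T" if "T \<subseteq> P0" for T
  proof -
    have "k' p * int (L div p) = int d * (k p * int (n div p))" if p: "p \<in> P0" for p
      using p pn[OF p] d by (auto simp: k'_def div_mult_swap mult.commute)
    then show ?thesis unfolding \<tau>_def \<sigma>_def sum_distrib_left using that by (intro sum.cong) auto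
  qed
  have ndvd: "r = s0 \<and> T \<subseteq> P0"
    if T: "T \<subseteq> P" and r: "r \<in> {2..R}" "m r \<noteq> 0" and nz: "wedge L r (int d * u + \<tau> T) \<noteq> 0" for T r
  proof -
    define \<rho> where "\<rho> = (if even r then 2 * r else r)"
    define T1 where "T1 = T - P0"
    \<comment> \<open>Multiplication by \<open>Q\<close> makes all shifts at primes outside n vanish
      modulo L.\<close>
    define Q where "Q = \<Prod>T1"
    define v where "v = u + \<sigma> (T \<inter> P0)"
    have finT: "finite T1" using T finP by (auto simp: T1_def intro: finite_subset)
    have "\<tau> T = \<tau> (T \<inter> P0) + \<tau> T1"
      unfolding \<tau>_def T1_def using finite_subset[OF T finP(1)] by (subst sum.Int_Diff[of T _ P0]) auto
    then have tau: "int d * u + \<tau> T = int d * v + \<tau> T1"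
      using split[of "T \<inter> P0"] by (simp add: v_def distrib_left)
    have T1: "prime p" "p dvd L" "\<not> p dvd n" "p \<in> P" if "p \<in> T1" for p
      using that T pL notn by (auto simp: T1_def)
    have dvdL: "int L dvd int \<rho> * (int d * v + \<tau> T1)"
      using nz unfolding tau wedge_def \<rho>_def by (auto split: if_splits)
    have copv: "coprime v (int n)" using cop[of "T \<inter> P0"] by (auto simp: v_def P0_def)
    have Qtau: "int L dvd int Q * \<tau> T1"
    proof -
      have "int L dvd int Q * (k' p * int (L div p))" if "p \<in> T1" for p
      proof -
        have "Q = p * \<Prod>(T1 - {p})" unfolding Q_def using finT that by (subst prod.remove[of _ p]) auto
        then have "int Q * (k' p * int (L div p)) = int (\<Prod>(T1 - {p})) * k' p * int (p * (L div p))" by simp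
        moreover have "p * (L div p) = L" using T1(2)[OF that] by simp
        ultimately show ?thesis by (metis dvd_triv_right)
      qed
      then show ?thesis unfolding \<tau>_def sum_distrib_left by (intro dvd_sum)
    qed
    have copQ: "coprime (int Q) (int n)"
      unfolding Q_def using T1 by (auto intro!: prod_coprime_left prime_imp_coprime simp flip: of_nat_prod)
    have "int L dvd int Q * (int \<rho> * (int d * v + \<tau> T1)) - int \<rho> * (int Q * \<tau> T1)"
      using dvdL Qtau by - (rule dvd_diff, auto)
    then have "int n * int d dvd (int Q * int \<rho> * v) * int d" by (simp add: d algebra_simps)
    then have "int n dvd int Q * int \<rho> * v" using d0 by simp
    then have "int n dvd int \<rho>" using copQ copv
      by (simp add: coprime_dvd_mult_left_iff coprime_dvd_mult_right_iff coprime_commute)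
    then have n\<rho>: "n dvd \<rho>" by simp
    have par: "odd r \<longleftrightarrow> odd s0"
    proof (cases "even s0")
      case True
      then have "even n" by (simp add: n_def)
      then have "even \<rho>" using n\<rho> dvd_trans by blast
      then show ?thesis using True s0 n\<rho> by (auto simp: \<rho>_def split: if_splits)
    next
      case False
      \<comment> \<open>For even r the support of \<open>wedge\<close> demands an odd quotient.
        Clearing denominators by the odd number \<open>Q' * n\<close> and a single factor 2, which
        absorbs a possible shift at the prime 2, would equate an odd integer with an even
        one.\<close>
      have "\<not> even r"
      proof
        assume ev: "even r"
        define T' where "T' = T1 - {2}"
        define Q' where "Q' = \<Prod>T'"
        obtain z where z: "2 * int r * (int d * v + \<tau> T1) = int L * z" "odd z"
          using nz ev L(1) unfolding tau wedge_def by (auto split: if_splits)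
        have oddn: "odd n" using False by (simp add: n_def)
        have oddQ': "odd Q'"
          unfolding Q'_def T'_def using finT T1(1)
          by (subst even_prod_iff) (auto dest: primes_dvd_imp_eq[OF two_is_prime_nat])
        have "\<exists>e. 2 * int Q' * (int n * (int d * v + \<tau> T1)) = int L * e"
        proof -
          have "int L dvd 2 * int Q' * \<tau> T1"
          proof -
            have "Q dvd 2 * Q'"
            proof (cases "2 \<in> T1")
              case True
              then show ?thesis unfolding Q_def Q'_def T'_def using finT by (subst prod.remove[of _ 2]) auto
            qed (simp add: Q_def Q'_def T'_def)
            then have "int Q dvd 2 * int Q'" by (metis of_nat_dvd_iff of_nat_mult of_nat_numeral)
            then have "int Q * \<tau> T1 dvd 2 * int Q' * \<tau> T1" by (rule mult_dvd_mono) simp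
            then show ?thesis using Qtau dvd_trans by blast
          qed
          then have "int L dvd int n * (2 * int Q' * \<tau> T1)" by simp
          moreover have "int n * (2 * int Q' * (int d * v)) = int L * (2 * int Q' * v)" by (simp add: d)
          then have "int L dvd int n * (2 * int Q' * (int d * v))" by (metis dvd_triv_left)
          ultimately have "int L dvd int n * (2 * int Q' * (int d * v)) + int n * (2 * int Q' * \<tau> T1)"
            by (intro dvd_add) auto
          then show ?thesis by (auto simp: algebra_simps elim!: dvdE)
        qed
        then obtain e where e: "2 * int Q' * (int n * (int d * v + \<tau> T1)) = int L * e" by blast
        have "int L * (int Q' * int n * z) = int Q' * int n * (2 * int r * (int d * v + \<tau> T1))"
          using z(1) by simp
        also have "\<dots> = int r * (2 * int Q' * (int n * (int d * v + \<tau> T1)))" by (simp add: mult_ac)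
        also have "\<dots> = int L * (int r * e)" using e by simp
        finally have "int Q' * int n * z = int r * e" using L(1) by simp
        moreover have "odd (int Q' * int n * z)" using oddQ' oddn z(2) by simp
        moreover have "even (int r * e)" using ev by simp
        ultimately show False by simp
      qed
      then show ?thesis using False by simp
    qed
    have "s0 dvd r" using n\<rho> par by (auto simp: n_def \<rho>_def split: if_splits)
    then have rs: "r = s0" using top r par by blast
    \<comment> \<open>Now that r = s0, a remaining shift at p can be isolated by multiplying with
      the other primes of \<open>T1\<close>; then p would divide a product of integers prime to
      p.\<close>
    have "T1 = {}"
    proof (rule ccontr)
      assume "T1 \<noteq> {}"
      then obtain p where p: "p \<in> T1" by auto
      have \<rho>n: "\<rho> = n" using rs par by (simp add: \<rho>_def n_def)
      define Q' where "Q' = \<Prod>(T1 - {p})"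
      have div: "int L dvd int Q' * (k' q * int (L div q))" if "q \<in> T1 - {p}" for q
      proof -
        have "Q' = q * \<Prod>(T1 - {p} - {q})" unfolding Q'_def using finT that by (subst prod.remove[of _ q]) auto
        then have "int Q' * (k' q * int (L div q)) = int (\<Prod>(T1 - {p} - {q})) * k' q * int (q * (L div q))" by simp
        moreover have "q * (L div q) = L" using T1(2)[of q] that by simp
        ultimately show ?thesis by (metis dvd_triv_right)
      qed
      have tauT1: "\<tau> T1 = k' p * int (L div p) + \<tau> (T1 - {p})"
        unfolding \<tau>_def using finT p by (subst sum.remove[of _ p]) auto
      moreover have "int L dvd int n * (int Q' * \<tau> (T1 - {p}))"
        unfolding \<tau>_def sum_distrib_left using div by (intro dvd_sum) (auto intro: dvd_mult)
      moreover have "int L dvd int Q' * (int n * (int d * v))" by (simp add: d)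
      moreover have "int L dvd int Q' * (int n * (int d * v + \<tau> T1))" using dvdL \<rho>n by simp
      ultimately have "int L dvd int Q' * (int n * (int d * v + \<tau> T1)) - int Q' * (int n * (int d * v))
          - int n * (int Q' * \<tau> (T1 - {p}))" by (intro dvd_diff)
      then have "int L dvd int Q' * int n * k' p * int (L div p)"
        using tauT1 by (simp add: algebra_simps)
      moreover obtain c where c: "L = p * c" using T1(2)[OF p] by auto
      moreover have "p > 0" using T1(1)[OF p] prime_gt_0_nat by blast
      ultimately have "int p * int c dvd (int Q' * int n * k' p) * int c" by simp
      moreover have "c > 0" using c L(1) by (cases c) auto
      ultimately have "int p dvd int Q' * int n * k' p" by simp
      moreover have pp: "prime (int p)" using T1(1)[OF p] by simp
      ultimately have "int p dvd int Q' \<or> int p dvd int n \<or> int p dvd k' p"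
        by (auto simp: prime_dvd_mult_iff)
      moreover have "\<not> p dvd Q'"
      proof
        assume "p dvd Q'"
        then obtain x where "x \<in> T1 - {p}" "p dvd x"
          unfolding Q'_def using finT T1(1)[OF p] by (auto simp: prime_dvd_prod_iff)
        then show False using T1(1)[OF p] T1(1)[of x] primes_dvd_imp_eq[of p x] by auto
      qed
      ultimately show False using T1[OF p] k' by auto
    qed
    then show ?thesis using rs by (auto simp: T1_def)
  qed
  \<comment> \<open>The support condition holds at these vertices because
    \<open>u + \<sigma> T\<close> is coprime to n: the quotient is odd for even s0, and the
    exceptional point 0 of the sawtooth is avoided for odd s0.\<close>
  have val: "H (int d * u + \<tau> T) = m s0 * (2 * int d * ((u + \<sigma> T) mod int n) - int (L div s0))"
    if T: "T \<subseteq> P0" for T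
  proof -
    have eq: "int d * u + \<tau> T = int d * (u + \<sigma> T)" using split[OF T] by (simp add: distrib_left)
    have "H (int d * u + \<tau> T) = (\<Sum>r\<in>{s0}. m r * wedge L r (int d * u + \<tau> T))"
      unfolding H_def
    proof (rule sum.mono_neutral_right; (intro ballI)?)
      fix r assume r: "r \<in> {2..R} - {s0}"
      show "m r * wedge L r (int d * u + \<tau> T) = 0"
      proof (rule ccontr)
        assume "\<not> ?thesis"
        then have nz: "m r \<noteq> 0" "wedge L r (int d * u + \<tau> T) \<noteq> 0" by simp_all
        have "r \<in> {2..R}" "T \<subseteq> P" using r T P0P by blast+
        then have "r = s0" using ndvd nz by blast
        then show False using r by blast
      qed
    qed (use s0 in auto)
    moreover have "wedge L s0 (int d * (u + \<sigma> T)) = 2 * int d * ((u + \<sigma> T) mod int n) - int (L div s0)"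
    proof -
      have md: "int d * (u + \<sigma> T) mod int L = int d * ((u + \<sigma> T) mod int n)"
        by (simp add: d mult.commute[of "int n" "int d"])
      have c: "coprime (u + \<sigma> T) (int n)" using cop T by (simp add: P0_def)
      show ?thesis
      proof (cases "even s0")
        case True
        have eq2: "2 * int s0 * (int d * (u + \<sigma> T)) = int L * (u + \<sigma> T)" using True by (simp add: d n_def)
        have "odd (u + \<sigma> T)" using c True by (auto simp: n_def)
        then show ?thesis using True md L(1) by (simp add: wedge_def eq2)
      next
        case False
        have eq2: "int s0 * (int d * (u + \<sigma> T)) = int L * (u + \<sigma> T)" using False by (simp add: d n_def)
        have "\<not> int L dvd int d * (u + \<sigma> T)"
        proof
          assume "int L dvd int d * (u + \<sigma> T)"
          then have "int n dvd u + \<sigma> T" using d0 by (simp add: d)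
          then have "is_unit (int n)" using c by (meson coprime_common_divisor dvd_refl)
          then show False using False s0 by (simp add: n_def)
        qed
        then show ?thesis using False md by (simp add: wedge_def eq2)
      qed
    qed
    ultimately show ?thesis using eq by simp
  qed
  \<comment> \<open>This removes the constant term of the affine function from the alternating
    sum.\<close>
  have alt: "(\<Sum>T\<in>Pow P0. (-1) ^ card T) = (0::int)"
  proof -
    have "n \<noteq> 1" using s0 by (auto simp: n_def)
    then obtain p where "prime p" "p dvd n" using prime_factor_nat by blast
    then have "P0 \<noteq> {}" using n by (auto simp: P0_def prime_factors_dvd)
    moreover have "(\<Prod>p\<in>P0. (-1::int) + 1) = (\<Sum>T\<in>Pow P0. (-1) ^ card T)"
      using finP by (subst prod_add) simp_all
    ultimately show ?thesis using finP by (simp add: power_0_left card_eq_0_iff)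
  qed
  have "0 = (\<Sum>T\<in>Pow P0. (-1) ^ card T * H (int d * u + \<tau> T))"
  proof -
    have "H (int d * u + \<tau> T) = 0" if "T \<subseteq> P" "\<not> T \<subseteq> P0" for T
      unfolding H_def
    proof (rule sum.neutral, rule ballI, rule ccontr)
      fix r assume r: "r \<in> {2..R}" "m r * wedge L r (int d * u + \<tau> T) \<noteq> 0"
      then have "m r \<noteq> 0" "wedge L r (int d * u + \<tau> T) \<noteq> 0" by simp_all
      then show False using ndvd r(1) that by blast
    qed
    then have "(\<Sum>T\<in>Pow P. (-1) ^ card T * H (int d * u + \<tau> T))
        = (\<Sum>T\<in>Pow P0. (-1) ^ card T * H (int d * u + \<tau> T))"
      using finP P0P by (intro sum.mono_neutral_right) auto
    then show ?thesis using cube0 by simp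
  qed
  also have "\<dots> = (\<Sum>T\<in>Pow P0. 2 * int d * (m s0 * ((-1) ^ card T * ((u + \<sigma> T) mod int n)))
      - m s0 * int (L div s0) * (-1) ^ card T)"
    by (intro sum.cong refl, subst val) (auto simp: algebra_simps)
  also have "\<dots> = 2 * int d * (m s0 * (\<Sum>T\<in>Pow P0. (-1) ^ card T * ((u + \<sigma> T) mod int n)))"
    unfolding sum_subtractf sum_distrib_left[symmetric] alt by simp
  finally show ?thesis using d0 by (simp add: P0_def)
qed

section \<open>Cubes of units modulo n with nonvanishing alternating sum\<close>

lemma exists_residue_avoiding:
  fixes a b c :: int
  assumes "p \<ge> 5"
  obtains d where "\<not> int p dvd d" "\<not> int p dvd d - a" "\<not> int p dvd d - b" "\<not> int p dvd d - c"
proof -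
  \<comment> \<open>The candidates 1, 2, 3, 4 are distinct modulo p, since p is at least 5, and
    three forbidden residues exclude at most three of them.\<close>
  have "\<exists>d\<in>{1..4::int}. \<not> int p dvd d - a \<and> \<not> int p dvd d - b \<and> \<not> int p dvd d - c"
  proof (rule ccontr)
    assume neg: "\<not> ?thesis"
    have diff: "x = y" if "x \<in> {1..4}" "y \<in> {1..4}" "int p dvd x - z" "int p dvd y - z" for x y z :: int
    proof -
      have "int p dvd (x - z) - (y - z)" using that(3,4) by (rule dvd_diff)
      then have "int p dvd x - y" by simp
      moreover have "\<bar>x - y\<bar> < int p" using that assms by auto
      ultimately show ?thesis using zdvd_not_zless[of "\<bar>x - y\<bar>" "int p"] by fastforce
    qed
    have "\<forall>d\<in>{1,2,3,4::int}. int p dvd d - a \<or> int p dvd d - b \<or> int p dvd d - c" using neg by auto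
    then show False using diff[of 1 2 a] diff[of 1 2 b] diff[of 1 2 c] diff[of 1 3 a] diff[of 1 3 b] diff[of 1 3 c]
      diff[of 1 4 a] diff[of 1 4 b] diff[of 1 4 c] diff[of 2 3 a] diff[of 2 3 b] diff[of 2 3 c]
      diff[of 2 4 a] diff[of 2 4 b] diff[of 2 4 c] diff[of 3 4 a] diff[of 3 4 b] diff[of 3 4 c]
      by (simp; blast)
  qed
  then obtain d where d: "d \<in> {1..4::int}" "\<not> int p dvd d - a" "\<not> int p dvd d - b" "\<not> int p dvd d - c" by blast
  then have "\<not> int p dvd d" using assms zdvd_not_zless[of d "int p"] by auto
  then show ?thesis using that d by blast
qed

text \<open>Shifts for which \<open>1\<close> and \<open>- q\<close> stay coprime to \<open>n\<close> throughout the cube, while passing from one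
  cube to the other crosses the jump at \<open>0\<close> in a controlled number of vertices.\<close>

definition straddle :: "nat \<Rightarrow> nat \<Rightarrow> nat \<Rightarrow> int \<Rightarrow> bool" where
  "straddle n q p k \<longleftrightarrow> \<not> int p dvd k \<and> \<not> int p dvd 1 + k * int (n div p) \<and>
     \<not> int p dvd - int q + k * int (n div p) \<and>
     (p \<ge> 5 \<longrightarrow> \<not> int (p ^ multiplicity p n) dvd k * int (n div p) - (int q - 1)) \<and>
     (p = 3 \<and> \<not> 9 dvd n \<longrightarrow> k = int (n div 3))"

text \<open>If p ^ 2 divides n, every shift is a multiple of p and coprimality is automatic.
  Otherwise p is odd, because an even n is divisible by 4. For p = 3 the prescribed shift is (n / 3)
  ^ 2, congruent to 1 modulo 3, and q congruent to 2 is exactly what keeps both 1 and - q units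
  after it. For p \<ge> 5 the shift has to avoid the four residues 0, -1, q and q - 1.\<close>

lemma exists_straddle:
  assumes n: "n > 0" and p: "prime p" "p dvd n" and q: "q > 0" "coprime q n" and n2: "even n \<Longrightarrow> 4 dvd n"
    and q3: "3 dvd n \<Longrightarrow> \<not> 9 dvd n \<Longrightarrow> q mod 3 = 2"
  shows "\<exists>k. straddle n q p k"
proof (cases "p * p dvd n")
  case True
  then obtain c where c: "n = p * p * c" by auto
  have ndp: "n div p = p * c" using c prime_gt_0_nat[OF p(1)] by simp
  have unit: "\<not> int p dvd 1 + k * int (n div p)" for k
  proof
    assume "int p dvd 1 + k * int (n div p)"
    then have "int p dvd 1 + k * int (n div p) - int p * (k * int c)" by - (rule dvd_diff, auto)
    then show False using p(1) by (simp add: ndp)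
  qed
  have unit2: "\<not> int p dvd - int q + k * int (n div p)" for k
  proof
    assume "int p dvd - int q + k * int (n div p)"
    then have "int p dvd int p * (k * int c) - (- int q + k * int (n div p))" by - (rule dvd_diff, auto)
    then have "p dvd q" by (simp add: ndp)
    then show False using q(2) p by (meson coprime_common_divisor not_prime_unit)
  qed
  have three: "p = 3 \<Longrightarrow> 9 dvd n" using c by auto
  define D where "D = p ^ multiplicity p n"
  have nD: "\<not> D dvd n div p"
  proof
    assume "D dvd n div p"
    then have "p ^ Suc (multiplicity p n) dvd n"
      using p(2) unfolding D_def by (metis dvd_mult_div_cancel mult_dvd_mono dvd_refl power_Suc)
    then have "Suc (multiplicity p n) \<le> multiplicity p n"
      using p(1) n by (intro multiplicity_geI) auto
    then show False by simp
  qed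
  \<comment> \<open>If k = 1 hits the forbidden residue, then k = 2 does not: the two shifts differ
    by \<open>n div p\<close>, which the full power of p in n does not divide.\<close>
  show ?thesis
  proof (cases "p \<ge> 5 \<and> int D dvd 1 * int (n div p) - (int q - 1)")
    case True
    have "\<not> int D dvd 2 * int (n div p) - (int q - 1)"
    proof
      assume "int D dvd 2 * int (n div p) - (int q - 1)"
      then have "int D dvd (2 * int (n div p) - (int q - 1)) - (1 * int (n div p) - (int q - 1))"
        using True by - (rule dvd_diff, auto)
      then show False using nD by simp
    qed
    moreover have "\<not> int p dvd 2" using True zdvd_not_zless[of 2 "int p"] by auto
    ultimately have "straddle n q p 2" using unit[of 2] unit2[of 2] three by (auto simp: straddle_def D_def)
    then show ?thesis ..
  next
    case False
    then have "straddle n q p 1" using unit[of 1] unit2[of 1] three p(1) by (auto simp: straddle_def D_def)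
    then show ?thesis ..
  qed
next
  case False
  have p2: "p \<noteq> 2" using n2 p(2) False by auto
  define m where "m = n div p"
  have nm: "n = p * m" using p(2) by (simp add: m_def)
  have cop: "\<not> p dvd m" using False nm by auto
  then have "coprime p m" using p(1) by (intro prime_imp_coprime)
  then have copm: "coprime (int m) (int p)" by (simp add: coprime_commute)
  have mult: "multiplicity p n = 1"
  proof -
    have "multiplicity p m = 0" using cop by (simp add: not_dvd_imp_multiplicity_0)
    moreover have "m \<noteq> 0" "p \<noteq> 0" "\<not> is_unit p" using nm n p(1) by (auto simp: prime_nat_iff)
    ultimately show ?thesis using nm multiplicity_times_same[of m p] by simp
  qed
  show ?thesis
  proof (cases "p = 3")
    case True
    have "q mod 3 = 2" using q3 p(2) False True by simp
    then have qm: "int q mod 3 = 2" by presburger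
    have m3: "int m mod 3 \<noteq> 0" using cop True by presburger
    have sq: "int m * int m mod 3 = 1"
    proof -
      have "int m mod 3 = 1 \<or> int m mod 3 = 2" using m3 by presburger
      then show ?thesis by (auto simp: mod_mult_eq[symmetric, of "int m" "int m"])
    qed
    have "\<not> (3::int) dvd 1 + int m * int m" using sq by presburger
    moreover have "\<not> (3::int) dvd - int q + int m * int m" using sq qm by presburger
    ultimately have "straddle n q p (int m)" using True m3 by (auto simp: straddle_def m_def dvd_eq_mod_eq_0)
    then show ?thesis ..
  next
    case p3: False
    have "p \<ge> 5"
    proof -
      have "p \<noteq> 4" using p(1) by auto
      then show ?thesis using p2 p3 prime_ge_2_nat[OF p(1)] by linarith
    qed
    then obtain d where d: "\<not> int p dvd d" "\<not> int p dvd d - (- 1)" "\<not> int p dvd d - int q" "\<not> int p dvd d - (int q - 1)"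
      using exists_residue_avoiding by blast
    obtain k where k: "[int m * k = d] (mod int p)"
    proof -
      obtain x where "[int m * x = 1] (mod int p)" using copm by (metis coprime_iff_invertible_int)
      then have "[int m * x * d = 1 * d] (mod int p)" by (rule cong_scalar_right)
      then show ?thesis using that[of "x * d"] by (simp add: mult.assoc)
    qed
    have tr: "int p dvd d + e" if "int p dvd k * int m + e" for e
    proof -
      have "[k * int m + e = d + e] (mod int p)" using k by (intro cong_add) (auto simp: mult.commute)
      then show ?thesis using that by (simp add: cong_dvd_iff)
    qed
    have "\<not> int p dvd k" using tr[of 0] d(1) by auto
    moreover have "\<not> int p dvd 1 + k * int m" using tr[of 1] d(2) by (auto simp: add.commute)
    moreover have "\<not> int p dvd - int q + k * int m" using tr[of "- int q"] d(3) by (auto simp: add.commute)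
    moreover have "\<not> int p dvd k * int m - (int q - 1)" using tr[of "- (int q - 1)"] d(4) unfolding add_uminus_conv_diff by blast
    ultimately have "straddle n q p k" using p3 by (auto simp: straddle_def mult m_def)
    then show ?thesis ..
  qed
qed

text \<open>Chinese remainder theorem: modulo the full power of p in n the shifts at all other
  primes vanish, so a vertex sees at most its own shift at p. Coprimality is then checked prime by
  prime, against the conditions in \<open>straddle\<close>.\<close>

lemma straddle_vertex:
  assumes n: "n > 0" and q: "coprime q n"
    and k: "\<And>p. p \<in> prime_factors n \<Longrightarrow> straddle n q p (k p)"
    and T: "T \<subseteq> prime_factors n"
  defines "s \<equiv> \<Sum>p\<in>T. k p * int (n div p)"
  shows "coprime (1 + s) (int n)" "coprime (- int q + s) (int n)"
    and "\<And>p. p \<in> prime_factors n \<Longrightarrow>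
      int (p ^ multiplicity p n) dvd s - (if p \<in> T then k p * int (n div p) else 0)"
proof -
  have finT: "finite T" using T finite_subset by blast
  show loc: "int (p ^ multiplicity p n) dvd s - (if p \<in> T then k p * int (n div p) else 0)"
    if p: "p \<in> prime_factors n" for p
  proof -
    have other: "int (p ^ multiplicity p n) dvd k r * int (n div r)" if r: "r \<in> prime_factors n" "r \<noteq> p" for r
    proof -
      have "r dvd n" "prime r" "prime p" using r p by auto
      have "p ^ multiplicity p n dvd r * (n div r)" using \<open>r dvd n\<close> by (simp add: multiplicity_dvd)
      moreover have "coprime (p ^ multiplicity p n) r" 
        using r(2) \<open>prime r\<close> \<open>prime p\<close> by (simp add: primes_coprime)
      ultimately have "p ^ multiplicity p n dvd n div r" by (simp add: coprime_dvd_mult_right_iff)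
      then have "int (p ^ multiplicity p n) dvd int (n div r)" by (simp only: of_nat_dvd_iff)
      then show ?thesis by (rule dvd_mult)
    qed
    have "s - (if p \<in> T then k p * int (n div p) else 0) = (\<Sum>r\<in>T - {p}. k r * int (n div r))"
      unfolding s_def using finT by (auto simp: sum.remove[of T p])
    then show ?thesis using other T by (auto intro!: dvd_sum)
  qed
  have base: "\<not> int p dvd 1 + s \<and> \<not> int p dvd - int q + s" if p: "p \<in> prime_factors n" for p
  proof -
    have pp: "prime p" "p dvd n" using p by auto
    define w where "w = (if p \<in> T then k p * int (n div p) else 0)"
    have "multiplicity p n > 0" using p by (simp add: prime_factors_multiplicity)
    then have "int p dvd int (p ^ multiplicity p n)" by (simp add: dvd_power)
    then have "int p dvd s - w" using loc[OF p] dvd_trans unfolding w_def by blast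
    moreover have "\<not> p dvd q" using q pp by (meson coprime_common_divisor not_prime_unit)
    then have "\<not> int p dvd 1 + w" "\<not> int p dvd - int q + w"
      using k[OF p] pp unfolding w_def straddle_def by auto
    moreover have "int p dvd e + w" if "int p dvd e + s" "int p dvd s - w" for e
      using dvd_diff[OF that] by (simp add: algebra_simps)
    ultimately show ?thesis by blast
  qed
  have cop: "coprime x (int n)" if "\<And>p. p \<in> prime_factors n \<Longrightarrow> \<not> int p dvd x" for x :: int
  proof (rule ccontr)
    assume "\<not> coprime x (int n)"
    then have "\<not> coprime (nat \<bar>x\<bar>) n" by (metis coprime_int_iff coprime_abs_left_iff nat_0_le abs_ge_zero)
    then have "gcd (nat \<bar>x\<bar>) n \<noteq> 1" by (simp add: coprime_iff_gcd_eq_1)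
    then obtain p where p: "prime p" "p dvd gcd (nat \<bar>x\<bar>) n" by (metis prime_factor_nat)
    then have "p dvd nat \<bar>x\<bar>" "p dvd n" by (meson gcd_dvd1 gcd_dvd2 dvd_trans)+
    then have "int p dvd x" "p \<in> prime_factors n" using p n by (auto simp: prime_factors_dvd int_dvd_int_iff[symmetric] simp del: int_dvd_int_iff)
    then show False using that by blast
  qed
  show "coprime (1 + s) (int n)" "coprime (- int q + s) (int n)" using base by (auto intro!: cop)
qed

lemma six_minus_one_mod_three:
  assumes "c > 0"
  shows "(6 * c - 1) mod 3 = (2::nat)"
proof -
  obtain d where "c = Suc d" using assms gr0_implies_Suc by blast
  then have "6 * c - 1 = 2 + 3 * (2 * d + 1)" by simp
  then show ?thesis by (simp only: mod_mult_self2) simp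
qed

text \<open>For n = 12 * c this exhibits a unit below n / 2; together with
  \<open>six_minus_one_mod_three\<close> it bounds the least unit congruent to 2 modulo 3.\<close>

lemma coprime_six_minus_one:
  assumes "c > 0"
  shows "coprime (6 * c - 1) (12 * c :: nat)"
proof -
  obtain x where x: "6 * c = Suc x" using assms by (cases "6 * c") auto
  have "odd x" using arg_cong[OF x, of even] by simp
  then have "coprime x 2" by simp
  moreover have "coprime x (Suc x)" by simp
  ultimately have "coprime x (2 * Suc x)" by (simp only: coprime_mult_right_iff)
  moreover have "2 * Suc x = 12 * c" "6 * c - 1 = x" using x by simp_all
  ultimately show ?thesis by (simp only:)
qed

text \<open>Residues below q + 1 that are units are scarce by the minimality of q. Unless 3 divides
  n exactly once, q = 1 and only the residue 1 qualifies. Otherwise such a residue is 1 or q; the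
  first belongs to the empty set only, the second at most to the empty set or {2, 3}.\<close>

lemma straddle_crossing_even:
  assumes n: "n > 1" and n2: "even n \<Longrightarrow> 4 dvd n" and n12: "n \<noteq> 12" and n3: "n \<noteq> 3"
    and q: "q > 0" "coprime q n"
    and least: "3 dvd n \<Longrightarrow> \<not> 9 dvd n \<Longrightarrow> q mod 3 = 2 \<and> (\<forall>q'. q' mod 3 = 2 \<longrightarrow> coprime q' n \<longrightarrow> q \<le> q')"
    and q1: "\<not> (3 dvd n \<and> \<not> 9 dvd n) \<Longrightarrow> q = 1"
    and qn: "q + 1 < n"
    and k: "\<And>p. p \<in> prime_factors n \<Longrightarrow> straddle n q p (k p)"
    and T: "T \<subseteq> prime_factors n"
    and less: "(1 + (\<Sum>p\<in>T. k p * int (n div p))) mod int n < int q + 1"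
  shows "even (card T)"
proof -
  define s where "s = (\<Sum>p\<in>T. k p * int (n div p))"
  define \<tau> where "\<tau> = (1 + s) mod int n"
  note vert = straddle_vertex[OF _ q(2) k T, folded s_def]
  have cop: "coprime (1 + s) (int n)" "coprime (- int q + s) (int n)" using vert(1,2) n by auto
  have loc: "int (p ^ multiplicity p n) dvd s - (if p \<in> T then k p * int (n div p) else 0)"
    if "p \<in> prime_factors n" for p using vert(3) n that by auto
  have tau: "0 \<le> \<tau>" "\<tau> < int q + 1" "\<tau> < int n" using less n by (simp_all add: \<tau>_def s_def)
  have ctau: "coprime \<tau> (int n)" using cop(1) n by (simp add: \<tau>_def)
  then have tau0: "\<tau> \<noteq> 0" using n by auto
  have s_cong: "[s = \<tau> - 1] (mod int n)"
  proof -
    have "[1 + s = \<tau>] (mod int n)" by (simp add: \<tau>_def cong_def)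
    then have "[1 + s - 1 = \<tau> - 1] (mod int n)" by (intro cong_diff) auto
    then show ?thesis by simp
  qed
  have nzk: "\<not> int (p ^ multiplicity p n) dvd k p * int (n div p)" if p: "p \<in> prime_factors n" for p
  proof
    assume *: "int (p ^ multiplicity p n) dvd k p * int (n div p)"
    have pp: "prime p" "p dvd n" using p by auto
    have "\<not> int p dvd k p" using k[OF p] by (simp add: straddle_def)
    then have "coprime (int p) (k p)" using pp(1) by (simp add: prime_imp_coprime)
    then have "int (p ^ multiplicity p n) dvd int (n div p)" using * by (simp add: coprime_dvd_mult_right_iff)
    then have "p ^ multiplicity p n dvd n div p" by (simp only: of_nat_dvd_iff)
    then have "p ^ Suc (multiplicity p n) dvd n"
      using pp(2) by (metis dvd_mult_div_cancel mult_dvd_mono dvd_refl power_Suc)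
    then have "Suc (multiplicity p n) \<le> multiplicity p n"
      using pp(1) n by (intro multiplicity_geI) auto
    then show False by simp
  qed
  \<comment> \<open>The total shift is then 0 modulo n, so the shift at any p in \<open>T\<close>
    would be divisible by the full power of p in n, against \<open>nzk\<close>.\<close>
  have one: "T = {}" if "\<tau> = 1"
  proof (rule ccontr)
    assume "T \<noteq> {}"
    then obtain p where p: "p \<in> T" by auto
    then have pn: "p \<in> prime_factors n" using T by auto
    have "int n dvd s" using s_cong that by (simp add: cong_0_iff)
    then have "int (p ^ multiplicity p n) dvd s" by (meson dvd_trans multiplicity_dvd of_nat_dvd_iff)
    then have "int (p ^ multiplicity p n) dvd s - (s - k p * int (n div p))"
      using loc[OF pn] p by - (rule dvd_diff, auto)
    then show False using nzk[OF pn] by simp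
  qed
  show ?thesis
  proof (cases "3 dvd n \<and> \<not> 9 dvd n")
    case False
    then have "\<tau> = 1" using q1 tau tau0 by auto
    then show ?thesis using one by simp
  next
    case True
    define m where "m = n div 3"
    have m: "n = 3 * m" using True by (simp add: m_def)
    have m3: "\<not> 3 dvd m" using True m by auto
    have q3: "q mod 3 = 2" and qle: "\<And>q'. q' mod 3 = 2 \<Longrightarrow> coprime q' n \<Longrightarrow> q \<le> q'"
      using least True by auto
    have qleZ: "int q \<le> x" if "x > 0" "x mod 3 = 2" "coprime x (int n)" for x
    proof -
      have "nat x mod 3 = 2" using that nat_mod_distrib[of x 3] by simp
      moreover have "coprime (nat x) n" using that by (simp flip: coprime_int_iff)
      ultimately have "q \<le> nat x" by (rule qle)
      then show ?thesis using that(1) by linarith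
    qed
    have "\<tau> mod 3 \<noteq> 0"
    proof
      assume "\<tau> mod 3 = 0"
      then have "3 dvd \<tau>" "3 dvd int n" using True by auto
      then have "is_unit (3::int)" using ctau by (meson coprime_common_divisor)
      then show False by simp
    qed
    then have "\<tau> mod 3 = 1 \<or> \<tau> mod 3 = 2" by presburger
    then consider "\<tau> mod 3 = 1" | "\<tau> mod 3 = 2" by blast
    then show ?thesis
    proof cases
      case 1
      \<comment> \<open>Modulo n, \<open>int q + 1 - \<tau>\<close> is the negative of the
        corresponding vertex of the cube based at - q, hence a unit. Being congruent to 2 modulo 3,
        it is at least q.\<close>
      have "(int q + 1 - \<tau>) mod 3 = 2" using 1 q3 by presburger
      moreover have "coprime (int q + 1 - \<tau>) (int n)"
      proof -
        have "[- (- int q + s) = int q + 1 - \<tau>] (mod int n)"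
          using cong_diff[OF cong_refl[of "int q"] s_cong] by (simp add: algebra_simps)
        then show ?thesis using cop(2) by (metis cong_imp_coprime coprime_minus_left_iff)
      qed
      ultimately have "int q \<le> int q + 1 - \<tau>" using tau by (intro qleZ) auto
      then have "\<tau> = 1" using tau tau0 by linarith
      then show ?thesis using one by simp
    next
      case 2
      then have "\<tau> = int q" using tau ctau tau0 qleZ[of \<tau>] by linarith
      then have s_q: "[s = int q - 1] (mod int n)" using s_cong by simp
      have no5: "p < 5" if p: "p \<in> T" for p
      proof (rule ccontr)
        assume p5: "\<not> p < 5"
        have pn: "p \<in> prime_factors n" using p T by auto
        have "int n dvd s - (int q - 1)" using s_q by (simp add: cong_iff_dvd_diff)
        then have "int (p ^ multiplicity p n) dvd s - (int q - 1)"
          by (meson dvd_trans multiplicity_dvd of_nat_dvd_iff)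
        then have "int (p ^ multiplicity p n) dvd (s - (int q - 1)) - (s - k p * int (n div p))"
          using loc[OF pn] p by - (rule dvd_diff, auto)
        then show False using k[OF pn] p5 by (simp add: straddle_def algebra_simps)
      qed
      have "T \<subseteq> {2, 3}"
      proof
        fix p assume p: "p \<in> T"
        then have "prime p" using T by auto
        moreover have "p \<noteq> 4" using \<open>prime p\<close> by auto
        ultimately show "p \<in> {2, 3}" using no5[OF p] prime_ge_2_nat[of p] by (auto simp: numeral_eq_Suc)
      qed
      \<comment> \<open>The shift at 2 is a multiple of n / 2 and so of 3, whereas q - 1 is
        congruent to 1 modulo 3.\<close>
      moreover have "T \<noteq> {2}"
      proof
        assume T2: "T = {2}"
        then have "2 \<in> prime_factors n" using T by auto
        then have "even n" by auto
        then have "4 dvd n" by (rule n2)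
        then have "4 dvd m" using m by presburger
        then obtain c where c: "m = 4 * c" by blast
        have "n div 2 = 6 * c" using m c by simp
        then have "s = k 2 * (6 * int c)" by (simp add: s_def T2)
        then have "s = 3 * (k 2 * 2 * int c)" by simp
        then have "3 dvd s" by (rule dvdI)
        moreover have "3 dvd int n" by (simp add: m)
        then have "3 dvd s - (int q - 1)" using s_q dvd_trans unfolding cong_iff_dvd_diff by blast
        ultimately have "3 dvd s - (s - (int q - 1))" by (rule dvd_diff)
        then have "3 dvd int q - 1" by simp
        then show False using q3 by presburger
      qed
      \<comment> \<open>Here q = 1 + m * g with m = n / 3, g positive and congruent to m modulo 3.
        This is too large compared with explicit units congruent to 2 modulo 3: for odd n the number
        2, and for m = 4 * c the number 2 * c + 3 or 6 * c - 1 according to m modulo 3. The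
        exclusions of n = 3 and n = 12 settle the boundary cases.\<close>
      moreover have "T \<noteq> {3}"
      proof
        assume T3: "T = {3}"
        have "k 3 = int m" using k[of 3] T3 T True by (auto simp: straddle_def m_def)
        then have s: "s = int m * int m" by (simp add: s_def T3 m_def)
        have "int n dvd int m * int m - (int q - 1)" using s_q by (simp add: s cong_iff_dvd_diff)
        then obtain e where e: "int m * int m - (int q - 1) = 3 * int m * e" using m by auto
        then have e': "int q = 1 + int m * (int m - 3 * e)" by (simp add: algebra_simps)
        define g where "g = int m - 3 * e"
        have qg: "int q = 1 + int m * g" using e' g_def by simp
        have gm: "g mod 3 = int m mod 3" by (simp add: g_def mod_diff_right_eq[symmetric])
        have mpos: "m > 0" using n m by simp
        have gpos: "g \<ge> 1"
        proof (rule ccontr)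
          assume "\<not> g \<ge> 1"
          moreover have "g \<noteq> 0" using gm m3 by presburger
          ultimately have "int m * g \<le> int m * (-1)" using mpos by (intro mult_left_mono) auto
          then show False using qg q(1) mpos by linarith
        qed
        have q2: "q \<ge> 2" using q3 by presburger
        show False
        proof (cases "even n")
          case False
          have "coprime 2 n" using False by simp
          then have "q \<le> 2" by (intro qle) auto
          then have "int m * g = 1" using qg q2 by linarith
          then have "m = 1" using zmult_eq_1_iff[of "int m" g] by auto
          then show False using n3 m by simp
        next
          case ev: True
          then have "4 dvd n" by (rule n2)
          then have "4 dvd m" using m by presburger
        then obtain c where c: "m = 4 * c" by blast
          have c0: "c > 0" "c \<noteq> 1" using mpos c n12 m by auto
          have "int m mod 3 = 1 \<or> int m mod 3 = 2" using m3 by presburger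
          then show False
          proof
            assume m1: "int m mod 3 = 1"
            have "coprime (2 * c + 3) n"
            proof (rule ccontr)
              assume "\<not> coprime (2 * c + 3) n"
              then have "gcd (2 * c + 3) n \<noteq> 1" by (simp add: coprime_iff_gcd_eq_1)
              then obtain p where p: "prime p" "p dvd gcd (2 * c + 3) n" by (metis prime_factor_nat)
              then have pd: "p dvd 2 * c + 3" "p dvd 12 * c" using m c by auto
              have "p dvd 6 * (2 * c + 3)" using pd(1) by (rule dvd_mult)
              then have "p dvd 6 * (2 * c + 3) - 12 * c" using pd(2) by (rule dvd_diff_nat)
              then have "p dvd 18" by simp
              then have "p dvd 2 * (3 * 3)" by simp
              then have "p dvd 2 \<or> p dvd 3" using p(1) by (simp only: prime_dvd_mult_iff) auto
              then have "p = 2 \<or> p = 3" using p(1) primes_dvd_imp_eq[of p 2] primes_dvd_imp_eq[of p 3] by auto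
              then show False
              proof
                assume "p = 2"
                then show False using pd(1) by presburger
              next
                assume "p = 3"
                then show False using pd(1) m3 c by presburger
              qed
            qed
            moreover have "(2 * c + 3) mod 3 = 2" using m1 c by presburger
            ultimately have "q \<le> 2 * c + 3" by (intro qle)
            moreover have "int m * 1 \<le> int m * g" using gpos by (intro mult_left_mono) auto
            ultimately have "1 + 4 * c \<le> 2 * c + 3" using qg c by simp
            then show False using c0 by linarith
          next
            assume m2: "int m mod 3 = 2"
            have "g \<ge> 2" using gm m2 gpos by presburger
            then have "int m * 2 \<le> int m * g" by (intro mult_left_mono) auto
            then have "1 + 2 * m \<le> q" using qg by linarith
            moreover have "q \<le> 6 * c - 1"
            proof (rule qle)
              show "(6 * c - 1) mod 3 = 2" using c0(1) by (rule six_minus_one_mod_three)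
              show "coprime (6 * c - 1) n" using m c coprime_six_minus_one[OF c0(1)] by simp
            qed
            ultimately show False using c c0 by linarith
          qed
        qed
      qed
      ultimately have "T = {} \<or> T = {2, 3}" by blast
      then show ?thesis by auto
    qed
  qed
qed

text \<open>Two cubes with the same shifts, based at 1 and at - q, are compared. Passing from the
  first to the second lowers every residue by q + 1, except that those falling below 0 gain n. The
  constant cancels in the alternating sum and the wrapped vertices all carry the sign +1, so the two
  sums differ and one of them is nonzero. The excluded value 12 belongs to the index 6.\<close>

lemma unit_cube_exists:
  assumes n: "n > 2" and n2: "even n \<Longrightarrow> 4 dvd n" and n12: "n \<noteq> 12"
  obtains k u where "\<And>p. p \<in> prime_factors n \<Longrightarrow> \<not> int p dvd k p"
    and "\<And>T. T \<subseteq> prime_factors n \<Longrightarrow> coprime (u + (\<Sum>p\<in>T. k p * int (n div p))) (int n)"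
    and "(\<Sum>T\<in>Pow (prime_factors n). (-1) ^ card T * ((u + (\<Sum>p\<in>T. k p * int (n div p))) mod int n)) \<noteq> 0"
proof (cases "n = 3")
  case True
  have pf: "prime_factors n = {3}" unfolding True by (simp add: prime_prime_factors)
  have Pow: "Pow {3::nat} = {{}, {3}}" by auto
  show ?thesis
  proof (rule that[of "\<lambda>_. 1" 1]; unfold pf)
    fix T assume "T \<subseteq> {3::nat}"
    then have "T = {} \<or> T = {3}" by auto
    then show "coprime (1 + (\<Sum>p\<in>T. 1 * int (n div p))) (int n)" by (auto simp: True)
  qed (auto simp: True Pow)
next
  case n3: False
  \<comment> \<open>The value 1 fails only if 3 divides n exactly once: a nonzero shift at 3 that
    keeps 1 a unit is congruent to 1 modulo 3 and would send -1 to 0, so q has to be 2 modulo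
    3.\<close>
  define q where "q = (if 3 dvd n \<and> \<not> 9 dvd n then LEAST q. q mod 3 = 2 \<and> coprime q n else 1)"
  have least: "q mod 3 = 2 \<and> coprime q n \<and> (\<forall>q'. q' mod 3 = 2 \<longrightarrow> coprime q' n \<longrightarrow> q \<le> q')"
    if three: "3 dvd n \<and> \<not> 9 dvd n"
  proof -
    obtain c where c: "n = 3 * c" using three by blast
    have c0: "c > 0" using c n by simp
    then obtain d where "c = Suc d" using gr0_implies_Suc by blast
    then have "n - 1 = 3 * d + 2" using c by simp
    moreover have "(3 * d + 2) mod 3 = 2" by presburger
    ultimately have "(n - 1) mod 3 = 2" by (simp only:)
    moreover have "coprime (n - 1) n" using n by (intro coprime_diff_one_left_nat) simp
    ultimately have ex: "(n - 1) mod 3 = 2 \<and> coprime (n - 1) n" by blast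
    have q: "q = (LEAST q. q mod 3 = 2 \<and> coprime q n)" using three by (simp add: q_def)
    have "q mod 3 = 2 \<and> coprime q n"
      unfolding q by (rule LeastI[of "\<lambda>q. q mod 3 = 2 \<and> coprime q n", OF ex])
    moreover have "q \<le> q'" if "q' mod 3 = 2" "coprime q' n" for q'
      unfolding q by (rule Least_le) (use that in blast)
    ultimately show ?thesis by blast
  qed
  have q1: "\<not> (3 dvd n \<and> \<not> 9 dvd n) \<Longrightarrow> q = 1" by (auto simp: q_def)
  have q0: "q > 0" using least q1 by (cases "3 dvd n \<and> \<not> 9 dvd n") (auto intro: Nat.gr0I)
  have qn: "coprime q n" using least q1 by (cases "3 dvd n \<and> \<not> 9 dvd n") auto
  have small: "q + 1 < n"
  proof (cases "3 dvd n \<and> \<not> 9 dvd n")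
    case True
    show ?thesis
    proof (cases "even n")
      case ev: True
      then have "4 dvd n" by (rule n2)
      then have "12 dvd n" using True by presburger
      then obtain c where c: "n = 12 * c" by blast
      have c0: "c > 0" using n c by auto
      have "coprime (6 * c - 1) n" using c coprime_six_minus_one[OF c0] by simp
      moreover have "(6 * c - 1) mod 3 = 2" using c0 by (rule six_minus_one_mod_three)
      ultimately have "q \<le> 6 * c - 1" using least[OF True] by blast
      then show ?thesis using c c0 by linarith
    next
      case False
      then have "q \<le> 2" using least[OF True] by simp
      moreover have "n \<noteq> 4" using True by auto
      ultimately show ?thesis using n n3 by linarith
    qed
  qed (use n q1 in auto)
  define \<Delta> where "\<Delta> = int q + 1"
  have "\<exists>k. \<forall>p\<in>prime_factors n. straddle n q p (k p)"
    using n n2 q0 qn least by (intro bchoice ballI exists_straddle) auto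
  then obtain k where k: "\<And>p. p \<in> prime_factors n \<Longrightarrow> straddle n q p (k p)" by blast
  define s where "s T = (\<Sum>p\<in>T. k p * int (n div p))" for T
  define S where "S u = (\<Sum>T\<in>Pow (prime_factors n). (-1) ^ card T * ((u + s T) mod int n))" for u
  have cop: "coprime (1 + s T) (int n)" "coprime (- int q + s T) (int n)" if "T \<subseteq> prime_factors n" for T
    using straddle_vertex(1,2)[OF _ qn k that] n by (auto simp: s_def)
  have fin: "finite (Pow (prime_factors n))" by simp
  have ne: "prime_factors n \<noteq> {}"
    using n prime_factor_nat[of n] by (auto simp: prime_factors_dvd)
  have alt: "(\<Sum>T\<in>Pow (prime_factors n). (-1) ^ card T) = (0::int)"
  proof -
    have "(\<Prod>p\<in>prime_factors n. (-1::int) + 1) = (\<Sum>T\<in>Pow (prime_factors n). (-1) ^ card T)"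
      by (subst prod_add) simp_all
    then show ?thesis using ne by (simp add: power_0_left card_eq_0_iff)
  qed
  define C where "C = {T\<in>Pow (prime_factors n). (1 + s T) mod int n < \<Delta>}"
  have step: "(1 + s T) mod int n - (- int q + s T) mod int n = \<Delta> - (if (1 + s T) mod int n < \<Delta> then int n else 0)" for T
  proof -
    define x where "x = (1 + s T) mod int n"
    have x: "0 \<le> x" "x < int n" using n by (simp_all add: x_def)
    have "(- int q + s T) mod int n = (x - \<Delta>) mod int n"
      unfolding x_def \<Delta>_def mod_diff_left_eq by (simp add: algebra_simps)
    also have "\<dots> = (if x < \<Delta> then x - \<Delta> + int n else x - \<Delta>)"
    proof (cases "x < \<Delta>")
      case True
      have "(x - \<Delta>) mod int n = (x - \<Delta> + int n) mod int n" by simp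
      also have "\<dots> = x - \<Delta> + int n" using True x small by (intro mod_pos_pos_trivial) (auto simp: \<Delta>_def)
      finally show ?thesis using True by simp
    next
      case False
      then show ?thesis using x small by (auto simp: \<Delta>_def intro!: mod_pos_pos_trivial)
    qed
    finally show ?thesis by (auto simp: x_def)
  qed
  have "S 1 - S (- int q) = (\<Sum>T\<in>Pow (prime_factors n). \<Delta> * (-1) ^ card T
      - int n * (if T \<in> C then (-1) ^ card T else 0))"
    unfolding S_def sum_subtractf[symmetric]
    by (intro sum.cong refl, subst right_diff_distrib[symmetric], subst step) (auto simp: C_def right_diff_distrib mult.commute)
  also have "\<dots> = - int n * (\<Sum>T\<in>C. (-1) ^ card T)"
  proof -
    have "(\<Sum>T\<in>Pow (prime_factors n). (if T \<in> C then (-1) ^ card T else 0)) = (\<Sum>T\<in>C. (-1) ^ card T :: int)"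
      using fin by (subst sum.inter_filter[symmetric]) (auto simp: C_def intro!: sum.cong)
    then show ?thesis by (simp add: sum_subtractf alt flip: sum_distrib_left)
  qed
  also have "(\<Sum>T\<in>C. (-1) ^ card T) = (\<Sum>T\<in>C. 1 :: int)"
  proof (rule sum.cong)
    fix T assume "T \<in> C"
    then have "even (card T)"
      using n n2 n12 n3 q0 qn least q1 small k
      by (intro straddle_crossing_even[of n q k T]) (auto simp: C_def \<Delta>_def s_def)
    then show "(-1) ^ card T = (1::int)" by simp
  qed simp
  also have "(\<Sum>T\<in>C. 1 :: int) = int (card C)" by simp
  finally have "S 1 - S (- int q) = - int n * int (card C)" .
  moreover have "{} \<in> C" using n q0 by (auto simp: C_def s_def \<Delta>_def)
  then have "card C > 0" using fin by (auto simp: card_gt_0_iff C_def)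
  ultimately have "S 1 \<noteq> S (- int q)" using n by auto
  then have "S 1 \<noteq> 0 \<or> S (- int q) \<noteq> 0" by auto
  then show ?thesis
    using that[of k 1] that[of k "- int q"] cop k by (auto simp: S_def s_def straddle_def)
qed

text \<open>The exception \<open>6\<close> reflects that the values for 2 and 6 are proportional.\<close>

theorem wedge_independent:
  fixes m :: "nat \<Rightarrow> int"
  assumes L: "L > 0" "\<And>r. r \<in> {2..R} \<Longrightarrow> 2 * r dvd L"
    and zero: "(\<Sum>s<L. of_int (\<Sum>r=2..R. m r * wedge L r (int s)) * unity L (int s)) = 0"
    and r: "r \<in> {2..R}" "r \<noteq> 2" "r \<noteq> 6"
  shows "m r = 0"
proof (rule ccontr)
  assume "m r \<noteq> 0"
  define B where "B = {r\<in>{2..R}. m r \<noteq> 0 \<and> r \<noteq> 2 \<and> r \<noteq> 6}"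
  have B: "finite B" "B \<noteq> {}" using \<open>m r \<noteq> 0\<close> r by (auto simp: B_def)
  define s0 where "s0 = Max B"
  have s0: "s0 \<in> B" "\<And>r. r \<in> B \<Longrightarrow> r \<le> s0" using B by (auto simp: s0_def)
  have s0': "s0 \<in> {2..R}" "m s0 \<noteq> 0" "s0 \<noteq> 2" "s0 \<noteq> 6" using s0(1) by (auto simp: B_def)
  \<comment> \<open>A larger multiple of \<open>s0\<close> with nonzero coefficient could only be 6,
    by maximality; equal parity would then force \<open>s0 = 2\<close>, which is excluded.\<close>
  have top: "r = s0" if r: "r \<in> {2..R}" "m r \<noteq> 0" "s0 dvd r" "odd r \<longleftrightarrow> odd s0" for r
  proof (rule ccontr)
    assume "r \<noteq> s0"
    then have "r > s0" using dvd_imp_le[OF r(3)] r(1) by auto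
    then have "r \<notin> B" using s0(2) by fastforce
    then have "r = 6" using r \<open>r > s0\<close> s0' by (auto simp: B_def)
    then have "s0 \<in> {1,2,3,4,5}" "s0 dvd 6" "even s0" using r \<open>r > s0\<close> s0' by auto
    then show False using s0' by auto
  qed
  define n where "n = (if even s0 then 2 * s0 else s0)"
  have n: "n > 2" "even n \<Longrightarrow> 4 dvd n" "n \<noteq> 12" using s0' by (auto simp: n_def)
  have "\<exists>k u. (\<forall>p\<in>prime_factors n. \<not> int p dvd k p) \<and>
      (\<forall>T. T \<subseteq> prime_factors n \<longrightarrow> coprime (u + (\<Sum>p\<in>T. k p * int (n div p))) (int n)) \<and>
      (\<Sum>T\<in>Pow (prime_factors n). (-1) ^ card T * ((u + (\<Sum>p\<in>T. k p * int (n div p))) mod int n)) \<noteq> 0"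
  proof (rule unit_cube_exists[OF n])
    fix k u
    assume ku: "\<And>p. p \<in> prime_factors n \<Longrightarrow> \<not> int p dvd k p"
      "\<And>T. T \<subseteq> prime_factors n \<Longrightarrow> coprime (u + (\<Sum>p\<in>T. k p * int (n div p))) (int n)"
      "(\<Sum>T\<in>Pow (prime_factors n). (-1) ^ card T * ((u + (\<Sum>p\<in>T. k p * int (n div p))) mod int n)) \<noteq> 0"
    show ?thesis
      by (intro exI[of _ k] exI[of _ u] conjI ballI allI impI) (rule ku(1), assumption, rule ku(2), assumption, rule ku(3))
  qed
  then obtain k u where ku: "\<And>p. p \<in> prime_factors n \<Longrightarrow> \<not> int p dvd k p"
    "\<And>T. T \<subseteq> prime_factors n \<Longrightarrow> coprime (u + (\<Sum>p\<in>T. k p * int (n div p))) (int n)"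
    "(\<Sum>T\<in>Pow (prime_factors n). (-1) ^ card T * ((u + (\<Sum>p\<in>T. k p * int (n div p))) mod int n)) \<noteq> 0"
    by blast
  have "m s0 * (\<Sum>T\<in>Pow (prime_factors n). (-1) ^ card T * ((u + (\<Sum>p\<in>T. k p * int (n div p))) mod int n)) = 0"
    unfolding n_def
    by (rule cube_top[OF L zero s0'(1) top ku(1)[unfolded n_def] ku(2)[unfolded n_def]])
  then show False using ku(3) s0'(2) by simp
qed

subsection \<open>Eulerian functions\<close>

lemma double_sum_swap:
  fixes f :: "nat \<Rightarrow> nat \<Rightarrow> complex"
  assumes bound: "\<And>j k. norm (f j k) \<le> a j * b k" and a: "summable a" "\<And>j. 0 \<le> a j"
    and b: "summable b" "\<And>k. 0 \<le> b k"
  shows "(\<lambda>p. f (fst p) (snd p)) summable_on UNIV"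
    and "\<And>j. summable (f j)" "\<And>k. summable (\<lambda>j. f j k)"
    and "summable (\<lambda>k. \<Sum>j. f j k)" "summable (\<lambda>j. \<Sum>k. f j k)"
    and "(\<Sum>k. \<Sum>j. f j k) = (\<Sum>j. \<Sum>k. f j k)"
proof -
  have on: "a summable_on UNIV" "b summable_on UNIV"
    using a b by (auto simp: summable_on_UNIV_nonneg_real_iff)
  have prod: "(\<lambda>p. a (fst p) * b (snd p)) summable_on UNIV \<times> UNIV"
  proof (rule summable_on_SigmaI)
    fix j :: nat
    have "(b has_sum infsum b UNIV) UNIV" using on by simp
    then show "((\<lambda>k. a (fst (j, k)) * b (snd (j, k))) has_sum a j * infsum b UNIV) UNIV"
      by (simp add: has_sum_cmult_right)
    show "(\<lambda>j. a j * infsum b UNIV) summable_on UNIV" using on by (simp add: summable_on_cmult_left)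
  qed (use a b in auto)
  have nrm: "(\<lambda>p. norm (a (fst p) * b (snd p))) summable_on UNIV \<times> UNIV"
    using prod a b by (simp add: abs_mult)
  have abs: "(\<lambda>p. norm (f (fst p) (snd p))) summable_on UNIV"
    using Infinite_Sum.abs_summable_on_comparison_test[OF nrm, of "\<lambda>p. f (fst p) (snd p)"] bound a b
    by (auto simp: abs_mult)
  show on2: "(\<lambda>p. f (fst p) (snd p)) summable_on UNIV"
    using abs by (rule abs_summable_summable)
  show sj: "summable (f j)" for j
    by (rule summable_comparison_test[of _ "\<lambda>k. a j * b k"]) (use bound b in \<open>auto intro: summable_mult\<close>)
  show sk: "summable (\<lambda>j. f j k)" for k
    by (rule summable_comparison_test[of _ "\<lambda>j. a j * b k"]) (use bound a in \<open>auto intro: summable_mult2\<close>)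
  have nsj: "summable (\<lambda>k. norm (f j k))" for j
    by (rule summable_comparison_test[of _ "\<lambda>k. a j * b k"]) (use bound b in \<open>auto intro: summable_mult\<close>)
  have nsk: "summable (\<lambda>j. norm (f j k))" for k
    by (rule summable_comparison_test[of _ "\<lambda>j. a j * b k"]) (use bound a in \<open>auto intro: summable_mult2\<close>)
  have bk: "norm (\<Sum>j. f j k) \<le> suminf a * b k" for k
  proof -
    have "norm (\<Sum>j. f j k) \<le> (\<Sum>j. norm (f j k))" by (rule summable_norm[OF nsk])
    also have "\<dots> \<le> (\<Sum>j. a j * b k)" by (rule suminf_le[OF bound nsk summable_mult2[OF a(1)]])
    finally show ?thesis using a by (simp add: suminf_mult2)
  qed
  have bj: "norm (\<Sum>k. f j k) \<le> a j * suminf b" for j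
  proof -
    have "norm (\<Sum>k. f j k) \<le> (\<Sum>k. norm (f j k))" by (rule summable_norm[OF nsj])
    also have "\<dots> \<le> (\<Sum>k. a j * b k)" by (rule suminf_le[OF bound nsj summable_mult[OF b(1)]])
    finally show ?thesis using b by (simp add: suminf_mult)
  qed
  have n1: "summable (\<lambda>k. norm (\<Sum>j. f j k))"
    by (rule summable_comparison_test[of _ "\<lambda>k. suminf a * b k"]) (use bk b in \<open>auto intro: summable_mult\<close>)
  have n2: "summable (\<lambda>j. norm (\<Sum>k. f j k))"
    by (rule summable_comparison_test[of _ "\<lambda>j. a j * suminf b"]) (use bj a in \<open>auto intro: summable_mult2\<close>)
  show "summable (\<lambda>k. \<Sum>j. f j k)" "summable (\<lambda>j. \<Sum>k. f j k)"
    using n1 n2 by (auto intro: summable_norm_cancel)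
  have i1: "infsum g UNIV = suminf g" if "summable (\<lambda>n. norm (g n))" for g :: "nat \<Rightarrow> complex"
    using that by (metis infsumI norm_summable_imp_has_sum summable_norm_cancel summable_sums)
  have "infsum (\<lambda>j. infsum (\<lambda>k. f j k) UNIV) UNIV = infsum (\<lambda>k. infsum (\<lambda>j. f j k) UNIV) UNIV"
    by (rule infsum_swap_banach) (use on2 in \<open>simp add: case_prod_unfold\<close>)
  then show "(\<Sum>k. \<Sum>j. f j k) = (\<Sum>j. \<Sum>k. f j k)"
    using n1 n2 by (simp add: i1 nsj nsk)
qed

text \<open>These turn out to be the values of the stuffle character on the letters; Euler's
  constant takes the place of zeta at 1, where the series diverges.\<close>

definition zeta_gamma :: "nat \<Rightarrow> complex" where
  "zeta_gamma k = (if k = 1 then euler_mascheroni else zeta_nat k)"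

lemma zeta_nat_summable: "k \<ge> 2 \<Longrightarrow> summable (\<lambda>n. 1 / of_nat (Suc n) ^ k :: complex)"
proof -
  assume k: "k \<ge> 2"
  have "summable (\<lambda>n. inverse ((real (Suc n)) ^ k))" 
    using inverse_power_summable[OF k, where 'a = real] by (subst summable_Suc_iff) simp
  then have "summable (\<lambda>n. norm (1 / of_nat (Suc n) ^ k :: complex))"
    by (simp add: norm_divide norm_power inverse_eq_divide del: of_nat_Suc)
  then show ?thesis by (rule summable_norm_cancel)
qed

lemma norm_zeta_nat_le: "k \<ge> 2 \<Longrightarrow> norm (zeta_nat k) \<le> (\<Sum>n. 1 / real (Suc n) ^ 2)"
proof -
  assume k: "k \<ge> 2"
  have s2: "summable (\<lambda>n. 1 / real (Suc n) ^ 2)"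
    using inverse_power_summable[of 2, where 'a = real]
      summable_Suc_iff[of "\<lambda>n. inverse (real n ^ 2)"] by (simp add: inverse_eq_divide)
  have le: "norm (1 / of_nat (Suc n) ^ k :: complex) \<le> 1 / real (Suc n) ^ 2" for n
    using k by (simp add: norm_divide norm_power frac_le power_increasing del: of_nat_Suc)
  have sk: "summable (\<lambda>n. norm (1 / of_nat (Suc n) ^ k :: complex))"
    by (rule summable_comparison_test[OF _ s2]) (use le in auto)
  have "norm (zeta_nat k) \<le> (\<Sum>n. norm (1 / of_nat (Suc n) ^ k :: complex))"
    unfolding zeta_nat_def by (rule summable_norm[OF sk])
  also have "\<dots> \<le> (\<Sum>n. 1 / real (Suc n) ^ 2)" by (rule suminf_le[OF le sk s2])
  finally show ?thesis .
qed

lemma zeta_gamma_bounded: "\<exists>C. \<forall>k\<ge>1. norm (zeta_gamma k) \<le> C"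
proof -
  have "norm (zeta_gamma k) \<le> max (norm (euler_mascheroni :: complex)) (\<Sum>n. 1 / real (Suc n) ^ 2)" if "k \<ge> 1" for k
    using norm_zeta_nat_le[of k] that by (cases "k = 1") (auto simp: zeta_gamma_def)
  then show ?thesis by blast
qed

text \<open>With \<open>zeta_gamma 1\<close> equal to Euler's constant, the exceptional linear term
  for r = 1 becomes the term n = 0 of the common series, so both cases of \<open>ell\<close> are
  handled at once from here on.\<close>

lemma ell_sums:
  assumes z: "norm z < 1" and r: "r \<ge> 1"
  shows "(\<lambda>n. (-1) ^ n * zeta_gamma (r * (n + 1)) * z ^ (r * (n + 1)) / of_nat (n + 1)) sums ell r z"
    and "summable (\<lambda>n. norm ((-1) ^ n * zeta_gamma (r * (n + 1)) * z ^ (r * (n + 1)) / of_nat (n + 1)))"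
proof -
  define f where "f n = (-1) ^ n * zeta_gamma (r * (n + 1)) * z ^ (r * (n + 1)) / of_nat (n + 1)" for n
  obtain C where C: "\<And>k. k \<ge> 1 \<Longrightarrow> norm (zeta_gamma k) \<le> C" using zeta_gamma_bounded by blast
  have C0: "C \<ge> 0" using C[of 1] norm_ge_zero order_trans by blast
  have le: "norm (f n) \<le> C * norm z ^ n" for n
  proof -
    have "norm (f n) \<le> norm (zeta_gamma (r * (n + 1))) * norm z ^ (r * (n + 1))"
    proof -
      define X where "X = norm (zeta_gamma (r * (n + 1))) * norm z ^ (r * (n + 1))"
      have "norm (f n) = X / real (n + 1)"
        unfolding f_def X_def norm_divide norm_mult norm_power norm_of_nat by simp
      also have "\<dots> \<le> X / 1" by (rule divide_left_mono) (auto simp: X_def)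
      finally show ?thesis by (simp add: X_def)
    qed
    also have "\<dots> \<le> C * norm z ^ n"
    proof (rule mult_mono)
      show "norm z ^ (r * (n + 1)) \<le> norm z ^ n"
      proof (rule power_decreasing)
        have "1 * n \<le> r * (n + 1)" using r by (intro mult_le_mono) auto
        then show "n \<le> r * (n + 1)" by simp
      qed (use z in auto)
    qed (use C r C0 in auto)
    finally show ?thesis .
  qed
  have sn: "summable (\<lambda>n. norm (f n))"
    by (rule summable_comparison_test[of _ "\<lambda>n. C * norm z ^ n"])
       (use le z in \<open>auto intro: summable_mult summable_geometric\<close>)
  then show "summable (\<lambda>n. norm ((-1) ^ n * zeta_gamma (r * (n + 1)) * z ^ (r * (n + 1)) / of_nat (n + 1)))"
    by (simp add: f_def)
  have s: "summable f" using sn by (rule summable_norm_cancel)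
  have "suminf f = ell r z"
  proof (cases "r = 1")
    case True
    have "suminf f = f 0 + (\<Sum>n. f (Suc n))" using suminf_split_head[OF s] by simp
    moreover have "f 0 = euler_mascheroni * z" using True by (simp add: f_def zeta_gamma_def)
    moreover have "f (Suc n) = - (zeta_nat (n + 2) * (- z) ^ (n + 2) / of_nat (n + 2))" for n
      using True power_minus[of z n] by (simp add: f_def zeta_gamma_def)
    moreover have "summable (\<lambda>n. f (Suc n))" using s by (simp only: summable_Suc_iff)
    ultimately show ?thesis using True suminf_minus[of "\<lambda>n. - f (Suc n)"]
      by (simp add: ell_def summable_minus_iff)
  next
    case False
    have "f n = - (zeta_nat ((n + 1) * r) * (- (z ^ r)) ^ (n + 1) / of_nat (n + 1))" for n
    proof -
      have "r * (n + 1) \<noteq> 1" using False by (metis nat_mult_eq_1_iff)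
      moreover have p: "(- (z ^ r)) ^ (n + 1) = - ((-1) ^ n * z ^ (r * (n + 1)))"
        by (subst power_minus) (simp add: power_add power_mult)
      ultimately show ?thesis unfolding f_def zeta_gamma_def p mult.commute[of "n + 1" r] by simp
    qed
    then have "f = (\<lambda>n. - (zeta_nat ((n + 1) * r) * (- (z ^ r)) ^ (n + 1) / of_nat (n + 1)))" by auto
    moreover from this have "summable (\<lambda>n. zeta_nat ((n + 1) * r) * (- (z ^ r)) ^ (n + 1) / of_nat (n + 1))"
      using s summable_minus_iff by metis
    ultimately show ?thesis using False by (simp only: ell_def if_False suminf_minus)
  qed
  then show "(\<lambda>n. (-1) ^ n * zeta_gamma (r * (n + 1)) * z ^ (r * (n + 1)) / of_nat (n + 1)) sums ell r z"
    using s by (simp add: f_def[abs_def] sums_iff)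
qed

text \<open>Adding the series at t and e * t cancels the terms with even n and doubles those with n
  = 2 * m + 1, since e ^ (r * (n + 1)) = (-1) ^ (n + 1). The doubling cancels the 2 in the
  denominator, and the change of sign pattern is supplied by the powers of w.\<close>

lemma ell_duplication:
  assumes t: "norm t < 1" and r: "r \<ge> 1" and w: "w ^ (2 * r) = -1" and e: "e ^ r = -1"
  shows "ell (2 * r) (w * t) = ell r t + ell r (e * t)"
proof -
  have nw: "norm w = 1" 
  proof -
    have "norm w ^ (2 * r) = 1" using w by (metis norm_minus_cancel norm_one norm_power)
    then show ?thesis using r power_eq_imp_eq_base[of "norm w" "2 * r" 1] by simp
  qed
  have ne: "norm e = 1"
  proof -
    have "norm e ^ r = 1" using e by (metis norm_minus_cancel norm_one norm_power)
    then show ?thesis using r power_eq_imp_eq_base[of "norm e" r 1] by simp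
  qed
  define f where "f n = (-1) ^ n * zeta_gamma (r * (n + 1)) * t ^ (r * (n + 1)) / of_nat (n + 1)
      + (-1) ^ n * zeta_gamma (r * (n + 1)) * (e * t) ^ (r * (n + 1)) / of_nat (n + 1)" for n
  have s: "f sums (ell r t + ell r (e * t))"
    unfolding f_def using t r ne by (intro sums_add ell_sums) (auto simp: norm_mult)
  have ep: "e ^ (r * (n + 1)) = (-1) ^ (n + 1)" for n by (simp only: power_mult e)
  have f0: "f n = 0" if "n \<notin> range (\<lambda>m. 2 * m + 1)" for n
  proof -
    have "even n" using that by (metis oddE rangeI)
    then show ?thesis using ep[of n] by (simp add: f_def power_mult_distrib)
  qed
  have "(\<lambda>m. f (2 * m + 1)) sums (ell r t + ell r (e * t))"
    using s f0 by (subst sums_mono_reindex) (auto simp: strict_mono_def)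
  moreover have "f (2 * m + 1) = (-1) ^ m * zeta_gamma (2 * r * (m + 1)) * (w * t) ^ (2 * r * (m + 1)) / of_nat (m + 1)" for m
  proof -
    have wt: "(w * t) ^ (2 * r * (m + 1)) = (-1) ^ (m + 1) * t ^ (2 * r * (m + 1))"
      by (simp only: power_mult_distrib power_mult[of w "2 * r" "m + 1"] w)
    have e1: "e ^ (r * (2 * m + 1 + 1)) = 1" using ep[of "2 * m + 1"] by simp
    have N: "r * (2 * m + 1 + 1) = 2 * r * (m + 1)" by (simp add: algebra_simps)
    have d: "of_nat (2 * m + 1 + 1) = (2 :: complex) * of_nat (m + 1)" by simp
    have half: "x / (2 * d) + x / (2 * d) = x / d" for x d :: complex
      by (cases "d = 0") (simp_all add: field_simps)
    have "f (2 * m + 1) = (-1) ^ (2 * m + 1) * zeta_gamma (2 * r * (m + 1)) * t ^ (2 * r * (m + 1)) / of_nat (m + 1)"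
      unfolding f_def power_mult_distrib e1 unfolding N d mult_1_left half ..
    also have "(-1) ^ (2 * m + 1) = (-1) ^ m * ((-1) ^ (m + 1) :: complex)"
      by (simp flip: power_add)
    finally show ?thesis unfolding wt by (simp only: mult_ac)
  qed
  ultimately have "(\<lambda>m. (-1) ^ m * zeta_gamma (2 * r * (m + 1)) * (w * t) ^ (2 * r * (m + 1)) / of_nat (m + 1))
      sums (ell r t + ell r (e * t))" by simp
  moreover have "(\<lambda>m. (-1) ^ m * zeta_gamma (2 * r * (m + 1)) * (w * t) ^ (2 * r * (m + 1)) / of_nat (m + 1))
      sums ell (2 * r) (w * t)"
    using t r nw by (intro ell_sums) (auto simp: norm_mult)
  ultimately show ?thesis by (rule sums_unique2[symmetric])
qed

section \<open>Eulerian functions as products of reciprocal Gamma functions\<close>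

definition minus_root :: "nat \<Rightarrow> nat \<Rightarrow> complex" where
  "minus_root r j = cis (pi * (2 * real j + 1) / real r)"

definition eulerian :: "nat \<Rightarrow> complex \<Rightarrow> complex" where
  "eulerian r z = (\<Prod>j<r. rGamma (1 - minus_root r j * z))"

lemma norm_minus_root [simp]: "norm (minus_root r j) = 1"
  by (simp add: minus_root_def)

lemma minus_root_power: "r > 0 \<Longrightarrow> minus_root r j ^ r = -1"
proof -
  assume r: "r > 0"
  have "minus_root r j ^ r = cis (real r * (pi * (2 * real j + 1) / real r))"
    by (simp only: minus_root_def Complex.DeMoivre)
  also have "real r * (pi * (2 * real j + 1) / real r) = pi + 2 * pi * real j" using r by (simp add: field_simps)
  also have "cis (pi + 2 * pi * real j) = -1" by (simp add: cis_mult[symmetric] cis_multiple_2pi)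
  finally show ?thesis .
qed

lemma sum_minus_root_power:
  assumes r: "r > 0"
  shows "(\<Sum>j<r. minus_root r j ^ k) = (if r dvd k then of_nat r * (-1) ^ (k div r) else 0)"
proof (cases "r dvd k")
  case True
  then obtain m where m: "k = r * m" by auto
  have "minus_root r j ^ k = (-1) ^ m" for j
    by (simp add: m power_mult minus_root_power[OF r])
  then show ?thesis using r m by simp
next
  case False
  define w where "w = cis (2 * pi * real k / real r)"
  have eq: "minus_root r j ^ k = cis (pi * real k / real r) * w ^ j" for j
  proof -
    have "real k * (pi * (2 * real j + 1) / real r) = pi * real k / real r + real j * (2 * pi * real k / real r)"
      using r by (simp add: field_simps)
    then show ?thesis by (simp only: minus_root_def w_def Complex.DeMoivre cis_mult)
  qed
  have w1: "w \<noteq> 1"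
  proof
    assume "w = 1"
    then have "cos (2 * pi * real k / real r) = 1" by (simp add: w_def complex_eq_iff)
    then obtain n :: int where n: "2 * pi * real k / real r = of_int n * 2 * pi"
      by (auto simp: cos_one_2pi_int)
    then have "real_of_int (int k) = real_of_int (n * int r)" using r by (simp add: field_simps)
    then have "int k = n * int r" by linarith
    then have "int r dvd int k" by simp
    then show False using False by simp
  qed
  have "w ^ r = cis (2 * pi * real k)" using r by (simp add: w_def Complex.DeMoivre)
  then have "w ^ r = 1" by (simp add: cis_multiple_2pi)
  then have "(\<Sum>j<r. w ^ j) = 0" using w1 geometric_sum[OF w1, of r] by simp
  then show ?thesis using False by (simp add: eq flip: sum_distrib_left)
qed

text \<open>Each factor (1 + z / k) * exp (- z / k) of the Weierstrass product is the exponential of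
  a power series starting in degree 2. The double series is dominated by a product of a geometric
  series and the sum of 1 / k ^ 2; summing over k first produces the zeta values.\<close>

lemma rGamma_eq_exp_ell:
  assumes z: "norm z < 1"
  shows "rGamma (1 + z) = exp (ell 1 z)"
\<comment> \<open>The Weierstrass product represents \<open>rGamma z\<close>, from which a factor z
  has to be cancelled.\<close>
proof (cases "z = 0")
  case True
  then show ?thesis by (simp add: ell_def)
next
  case False
  define f where "f j k = - ((- z / of_nat (Suc k)) ^ (j + 2) / of_nat (j + 2))" for j k
  define a where "a j = norm z ^ (j + 2)" for j
  define b where "b k = 1 / real (Suc k) ^ 2" for k
  have bound: "norm (f j k) \<le> a j * b k" for j k
  proof -
    have "norm (f j k) = norm z ^ (j + 2) / real (Suc k) ^ (j + 2) / real (j + 2)"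
      unfolding f_def norm_minus_cancel norm_divide norm_power norm_of_nat power_divide by simp
    also have "\<dots> \<le> norm z ^ (j + 2) / real (Suc k) ^ (j + 2) / 1"
      by (rule divide_left_mono) auto
    also have "\<dots> \<le> norm z ^ (j + 2) / real (Suc k) ^ 2"
      unfolding div_by_1 by (rule divide_left_mono[OF power_increasing]) auto
    finally show ?thesis by (simp add: a_def b_def)
  qed
  have sa: "summable a" unfolding a_def using z by (simp add: summable_geometric)
  have sb: "summable b" unfolding b_def
    using inverse_power_summable[of 2, where 'a = real]
      summable_Suc_iff[of "\<lambda>n. inverse (real n ^ 2)"] by (simp add: inverse_eq_divide)
  note swap = double_sum_swap[of f a b, OF bound sa _ sb]
  have nn: "\<And>j. 0 \<le> a j" "\<And>k. 0 \<le> b k" by (auto simp: a_def b_def)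
  define t where "t k = (\<Sum>j. f j k)" for k
  have exp_t: "exp (t k) = (1 + z / of_nat (Suc k)) * exp (- z / of_nat (Suc k))" for k
  proof -
    define u where "u = z / of_nat (Suc k)"
    have u: "norm u < 1" using z by (simp add: u_def norm_divide divide_less_eq del: of_nat_Suc)
    have "(\<lambda>n. - ((- u) ^ n) / of_nat n) sums ln (1 + u)"
      using Ln_series'[OF u] by simp
    then have "(\<lambda>n. - ((- u) ^ Suc n) / of_nat (Suc n)) sums (ln (1 + u) - 0)"
      by (subst sums_Suc_iff) simp
    then have "(\<lambda>n. - ((- u) ^ Suc (Suc n)) / of_nat (Suc (Suc n))) sums (ln (1 + u) - u)"
      by (subst sums_Suc_iff[of "\<lambda>n. - ((- u) ^ Suc n) / of_nat (Suc n)"]) simp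
    then have "(\<lambda>j. f j k) sums (ln (1 + u) - u)"
      by (simp add: f_def u_def)
    then have "t k = ln (1 + u) - u" by (simp add: t_def sums_iff)
    moreover have "1 + u \<noteq> 0" using u by (metis add_eq_0_iff norm_minus_cancel norm_one less_irrefl)
    ultimately show ?thesis by (simp add: exp_diff u_def exp_minus divide_inverse)
  qed
  have "summable t" using swap(4) nn by (simp add: t_def[abs_def])
  then have "(\<lambda>n. \<Sum>k<n. t k) \<longlonglongrightarrow> suminf t" by (rule summable_LIMSEQ)
  then have lim: "(\<lambda>n. exp (euler_mascheroni * z) * z * exp (\<Sum>k<n. t k)) \<longlonglongrightarrow> exp (euler_mascheroni * z) * z * exp (suminf t)"
    by (intro tendsto_intros)
  have "(\<lambda>n. exp (euler_mascheroni * z) * z * exp (\<Sum>k<n. t k)) = rGamma_series_Weierstrass z"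
    by (rule ext) (simp add: rGamma_series_Weierstrass_def exp_sum exp_t lessThan_Suc_atMost[symmetric] prod.atLeast1_atMost_eq)
  then have "rGamma z = exp (euler_mascheroni * z) * z * exp (suminf t)"
    using lim rGamma_Weierstrass_complex[of z] LIMSEQ_unique by metis
  moreover have "z * rGamma (1 + z) = rGamma z" using rGamma_plus1[of z] by (simp add: add.commute)
  ultimately have "rGamma (1 + z) = exp (euler_mascheroni * z + suminf t)"
    using False by (simp add: exp_add)
  also have "suminf t = (\<Sum>j. \<Sum>k. f j k)" unfolding t_def using swap(6) nn by simp
  also have "(\<lambda>j. \<Sum>k. f j k) = (\<lambda>j. - (zeta_nat (j + 2) * (- z) ^ (j + 2) / of_nat (j + 2)))"
  proof
    fix j
    have "f j k = - ((- z) ^ (j + 2) / of_nat (j + 2)) * (1 / of_nat (Suc k) ^ (j + 2))" for k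
      unfolding f_def power_divide by simp
    then have "(\<Sum>k. f j k) = - ((- z) ^ (j + 2) / of_nat (j + 2)) * zeta_nat (j + 2)"
      using suminf_mult[OF zeta_nat_summable[of "j + 2"], of "- ((- z) ^ (j + 2) / of_nat (j + 2))"]
      by (simp only: zeta_nat_def)
    then show "(\<Sum>k. f j k) = - (zeta_nat (j + 2) * (- z) ^ (j + 2) / of_nat (j + 2))" by simp
  qed
  also have "(\<Sum>j. - (zeta_nat (j + 2) * (- z) ^ (j + 2) / of_nat (j + 2)))
      = - (\<Sum>j. zeta_nat (j + 2) * (- z) ^ (j + 2) / of_nat (j + 2))"
  proof (rule suminf_minus)
    have "summable (\<lambda>j. - (\<Sum>k. f j k))" using swap(5) nn by (simp add: summable_minus_iff)
    then show "summable (\<lambda>j. zeta_nat (j + 2) * (- z) ^ (j + 2) / of_nat (j + 2))"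
      using \<open>(\<lambda>j. \<Sum>k. f j k) = _\<close> by (simp add: fun_eq_iff)
  qed
  finally show ?thesis by (simp add: ell_def)
qed

text \<open>Summing the series of \<open>ell 1\<close> over the roots of -1 keeps only the exponents
  divisible by r, and these terms form the series of \<open>ell r\<close>.\<close>

theorem eulerian_eq_exp_ell:
  assumes z: "norm z < 1" and r: "r \<ge> 1"
  shows "eulerian r z = exp (ell r z)"
proof (cases "r = 1")
  case True
  have "minus_root 1 0 = -1" by (simp add: minus_root_def)
  then show ?thesis using True rGamma_eq_exp_ell[OF z] by (simp add: eulerian_def)
next
  case False
  define h where "h n = (-1) ^ n * zeta_gamma (n + 1) / of_nat (n + 1)" for n
  have "(\<lambda>n. h n * (- minus_root r j * z) ^ (n + 1)) sums ell 1 (- minus_root r j * z)" for j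
    using ell_sums(1)[of "- minus_root r j * z" 1] z by (simp add: h_def norm_mult mult_ac)
  then have "(\<lambda>n. \<Sum>j<r. h n * (- minus_root r j * z) ^ (n + 1)) sums (\<Sum>j<r. ell 1 (- minus_root r j * z))"
    by (intro sums_sum)
  moreover have "(\<Sum>j<r. h n * (- minus_root r j * z) ^ (n + 1))
      = h n * (- z) ^ (n + 1) * (\<Sum>j<r. minus_root r j ^ (n + 1))" for n
  proof -
    have "h n * (- minus_root r j * z) ^ (n + 1) = h n * (- z) ^ (n + 1) * minus_root r j ^ (n + 1)" for j
      by (metis mult.assoc mult.commute mult_minus_left mult_minus_right power_mult_distrib)
    then show ?thesis by (simp only: sum_distrib_left)
  qed
  ultimately have s: "(\<lambda>n. h n * (- z) ^ (n + 1) * (\<Sum>j<r. minus_root r j ^ (n + 1)))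
      sums (\<Sum>j<r. ell 1 (- minus_root r j * z))" by simp
  define F where "F n = h n * (- z) ^ (n + 1) * (\<Sum>j<r. minus_root r j ^ (n + 1))" for n
  \<comment> \<open>\<open>F n\<close> has degree n + 1 in z, so the surviving indices are r * (m +
    1) - 1.\<close>
  have F0: "F n = 0" if "n \<notin> range (\<lambda>m. r * (m + 1) - 1)" for n
  proof -
    have "\<not> r dvd n + 1"
    proof
      assume "r dvd n + 1"
      then obtain q where q: "n + 1 = r * q" by auto
      then obtain m where "q = m + 1" by (cases q) auto
      then have "n = r * (m + 1) - 1" using q by simp
      then show False using that by blast
    qed
    moreover have "r > 0" using r by simp
    ultimately show ?thesis unfolding F_def sum_minus_root_power[OF \<open>r > 0\<close>] by simp
  qed
  have mono: "strict_mono (\<lambda>m. r * (m + 1) - 1)"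
  proof (rule strict_monoI)
    fix x y :: nat assume "x < y"
    then have "r * (x + 1) < r * (y + 1)" using r by simp
    moreover have "1 \<le> r * (x + 1)" using r by simp
    ultimately show "r * (x + 1) - 1 < r * (y + 1) - 1" by linarith
  qed
  have "(\<lambda>m. F (r * (m + 1) - 1)) sums (\<Sum>j<r. ell 1 (- minus_root r j * z))"
    using s F0 sums_mono_reindex[OF mono, of F] unfolding F_def[symmetric] by blast
  moreover have "F (r * (m + 1) - 1) = (-1) ^ m * zeta_gamma (r * (m + 1)) * z ^ (r * (m + 1)) / of_nat (m + 1)" for m
  proof -
    define N where "N = r * (m + 1)"
    have N: "N \<ge> 1" "N - 1 + 1 = N" using r by (auto simp: N_def)
    have "(\<Sum>j<r. minus_root r j ^ N) = of_nat r * (-1) ^ (m + 1)"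
      using sum_minus_root_power[of r N] r by (simp add: N_def)
    then have "F (N - 1) = (-1) ^ (N - 1) * zeta_gamma N / of_nat N * (- z) ^ N * (of_nat r * (-1) ^ (m + 1))"
      unfolding F_def h_def N(2) by simp
    also have "(- z) ^ N = (-1) ^ N * z ^ N" by (rule power_minus)
    also have "(-1) ^ (N - 1) * zeta_gamma N / of_nat N * ((-1) ^ N * z ^ N) * (of_nat r * (-1) ^ (m + 1))
        = ((-1) ^ (N - 1) * (-1) ^ N) * (-1) ^ (m + 1) * zeta_gamma N * z ^ N * (of_nat r / of_nat N)"
      by simp
    also have "(-1) ^ (N - 1) * (-1) ^ N = (-1 :: complex)"
      using N(1) by (cases N) (auto simp flip: power_add mult_2)
    also have "of_nat r / of_nat N = (1 / of_nat (m + 1) :: complex)"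
      using r unfolding N_def of_nat_mult by simp
    finally show ?thesis by (simp add: N_def)
  qed
  ultimately have "(\<Sum>j<r. ell 1 (- minus_root r j * z)) = ell r z"
    using ell_sums(1)[OF z r] sums_unique2 by simp
  moreover have "rGamma (1 - minus_root r j * z) = exp (ell 1 (- minus_root r j * z))" for j
    using rGamma_eq_exp_ell[of "- minus_root r j * z"] z by (simp add: norm_mult)
  ultimately show ?thesis by (simp add: eulerian_def exp_sum[symmetric])
qed

lemma eulerian_holomorphic: "eulerian r holomorphic_on UNIV"
  unfolding eulerian_def[abs_def]
  by (rule holomorphic_on_prod, rule holomorphic_rGamma') (auto intro: holomorphic_on_diff holomorphic_on_mult)

subsection \<open>Growth on the positive axis\<close>

lemma minus_root_inj:
  assumes "r > 0" shows "inj_on (minus_root r) {..<r}"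
proof (rule inj_onI)
  fix i j assume ij: "i \<in> {..<r}" "j \<in> {..<r}" "minus_root r i = minus_root r j"
  have "minus_root r i = cis (pi / r) * unity r (int i)" for i
    using assms by (simp add: minus_root_def unity_def cis_mult field_simps)
  then have "unity r (int i) = unity r (int j)" using ij by simp
  moreover have "unity r (int i) = unity r (int i - int j) * unity r (int j)"
    by (simp flip: unity_add)
  moreover have "unity r (int j) \<noteq> 0" by (simp add: unity_def)
  ultimately have "int r dvd int i - int j" using assms by (simp add: unity_eq_1_iff[symmetric])
  then have "int r dvd \<bar>int i - int j\<bar>" by simp
  moreover have "\<bar>int i - int j\<bar> < int r" using ij by auto
  ultimately have "\<not> 0 < \<bar>int i - int j\<bar>" using zdvd_not_zless by blast
  then show "i = j" by simp
qed

lemma prod_minus_root: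
  assumes r: "r > 0"
  shows "(\<Prod>j<r. 1 - minus_root r j * u) = 1 + u ^ r"
proof (cases "u = 0")
  case False
  define p :: "complex poly" where "p = monom 1 r + 1"
  define q :: "complex poly" where "q = (\<Prod>j<r. [:- minus_root r j, 1:])"
  have dq: "degree q = r" unfolding q_def by (subst degree_prod_eq_sum_degree) auto
  have lq: "coeff q r = 1" using dq lead_coeff_prod[of "\<lambda>j. [:- minus_root r j, 1:]" "{..<r}"] by (simp add: q_def)
  have "p = q"
  proof (rule poly_eqI_degree_lead_coeff[of _ r _ "minus_root r ` {..<r}"])
    show "coeff p r = coeff q r" using lq r by (simp add: p_def)
    show "degree p \<le> r" unfolding p_def by (rule degree_add_le) (auto simp: degree_monom_le)
    show "card (minus_root r ` {..<r}) \<ge> r" using card_image[OF minus_root_inj[OF r]] by simp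
    fix z assume "z \<in> minus_root r ` {..<r}"
    then obtain j where j: "j < r" "z = minus_root r j" by auto
    have "poly q z = 0" unfolding q_def poly_prod using j by (auto intro!: prod_zero)
    moreover have "poly p z = 0" using j minus_root_power[OF r] by (simp add: p_def poly_monom)
    ultimately show "poly p z = poly q z" by simp
  qed (use dq in auto)
  then have "poly p (1 / u) = (\<Prod>j<r. 1 / u - minus_root r j)" by (simp add: q_def poly_prod)
  then have "u ^ r * (1 / u ^ r + 1) = (\<Prod>j<r. u * (1 / u - minus_root r j))"
    by (simp add: p_def poly_monom prod.distrib power_divide)
  then show ?thesis using False by (simp add: right_diff_distrib distrib_left mult.commute add.commute)
qed (use r in simp)

text \<open>For r \<ge> 2 the roots of -1 sum to 0, so the convergence factors of the r Weierstrass
  products cancel each other; the linear factors with the same k multiply to 1 + (z / k) ^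
  r.\<close>

lemma eulerian_product:
  assumes r: "r \<ge> 2"
  shows "(\<lambda>n. \<Prod>k=1..n. 1 + (z / of_nat k) ^ r) \<longlonglongrightarrow> eulerian r z"
proof -
  have one: "(\<lambda>n. exp (euler_mascheroni * w) * (\<Prod>k=1..n. (1 + w / of_nat k) * exp (- w / of_nat k)))
      \<longlonglongrightarrow> rGamma (1 + w)" for w :: complex
  proof (cases "w = 0")
    case False
    have "(\<lambda>n. rGamma_series_Weierstrass w n / w) \<longlonglongrightarrow> rGamma w / w"
      using False by (intro tendsto_intros rGamma_Weierstrass_complex) auto
    moreover have "rGamma w = w * rGamma (1 + w)" using rGamma_plus1[of w] by (simp add: add.commute)
    ultimately show ?thesis using False by (simp add: rGamma_series_Weierstrass_def)
  qed (simp add: rGamma_inverse_Gamma)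
  have s0: "(\<Sum>j<r. minus_root r j) = 0" using sum_minus_root_power[of r 1] r by simp
  have "(\<lambda>n. \<Prod>j<r. exp (euler_mascheroni * (- minus_root r j * z)) *
      (\<Prod>k=1..n. (1 + (- minus_root r j * z) / of_nat k) * exp (- (- minus_root r j * z) / of_nat k)))
      \<longlonglongrightarrow> (\<Prod>j<r. rGamma (1 + - minus_root r j * z))"
    by (intro tendsto_prod one)
  moreover have "(\<Prod>j<r. exp (euler_mascheroni * (- minus_root r j * z)) *
      (\<Prod>k=1..n. (1 + (- minus_root r j * z) / of_nat k) * exp (- (- minus_root r j * z) / of_nat k)))
      = (\<Prod>k=1..n. 1 + (z / of_nat k) ^ r)" for n
  proof -
    have "(\<Prod>j<r. exp (euler_mascheroni * (- minus_root r j * z))) = exp (euler_mascheroni * (- (\<Sum>j<r. minus_root r j) * z))"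
      by (simp add: exp_sum[symmetric] sum_distrib_left sum_distrib_right sum_negf)
    then have e1: "(\<Prod>j<r. exp (euler_mascheroni * (- minus_root r j * z))) = 1" by (simp add: s0)
    have e2: "(\<Prod>j<r. exp (- (- minus_root r j * z) / of_nat k)) = 1" for k
    proof -
      have "(\<Prod>j<r. exp (- (- minus_root r j * z) / of_nat k)) = exp ((\<Sum>j<r. minus_root r j) * z / of_nat k)"
        by (simp add: exp_sum[symmetric] sum_distrib_right sum_divide_distrib)
      then show ?thesis by (simp add: s0)
    qed
    have e3: "(\<Prod>j<r. 1 + (- minus_root r j * z) / of_nat k) = 1 + (z / of_nat k) ^ r" for k
      using prod_minus_root[of r "z / of_nat k"] r by simp
    have e4: "(\<Prod>j<r. \<Prod>k = 1..n. exp (- (- minus_root r j * z) / of_nat k)) = 1"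
      by (subst prod.swap) (simp only: e2 prod.neutral_const)
    have e5: "(\<Prod>j<r. \<Prod>k = 1..n. 1 + (- minus_root r j * z) / of_nat k) = (\<Prod>k = 1..n. 1 + (z / of_nat k) ^ r)"
      by (subst prod.swap) (simp only: e3)
    show ?thesis unfolding prod.distrib e1 e4 e5 by simp
  qed
  ultimately show ?thesis by (simp add: eulerian_def)
qed

text \<open>For r \<ge> 2 this is pi / sin (pi / r), the integral of ln (1 + (1 / u) ^ r) over the
  positive half-line. It is kept as a combination of roots of unity, the form to which Galois
  conjugation applies.\<close>

definition growth_const :: "nat \<Rightarrow> complex" where
  "growth_const r = 2 * of_real pi * \<i> * (\<Sum>j<r. of_real (real j / real r) * minus_root r j)"

text \<open>The antiderivative comes from the partial fraction expansion of \<open>1 / (1 + u ^ r)\<close>.\<close>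

definition prim :: "nat \<Rightarrow> real \<Rightarrow> complex" where
  "prim r u = - (\<Sum>j<r. minus_root r j * Ln (1 - of_real u * cnj (minus_root r j)))"

lemma minus_root_cnj: "minus_root r j * cnj (minus_root r j) = 1"
  using complex_norm_square[of "minus_root r j"] by simp

text \<open>A nonpositive real value would force the root to be 1, which is not an r-th root of -1.
  Hence the principal logarithms in \<open>prim\<close> are differentiable along the whole
  half-line.\<close>

lemma slit_plane_minus_root:
  assumes "r > 0" "u \<ge> 0"
  shows "1 - of_real u * cnj (minus_root r j) \<notin> \<real>\<^sub>\<le>\<^sub>0"
proof
  let ?z = "minus_root r j"
  assume "1 - of_real u * cnj ?z \<in> \<real>\<^sub>\<le>\<^sub>0"
  then have "Im (1 - of_real u * cnj ?z) = 0" "Re (1 - of_real u * cnj ?z) \<le> 0"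
    by (auto simp: complex_nonpos_Reals_iff)
  then have im: "u * Im ?z = 0" and re: "1 \<le> u * Re ?z" by auto
  have "u > 0" using re assms(2) by (cases "u = 0") auto
  then have "Im ?z = 0" using im by simp
  have "0 < u * Re ?z" using re by linarith
  then have "Re ?z > 0" using \<open>u > 0\<close> by (rule zero_less_mult_pos)
  have "Re ?z ^ 2 + Im ?z ^ 2 = 1" using norm_minus_root[of r j] by (simp add: cmod_def)
  then have "Re ?z = 1" using \<open>Re ?z > 0\<close> \<open>Im ?z = 0\<close> by (auto simp: power2_eq_1_iff)
  then have "?z = 1" using \<open>Im ?z = 0\<close> by (simp add: complex_eq_iff)
  then show False using minus_root_power[OF assms(1), of j] by simp
qed

text \<open>Multiplied by 1 + u ^ r, each summand becomes a finite geometric series, and only its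
  constant term survives summation over the roots.\<close>

lemma sum_inverse_minus_root:
  assumes r: "r > 0" and u: "u \<ge> 0"
  shows "(\<Sum>j<r. 1 / (1 - of_real u * cnj (minus_root r j))) = of_nat r / (1 + of_real u ^ r)"
proof -
  define w where "w = complex_of_real u"
  have nz: "1 - w * cnj (minus_root r j) \<noteq> 0" for j
    using slit_plane_minus_root[OF r u, of j] by (auto simp: w_def)
  have geo: "1 / (1 - w * cnj (minus_root r j)) * (1 + w ^ r) = (\<Sum>i<r. (w * cnj (minus_root r j)) ^ i)" for j
  proof -
    have "cnj (minus_root r j) ^ r = -1" using minus_root_power[OF r, of j] by (metis complex_cnj_minus complex_cnj_one complex_cnj_power)
    then have "(w * cnj (minus_root r j)) ^ r = - (w ^ r)" by (simp add: power_mult_distrib)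
    then show ?thesis using nz[of j] geometric_sum[of "w * cnj (minus_root r j)" r]
      by (simp add: field_simps)
  qed
  have "1 + w ^ r \<noteq> 0"
  proof -
    have "Re (1 + w ^ r) \<ge> 1" using u by (simp add: w_def flip: of_real_power)
    then show ?thesis by (metis not_one_le_zero zero_complex.sel(1))
  qed
  have "(\<Sum>j<r. 1 / (1 - w * cnj (minus_root r j))) * (1 + w ^ r)
      = (\<Sum>j<r. \<Sum>i<r. (w * cnj (minus_root r j)) ^ i)"
    by (simp only: sum_distrib_right geo)
  also have "\<dots> = (\<Sum>i<r. w ^ i * cnj (\<Sum>j<r. minus_root r j ^ i))"
    by (subst sum.swap) (simp add: power_mult_distrib sum_distrib_left)
  also have "\<dots> = (\<Sum>i<r. if i = 0 then of_nat r else 0)"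
    using r by (intro sum.cong refl) (auto simp: sum_minus_root_power dest: dvd_imp_le)
  also have "\<dots> = of_nat r" using r by simp
  finally show ?thesis using \<open>1 + w ^ r \<noteq> 0\<close> by (simp add: field_simps w_def)
qed

lemma prim_deriv:
  assumes r: "r > 0" and u: "u \<ge> 0"
  shows "(prim r has_vector_derivative (of_nat r / (1 + of_real u ^ r))) (at u within S)"
proof -
  have "((\<lambda>u. minus_root r j * Ln (1 - of_real u * cnj (minus_root r j))) has_vector_derivative
      - (1 / (1 - of_real u * cnj (minus_root r j)))) (at u within S)" for j
  proof -
    have *: "((\<lambda>w. minus_root r j * Ln (1 - w * cnj (minus_root r j))) has_field_derivative
        minus_root r j * (inverse (1 - of_real u * cnj (minus_root r j)) * (- cnj (minus_root r j)))) (at (of_real u))"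
      using slit_plane_minus_root[OF r u, of j] by (auto intro!: derivative_eq_intros)
    have "((\<lambda>u. minus_root r j * Ln (1 - of_real u * cnj (minus_root r j))) has_vector_derivative
        minus_root r j * (inverse (1 - of_real u * cnj (minus_root r j)) * (- cnj (minus_root r j)))) (at u)"
      using has_vector_derivative_real_field[OF *] by simp
    moreover have "minus_root r j * (inverse (1 - of_real u * cnj (minus_root r j)) * (- cnj (minus_root r j)))
        = - (1 / (1 - of_real u * cnj (minus_root r j)))"
      using minus_root_cnj[of r j] by (simp add: divide_inverse mult.left_commute[of "minus_root r j"])
    ultimately show ?thesis by (auto intro: has_vector_derivative_at_within)
  qed
  then have "((\<lambda>u. \<Sum>j<r. minus_root r j * Ln (1 - of_real u * cnj (minus_root r j))) has_vector_derivative
      (\<Sum>j<r. - (1 / (1 - of_real u * cnj (minus_root r j))))) (at u within S)"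
    by (intro has_vector_derivative_sum)
  then have "((\<lambda>u. - (\<Sum>j<r. minus_root r j * Ln (1 - of_real u * cnj (minus_root r j)))) has_vector_derivative
      - (\<Sum>j<r. - (1 / (1 - of_real u * cnj (minus_root r j))))) (at u within S)"
    by (rule has_vector_derivative_minus)
  then show ?thesis unfolding prim_def[abs_def] sum_negf sum_inverse_minus_root[OF r u] by simp
qed

lemma prim_0: "prim r 0 = 0"
  by (simp add: prim_def)

text \<open>Each logarithm splits into ln u and a part that converges. The terms with ln u cancel
  because the roots sum to 0, and the limiting arguments lie strictly between - pi and pi, where the
  principal branch can be read off.\<close>

lemma prim_limit:
  assumes r: "r \<ge> 2"
  shows "(prim r \<longlongrightarrow> growth_const r) at_top"
proof -
  have s0: "(\<Sum>j<r. minus_root r j) = 0" using sum_minus_root_power[of r 1] r by simp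
  define a where "a j = pi - pi * (2 * real j + 1) / real r" for j
  have cnj_eq: "- cnj (minus_root r j) = cis (a j)" for j
    by (simp add: minus_root_def a_def cis_cnj complex_eq_iff cos_diff sin_diff)
  have a: "- pi < a j" "a j < pi" if "j < r" for j
  proof -
    have "0 < pi * (2 * real j + 1) / real r" using r by simp
    moreover have "pi * (2 * real j + 1) / real r < pi * 2"
    proof -
      have "2 * real j + 1 < 2 * real r" using that by simp
      then have "pi * (2 * real j + 1) < pi * (2 * real r)" by (intro mult_strict_left_mono) auto
      then show ?thesis using r by (simp add: divide_less_eq)
    qed
    ultimately show "- pi < a j" "a j < pi" by (auto simp: a_def)
  qed
  have Ln_a: "Ln (cis (a j)) = \<i> * of_real (a j)" if "j < r" for j
    using a[OF that] by (intro Ln_unique) (auto simp: cis_conv_exp)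
  have notneg: "cis (a j) \<notin> \<real>\<^sub>\<le>\<^sub>0" if "j < r" for j
  proof
    assume "cis (a j) \<in> \<real>\<^sub>\<le>\<^sub>0"
    then have "sin (a j) = 0" "cos (a j) \<le> 0" by (auto simp: complex_nonpos_Reals_iff)
    moreover have "a j = 0" using a[OF that] \<open>sin (a j) = 0\<close> sin_eq_0_pi by blast
    ultimately show False by simp
  qed
  have "((\<lambda>u. - (\<Sum>j<r. minus_root r j * Ln (of_real (1 / u) + cis (a j)))) \<longlongrightarrow>
      - (\<Sum>j<r. minus_root r j * Ln (of_real 0 + cis (a j)))) at_top"
  proof (intro tendsto_intros)
    show "((\<lambda>u::real. 1 / u) \<longlongrightarrow> 0) at_top" by real_asymp
  qed (use notneg in auto)
  moreover have "eventually (\<lambda>u. prim r u = - (\<Sum>j<r. minus_root r j * Ln (of_real (1 / u) + cis (a j)))) at_top"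
    using eventually_gt_at_top[of 0]
  proof eventually_elim
    case (elim u)
    have "Ln (1 - of_real u * cnj (minus_root r j)) = of_real (ln u) + Ln (of_real (1 / u) + cis (a j))" if "j < r" for j
    proof -
      have eq: "1 - of_real u * cnj (minus_root r j) = of_real u * (of_real (1 / u) + cis (a j))"
        unfolding cnj_eq[symmetric] using elim by (simp add: algebra_simps)
      have "of_real (1 / u) + cis (a j) \<noteq> 0"
        using slit_plane_minus_root[of r u j] r elim eq by auto
      then show ?thesis
        unfolding eq using elim Ln_times_of_real[of u "complex_of_real (1 / u) + cis (a j)"]
        by (simp add: Ln_of_real del: of_real_divide of_real_1)
    qed
    then have "prim r u = - (\<Sum>j<r. minus_root r j * (of_real (ln u) + Ln (of_real (1 / u) + cis (a j))))"
      unfolding prim_def by (intro arg_cong[of _ _ uminus] sum.cong) auto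
    also have "\<dots> = - ((\<Sum>j<r. minus_root r j) * of_real (ln u)) - (\<Sum>j<r. minus_root r j * Ln (of_real (1 / u) + cis (a j)))"
      by (simp add: distrib_left sum.distrib sum_distrib_right)
    finally show ?case by (simp add: s0)
  qed
  ultimately have "(prim r \<longlongrightarrow> - (\<Sum>j<r. minus_root r j * Ln (of_real 0 + cis (a j)))) at_top"
    by (simp only: tendsto_cong)
  moreover have "- (\<Sum>j<r. minus_root r j * Ln (of_real 0 + cis (a j))) = growth_const r"
  proof -
    have "(\<Sum>j<r. minus_root r j * Ln (of_real 0 + cis (a j)))
        = (\<Sum>j<r. minus_root r j * (\<i> * of_real (pi - pi / r)) - 2 * of_real pi * \<i> * (of_real (real j / real r) * minus_root r j))"
    proof (intro sum.cong refl)
      fix j assume "j \<in> {..<r}"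
      \<comment> \<open>The part of \<open>a j\<close> that does not depend on j drops out, again
        because the roots sum to 0.\<close>
      have "a j = (pi - pi / r) - 2 * pi * (real j / real r)" using r by (simp add: a_def field_simps)
      then have aj: "complex_of_real (a j) = of_real (pi - pi / r) - 2 * of_real pi * of_real (real j / real r)"
        by simp
      have "Ln (of_real 0 + cis (a j)) = \<i> * of_real (a j)" using Ln_a[of j] \<open>j \<in> _\<close> by simp
      then show "minus_root r j * Ln (of_real 0 + cis (a j)) = minus_root r j * (\<i> * of_real (pi - pi / r)) - 2 * of_real pi * \<i> * (of_real (real j / real r) * minus_root r j)"
        by (simp only: aj right_diff_distrib mult_ac)
    qed
    also have "\<dots> = - growth_const r"
      by (simp only: sum_subtractf growth_const_def s0 sum_distrib_left[symmetric] sum_distrib_right[symmetric]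
          mult_zero_left diff_0)
    finally show ?thesis by simp
  qed
  ultimately show ?thesis by simp
qed

section \<open>Comparison of the logarithm of the product with an integral\<close>

definition step_fun :: "nat \<Rightarrow> real \<Rightarrow> real" where
  "step_fun r u = ln (1 + (1 / u) ^ r)"

text \<open>An antiderivative of \<open>step_fun r\<close>, by integration by parts: the integrand
  that remains is r / (1 + u ^ r), whose antiderivative is \<open>prim r\<close>.\<close>

definition step_prim :: "nat \<Rightarrow> real \<Rightarrow> real" where
  "step_prim r u = u * step_fun r u + Re (prim r u)"

lemma Re_prim_deriv:
  assumes "r > 0" "u \<ge> 0"
  shows "((\<lambda>u. Re (prim r u)) has_real_derivative real r / (1 + u ^ r)) (at u within S)"
proof -
  have "((\<lambda>u. Re (prim r u)) has_vector_derivative Re (of_nat r / (1 + of_real u ^ r))) (at u within S)"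
    using bounded_linear.has_vector_derivative[OF bounded_linear_Re prim_deriv[OF assms]] .
  moreover have "of_nat r / (1 + of_real u ^ r) = complex_of_real (real r / (1 + u ^ r))" by simp
  then have "Re (of_nat r / (1 + of_real u ^ r)) = real r / (1 + u ^ r)" by (metis Re_complex_of_real)
  ultimately show ?thesis by (simp add: has_real_derivative_iff_has_vector_derivative)
qed

lemma Re_prim_bounds:
  assumes r: "r > 0" and u: "u \<ge> 0"
  shows "0 \<le> Re (prim r u)" "Re (prim r u) \<le> real r * u"
proof -
  have d: "((\<lambda>u. Re (prim r u)) has_real_derivative real r / (1 + x ^ r)) (at x)" if "0 \<le> x" for x
    using Re_prim_deriv[OF r that, of UNIV] by simp
  have "Re (prim r 0) \<le> Re (prim r u)"
    by (rule DERIV_nonneg_imp_nondecreasing[OF u]) (use d in \<open>force intro!: exI divide_nonneg_pos add_pos_nonneg\<close>)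
  then show "0 \<le> Re (prim r u)" by (simp add: prim_0)
  have "real r * 0 - Re (prim r 0) \<le> real r * u - Re (prim r u)"
  proof (rule DERIV_nonneg_imp_nondecreasing[OF u])
    fix x :: real assume x: "0 \<le> x" "x \<le> u"
    have "((\<lambda>u. real r * u - Re (prim r u)) has_real_derivative (real r - real r / (1 + x ^ r))) (at x)"
      using DERIV_diff[OF DERIV_cmult_Id[of "real r" x UNIV] d[OF x(1)]] by simp
    moreover have "real r / (1 + x ^ r) \<le> real r / 1" using x by (intro divide_left_mono) (auto simp: add_pos_nonneg)
    ultimately show "\<exists>y. ((\<lambda>u. real r * u - Re (prim r u)) has_real_derivative y) (at x) \<and> 0 \<le> y"
      by (intro exI[of _ "real r - real r / (1 + x ^ r)"]) auto
  qed
  then show "Re (prim r u) \<le> real r * u" by (simp add: prim_0)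
qed

lemma step_prim_deriv:
  assumes r: "r > 0" and u: "u > 0"
  shows "(step_prim r has_real_derivative step_fun r u) (at u)"
proof -
  obtain m where m: "r = Suc m" using r by (cases r) auto
  have pos: "1 + (1 / u) ^ r > 0" using u by (simp add: add_pos_pos)
  have inv: "((\<lambda>u. 1 / u) has_real_derivative (- 1 / u\<^sup>2)) (at u)"
    using u by (auto intro!: derivative_eq_intros simp: power2_eq_square)
  have "((\<lambda>u. ln (1 + (1 / u) ^ r)) has_real_derivative
      1 / (1 + (1 / u) ^ r) * (0 + of_nat r * (- 1 / u\<^sup>2 * (1 / u) ^ (r - Suc 0)))) (at u)"
    by (rule DERIV_chain2[OF DERIV_ln_divide[OF pos] DERIV_add[OF DERIV_const DERIV_power[OF inv]]])
  from DERIV_add[OF DERIV_mult[OF DERIV_ident this] Re_prim_deriv[OF r less_imp_le[OF u]]]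
  have "(step_prim r has_real_derivative
      (1 * step_fun r u + u * ((real r * (1 / u) ^ (r - 1) * (- 1 / u\<^sup>2)) / (1 + (1 / u) ^ r)) + real r / (1 + u ^ r))) (at u)"
    unfolding step_prim_def[abs_def] step_fun_def by (rule DERIV_cong) (simp add: mult_ac)
  moreover have "u * ((real r * (1 / u) ^ (r - 1) * (- 1 / u\<^sup>2)) / (1 + (1 / u) ^ r)) = - (real r / (1 + u ^ r))"
  proof -
    define v where "v = u ^ m"
    have v: "v > 0" using u by (simp add: v_def)
    have "u * ((real r * (1 / v) * (- 1 / u\<^sup>2)) / (1 + 1 / (u * v))) = - (real r / (1 + u * v))"
    proof -
      have uv: "u * v > 0" using u v by simp
      have "1 + 1 / (u * v) = (1 + u * v) / (u * v)" using u v by (simp add: add_divide_distrib)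
      then have "u * ((real r * (1 / v) * (- 1 / u\<^sup>2)) / (1 + 1 / (u * v)))
          = u * ((real r * (1 / v) * (- 1 / u\<^sup>2)) * (u * v) / (1 + u * v))" by simp
      also have "\<dots> = (u * ((real r * (1 / v) * (- 1 / u\<^sup>2)) * (u * v))) / (1 + u * v)" by simp
      also have "u * ((real r * (1 / v) * (- 1 / u\<^sup>2)) * (u * v)) = - real r"
        using u v by (simp add: field_simps power2_eq_square)
      finally show ?thesis by simp
    qed
    then show ?thesis by (simp add: m v_def power_divide)
  qed
  ultimately show ?thesis by simp
qed

lemma step_fun_antimono:
  assumes "0 < u" "u \<le> v" shows "step_fun r v \<le> step_fun r u"
proof -
  have "(1 / v) ^ r \<le> (1 / u) ^ r" using assms by (intro power_mono) (auto simp: frac_le)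
  moreover have "0 < 1 + (1 / v) ^ r" using assms by (simp add: add_pos_pos)
  ultimately show ?thesis unfolding step_fun_def by (simp add: ln_mono)
qed

lemma step_prim_mvt:
  assumes r: "r > 0" and uv: "0 < u" "u < v"
  shows "(v - u) * step_fun r v \<le> step_prim r v - step_prim r u"
    "step_prim r v - step_prim r u \<le> (v - u) * step_fun r u"
proof -
  obtain z where z: "u < z" "z < v" "step_prim r v - step_prim r u = (v - u) * step_fun r z"
    using MVT2[OF uv(2), of "step_prim r" "step_fun r"] step_prim_deriv[OF r] uv by auto
  show "(v - u) * step_fun r v \<le> step_prim r v - step_prim r u"
    "step_prim r v - step_prim r u \<le> (v - u) * step_fun r u"
    unfolding z(3) using z uv step_fun_antimono[of z v r] step_fun_antimono[of u z r]
    by (auto intro!: mult_left_mono)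
qed

lemma step_prim_limit:
  assumes r: "r \<ge> 2"
  shows "(step_prim r \<longlongrightarrow> Re (growth_const r)) at_top"
proof -
  have "((\<lambda>u. Re (prim r u)) \<longlongrightarrow> Re (growth_const r)) at_top"
    using prim_limit[OF r] by (rule tendsto_Re)
  moreover have "((\<lambda>u. u * step_fun r u) \<longlongrightarrow> 0) at_top"
  proof (rule tendsto_sandwich[of "\<lambda>_. 0" _ _ "\<lambda>u. 1 / u"])
    show "eventually (\<lambda>u. 0 \<le> u * step_fun r u) at_top"
      using eventually_gt_at_top[of 0] by eventually_elim (simp add: step_fun_def)
    show "eventually (\<lambda>u. u * step_fun r u \<le> 1 / u) at_top"
      using eventually_ge_at_top[of "1::real"]
    proof eventually_elim
      case (elim u)
      have "step_fun r u \<le> (1 / u) ^ r" unfolding step_fun_def using elim by (intro ln_add_one_self_le_self) auto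
      also have "\<dots> \<le> (1 / u) ^ 2" using elim r by (intro power_decreasing) auto
      finally have "u * step_fun r u \<le> u * (1 / u) ^ 2" using elim by (intro mult_left_mono) auto
      then show ?case using elim by (simp add: power2_eq_square)
    qed
    show "((\<lambda>u::real. 1 / u) \<longlongrightarrow> 0) at_top" by real_asymp
  qed auto
  ultimately show ?thesis using tendsto_add[of "\<lambda>u. u * step_fun r u" 0] unfolding step_prim_def[abs_def] by fastforce
qed

text \<open>Divided by x, the logarithm of the product is a Riemann sum of the decreasing function
  \<open>step_fun r\<close> with mesh 1 / x. From above, the logarithmic singularity at 0 is
  harmless, because the first cell is bounded by \<open>step_prim r (1 / x)\<close>; from below,
  that cell is given up and becomes the error term.\<close>

lemma eulerian_pos_bounds:
  assumes r: "r \<ge> 2" and x: "x > 0"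
  obtains s where "eulerian r (of_real x) = of_real (exp s)"
    "x * (Re (growth_const r) - step_prim r (1 / x)) \<le> s" "s \<le> x * Re (growth_const r)"
proof -
  have r0: "r > 0" using r by simp
  define S where "S n = (\<Sum>k=1..n. step_fun r (real k / x))" for n
  define c where "c = Re (growth_const r)"
  have nn: "step_fun r u \<ge> 0" if "u > 0" for u using that by (simp add: step_fun_def)
  have upper: "S (Suc n) \<le> x * step_prim r (real (Suc n) / x)" for n
  proof (induction n)
    case 0
    have "step_fun r (1 / x) = x * ((1 / x) * step_fun r (1 / x))" using x by simp
    also have "\<dots> \<le> x * step_prim r (1 / x)"
      unfolding step_prim_def using x Re_prim_bounds(1)[OF r0, of "1 / x"] by (intro mult_left_mono) auto
    finally show ?case by (simp add: S_def)
  next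
    case (Suc n)
    have "(real (Suc (Suc n)) / x - real (Suc n) / x) * step_fun r (real (Suc (Suc n)) / x)
        \<le> step_prim r (real (Suc (Suc n)) / x) - step_prim r (real (Suc n) / x)"
      using x by (intro step_prim_mvt r0) (auto simp: divide_simps)
    moreover have "real (Suc (Suc n)) / x - real (Suc n) / x = 1 / x" by (simp add: diff_divide_distrib[symmetric])
    ultimately have "step_fun r (real (Suc (Suc n)) / x) \<le> x * (step_prim r (real (Suc (Suc n)) / x) - step_prim r (real (Suc n) / x))"
      using x by (simp add: field_simps)
    then show ?case using Suc by (simp add: S_def right_diff_distrib)
  qed
  have lower: "x * (step_prim r (real (Suc n) / x) - step_prim r (1 / x)) \<le> S n" for n
  proof (induction n)
    case 0
    then show ?case by (simp add: S_def)
  next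
    case (Suc n)
    have "step_prim r (real (Suc (Suc n)) / x) - step_prim r (real (Suc n) / x)
        \<le> (real (Suc (Suc n)) / x - real (Suc n) / x) * step_fun r (real (Suc n) / x)"
      using x by (intro step_prim_mvt r0) (auto simp: divide_simps)
    moreover have "real (Suc (Suc n)) / x - real (Suc n) / x = 1 / x" by (simp add: diff_divide_distrib[symmetric])
    ultimately have "x * (step_prim r (real (Suc (Suc n)) / x) - step_prim r (real (Suc n) / x)) \<le> step_fun r (real (Suc n) / x)"
      using x by (simp add: field_simps)
    then show ?case using Suc by (simp add: S_def right_diff_distrib)
  qed
  have top: "filterlim (\<lambda>n. real (Suc n) / x) at_top sequentially"
    using x by real_asymp
  have lim: "(\<lambda>n. step_prim r (real (Suc n) / x)) \<longlonglongrightarrow> c"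
    unfolding c_def by (rule filterlim_compose[OF step_prim_limit[OF r] top])
  have "convergent (\<lambda>n. x * step_prim r (real (Suc n) / x))"
    using tendsto_mult_left[OF lim, of x] by (auto simp: convergent_def)
  then have "Bseq (\<lambda>n. x * step_prim r (real (Suc n) / x))" by (rule convergent_imp_Bseq)
  then obtain B where B: "\<And>n. \<bar>x * step_prim r (real (Suc n) / x)\<bar> \<le> B" by (auto simp: Bseq_def)
  have inc: "incseq S"
    by (rule incseq_SucI) (use nn x in \<open>auto simp: S_def\<close>)
  have "S n \<le> B" for n
  proof -
    have "S n \<le> S (Suc n)" using inc by (simp add: incseq_SucD)
    also have "\<dots> \<le> B" using upper[of n] B[of n] by linarith
    finally show ?thesis .
  qed
  then obtain s where s: "S \<longlonglongrightarrow> s" using incseq_convergent[OF inc, of B] by blast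
  have "s \<le> x * c"
  proof (rule LIMSEQ_le)
    show "(\<lambda>n. S (Suc n)) \<longlonglongrightarrow> s" using s by (simp add: LIMSEQ_Suc)
    show "(\<lambda>n. x * step_prim r (real (Suc n) / x)) \<longlonglongrightarrow> x * c" by (intro tendsto_intros lim)
  qed (use upper in auto)
  moreover have "x * (c - step_prim r (1 / x)) \<le> s"
  proof (rule LIMSEQ_le)
    show "S \<longlonglongrightarrow> s" by fact
    show "(\<lambda>n. x * (step_prim r (real (Suc n) / x) - step_prim r (1 / x))) \<longlonglongrightarrow> x * (c - step_prim r (1 / x))"
      by (intro tendsto_intros lim)
  qed (use lower in auto)
  moreover have "eulerian r (of_real x) = of_real (exp s)"
  proof -
    have "(\<Prod>k=1..n. 1 + (complex_of_real x / of_nat k) ^ r) = of_real (exp (S n))" for n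
    proof -
      have "exp (step_fun r (real k / x)) = 1 + (x / real k) ^ r" for k
        unfolding step_fun_def using x by (simp add: add_pos_nonneg)
      then have "exp (S n) = (\<Prod>k=1..n. 1 + (x / real k) ^ r)" by (simp add: S_def exp_sum)
      then show ?thesis by simp
    qed
    then have "(\<lambda>n. of_real (exp (S n))) \<longlonglongrightarrow> eulerian r (of_real x)" using eulerian_product[OF r, of "of_real x"] by simp
    moreover have "(\<lambda>n. complex_of_real (exp (S n))) \<longlonglongrightarrow> of_real (exp s)" by (intro tendsto_intros s)
    ultimately show ?thesis by (rule LIMSEQ_unique)
  qed
  ultimately show ?thesis using that by (simp add: c_def)
qed

lemma eulerian_pos_growth:
  assumes r: "r \<ge> 2"
  shows "((\<lambda>x. ln (norm (eulerian r (of_real x))) / x) \<longlongrightarrow> Re (growth_const r)) at_top"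
proof (rule tendsto_sandwich)
  show "eventually (\<lambda>x. Re (growth_const r) - (ln (1 + x ^ r) / x + real r / x) \<le> ln (norm (eulerian r (of_real x))) / x) at_top"
    using eventually_gt_at_top[of 0]
  proof eventually_elim
    case (elim x)
    obtain s where s: "eulerian r (of_real x) = of_real (exp s)" "x * (Re (growth_const r) - step_prim r (1 / x)) \<le> s"
      using eulerian_pos_bounds[OF r elim] by blast
    have "step_prim r (1 / x) \<le> ln (1 + x ^ r) / x + real r / x"
      using Re_prim_bounds(2)[of r "1 / x"] r elim by (simp add: step_prim_def step_fun_def)
    then have "Re (growth_const r) - (ln (1 + x ^ r) / x + real r / x) \<le> Re (growth_const r) - step_prim r (1 / x)" by linarith
    also have "\<dots> \<le> s / x" using s(2) elim by (simp add: field_simps)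
    also have "s = ln (norm (eulerian r (of_real x)))" by (simp add: s(1))
    finally show ?case .
  qed
  show "eventually (\<lambda>x. ln (norm (eulerian r (of_real x))) / x \<le> Re (growth_const r)) at_top"
    using eventually_gt_at_top[of 0]
  proof eventually_elim
    case (elim x)
    obtain s where s: "eulerian r (of_real x) = of_real (exp s)" "s \<le> x * Re (growth_const r)"
      using eulerian_pos_bounds[OF r elim] by blast
    then show ?case using elim by (simp add: field_simps)
  qed
  have "((\<lambda>x::real. ln (1 + x ^ r) / x) \<longlongrightarrow> 0) at_top"
  proof (rule tendsto_sandwich[of "\<lambda>_. 0" _ _ "\<lambda>x. (ln 2 + real r * ln x) / x"])
    show "eventually (\<lambda>x::real. 0 \<le> ln (1 + x ^ r) / x) at_top"
      using eventually_gt_at_top[of "0::real"] by eventually_elim (auto intro!: divide_nonneg_pos)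
    show "eventually (\<lambda>x::real. ln (1 + x ^ r) / x \<le> (ln 2 + real r * ln x) / x) at_top"
      using eventually_ge_at_top[of "1::real"]
    proof eventually_elim
      case (elim x)
      have "ln (1 + x ^ r) \<le> ln (2 * x ^ r)" using elim one_le_power[OF elim, of r] by (intro ln_mono add_pos_nonneg) auto
      also have "\<dots> = ln 2 + real r * ln x" using elim by (simp add: ln_mult ln_realpow)
      finally show ?case using elim by (intro divide_right_mono) auto
    qed
    show "((\<lambda>x. (ln 2 + real r * ln x) / x) \<longlongrightarrow> 0) at_top" by real_asymp
  qed auto
  moreover have "((\<lambda>x. real r / x) \<longlongrightarrow> 0) at_top" by real_asymp
  ultimately have "((\<lambda>x. Re (growth_const r) - (ln (1 + x ^ r) / x + real r / x)) \<longlongrightarrow> Re (growth_const r) - (0 + 0)) at_top"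
    by (intro tendsto_intros)
  then show "((\<lambda>x. Re (growth_const r) - (ln (1 + x ^ r) / x + real r / x)) \<longlongrightarrow> Re (growth_const r)) at_top" by simp
qed auto

subsection \<open>Growth on the negative axis\<close>

lemma minus_root_rev:
  assumes "j < r" shows "minus_root r (r - 1 - j) = cnj (minus_root r j)"
proof -
  have "pi * (2 * real (r - 1 - j) + 1) / real r = 2 * pi - pi * (2 * real j + 1) / real r"
    using assms by (simp add: of_nat_diff field_simps)
  then show ?thesis by (simp add: minus_root_def complex_eq_iff cos_diff sin_diff)
qed

lemma sum_reverse_minus_root:
  fixes f :: "nat \<Rightarrow> 'a::comm_monoid_add"
  shows "(\<Sum>j<r. f (r - 1 - j)) = (\<Sum>j<r. f j)"
  by (rule sum.reindex_bij_witness[of _ "\<lambda>j. r - 1 - j" "\<lambda>j. r - 1 - j"]) auto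

lemma Im_growth_const:
  assumes r: "r \<ge> 2"
  shows "Im (growth_const r) = 0"
proof -
  have s0: "(\<Sum>j<r. minus_root r j) = 0" using sum_minus_root_power[of r 1] r by simp
  define A where "A = (\<Sum>j<r. of_real (real j / real r) * minus_root r j)"
  have "cnj A = (\<Sum>j<r. of_real (real j / real r) * minus_root r (r - 1 - j))"
    unfolding A_def cnj_sum by (intro sum.cong) (auto simp: minus_root_rev[simplified])
  also have "\<dots> = (\<Sum>j<r. of_real (real (r - 1 - (r - 1 - j)) / real r) * minus_root r (r - 1 - j))"
    by (intro sum.cong) auto
  also have "\<dots> = (\<Sum>j<r. of_real (real (r - 1 - j) / real r) * minus_root r j)"
    by (rule sum_reverse_minus_root[of "\<lambda>j. of_real (real (r - 1 - j) / real r) * minus_root r j"])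
  also have "\<dots> = (\<Sum>j<r. of_real (real (r - 1) / real r) * minus_root r j - of_real (real j / real r) * minus_root r j)"
    by (intro sum.cong) (auto simp: of_nat_diff diff_divide_distrib add_divide_distrib algebra_simps)
  also have "\<dots> = - A" by (simp add: sum_subtractf A_def s0 flip: sum_distrib_left sum_divide_distrib)
  finally have "Re A = 0" by (simp add: complex_eq_iff)
  moreover have "growth_const r = 2 * of_real pi * \<i> * A" by (simp only: growth_const_def A_def)
  ultimately show ?thesis by simp
qed

text \<open>With q = L / (2 * r), the roots of -1 are the L-th roots of unity with exponents q * (2
  * j + 1), where \<open>wedge\<close> takes the value 4 * q * j.\<close>

lemma growth_const_even:
  assumes r: "even r" "r \<ge> 2" and L: "L > 0" "2 * r dvd L"
  shows "growth_const r = of_real (pi / L) * \<i> * (\<Sum>s<L. of_int (wedge L r (int s)) * unity L (int s))"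
proof -
  obtain q where q: "L = 2 * r * q" using L by auto
  have q0: "q > 0" "r > 0" using q L by auto
  have mem: "int L dvd 2 * int r * int s \<longleftrightarrow> q dvd s" for s
  proof -
    have "int L dvd 2 * int r * int s \<longleftrightarrow> L dvd 2 * r * s"
      by (metis int_dvd_int_iff of_nat_mult of_nat_numeral)
    then show ?thesis using q q0 by simp
  qed
  have w: "wedge L r (int (q * i)) = (if odd i then 2 * int q * (int i - 1) else 0)" if "i < 2 * r" for i
  proof -
    have "q * i < L" using that q q0 by simp
    have "2 * int r * int (q * i) div int L = int i" using q L by simp
    moreover have "int (q * i) mod int L = int (q * i)"
      using \<open>q * i < L\<close> by (intro mod_pos_pos_trivial) (simp_all only: of_nat_less_iff of_nat_0_le_iff)
    moreover have "L div r = 2 * q" using q q0 by simp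
    moreover have "int L dvd 2 * int r * int (q * i)" unfolding mem by simp
    ultimately show ?thesis using r by (simp add: wedge_def algebra_simps)
  qed
  have "(\<Sum>s<L. of_int (wedge L r (int s)) * unity L (int s))
      = (\<Sum>s\<in>{s\<in>{..<L}. q dvd s}. of_int (wedge L r (int s)) * unity L (int s))"
    by (rule sum.mono_neutral_right) (use mem r in \<open>auto simp: wedge_def\<close>)
  also have "\<dots> = (\<Sum>i<2 * r. of_int (wedge L r (int (q * i))) * unity L (int (q * i)))"
    by (rule sum.reindex_bij_witness[of _ "\<lambda>i. q * i" "\<lambda>s. s div q"]) (use q q0 in \<open>auto simp: div_less_iff_less_mult mult_ac\<close>)
  also have "\<dots> = (\<Sum>i\<in>{i\<in>{..<2 * r}. odd i}. of_int (wedge L r (int (q * i))) * unity L (int (q * i)))"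
    by (rule sum.mono_neutral_right) (use w in auto)
  also have "\<dots> = (\<Sum>j<r. of_int (wedge L r (int (q * (2 * j + 1)))) * unity L (int (q * (2 * j + 1))))"
    by (rule sum.reindex_bij_witness[of _ "\<lambda>j. 2 * j + 1" "\<lambda>i. i div 2"]) auto
  also have "\<dots> = (\<Sum>j<r. (4 * of_nat q * of_nat j) * minus_root r j)"
  proof (intro sum.cong refl)
    fix j assume j: "j \<in> {..<r}"
    have "2 * pi * of_int (int (q * (2 * j + 1))) / real L = pi * (2 * real j + 1) / real r"
      using q q0 by (simp add: field_simps)
    then have "unity L (int (q * (2 * j + 1))) = minus_root r j" unfolding unity_def minus_root_def by simp
    moreover have "wedge L r (int (q * (2 * j + 1))) = 4 * int q * int j"
      using j by (subst w) auto
    ultimately show "of_int (wedge L r (int (q * (2 * j + 1)))) * unity L (int (q * (2 * j + 1)))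
        = (4 * of_nat q * of_nat j) * minus_root r j" by simp
  qed
  finally have *: "(\<Sum>s<L. of_int (wedge L r (int s)) * unity L (int s)) = (\<Sum>j<r. (4 * of_nat q * of_nat j) * minus_root r j)" .
  have "of_real (pi / L) * \<i> * (4 * of_nat q * of_nat j) = 2 * of_real pi * \<i> * of_real (real j / real r)" for j
    using q q0 by (simp add: field_simps)
  then show ?thesis unfolding * growth_const_def sum_distrib_left mult.assoc[symmetric] by (simp only:)
qed

lemma abs_Im_minus_root:
  assumes "j < r"
  shows "\<bar>Im (minus_root r j)\<bar> = (if 2 * j + 1 < r then 1 else if 2 * j + 1 = r then 0 else -1) * Im (minus_root r j)"
proof -
  define a where "a = pi * (2 * real j + 1) / real r"
  have im: "Im (minus_root r j) = sin a" by (simp add: minus_root_def a_def)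
  have a: "a = pi * (real (2 * j + 1) / real r)" by (simp add: a_def)
  consider "2 * j + 1 < r" | "2 * j + 1 = r" | "2 * j + 1 > r" by linarith
  then show ?thesis
  proof cases
    case 1
    then have le: "real (2 * j + 1) / real r \<le> 1" using assms by (simp add: divide_le_eq)
    have "a \<le> pi" unfolding a using mult_left_mono[OF le, of pi] by simp
    moreover have "0 \<le> a" by (simp add: a_def)
    ultimately have "sin a \<ge> 0" by (simp add: sin_ge_zero)
    then show ?thesis using 1 im by simp
  next
    case 2
    then have "a = pi" unfolding a by simp
    then show ?thesis using 2 im by simp
  next
    case 3
    then have ge: "real (2 * j + 1) / real r \<ge> 1" using assms by (simp add: le_divide_eq)
    have le: "real (2 * j + 1) / real r \<le> 2" using assms by (simp add: divide_le_eq)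
    have "a \<ge> pi" unfolding a using mult_left_mono[OF ge, of pi] by simp
    moreover have "a \<le> 2 * pi" unfolding a using mult_left_mono[OF le, of pi] by simp
    ultimately have "sin (a - pi) \<ge> 0" by (intro sin_ge_zero) auto
    then have "sin a \<le> 0" by (simp add: sin_diff)
    then show ?thesis using 3 im by simp
  qed
qed

text \<open>For odd r the negatives of the roots of -1 are the r-th roots of unity. The absolute
  values amount to a sign that flips in the middle of the index range; this jump and the linear
  coefficients of \<open>growth_const\<close> combine into a single sawtooth once the indices are
  rotated by h = (r - 1) / 2.\<close>

lemma growth_const_odd:
  assumes r: "odd r" "r \<ge> 2" and L: "L > 0" "2 * r dvd L"
  shows "of_real (pi * (\<Sum>j<r. \<bar>Im (minus_root r j)\<bar>)) - growth_const r
    = of_real (pi / L) * \<i> * (\<Sum>s<L. of_int (wedge L r (int s)) * unity L (int s))"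
proof -
  obtain h where h: "r = 2 * h + 1" using r by (elim oddE)
  obtain q' where "L = 2 * r * q'" using L by auto
  define q where "q = 2 * q'"
  have q: "L = r * q" using \<open>L = _\<close> by (simp add: q_def)
  have q0: "q > 0" "r > 0" using q L by auto
  define e :: "nat \<Rightarrow> int" where "e j = (if j < h then 1 else if j = h then 0 else -1)" for j
  have e: "\<bar>Im (minus_root r j)\<bar> = of_int (e j) * Im (minus_root r j)" if "j < r" for j
    using abs_Im_minus_root[OF that] by (auto simp: e_def h)
  define A where "A = (\<Sum>j<r. of_int (e j) * minus_root r j)"
  have "cnj A = (\<Sum>j<r. of_int (e j) * minus_root r (r - 1 - j))"
    unfolding A_def cnj_sum by (intro sum.cong) (auto simp: minus_root_rev[simplified])
  also have "\<dots> = (\<Sum>j<r. - of_int (e (r - 1 - j)) * minus_root r (r - 1 - j))"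
    by (intro sum.cong) (auto simp: e_def h)
  also have "\<dots> = (\<Sum>j<r. - of_int (e j) * minus_root r j)"
    by (rule sum_reverse_minus_root[of "\<lambda>j. - of_int (e j) * minus_root r j"])
  also have "\<dots> = - A" by (simp add: A_def sum_negf)
  finally have "Re A = 0" by (simp add: complex_eq_iff)
  moreover have "Im A = (\<Sum>j<r. \<bar>Im (minus_root r j)\<bar>)" using e by (simp add: A_def)
  ultimately have "of_real (\<Sum>j<r. \<bar>Im (minus_root r j)\<bar>) = - \<i> * A" by (simp add: complex_eq_iff)
  then have lhs: "of_real (pi * (\<Sum>j<r. \<bar>Im (minus_root r j)\<bar>)) - growth_const r
      = of_real (pi / L) * \<i> * (\<Sum>j<r. - of_int (int L * e j + 2 * int q * int j) * minus_root r j)"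
    (is "?l = ?r")
  proof -
    have "?l = - (of_real pi * \<i> * A + growth_const r)" using \<open>_ = - \<i> * A\<close> by (simp add: of_real_mult)
    also have "of_real pi * \<i> * A + growth_const r = (\<Sum>j<r. of_real pi * \<i> * (of_int (e j) + 2 * of_real (real j / real r)) * minus_root r j)"
      by (simp add: A_def growth_const_def sum_distrib_left distrib_left distrib_right sum.distrib mult_ac)
    also have "\<dots> = (\<Sum>j<r. of_real (pi / L) * \<i> * (of_int (int L * e j + 2 * int q * int j) * minus_root r j))"
    proof (intro sum.cong refl)
      fix j
      have "of_int (e j) + 2 * of_real (real j / real r) = (of_int (int L * e j + 2 * int q * int j) / of_nat L :: complex)"
        using q q0 by (simp add: field_simps)
      then show "of_real pi * \<i> * (of_int (e j) + 2 * of_real (real j / real r)) * minus_root r j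
        = of_real (pi / L) * \<i> * (of_int (int L * e j + 2 * int q * int j) * minus_root r j)" by (simp add: field_simps)
    qed
    also have "- \<dots> = (\<Sum>j<r. - (of_real (pi / L) * \<i> * (of_int (int L * e j + 2 * int q * int j) * minus_root r j)))"
      by (simp only: sum_negf)
    also have "\<dots> = ?r" unfolding sum_distrib_left by (simp only: mult_minus_left mult_minus_right)
    finally show ?thesis .
  qed
  have mr: "minus_root r j = - unity r (int j - int h)" for j
  proof -
    have "pi * (2 * real j + 1) / real r = pi + 2 * pi * of_int (int j - int h) / of_nat r"
      using q0 by (simp add: field_simps h)
    then show ?thesis by (simp add: minus_root_def unity_def cis_mult[symmetric])
  qed
  define V where "V k = wedge L r (int (q * k))" for k
  have mem: "int L dvd int r * int s \<longleftrightarrow> q dvd s" for s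
  proof -
    have "int L dvd int r * int s \<longleftrightarrow> L dvd r * s" by (metis int_dvd_int_iff of_nat_mult)
    then show ?thesis using q q0 by simp
  qed
  have V: "V k = (if k = 0 then int L - int q else 2 * int q * int k - int q)" if "k < r" for k
  proof -
    have "q * k < L" using that q q0 by simp
    then have "L dvd q * k \<longleftrightarrow> k = 0" using q0 by (auto dest: dvd_imp_le)
    then have "int L dvd int (q * k) \<longleftrightarrow> k = 0" by (simp only: int_dvd_int_iff)
    moreover have "int (q * k) mod int L = int (q * k)"
      using \<open>q * k < L\<close> by (intro mod_pos_pos_trivial) (simp_all only: of_nat_less_iff of_nat_0_le_iff)
    moreover have "L div r = q" using q q0 by simp
    moreover have "int L dvd int r * int (q * k)" unfolding mem by simp
    ultimately show ?thesis using r unfolding V_def wedge_def by (simp add: mult.assoc)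
  qed
  have un: "unity L (int (q * k)) = unity r (int k)" for k
    using q q0 by (simp add: unity_def mult_ac)
  have "(\<Sum>s<L. of_int (wedge L r (int s)) * unity L (int s))
      = (\<Sum>s\<in>{s\<in>{..<L}. q dvd s}. of_int (wedge L r (int s)) * unity L (int s))"
    by (rule sum.mono_neutral_right) (use mem r in \<open>auto simp: wedge_def\<close>)
  also have "\<dots> = (\<Sum>k<r. of_int (V k) * unity r (int k))"
    by (rule sum.reindex_bij_witness[of _ "\<lambda>i. q * i" "\<lambda>s. s div q"])
      (use q q0 un in \<open>auto simp: div_less_iff_less_mult V_def mult_ac\<close>)
  also have "\<dots> = (\<Sum>j<r. - of_int (int L * e j + 2 * int q * int j) * minus_root r j)"
  \<comment> \<open>The rotation k = j - h modulo r moves h, where the root is -1 and its imaginary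
    part is 0, to k = 0; this is the exceptional point in \<open>wedge\<close>.\<close>
  proof (rule sum.reindex_bij_witness[of _ "\<lambda>j. if j < h then j + h + 1 else j - h" "\<lambda>k. if k \<le> h then k + h else k - h - 1"])
    fix k assume k: "k \<in> {..<r}"
    let ?j = "if k \<le> h then k + h else k - h - 1"
    have "unity r (int ?j - int h) = unity r (int k)"
    proof (rule unity_cong)
      have "int ?j - int h - int k = 0 \<or> int ?j - int h - int k = - int r" using k by (auto simp: h of_nat_diff)
      then show "[int ?j - int h = int k] (mod int r)"
        unfolding cong_iff_dvd_diff by (metis dvd_0_right dvd_minus_iff dvd_refl)
    qed (use q0 in simp)
    then have "minus_root r ?j = - unity r (int k)" by (simp only: mr)
    moreover have "int L * e ?j + 2 * int q * int ?j = V k"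
    proof -
      have Lq: "int L = 2 * int q * int h + int q" using q by (simp add: h algebra_simps)
      show ?thesis using V[of k] k by (auto simp: e_def Lq h algebra_simps of_nat_diff)
    qed
    ultimately show "- of_int (int L * e ?j + 2 * int q * int ?j) * minus_root r ?j = of_int (V k) * unity r (int k)"
      by simp
  qed (auto simp: h split: if_splits)
  finally show ?thesis using lhs by simp
qed

section \<open>Size of the sine at half-integral distances along rays\<close>

lemma norm_sin_bounds:
  fixes z :: complex
  shows "norm (sin z) ^ 2 \<le> exp (2 * \<bar>Im z\<bar>)"
    and "(exp (2 * \<bar>Im z\<bar>) - 2 * cos (2 * Re z)) / 4 \<le> norm (sin z) ^ 2"
proof -
  have e: "exp (2 * Im z) + inverse (exp (2 * Im z)) = exp (2 * \<bar>Im z\<bar>) + inverse (exp (2 * \<bar>Im z\<bar>))"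
    by (cases "Im z \<ge> 0") (simp_all add: exp_minus)
  have f1: "exp (2 * \<bar>Im z\<bar>) \<ge> 1" by simp
  then have f2: "inverse (exp (2 * \<bar>Im z\<bar>)) \<le> 1" using inverse_le_1_iff by blast
  have f3: "- 1 \<le> cos (2 * Re z)" by simp
  have f4: "inverse (exp (2 * \<bar>Im z\<bar>)) \<ge> 0" by simp
  have "(E + I - 2 * c) / 4 \<le> E" if "E \<ge> 1" "I \<le> 1" "-1 \<le> c" for E I c :: real
    using that by simp
  then show "norm (sin z) ^ 2 \<le> exp (2 * \<bar>Im z\<bar>)"
    unfolding norm_sin_squared e using f1 f2 f3 by blast
  show "(exp (2 * \<bar>Im z\<bar>) - 2 * cos (2 * Re z)) / 4 \<le> norm (sin z) ^ 2"
    unfolding norm_sin_squared e using f4 by (intro divide_right_mono diff_right_mono) auto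
qed

lemma eighth_le:
  fixes a c s :: real
  assumes "(a - 2 * c) / 4 \<le> s" "c \<le> 1" "4 \<le> a" shows "a / 8 \<le> s"
  using assms by simp

definition sinc_pi :: "complex \<Rightarrow> complex" where
  "sinc_pi w = sin (of_real pi * w) / (of_real pi * w)"

lemma rGamma_sinc_pi:
  assumes "w \<noteq> 0"
  shows "rGamma (1 - w) * rGamma (1 + w) = sinc_pi w"
proof -
  have "rGamma w = w * rGamma (1 + w)" using rGamma_plus1[of w] by (simp add: add.commute)
  then have "w * (rGamma (1 - w) * rGamma (1 + w)) = sin (of_real pi * w) / of_real pi"
    using rGamma_reflection_complex[of w] by (simp add: mult_ac)
  then show ?thesis using assms by (simp add: sinc_pi_def field_simps)
qed

definition half_int :: "nat \<Rightarrow> real" where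
  "half_int n = real n + 1 / 2"

lemma half_int_pos: "half_int n > 0"
  by (simp add: half_int_def)

text \<open>A zero of the sine at pi * w makes the modulus of w an integer, but here it is a
  half-integer. This is why growth is measured at half-integers: no Eulerian function vanishes
  there.\<close>

lemma sinc_pi_nonzero:
  assumes "norm \<zeta> = 1"
  shows "sinc_pi (\<zeta> * of_real (half_int n)) \<noteq> 0"
proof
  assume "sinc_pi (\<zeta> * of_real (half_int n)) = 0"
  moreover have nz: "\<zeta> \<noteq> 0" using assms by auto
  ultimately have "sin (of_real pi * (\<zeta> * of_real (half_int n))) = 0"
    using half_int_pos[of n] by (simp add: sinc_pi_def)
  then obtain m :: int where "of_real pi * (\<zeta> * of_real (half_int n)) = of_real (of_int m * pi)"
    unfolding sin_eq_0 by auto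
  then have "norm (\<zeta> * complex_of_real (half_int n)) = norm (complex_of_real (of_int m))" by simp
  then have "half_int n = \<bar>of_int m\<bar>" using assms half_int_pos[of n] by (simp add: norm_mult)
  then have "real_of_int (2 * int n + 1) = real_of_int (2 * \<bar>m\<bar>)" by (simp add: half_int_def)
  then have "2 * int n + 1 = 2 * \<bar>m\<bar>" by (simp only: of_int_eq_iff)
  then show False by presburger
qed

text \<open>The squared modulus of the sine eventually lies between an eighth of
  \<open>exp (2 * (b * half_int n))\<close> and this exponential, and the denominator grows only
  linearly. For real \<zeta> there is no exponential growth to absorb the cosine, but at
  half-integers the cosine equals -1.\<close>

lemma sinc_pi_growth:
  assumes z: "norm \<zeta> = 1"
  shows "(\<lambda>n. ln (norm (sinc_pi (\<zeta> * of_real (half_int n)))) / half_int n) \<longlonglongrightarrow> pi * \<bar>Im \<zeta>\<bar>"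
proof -
  define b where "b = pi * \<bar>Im \<zeta>\<bar>"
  define s where "s n = norm (sin (of_real pi * (\<zeta> * of_real (half_int n))))" for n
  have up: "s n ^ 2 \<le> exp (2 * (b * half_int n))" for n
    using norm_sin_bounds(1)[of "of_real pi * (\<zeta> * of_real (half_int n))"] half_int_pos[of n]
    by (simp add: s_def b_def abs_mult mult_ac)
  have low: "eventually (\<lambda>n. exp (2 * (b * half_int n)) / 8 \<le> s n ^ 2) sequentially"
  proof (cases "Im \<zeta> = 0")
    case True
    have "\<bar>Re \<zeta>\<bar> = 1" using z True by (simp add: cmod_def)
    have c: "cos (2 * (pi * (Re \<zeta> * half_int n))) = -1" for n
    proof -
      have "cos (2 * (pi * (Re \<zeta> * half_int n))) = cos (2 * pi * half_int n)"
        using \<open>\<bar>Re \<zeta>\<bar> = 1\<close> by (cases "Re \<zeta> \<ge> 0") (auto simp: mult.assoc)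
      also have "2 * pi * half_int n = 2 * real n * pi + pi" by (simp add: half_int_def algebra_simps)
      also have "cos \<dots> = -1" using cos_2npi[of n] by (simp only: cos_periodic_pi)
      finally show ?thesis .
    qed
    show ?thesis
    proof (intro always_eventually allI)
      fix n
      show "exp (2 * (b * half_int n)) / 8 \<le> s n ^ 2"
        using norm_sin_bounds(2)[of "of_real pi * (\<zeta> * of_real (half_int n))"] c[of n] True
        by (simp add: s_def b_def)
    qed
  next
    case False
    then have "b > 0" by (simp add: b_def)
    then have "filterlim (\<lambda>n::nat. exp (2 * (b * half_int n))) at_top sequentially"
      unfolding half_int_def by real_asymp
    then have "eventually (\<lambda>n. exp (2 * (b * half_int n)) \<ge> 4) sequentially" by (simp add: filterlim_at_top)
    then show ?thesis
    proof eventually_elim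
      case (elim n)
      have "cos (2 * Re (of_real pi * (\<zeta> * of_real (half_int n)))) \<le> 1" by simp
      moreover have "(exp (2 * (b * half_int n)) - 2 * cos (2 * Re (of_real pi * (\<zeta> * of_real (half_int n))))) / 4 \<le> s n ^ 2"
        using norm_sin_bounds(2)[of "of_real pi * (\<zeta> * of_real (half_int n))"] half_int_pos[of n]
        by (simp add: s_def b_def abs_mult mult_ac)
      ultimately show ?case using elim eighth_le by blast
    qed
  qed
  have ln: "ln (norm (sinc_pi (\<zeta> * of_real (half_int n)))) = ln (s n) - ln (pi * half_int n)" "s n > 0" for n
  proof -
    have "s n \<noteq> 0" using sinc_pi_nonzero[OF z, of n] by (auto simp: sinc_pi_def s_def)
    then show "s n > 0" by (simp add: s_def)
    have "norm (sinc_pi (\<zeta> * of_real (half_int n))) = s n / (pi * half_int n)"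
      using z half_int_pos[of n] by (simp add: sinc_pi_def s_def norm_divide norm_mult)
    then show "ln (norm (sinc_pi (\<zeta> * of_real (half_int n)))) = ln (s n) - ln (pi * half_int n)"
      using \<open>s n > 0\<close> half_int_pos[of n] by (simp add: ln_div)
  qed
  show ?thesis unfolding b_def[symmetric]
  proof (rule tendsto_sandwich)
    show "eventually (\<lambda>n. (b * half_int n - ln 8 / 2 - ln (pi * half_int n)) / half_int n
        \<le> ln (norm (sinc_pi (\<zeta> * of_real (half_int n)))) / half_int n) sequentially"
      using low
    proof eventually_elim
      case (elim n)
      have "ln (exp (2 * (b * half_int n)) / 8) \<le> ln (s n ^ 2)" using elim by (intro ln_mono) auto
      then have "b * half_int n - ln 8 / 2 \<le> ln (s n)" using ln(2)[of n] by (simp add: ln_div ln_realpow)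
      then show ?case unfolding ln(1) using half_int_pos[of n] by (intro divide_right_mono) auto
    qed
    show "eventually (\<lambda>n. ln (norm (sinc_pi (\<zeta> * of_real (half_int n)))) / half_int n
        \<le> (b * half_int n - ln (pi * half_int n)) / half_int n) sequentially"
    proof (intro always_eventually allI)
      fix n
      have "ln (s n ^ 2) \<le> ln (exp (2 * (b * half_int n)))" using up[of n] ln(2)[of n] by (intro ln_mono) auto
      then have "ln (s n) \<le> b * half_int n" using ln(2)[of n] by (simp add: ln_realpow)
      then show "ln (norm (sinc_pi (\<zeta> * of_real (half_int n)))) / half_int n
        \<le> (b * half_int n - ln (pi * half_int n)) / half_int n"
        unfolding ln(1) using half_int_pos[of n] by (intro divide_right_mono) auto
    qed
    show "(\<lambda>n. (b * half_int n - ln 8 / 2 - ln (pi * half_int n)) / half_int n) \<longlonglongrightarrow> b"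
      unfolding half_int_def by real_asymp
    show "(\<lambda>n. (b * half_int n - ln (pi * half_int n)) / half_int n) \<longlonglongrightarrow> b"
      unfolding half_int_def by real_asymp
  qed
qed

lemma eulerian_reflection:
  assumes "z \<noteq> 0"
  shows "eulerian r (- z) * eulerian r z = (\<Prod>j<r. sinc_pi (minus_root r j * z))"
proof -
  have "rGamma (1 - minus_root r j * (- z)) * rGamma (1 - minus_root r j * z) = sinc_pi (minus_root r j * z)" for j
  proof -
    have "minus_root r j \<noteq> 0" by (metis norm_minus_root norm_zero zero_neq_one)
    then show ?thesis using rGamma_sinc_pi[of "minus_root r j * z"] assms by (simp add: mult.commute)
  qed
  then show ?thesis unfolding eulerian_def prod.distrib[symmetric] by (intro prod.cong) auto
qed

lemma eulerian_uminus:
  assumes "even r" "r \<ge> 2" shows "eulerian r (- z) = eulerian r z"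
  using eulerian_product[OF assms(2), of "- z"] eulerian_product[OF assms(2), of z] assms(1)
  by (intro LIMSEQ_unique) (simp_all add: power_divide)

definition neg_log :: "nat \<Rightarrow> nat \<Rightarrow> real" where
  "neg_log r n = ln (norm (eulerian r (- of_real (half_int n))))"

text \<open>In closed form pi / sin (pi / r) for even r and pi * cot (pi / r) for odd r \<ge>
  3.\<close>

definition neg_growth :: "nat \<Rightarrow> real" where
  "neg_growth r = (if even r then Re (growth_const r)
     else pi * (\<Sum>j<r. \<bar>Im (minus_root r j)\<bar>) - Re (growth_const r))"

lemma eulerian_half_int_nonzero:
  "eulerian r (- of_real (half_int n)) \<noteq> 0" "eulerian r (of_real (half_int n)) \<noteq> 0"
proof -
  have "eulerian r (- of_real (half_int n)) * eulerian r (of_real (half_int n)) \<noteq> 0"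
    using half_int_pos[of n] sinc_pi_nonzero[OF norm_minus_root]
    by (subst eulerian_reflection) auto
  then show "eulerian r (- of_real (half_int n)) \<noteq> 0" "eulerian r (of_real (half_int n)) \<noteq> 0" by auto
qed

lemma half_int_at_top: "filterlim half_int at_top sequentially"
  unfolding half_int_def[abs_def] by real_asymp

text \<open>For even r the function is even. For odd r the reflection formula expresses the value on
  the negative axis by sines divided by the value on the positive axis, whose growth constant
  therefore enters with a minus sign.\<close>

lemma neg_log_growth:
  assumes r: "r \<ge> 2"
  shows "(\<lambda>n. neg_log r n / half_int n) \<longlonglongrightarrow> neg_growth r"
proof -
  have pos: "(\<lambda>n. ln (norm (eulerian r (of_real (half_int n)))) / half_int n) \<longlonglongrightarrow> Re (growth_const r)"
    by (rule filterlim_compose[OF eulerian_pos_growth[OF r] half_int_at_top])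
  show ?thesis
  proof (cases "even r")
    case True
    then show ?thesis using pos eulerian_uminus[OF True r] by (simp add: neg_log_def neg_growth_def)
  next
    case False
    have "neg_log r n / half_int n = (\<Sum>j<r. ln (norm (sinc_pi (minus_root r j * of_real (half_int n)))) / half_int n)
        - ln (norm (eulerian r (of_real (half_int n)))) / half_int n" for n
    proof -
      have "ln (norm (eulerian r (- of_real (half_int n)) * eulerian r (of_real (half_int n))))
          = ln (\<Prod>j<r. norm (sinc_pi (minus_root r j * of_real (half_int n))))"
        using half_int_pos[of n] by (subst eulerian_reflection) (auto simp: prod_norm[symmetric])
      then have "neg_log r n + ln (norm (eulerian r (of_real (half_int n))))
          = (\<Sum>j<r. ln (norm (sinc_pi (minus_root r j * of_real (half_int n)))))"
        using eulerian_half_int_nonzero[of r n] sinc_pi_nonzero[OF norm_minus_root, of r _ n]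
        by (simp add: norm_mult ln_mult neg_log_def ln_prod)
      then have "neg_log r n = (\<Sum>j<r. ln (norm (sinc_pi (minus_root r j * of_real (half_int n)))))
        - ln (norm (eulerian r (of_real (half_int n))))" by simp
      then show ?thesis by (simp add: sum_divide_distrib diff_divide_distrib)
    qed
    moreover have "(\<lambda>n. (\<Sum>j<r. ln (norm (sinc_pi (minus_root r j * of_real (half_int n)))) / half_int n)
        - ln (norm (eulerian r (of_real (half_int n)))) / half_int n) \<longlonglongrightarrow> (\<Sum>j<r. pi * \<bar>Im (minus_root r j)\<bar>) - Re (growth_const r)"
      by (intro tendsto_intros pos sinc_pi_growth norm_minus_root)
    ultimately show ?thesis using False by (simp add: neg_growth_def sum_distrib_left)
  qed
qed

lemma neg_growth_wedge:
  assumes r: "r \<ge> 2" and L: "L > 0" "2 * r dvd L"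
  shows "of_real (neg_growth r) = of_real (pi / L) * \<i> * (\<Sum>s<L. of_int (wedge L r (int s)) * unity L (int s))"
proof -
  have "growth_const r = of_real (Re (growth_const r))" using Im_growth_const[OF r] by (simp add: complex_eq_iff)
  then show ?thesis
    using growth_const_even[OF _ r L] growth_const_odd[OF _ r L] by (cases "even r") (simp_all add: neg_growth_def)
qed

text \<open>By the functional equation the increments of \<open>neg_log 1\<close> are
  \<open>ln (half_int n)\<close>, which tend to infinity; so it outgrows every linear function, and
  the index 1 outweighs all others.\<close>

lemma neg_log_1: "filterlim (\<lambda>n. neg_log 1 n / half_int n) at_top sequentially"
proof -
  have "minus_root 1 0 = -1" by (simp add: minus_root_def)
  then have e1: "eulerian 1 (- of_real (half_int n)) = rGamma (1 - of_real (half_int n))" for n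
    by (simp add: eulerian_def)
  have step: "neg_log 1 (Suc n) = ln (half_int n) + neg_log 1 n" for n
  proof -
    have "rGamma (1 - of_real (half_int (Suc n))) = - of_real (half_int n) * rGamma (1 - complex_of_real (half_int n))"
    proof -
      have "1 - complex_of_real (half_int (Suc n)) = - of_real (half_int n)" by (simp add: half_int_def)
      moreover have "- complex_of_real (half_int n) + 1 = 1 - of_real (half_int n)" by simp
      ultimately show ?thesis using rGamma_plus1[of "- complex_of_real (half_int n)"] by (simp only:)
    qed
    then show ?thesis using eulerian_half_int_nonzero[of 1 n] half_int_pos[of n]
      unfolding neg_log_def e1 by (simp add: norm_mult ln_mult)
  qed
  show ?thesis unfolding filterlim_at_top
  proof
    fix Z :: real
    define M where "M = Z + 1"
    have "filterlim (\<lambda>n. ln (half_int n)) at_top sequentially"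
      by (rule filterlim_compose[OF ln_at_top half_int_at_top])
    then obtain N where N: "\<And>n. n \<ge> N \<Longrightarrow> M \<le> ln (half_int n)"
      unfolding filterlim_at_top eventually_sequentially by blast
    have low: "neg_log 1 N + M * (real n - real N) \<le> neg_log 1 n" if "n \<ge> N" for n
      using that
    proof (induction n rule: dec_induct)
      case (step n)
      then show ?case using N[of n] \<open>\<And>n. neg_log 1 (Suc n) = _ n\<close> by (simp add: algebra_simps)
    qed simp
    have "(\<lambda>n. (neg_log 1 N + M * (real n - real N)) / half_int n) \<longlonglongrightarrow> M"
      unfolding half_int_def by real_asymp
    then have "eventually (\<lambda>n. (neg_log 1 N + M * (real n - real N)) / half_int n > Z) sequentially"
      by (rule order_tendstoD) (simp add: M_def)
    then show "eventually (\<lambda>n. Z \<le> neg_log 1 n / half_int n) sequentially"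
      using eventually_ge_at_top[of N]
    proof eventually_elim
      case (elim n)
      then show ?case using divide_right_mono[OF low[of n], of "half_int n"] half_int_pos[of n] by linarith
    qed
  qed
qed

lemma minus_root_half: "h > 0 \<Longrightarrow> minus_root (2 * h) (j + h) = - minus_root (2 * h) j"
proof -
  assume "h > 0"
  then have "pi * (2 * real (j + h) + 1) / real (2 * h) = pi * (2 * real j + 1) / real (2 * h) + pi"
    by (simp add: field_simps)
  then show ?thesis unfolding minus_root_def by (simp add: complex_eq_iff)
qed

lemma minus_root_6: "Im (minus_root 6 0) = 1 / 2" "minus_root 6 1 = \<i>" "Im (minus_root 6 2) = 1 / 2"
  "minus_root 6 3 = - minus_root 6 0" "minus_root 6 4 = - minus_root 6 1" "minus_root 6 5 = - minus_root 6 2"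
proof -
  show "Im (minus_root 6 0) = 1 / 2" by (simp add: minus_root_def sin_30)
  have "pi * (2 * real 1 + 1) / real 6 = pi / 2" by simp
  then show "minus_root 6 1 = \<i>" unfolding minus_root_def by simp
  have "pi * (2 * real 2 + 1) / real 6 = pi - pi / 6" by simp
  then have "Im (minus_root 6 2) = sin (pi - pi / 6)" by (simp only: minus_root_def cis.simps)
  then show "Im (minus_root 6 2) = 1 / 2" by (simp only: sin_pi_minus sin_30)
qed (use minus_root_half[of 3 0] minus_root_half[of 3 1] minus_root_half[of 3 2] in simp_all)

lemma minus_root_2: "minus_root 2 0 = \<i>" "minus_root 2 1 = - \<i>"
proof -
  show "minus_root 2 0 = \<i>" by (simp add: minus_root_def)
  then show "minus_root 2 1 = - \<i>" using minus_root_half[of 1 0] by simp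
qed

lemma neg_growth_2: "neg_growth 2 = pi"
  by (simp add: neg_growth_def growth_const_def lessThan_nat_numeral minus_root_2(1) minus_root_2(2)[unfolded One_nat_def] mult.commute)

lemma neg_growth_6: "neg_growth 6 = 2 * pi"
  by (simp add: neg_growth_def growth_const_def lessThan_nat_numeral minus_root_6(1,3,4,6) minus_root_6(2,5)[unfolded One_nat_def])

text \<open>\<open>2 * neg_growth 2 = neg_growth 6\<close>, so here the logarithmic term decides.\<close>

lemma neg_log_2_6: "filterlim (\<lambda>n. 2 * neg_log 2 n - neg_log 6 n) at_top sequentially"
proof -
  \<comment> \<open>The roots for 2 and 6 occur in pairs of opposite sign, so the reflection formula
    gives exact products of one and of three factors \<open>sinc_pi\<close>.\<close>
  have s2: "eulerian 2 z = sinc_pi (\<i> * z)" if "z \<noteq> 0" for z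
    using rGamma_sinc_pi[of "\<i> * z"] that
    by (simp add: eulerian_def lessThan_nat_numeral minus_root_2(1) minus_root_2(2)[unfolded One_nat_def] mult.commute)
  have s6: "eulerian 6 z = sinc_pi (minus_root 6 0 * z) * sinc_pi (\<i> * z) * sinc_pi (minus_root 6 2 * z)" if "z \<noteq> 0" for z
  proof -
    have nz: "minus_root 6 j \<noteq> 0" for j by (metis norm_minus_root norm_zero zero_neq_one)
    show ?thesis
      using rGamma_sinc_pi[of "\<i> * z"] rGamma_sinc_pi[of "minus_root 6 0 * z"] rGamma_sinc_pi[of "minus_root 6 2 * z"] that nz
      by (simp add: eulerian_def lessThan_nat_numeral minus_root_6(1,3,4,6) minus_root_6(2,5)[unfolded One_nat_def] mult_ac)
  qed
  have up: "ln (norm (sinc_pi (\<zeta> * of_real (half_int n)))) \<le> pi * half_int n / 2 - ln (pi * half_int n)"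
    if "norm \<zeta> = 1" "Im \<zeta> = 1 / 2" for \<zeta> n
  proof -
    let ?s = "norm (sin (of_real pi * (\<zeta> * of_real (half_int n))))"
    have "?s \<noteq> 0" using sinc_pi_nonzero[OF that(1), of n] by (auto simp: sinc_pi_def)
    then have s: "?s > 0" by simp
    have "?s ^ 2 \<le> exp (pi * half_int n)"
      using norm_sin_bounds(1)[of "of_real pi * (\<zeta> * of_real (half_int n))"] half_int_pos[of n] that
      by (simp add: abs_mult)
    then have "ln (?s ^ 2) \<le> ln (exp (pi * half_int n))" using s by (intro ln_mono) auto
    then have "ln ?s \<le> pi * half_int n / 2" using s by (simp add: ln_realpow)
    moreover have "norm (sinc_pi (\<zeta> * of_real (half_int n))) = ?s / (pi * half_int n)"
      using that half_int_pos[of n] by (simp add: sinc_pi_def norm_divide norm_mult)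
    ultimately show ?thesis using s half_int_pos[of n] by (simp add: ln_div)
  qed
  \<comment> \<open>Every factor \<open>sinc_pi\<close> contributes - L with L =
    \<open>ln (pi * half_int n)\<close>: two of them occur in twice \<open>neg_log 2\<close>, three
    in \<open>neg_log 6\<close>. The exponential rates cancel and one L survives.\<close>
  have tie: "L - e \<le> 2 * (s - L) - (u + (s - L) + v)"
    if "p - e \<le> s" "u \<le> p / 2 - L" "v \<le> p / 2 - L" for p e s u v L :: real
    using that by simp
  have "filterlim (\<lambda>n::nat. exp (2 * (pi * half_int n))) at_top sequentially"
    unfolding half_int_def by real_asymp
  then have "eventually (\<lambda>n. exp (2 * (pi * half_int n)) \<ge> 4) sequentially" by (simp add: filterlim_at_top)
  then have ev: "eventually (\<lambda>n. ln (pi * half_int n) - ln 8 / 2 \<le> 2 * neg_log 2 n - neg_log 6 n) sequentially"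
  proof eventually_elim
    case (elim n)
    let ?x = "complex_of_real (half_int n)"
    have x: "?x \<noteq> 0" using half_int_pos[of n] by simp
    let ?s = "norm (sin (of_real pi * (\<i> * ?x)))"
    have "(exp (2 * (pi * half_int n)) - 2) / 4 \<le> ?s ^ 2"
      using norm_sin_bounds(2)[of "of_real pi * (\<i> * ?x)"] half_int_pos[of n] by (simp add: abs_mult)
    then have "exp (2 * (pi * half_int n)) / 8 \<le> ?s ^ 2" using elim eighth_le[of _ 1] by simp
    then have "ln (exp (2 * (pi * half_int n)) / 8) \<le> ln (?s ^ 2)" by (intro ln_mono) auto
    moreover have "?s \<noteq> 0" using sinc_pi_nonzero[of \<i> n] by (auto simp: sinc_pi_def)
    then have s: "?s > 0" by simp
    ultimately have a: "pi * half_int n - ln 8 / 2 \<le> ln ?s" by (simp add: ln_div ln_realpow)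
    have "norm (sinc_pi (\<i> * ?x)) = ?s / (pi * half_int n)"
      using half_int_pos[of n] by (simp add: sinc_pi_def norm_divide norm_mult)
    then have b: "ln (norm (sinc_pi (\<i> * ?x))) = ln ?s - ln (pi * half_int n)"
      using s half_int_pos[of n] by (simp add: ln_div)
    have n2: "neg_log 2 n = ln (norm (sinc_pi (\<i> * ?x)))"
      using x by (simp add: neg_log_def eulerian_uminus s2)
    have n6: "neg_log 6 n = ln (norm (sinc_pi (minus_root 6 0 * ?x))) + ln (norm (sinc_pi (\<i> * ?x))) + ln (norm (sinc_pi (minus_root 6 2 * ?x)))"
      using x sinc_pi_nonzero[OF norm_minus_root, of 6 0 n] sinc_pi_nonzero[OF norm_minus_root, of 6 2 n] sinc_pi_nonzero[of \<i> n]
      by (simp add: neg_log_def eulerian_uminus s6 norm_mult ln_mult)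
    show ?case unfolding n2 n6 b
      by (rule tie[OF a up[OF norm_minus_root minus_root_6(1)] up[OF norm_minus_root minus_root_6(3)]])
  qed
  have "filterlim (\<lambda>n. ln (pi * half_int n) - ln 8 / 2) at_top sequentially"
    unfolding half_int_def by real_asymp
  then show ?thesis using ev by (rule filterlim_at_top_mono)
qed

subsection \<open>Independence of monomials in Eulerian functions\<close>

lemma neg_log_combination_pos:
  fixes d :: "nat \<Rightarrow> int" and R :: nat
  defines "K \<equiv> \<Sum>r=2..R. of_int (d r) * neg_growth r"
  assumes R: "R \<ge> 1" and d: "d 1 > 0 \<or> d 1 = 0 \<and> K > 0"
  shows "filterlim (\<lambda>n. \<Sum>r=1..R. of_int (d r) * neg_log r n) at_top sequentially"
proof -
  have split: "(\<Sum>r=1..R. of_int (d r) * neg_log r n)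
      = (of_int (d 1) * (neg_log 1 n / half_int n) + (\<Sum>r=2..R. of_int (d r) * (neg_log r n / half_int n))) * half_int n" for n
  proof -
    have "{1..R} = insert 1 {2..R}" using R by auto
    then show ?thesis using half_int_pos[of n] by (simp add: distrib_right sum_distrib_right)
  qed
  have lim: "(\<lambda>n. \<Sum>r=2..R. of_int (d r) * (neg_log r n / half_int n)) \<longlonglongrightarrow> K"
    unfolding K_def by (intro tendsto_intros neg_log_growth) auto
  show ?thesis unfolding split
  proof (cases "d 1 > 0")
    case True
    have "filterlim (\<lambda>n. of_int (d 1) * (neg_log 1 n / half_int n)) at_top sequentially"
      by (rule filterlim_tendsto_pos_mult_at_top[OF tendsto_const _ neg_log_1]) (use True in simp)
    then have "filterlim (\<lambda>n. (\<Sum>r=2..R. of_int (d r) * (neg_log r n / half_int n)) + of_int (d 1) * (neg_log 1 n / half_int n)) at_top sequentially"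
      by (rule filterlim_tendsto_add_at_top[OF lim])
    then have "filterlim (\<lambda>n. of_int (d 1) * (neg_log 1 n / half_int n) + (\<Sum>r=2..R. of_int (d r) * (neg_log r n / half_int n))) at_top sequentially"
      by (simp only: add.commute)
    then show "filterlim (\<lambda>n. (of_int (d 1) * (neg_log 1 n / half_int n) + (\<Sum>r=2..R. of_int (d r) * (neg_log r n / half_int n))) * half_int n) at_top sequentially"
      by (rule filterlim_at_top_mult_at_top[OF _ half_int_at_top])
  next
    case False
    then have d0: "d 1 = 0" "K > 0" using d by auto
    have "filterlim (\<lambda>n. (\<Sum>r=2..R. of_int (d r) * (neg_log r n / half_int n)) * half_int n) at_top sequentially"
      by (rule filterlim_tendsto_pos_mult_at_top[OF lim d0(2) half_int_at_top])
    then show "filterlim (\<lambda>n. (of_int (d 1) * (neg_log 1 n / half_int n) + (\<Sum>r=2..R. of_int (d r) * (neg_log r n / half_int n))) * half_int n) at_top sequentially"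
      using d0(1) by simp
  qed
qed

text \<open>For d the difference of two exponent vectors, this says that the quotient of the two
  monomials tends to 0 or to infinity in modulus. The index 1 decides if it occurs; next the sum
  \<open>K\<close> of growth constants; and if both vanish, only the tie between 2 and 6 is
  left.\<close>

lemma neg_log_combination:
  fixes d :: "nat \<Rightarrow> int"
  assumes R: "R \<ge> 6" and s: "s \<in> {1..R}" "d s \<noteq> 0"
  shows "filterlim (\<lambda>n. \<Sum>r=1..R. of_int (d r) * neg_log r n) at_top sequentially
    \<or> filterlim (\<lambda>n. \<Sum>r=1..R. of_int (- d r) * neg_log r n) at_top sequentially"
proof -
  define K where "K = (\<Sum>r=2..R. of_int (d r) * neg_growth r)"
  have mK: "(\<Sum>r=2..R. of_int (- d r) * neg_growth r) = - K" by (simp add: K_def sum_negf)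
  consider "d 1 > 0 \<or> d 1 = 0 \<and> K > 0" | "- d 1 > 0 \<or> - d 1 = 0 \<and> - K > 0" | "d 1 = 0" "K = 0" by linarith
  then show ?thesis
  proof cases
    case 1
    then show ?thesis using neg_log_combination_pos[of R d] R by (simp add: K_def)
  next
    case 2
    then show ?thesis using neg_log_combination_pos[of R "\<lambda>r. - d r"] R mK by simp
  next
    case 3
    \<comment> \<open>A multiple of 2 * r for all indices in question, so that every growth constant
      is a combination of L-th roots of unity.\<close>
    define L where "L = 2 * (fact R :: nat)"
    have L: "L > 0" "\<And>r. r \<in> {2..R} \<Longrightarrow> 2 * r dvd L"
      unfolding L_def by (auto intro!: mult_dvd_mono dvd_fact)
    have "complex_of_real K = (\<Sum>r=2..R. of_int (d r) * of_real (neg_growth r))" by (simp add: K_def)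
    also have "\<dots> = (\<Sum>r=2..R. of_real (pi / L) * \<i> * (\<Sum>s<L. of_int (d r * wedge L r (int s)) * unity L (int s)))"
    proof (intro sum.cong refl)
      fix r assume "r \<in> {2..R}"
      then show "of_int (d r) * complex_of_real (neg_growth r) = of_real (pi / L) * \<i> * (\<Sum>s<L. of_int (d r * wedge L r (int s)) * unity L (int s))"
        by (subst neg_growth_wedge[OF _ L(1) L(2)]) (auto simp: sum_distrib_left mult_ac)
    qed
    also have "\<dots> = of_real (pi / L) * \<i> * (\<Sum>s<L. of_int (\<Sum>r=2..R. d r * wedge L r (int s)) * unity L (int s))"
      unfolding sum_distrib_left[symmetric] by (subst sum.swap) (simp add: sum_distrib_right)
    finally have "(\<Sum>s<L. of_int (\<Sum>r=2..R. d r * wedge L r (int s)) * unity L (int s)) = 0"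
      using 3 L(1) by simp
    then have z: "d r = 0" if "r \<in> {2..R}" "r \<noteq> 2" "r \<noteq> 6" for r
      using wedge_independent[OF L _ that] by blast
    then have z1: "d r = 0" if "r \<in> {1..R} - {2, 6}" for r
      using that 3(1) by (cases "r = 1") auto
    have "K = (\<Sum>r\<in>{2, 6}. of_int (d r) * neg_growth r)"
      unfolding K_def by (rule sum.mono_neutral_right) (use R z in auto)
    also have "\<dots> = pi * (of_int (d 2) + 2 * of_int (d 6))"
      by (simp add: neg_growth_2 neg_growth_6 algebra_simps)
    finally have "real_of_int (d 2 + 2 * d 6) = 0" using 3(2) by simp
    then have d2: "d 2 = - 2 * d 6" by linarith
    have d6: "d 6 \<noteq> 0" using s z1[of s] d2 by (cases "s = 6"; cases "s = 2") auto
    have G: "(\<Sum>r=1..R. of_int (d r) * neg_log r n) = - of_int (d 6) * (2 * neg_log 2 n - neg_log 6 n)" for n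
    proof -
      have "(\<Sum>r=1..R. of_int (d r) * neg_log r n) = (\<Sum>r\<in>{2, 6}. of_int (d r) * neg_log r n)"
        by (rule sum.mono_neutral_right) (use R z1 in auto)
      then show ?thesis using d2 by (simp add: algebra_simps)
    qed
    have G': "(\<Sum>r=1..R. of_int (- d r) * neg_log r n) = of_int (d 6) * (2 * neg_log 2 n - neg_log 6 n)" for n
      using G[of n] by (simp add: sum_negf)
    show ?thesis
    proof (cases "d 6 > 0")
      case True
      then show ?thesis unfolding G'
        using filterlim_tendsto_pos_mult_at_top[OF tendsto_const _ neg_log_2_6, of "of_int (d 6)"] by simp
    next
      case False
      then show ?thesis unfolding G using d6
          filterlim_tendsto_pos_mult_at_top[OF tendsto_const _ neg_log_2_6, of "- of_int (d 6)"] by simp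
    qed
  qed
qed

lemma dominant_sequence:
  fixes a :: "'k \<Rightarrow> nat \<Rightarrow> complex"
  assumes "finite F" "F \<noteq> {}" and nz: "\<And>k n. k \<in> F \<Longrightarrow> a k n \<noteq> 0"
    and cmp: "\<And>k l. k \<in> F \<Longrightarrow> l \<in> F \<Longrightarrow> k \<noteq> l \<Longrightarrow>
      (\<lambda>n. a k n / a l n) \<longlonglongrightarrow> 0 \<or> (\<lambda>n. a l n / a k n) \<longlonglongrightarrow> 0"
  shows "\<exists>m\<in>F. \<forall>k\<in>F - {m}. (\<lambda>n. a k n / a m n) \<longlonglongrightarrow> 0"
  using assms
proof (induction F rule: finite_ne_induct)
  case (insert x F)
  then obtain m where m: "m \<in> F" "\<And>k. k \<in> F - {m} \<Longrightarrow> (\<lambda>n. a k n / a m n) \<longlonglongrightarrow> 0" by blast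
  have "x \<noteq> m" using m insert by blast
  then consider "(\<lambda>n. a x n / a m n) \<longlonglongrightarrow> 0" | "(\<lambda>n. a m n / a x n) \<longlonglongrightarrow> 0"
    using insert.prems(2)[of x m] m by blast
  then show ?case
  proof cases
    case 1
    then show ?thesis using m by (intro bexI[of _ m]) auto
  next
    case 2
    have "(\<lambda>n. a k n / a x n) \<longlonglongrightarrow> 0" if "k \<in> F" for k
    proof (cases "k = m")
      case False
      have "(\<lambda>n. a k n / a m n * (a m n / a x n)) \<longlonglongrightarrow> 0 * 0"
        using m(2)[of k] that False 2 by (intro tendsto_mult) auto
      then show ?thesis using insert.prems(1)[of m] m(1) by simp
    qed (use 2 in simp)
    then show ?thesis by (intro bexI[of _ x]) auto
  qed
qed auto

lemma dominant_independent:
  fixes a :: "'k \<Rightarrow> nat \<Rightarrow> complex"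
  assumes fin: "finite F" and nz: "\<And>k n. k \<in> F \<Longrightarrow> a k n \<noteq> 0"
    and cmp: "\<And>k l. k \<in> F \<Longrightarrow> l \<in> F \<Longrightarrow> k \<noteq> l \<Longrightarrow>
      (\<lambda>n. a k n / a l n) \<longlonglongrightarrow> 0 \<or> (\<lambda>n. a l n / a k n) \<longlonglongrightarrow> 0"
    and zero: "\<And>n. (\<Sum>k\<in>F. c k * a k n) = 0"
    and k: "k \<in> F"
  shows "c k = 0"
proof (rule ccontr)
  assume ck: "c k \<noteq> 0"
  define G where "G = {k\<in>F. c k \<noteq> 0}"
  have G: "finite G" "G \<noteq> {}" using fin k ck by (auto simp: G_def)
  obtain m where m: "m \<in> G" "\<And>k. k \<in> G - {m} \<Longrightarrow> (\<lambda>n. a k n / a m n) \<longlonglongrightarrow> 0"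
    using dominant_sequence[OF G, of a] nz cmp unfolding G_def by blast
  have am: "a m n \<noteq> 0" for n using m(1) nz by (auto simp: G_def)
  have "(\<Sum>k\<in>G. c k * (a k n / a m n)) = 0" for n
  proof -
    have "(\<Sum>k\<in>G. c k * a k n) = (\<Sum>k\<in>F. c k * a k n)"
      by (rule sum.mono_neutral_left) (use fin in \<open>auto simp: G_def\<close>)
    then show ?thesis using zero[of n] by (simp add: sum_divide_distrib[symmetric])
  qed
  then have "c m = - (\<Sum>k\<in>G - {m}. c k * (a k n / a m n))" for n
    using sum.remove[OF G(1) m(1), of "\<lambda>k. c k * (a k n / a m n)"] am[of n] by (simp add: eq_neg_iff_add_eq_0)
  moreover have "(\<lambda>n. - (\<Sum>k\<in>G - {m}. c k * (a k n / a m n))) \<longlonglongrightarrow> - (\<Sum>k\<in>G - {m}. c k * 0)"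
    by (intro tendsto_intros m(2))
  ultimately have "(\<lambda>n. c m) \<longlonglongrightarrow> 0" by simp
  then have "c m = 0" by (simp add: LIMSEQ_const_iff)
  then show False using m(1) by (simp add: G_def)
qed

theorem exp_ell_independent:
  fixes F :: "(nat \<Rightarrow> nat) set" and c :: "(nat \<Rightarrow> nat) \<Rightarrow> complex"
  assumes fin: "finite F" and supp: "\<And>k. k \<in> F \<Longrightarrow> finite {r. k r \<noteq> 0} \<and> k 0 = 0"
    and zero: "\<And>z. norm z < 1 \<Longrightarrow> (\<Sum>k\<in>F. c k * (\<Prod>r | k r \<noteq> 0. exp (ell r z) ^ k r)) = 0"
    and k: "k \<in> F"
  shows "c k = 0"
proof -
  define R where "R = Max (insert 6 (\<Union>k\<in>F. {r. k r \<noteq> 0}))"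
  have finR: "finite (insert 6 (\<Union>k\<in>F. {r. k r \<noteq> 0}))" using fin supp by auto
  have R6: "R \<ge> 6" unfolding R_def using finR by (intro Max_ge) auto
  have R: "r \<in> {1..R}" if "k \<in> F" "k r \<noteq> 0" for k r
  proof -
    have "r \<le> R" unfolding R_def using finR that by (intro Max_ge) auto
    moreover have "r \<noteq> 0" using supp[OF that(1)] that(2) by (metis)
    ultimately show ?thesis by simp
  qed
  have prodR: "(\<Prod>r | k r \<noteq> 0. f r ^ k r) = (\<Prod>r=1..R. f r ^ k r)" if "k \<in> F" for k and f :: "nat \<Rightarrow> complex"
    by (rule prod.mono_neutral_left) (use R that in auto)
  define g where "g k z = (\<Prod>r=1..R. eulerian r z ^ k r)" for k :: "nat \<Rightarrow> nat" and z
  have gz: "(\<Prod>r | k r \<noteq> 0. exp (ell r z) ^ k r) = g k z" if "k \<in> F" "norm z < 1" for k z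
    unfolding prodR[OF that(1)] g_def
    by (intro prod.cong refl arg_cong2[of _ _ _ _ "(^)"] eulerian_eq_exp_ell[symmetric]) (use that in auto)
  define H where "H z = (\<Sum>k\<in>F. c k * g k z)" for z
  \<comment> \<open>All monomials are entire, so the relation passes from the unit disc to the whole
    plane, where the growth at the points \<open>- of_real (half_int n)\<close> can be used.\<close>
  have "H z = 0" for z
  proof (rule analytic_continuation[of H UNIV "ball 0 1" 0])
    show "H holomorphic_on UNIV"
      unfolding H_def[abs_def] g_def[abs_def]
      by (intro holomorphic_intros eulerian_holomorphic)
    show "(0::complex) islimpt ball 0 1" by (intro interior_limit_point) auto
    show "H z = 0" if "z \<in> ball 0 1" for z
      using zero[of z] that gz[of _ z] by (simp add: H_def)
  qed auto
  then have van: "(\<Sum>k\<in>F. c k * g k (- of_real (half_int n))) = 0" for n by (simp add: H_def)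
  have gnz: "g k (- of_real (half_int n)) \<noteq> 0" for k n
    unfolding g_def using eulerian_half_int_nonzero(1) by auto
  have nrm: "norm (g k (- of_real (half_int n)) / g l (- of_real (half_int n)))
      = exp (\<Sum>r=1..R. of_int (int (k r) - int (l r)) * neg_log r n)" for k l n
  proof -
    have e: "norm (g k (- of_real (half_int n))) = exp (\<Sum>r=1..R. of_nat (k r) * neg_log r n)" for k
      using eulerian_half_int_nonzero(1)
      by (simp add: g_def prod_norm[symmetric] norm_power neg_log_def exp_sum exp_of_nat_mult)
    show ?thesis by (simp add: norm_divide e exp_diff[symmetric] left_diff_distrib sum_subtractf)
  qed
  have key: "(\<lambda>n. g k (- of_real (half_int n)) / g l (- of_real (half_int n))) \<longlonglongrightarrow> 0"
    if "filterlim (\<lambda>n. \<Sum>r=1..R. of_int (- (int (k r) - int (l r))) * neg_log r n) at_top sequentially" for k l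
  proof -
    have "filterlim (\<lambda>n. \<Sum>r=1..R. of_int (int (k r) - int (l r)) * neg_log r n) at_bot sequentially"
      using that by (simp add: filterlim_uminus_at_top sum_negf[symmetric] left_diff_distrib)
    then have "(\<lambda>n. exp (\<Sum>r=1..R. of_int (int (k r) - int (l r)) * neg_log r n)) \<longlonglongrightarrow> 0"
      by (rule filterlim_compose[OF exp_at_bot])
    then show ?thesis unfolding nrm[symmetric] by (rule tendsto_norm_zero_cancel)
  qed
  show ?thesis
  proof (rule dominant_independent[OF fin _ _ van k])
    fix k l assume kl: "k \<in> F" "l \<in> F" "k \<noteq> l"
    then obtain r where r: "k r \<noteq> l r" by blast
    then have "r \<in> {1..R}" using R kl by (cases "k r = 0") force+
    then have "filterlim (\<lambda>n. \<Sum>r=1..R. of_int (int (k r) - int (l r)) * neg_log r n) at_top sequentially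
      \<or> filterlim (\<lambda>n. \<Sum>r=1..R. of_int (- (int (k r) - int (l r))) * neg_log r n) at_top sequentially"
      using r by (intro neg_log_combination[OF R6]) auto
    then show "(\<lambda>n. g k (- of_real (half_int n)) / g l (- of_real (half_int n))) \<longlonglongrightarrow> 0 \<or>
        (\<lambda>n. g l (- of_real (half_int n)) / g k (- of_real (half_int n))) \<longlonglongrightarrow> 0"
      using key[of l k] key[of k l] by (auto simp: algebra_simps)
  qed (use gnz in auto)
qed

subsection \<open>The shuffle product and its character\<close>

lemma shuffle_words_Nil_right: "shuffle_words u [] = word_series u"
  by (cases u) simp_all

lemma shuffle_words_at_Nil: "shuffle_words u v [] = (if u = [] \<and> v = [] then 1 else 0)"
  by (cases "(u, v)" rule: shuffle_words.cases) (auto simp: word_series_def add_series_def lcons_def)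

lemma shuffle_words_at_Cons:
  "shuffle_words u v (c # w) =
    (case u of [] \<Rightarrow> 0 | a # u' \<Rightarrow> if a = c then shuffle_words u' v w else 0) +
    (case v of [] \<Rightarrow> 0 | b # v' \<Rightarrow> if b = c then shuffle_words u v' w else 0)"
  by (cases u; cases v) (auto simp: word_series_def add_series_def lcons_def shuffle_words_Nil_right)

lemma shuffle_sum_superset:
  assumes "finite U" "{(u, v). shuffle_words u v w \<noteq> 0} \<subseteq> U"
  shows "shuffle S T w = (\<Sum>(u, v)\<in>U. S u * T v * shuffle_words u v w)"
  unfolding shuffle_def by (rule sum.mono_neutral_left) (use assms in auto)

lemma shuffle_Nil [simp]: "shuffle S T [] = S [] * T []"
proof -
  have "{(u, v). shuffle_words u v [] \<noteq> (0::complex)} = {([] :: 'a list, [] :: 'a list)}"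
    by (auto simp: shuffle_words_at_Nil)
  then show ?thesis by (simp add: shuffle_def shuffle_words_at_Nil)
qed

text \<open>Removing the first letter is a derivation of the shuffle product. Together with the
  value at the empty word this determines the product, so identities between series follow by
  induction on the word.\<close>

lemma shuffle_Cons:
  "shuffle S T (c # w) = shuffle (\<lambda>x. S (c # x)) T w + shuffle S (\<lambda>x. T (c # x)) w"
proof -
  define A where "A = {(u, v). shuffle_words u v w \<noteq> 0}"
  define U1 where "U1 = (\<lambda>(u, v). (c # u, v)) ` A"
  define U2 where "U2 = (\<lambda>(u, v). (u, c # v)) ` A"
  define X where "X u v = (case u of [] \<Rightarrow> 0 | a # u' \<Rightarrow> if a = c then shuffle_words u' v w else 0)" for u v
  define Y where "Y u v = (case v of [] \<Rightarrow> 0 | b # v' \<Rightarrow> if b = c then shuffle_words u v' w else 0)" for u v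
  have fin: "finite A" "finite U1" "finite U2" unfolding A_def U1_def U2_def using finite_shuffle_words by auto
  have X: "(u, v) \<in> U1" if "X u v \<noteq> 0" for u v
    using that by (auto simp: X_def U1_def A_def image_iff split: list.splits if_splits)
  have Y: "(u, v) \<in> U2" if "Y u v \<noteq> 0" for u v
    using that by (auto simp: Y_def U2_def A_def image_iff split: list.splits if_splits)
  have split: "shuffle_words u v (c # w) = X u v + Y u v" for u v
    by (simp add: shuffle_words_at_Cons X_def Y_def)
  have "shuffle S T (c # w) = (\<Sum>(u, v)\<in>U1 \<union> U2. S u * T v * shuffle_words u v (c # w))"
    by (rule shuffle_sum_superset) (use fin X Y split in \<open>auto, force\<close>)
  also have "\<dots> = (\<Sum>(u, v)\<in>U1 \<union> U2. S u * T v * X u v) + (\<Sum>(u, v)\<in>U1 \<union> U2. S u * T v * Y u v)"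
    by (simp add: split distrib_left sum.distrib case_prod_unfold)
  also have "(\<Sum>(u, v)\<in>U1 \<union> U2. S u * T v * X u v) = (\<Sum>(u, v)\<in>U1. S u * T v * X u v)"
    by (rule sum.mono_neutral_right) (use fin X in auto)
  also have "\<dots> = shuffle (\<lambda>x. S (c # x)) T w"
    unfolding U1_def shuffle_def A_def[symmetric]
    by (subst sum.reindex) (auto simp: inj_on_def X_def case_prod_unfold intro!: sum.cong)
  also have "(\<Sum>(u, v)\<in>U1 \<union> U2. S u * T v * Y u v) = (\<Sum>(u, v)\<in>U2. S u * T v * Y u v)"
    by (rule sum.mono_neutral_right) (use fin Y in auto)
  also have "\<dots> = shuffle S (\<lambda>x. T (c # x)) w"
    unfolding U2_def shuffle_def A_def[symmetric]
    by (subst sum.reindex) (auto simp: inj_on_def Y_def case_prod_unfold intro!: sum.cong)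
  finally show ?thesis .
qed

lemma shuffle_scale_left: "shuffle (\<lambda>x. c * S x) T w = c * shuffle S T w"
  by (simp add: shuffle_def sum_distrib_left case_prod_unfold mult.assoc)

lemma shuffle_scale_right: "shuffle S (\<lambda>x. c * T x) w = c * shuffle S T w"
  by (simp add: shuffle_def sum_distrib_left case_prod_unfold mult.assoc mult.left_commute)

lemma shuffle_zero_left [simp]: "shuffle (\<lambda>x. 0) T w = 0"
  by (simp add: shuffle_def case_prod_unfold)

lemma shuffle_zero_right [simp]: "shuffle S (\<lambda>x. 0) w = 0"
  by (simp add: shuffle_def case_prod_unfold)

lemma word_series_Cons: "(\<lambda>x. word_series (a # u) (c # x)) = (if a = c then word_series u else (\<lambda>x. 0))"
  by (auto simp: word_series_def)

lemma word_series_Nil_Cons [simp]: "(\<lambda>x. word_series [] (c # x)) = (\<lambda>x. 0)"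
  by (auto simp: word_series_def)

lemma shuffle_one_left: "shuffle (word_series []) T w = T w"
proof (induction w arbitrary: T)
  case (Cons c w)
  then show ?case by (simp add: shuffle_Cons)
qed (simp add: word_series_def)

lemma conc_Nil [simp]: "conc S T [] = S [] * T []"
  by (simp add: conc_def)

lemma conc_Cons: "conc S T (a # w) = S [] * T (a # w) + conc (\<lambda>x. S (a # x)) T w"
  by (simp add: conc_def sum.atMost_Suc_shift del: sum.atMost_Suc)

lemma conc_zero_left [simp]: "conc (\<lambda>x. 0) T w = 0"
  by (simp add: conc_def)

lemma conc_scale_left: "conc (\<lambda>x. c * S x) T w = c * conc S T w"
  by (simp add: conc_def sum_distrib_left mult.assoc)

lemma conc_one_left: "conc (word_series []) T w = T w"
  by (cases w) (simp_all add: conc_Cons, simp_all add: word_series_def)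

lemma conc_letter: "conc (scale_series t (word_series [c])) T w =
    (case w of [] \<Rightarrow> 0 | a # w' \<Rightarrow> if a = c then t * T w' else 0)"
proof (cases w)
  case (Cons a w')
  have "(\<lambda>x. scale_series t (word_series [c]) (a # x)) = (if a = c then (\<lambda>x. t * word_series [] x) else (\<lambda>x. 0))"
    by (auto simp: scale_series_def word_series_def)
  then show ?thesis using Cons
    by (simp add: conc_Cons conc_scale_left conc_one_left) (simp add: scale_series_def word_series_def)
qed (simp add: scale_series_def word_series_def)

lemma conc_power_letter:
  "conc_power (scale_series t (word_series [c])) n w = (if w = replicate n c then t ^ n else 0)"
proof (induction n arbitrary: w)
  case 0
  then show ?case by (simp add: word_series_def)
next
  case (Suc n)
  then show ?case by (auto simp: conc_letter split: list.splits)
qed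

text \<open>The Kleene star of the linear form with coefficients k, which as a function of words
  turns concatenation into multiplication. Shuffling two of these adds the coefficients.\<close>

definition mult_series :: "('a \<Rightarrow> complex) \<Rightarrow> 'a series" where
  "mult_series k w = prod_list (map k w)"

lemma mult_series_simps [simp]: "mult_series k [] = 1" "mult_series k (a # w) = k a * mult_series k w"
  by (simp_all add: mult_series_def)

lemma mult_series_append: "mult_series k (u @ v) = mult_series k u * mult_series k v"
  by (simp add: mult_series_def)

lemma exchangeable_mult_series: "exchangeable (mult_series k)"
  unfolding exchangeable_def mult_series_def by (metis mset_map prod_mset_prod_list)

lemma mult_series_single: "mult_series (\<lambda>a. if a = c then t else 0) w =
    (if w = replicate (length w) c then t ^ length w else 0)"
  by (induction w) auto

lemma star_letter: "star (scale_series t (word_series [c])) = mult_series (\<lambda>a. if a = c then t else 0)"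
proof
  fix w
  have eq: "conc_power (scale_series t (word_series [c])) n w =
      (if n = length w then mult_series (\<lambda>a. if a = c then t else 0) w else 0)" for n
    by (auto simp: conc_power_letter mult_series_single)
  show "star (scale_series t (word_series [c])) w = mult_series (\<lambda>a. if a = c then t else 0) w"
    unfolding star_def eq by (subst suminf_finite[of "{length w}"]) auto
qed

lemma shuffle_mult_series: "shuffle (mult_series k) (mult_series l) = mult_series (\<lambda>a. k a + l a)"
proof
  fix w show "shuffle (mult_series k) (mult_series l) w = mult_series (\<lambda>a. k a + l a) w"
    by (induction w) (simp_all add: shuffle_Cons shuffle_scale_left shuffle_scale_right distrib_right)
qed

lemma hom_part_shuffle:
  "hom_part n (shuffle S T) = (\<lambda>w. \<Sum>i\<le>n. shuffle (hom_part i S) (hom_part (n - i) T) w)"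
proof
  fix w
  have "(\<Sum>i\<le>n. shuffle (hom_part i S) (hom_part (n - i) T) w)
      = (\<Sum>(u, v) | shuffle_words u v w \<noteq> 0. \<Sum>i\<le>n. hom_part i S u * hom_part (n - i) T v * shuffle_words u v w)"
    unfolding shuffle_def case_prod_unfold by (rule sum.swap)
  also have "\<dots> = (\<Sum>(u, v) | shuffle_words u v w \<noteq> 0. if length w = n then S u * T v * shuffle_words u v w else 0)"
  proof (rule sum.cong[OF refl], clarify)
    fix u v assume nz: "shuffle_words u v w \<noteq> 0"
    then have len: "length u + length v = length w" using shuffle_words_support by blast
    have "(\<Sum>i\<le>n. hom_part i S u * hom_part (n - i) T v * shuffle_words u v w)
        = (\<Sum>i\<le>n. if i = length u then (if length v = n - length u then S u * T v * shuffle_words u v w else 0) else 0)"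
      by (intro sum.cong) (auto simp: hom_part_def)
    also have "\<dots> = (if length w = n then S u * T v * shuffle_words u v w else 0)"
      using len by auto
    finally show "(\<Sum>i\<le>n. hom_part i S u * hom_part (n - i) T v * shuffle_words u v w)
        = (if length w = n then S u * T v * shuffle_words u v w else 0)" .
  qed
  also have "\<dots> = hom_part n (shuffle S T) w"
    by (auto simp: hom_part_def shuffle_def case_prod_unfold intro!: sum.neutral)
  finally show "hom_part n (shuffle S T) w = (\<Sum>i\<le>n. shuffle (hom_part i S) (hom_part (n - i) T) w)" ..
qed

lemma polynomials_zero: "(\<lambda>w. 0) \<in> polynomials"
  by (simp add: polynomials_def)

lemma polynomials_add: "P \<in> polynomials \<Longrightarrow> Q \<in> polynomials \<Longrightarrow> (\<lambda>w. P w + Q w) \<in> polynomials"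
  unfolding polynomials_def by (auto intro: finite_subset[of _ "{w. P w \<noteq> 0} \<union> {w. Q w \<noteq> 0}"])

lemma polynomials_sum: "(\<And>i. i \<in> I \<Longrightarrow> f i \<in> polynomials) \<Longrightarrow> (\<lambda>w. \<Sum>i\<in>I. f i w) \<in> polynomials"
  by (induction I rule: infinite_finite_induct) (auto intro: polynomials_zero polynomials_add)

lemma polynomials_scale: "P \<in> polynomials \<Longrightarrow> (\<lambda>w. c * P w) \<in> polynomials"
  unfolding polynomials_def by (auto intro: finite_subset[of _ "{w. P w \<noteq> 0}"])

lemma polynomials_word [simp]: "word_series u \<in> polynomials"
  by (auto simp: polynomials_def word_series_def intro: finite_subset[of _ "{u}"])

lemma poly_expansion: "P \<in> polynomials \<Longrightarrow> P = (\<lambda>w. \<Sum>u | P u \<noteq> 0. P u * word_series u w)"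
  by (auto simp: word_series_def polynomials_def fun_eq_iff if_distrib sum.If_cases cong: if_cong)

context
  fixes m :: "'a series \<Rightarrow> 'a series \<Rightarrow> 'a series" and phi
  assumes ch: "character_on polynomials m phi"
begin

lemma character_one: "phi (word_series []) = 1"
  using ch by (simp add: character_on_def)

lemma character_scale: "P \<in> polynomials \<Longrightarrow> phi (\<lambda>w. c * P w) = c * phi P"
  using ch unfolding character_on_def scale_series_def by blast

lemma character_add: "P \<in> polynomials \<Longrightarrow> Q \<in> polynomials \<Longrightarrow> phi (\<lambda>w. P w + Q w) = phi P + phi Q"
  using ch unfolding character_on_def add_series_def by blast

lemma character_mult: "P \<in> polynomials \<Longrightarrow> Q \<in> polynomials \<Longrightarrow> phi (m P Q) = phi P * phi Q"
  using ch unfolding character_on_def by blast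

lemma character_zero: "phi (\<lambda>w. 0) = 0"
  using character_scale[OF polynomials_zero, of 0] by simp

lemma character_sum:
  "(\<And>i. i \<in> I \<Longrightarrow> f i \<in> polynomials) \<Longrightarrow> phi (\<lambda>w. \<Sum>i\<in>I. f i w) = (\<Sum>i\<in>I. phi (f i))"
  by (induction I rule: infinite_finite_induct) (auto simp: character_zero character_add polynomials_sum)

lemma character_expansion: "P \<in> polynomials \<Longrightarrow> phi P = (\<Sum>u | P u \<noteq> 0. P u * phi (word_series u))"
  by (subst poly_expansion, assumption, subst character_sum)
     (auto intro: polynomials_scale simp: character_scale)

end

section \<open>The zeta character on exchangeable series\<close>

lemma finite_xwords: "finite {w :: xletter list. length w = n}"
proof -
  have "UNIV = {X0, X1}" using xletter.exhaust by auto
  then have "finite (UNIV :: xletter set)" by (metis finite.emptyI finite.insertI)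
  then show ?thesis using finite_lists_length_eq[of UNIV n] by simp
qed

lemma hom_part_xpoly [simp]: "hom_part n (S :: xletter series) \<in> polynomials"
  unfolding polynomials_def hom_part_def by (auto intro: finite_subset[OF _ finite_xwords[of n]])

lemma shuffle_letter_powers:
  "shuffle (word_series (replicate i X0)) (word_series (replicate j X1)) w =
    (if count (mset w) X0 = i \<and> count (mset w) X1 = j then 1 else 0)"
proof (induction w arbitrary: i j)
  case Nil
  then show ?case by (auto simp: word_series_def)
next
  case (Cons c w)
  show ?case
  proof (cases c)
    case X0
    have "(\<lambda>x. word_series (replicate j X1) (X0 # x)) = (\<lambda>x. 0)"
      by (cases j) (simp_all add: word_series_Cons)
    then show ?thesis using Cons.IH X0 by (cases i) (simp_all add: shuffle_Cons word_series_Cons)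
  next
    case X1
    have "(\<lambda>x. word_series (replicate i X0) (X1 # x)) = (\<lambda>x. 0)"
      by (cases i) (simp_all add: word_series_Cons)
    then show ?thesis using Cons.IH X1 by (cases j) (simp_all add: shuffle_Cons word_series_Cons)
  qed
qed

lemma shuffle_letter_power:
  "shuffle (word_series [x]) (word_series (replicate i x)) w = of_nat (Suc i) * word_series (replicate (Suc i) x) w"
proof (induction i arbitrary: w)
  case 0
  show ?case
    by (cases w) (auto simp: shuffle_Cons word_series_Cons shuffle_one_left, auto simp: word_series_def)
next
  case (Suc i)
  show ?case
  proof (cases w)
    case Nil
    then show ?thesis by (simp add: word_series_def)
  next
    case (Cons c w')
    have "word_series (x # x # replicate i x) (c # w') = (if x = c then word_series (x # replicate i x) w' else 0)"
      by (auto simp: word_series_def)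
    then show ?thesis using Suc.IH[of w'] Cons
      by (auto simp: shuffle_Cons word_series_Cons shuffle_one_left algebra_simps)
  qed
qed

lemma exchangeable_xpart:
  assumes "exchangeable (G :: xletter series)"
  shows "hom_part n G = (\<lambda>w. \<Sum>i\<le>n. G (replicate i X0 @ replicate (n - i) X1) *
    shuffle (word_series (replicate i X0)) (word_series (replicate (n - i) X1)) w)"
proof
  fix w :: "xletter list"
  have len: "length w = count (mset w) X0 + count (mset w) X1"
  proof (induction w)
    case (Cons a w) then show ?case by (cases a) auto
  qed simp
  have ms: "mset w = mset (replicate (count (mset w) X0) X0 @ replicate (count (mset w) X1) X1)"
    by (rule multiset_eqI) (case_tac x, auto)
  have "(\<Sum>i\<le>n. G (replicate i X0 @ replicate (n - i) X1) *
      shuffle (word_series (replicate i X0)) (word_series (replicate (n - i) X1)) w)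
     = (\<Sum>i\<le>n. if i = count (mset w) X0 then (if length w = n then G w else 0) else 0)"
  proof (rule sum.cong[OF refl])
    fix i assume "i \<in> {..n}"
    moreover have "G (replicate (count (mset w) X0) X0 @ replicate (count (mset w) X1) X1) = G w"
      using assms ms unfolding exchangeable_def by metis
    ultimately show "G (replicate i X0 @ replicate (n - i) X1) *
      shuffle (word_series (replicate i X0)) (word_series (replicate (n - i) X1)) w
      = (if i = count (mset w) X0 then (if length w = n then G w else 0) else 0)"
      using len by (auto simp: shuffle_letter_powers)
  qed
  also have "\<dots> = hom_part n G w" using len by (auto simp: hom_part_def)
  finally show "hom_part n G w = (\<Sum>i\<le>n. G (replicate i X0 @ replicate (n - i) X1) *
    shuffle (word_series (replicate i X0)) (word_series (replicate (n - i) X1)) w)" ..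
qed

lemma polynomials_shuffle_words: "shuffle (word_series u) (word_series v) = shuffle_words u v"
proof
  fix w
  have "shuffle (word_series u) (word_series v) w
      = (\<Sum>p\<in>{(u, v). shuffle_words u v w \<noteq> 0}. if p = (u, v) then shuffle_words u v w else 0)"
    unfolding shuffle_def by (intro sum.cong refl) (auto simp: word_series_def split: if_splits)
  also have "\<dots> = shuffle_words u v w"
    by (subst sum.delta[OF finite_shuffle_words]) auto
  finally show "shuffle (word_series u) (word_series v) w = shuffle_words u v w" .
qed

context
  fixes \<zeta>
  assumes z: "is_zeta_shuffle \<zeta>"
begin

lemma ch: "character_on polynomials shuffle \<zeta>"
  using z by (simp add: is_zeta_shuffle_def)

lemma zeta_letter_power: "i > 0 \<Longrightarrow> \<zeta> (word_series (replicate i x)) = 0"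
proof -
  assume "i > 0"
  then obtain k where k: "i = Suc k" by (cases i) auto
  have "(\<lambda>w. of_nat (Suc k) * word_series (replicate (Suc k) x) w) = shuffle (word_series [x]) (word_series (replicate k x))"
    by (simp add: fun_eq_iff shuffle_letter_power)
  then have "of_nat (Suc k) * \<zeta> (word_series (replicate (Suc k) x)) = \<zeta> (word_series [x]) * \<zeta> (word_series (replicate k x))"
    using character_scale[OF ch, of "word_series (replicate (Suc k) x)" "of_nat (Suc k)"] character_mult[OF ch] by (simp del: of_nat_Suc replicate.simps)
  moreover have "\<zeta> (word_series [x]) = 0" using z by (cases x) (simp_all add: is_zeta_shuffle_def)
  ultimately show ?thesis unfolding k by (metis mult_eq_0_iff mult_zero_left of_nat_eq_0_iff nat.distinct(1))
qed

lemma zeta_exchangeable_part: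
  assumes "exchangeable G"
  shows "\<zeta> (hom_part n G) = (if n = 0 then G [] else 0)"
proof -
  have pol: "(\<lambda>w. G (replicate i X0 @ replicate (n - i) X1) *
    shuffle (word_series (replicate i X0)) (word_series (replicate (n - i) X1)) w) \<in> polynomials" for i
  proof (rule polynomials_scale, unfold polynomials_def, rule CollectI)
    show "finite {w. shuffle (word_series (replicate i X0)) (word_series (replicate (n - i) X1)) w \<noteq> 0}"
      by (rule finite_subset[OF _ finite_xwords[of "i + (n - i)"]])
         (auto simp: polynomials_shuffle_words dest: shuffle_words_support)
  qed
  have pol2: "shuffle (word_series (replicate i X0)) (word_series (replicate (n - i) X1)) \<in> polynomials" for i
    unfolding polynomials_def
    by (rule CollectI, rule finite_subset[OF _ finite_xwords[of "i + (n - i)"]])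
       (auto simp: polynomials_shuffle_words dest: shuffle_words_support)
  have "\<zeta> (hom_part n G) = (\<Sum>i\<le>n. G (replicate i X0 @ replicate (n - i) X1) *
      (\<zeta> (word_series (replicate i X0)) * \<zeta> (word_series (replicate (n - i) X1))))"
    unfolding exchangeable_xpart[OF assms] character_sum[OF ch pol] character_scale[OF ch pol2]
    by (simp add: character_mult[OF ch])
  also have "\<dots> = (\<Sum>i\<le>n. if n = 0 then G [] else 0)"
  proof (rule sum.cong[OF refl])
    fix i assume "i \<in> {..n}"
    show "G (replicate i X0 @ replicate (n - i) X1) *
      (\<zeta> (word_series (replicate i X0)) * \<zeta> (word_series (replicate (n - i) X1))) = (if n = 0 then G [] else 0)"
      using zeta_letter_power[of i X0] zeta_letter_power[of "n - i" X1] \<open>i \<in> _\<close> character_one[OF ch]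
      by (cases "i = 0"; cases "n = 0") auto
  qed
  also have "\<dots> = (if n = 0 then G [] else 0)" by simp
  finally show ?thesis .
qed

lemma zeta_part_shuffle:
  "\<zeta> (hom_part n (shuffle S T)) = (\<Sum>i\<le>n. \<zeta> (hom_part i S) * \<zeta> (hom_part (n - i) T))"
proof -
  have "shuffle (hom_part i S) (hom_part (n - i) T) \<in> polynomials" if "i \<le> n" for i
    unfolding polynomials_def
  proof (rule CollectI, rule finite_subset[OF _ finite_xwords[of n]], clarify)
    fix w assume "shuffle (hom_part i S) (hom_part (n - i) T) w \<noteq> 0"
    then obtain p where p: "p \<in> {(u, v). shuffle_words u v w \<noteq> 0}"
      "(case p of (u, v) \<Rightarrow> hom_part i S u * hom_part (n - i) T v * shuffle_words u v w) \<noteq> 0"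
      unfolding shuffle_def by (meson sum.neutral)
    then obtain u v where "shuffle_words u v w \<noteq> 0" "hom_part i S u \<noteq> 0" "hom_part (n - i) T v \<noteq> 0" by auto
    then show "length w = n" using shuffle_words_support[of u v w] that
      by (auto simp: hom_part_def split: if_splits)
  qed
  then show ?thesis
    unfolding hom_part_shuffle by (subst character_sum[OF ch]) (auto simp: character_mult[OF ch])
qed

definition zeta_ext :: "xletter series \<Rightarrow> complex" where
  "zeta_ext S = (\<Sum>n. \<zeta> (hom_part n S))"

lemma zeta_poly_parts:
  assumes "P \<in> polynomials"
  obtains N where "\<And>n. n \<ge> N \<Longrightarrow> \<zeta> (hom_part n P) = 0" "(\<Sum>n<N. \<zeta> (hom_part n P)) = \<zeta> P"
proof -
  have fin: "finite {w. P w \<noteq> 0}" using assms by (simp add: polynomials_def)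
  define N where "N = Suc (Max (insert 0 (length ` {w. P w \<noteq> 0})))"
  have N: "length w < N" if "P w \<noteq> 0" for w
    unfolding N_def using fin that by (intro le_imp_less_Suc Max_ge) auto
  have "hom_part n P = (\<lambda>w. 0)" if "n \<ge> N" for n
    using N that by (force simp: hom_part_def fun_eq_iff)
  then have 1: "\<zeta> (hom_part n P) = 0" if "n \<ge> N" for n using that character_zero[OF ch] by simp
  have "P = (\<lambda>w. \<Sum>n<N. hom_part n P w)" using N by (force simp: hom_part_def fun_eq_iff)
  then have "\<zeta> P = (\<Sum>n<N. \<zeta> (hom_part n P))" using character_sum[OF ch, of "{..<N}" "\<lambda>n. hom_part n P"] by simp
  then show ?thesis using that 1 by metis
qed

lemma zeta_part_add: "\<zeta> (hom_part n (add_series S T)) = \<zeta> (hom_part n S) + \<zeta> (hom_part n T)"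
proof -
  have "hom_part n (add_series S T) = (\<lambda>w. hom_part n S w + hom_part n T w)"
    by (auto simp: hom_part_def add_series_def)
  then show ?thesis using character_add[OF ch] by simp
qed

lemma zeta_part_scale: "\<zeta> (hom_part n (scale_series c S)) = c * \<zeta> (hom_part n S)"
proof -
  have "hom_part n (scale_series c S) = (\<lambda>w. c * hom_part n S w)"
    by (auto simp: hom_part_def scale_series_def)
  then show ?thesis using character_scale[OF ch] by simp
qed

text \<open>An exchangeable factor G contributes only its constant term, so the value on the degree
  n part of a product with P is that of \<open>hom_part n P\<close> times \<open>G []\<close>, which
  vanishes beyond the degree of P.\<close>

lemma zeta_parts_finite:
  assumes "S \<in> product_span shuffle polynomials rational_exchangeable"
  obtains N where "\<And>n. n \<ge> N \<Longrightarrow> \<zeta> (hom_part n S) = 0"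
proof -
  obtain k :: nat and P G where SPG: "S = (\<lambda>w. \<Sum>i<k. shuffle (P i) (G i) w) \<and>
      (\<forall>i<k. P i \<in> polynomials \<and> G i \<in> rational_exchangeable)"
    using assms[unfolded product_span_def mem_Collect_eq] by (elim exE) (rule that)
  note S = SPG[THEN conjunct1]
  from SPG have PG: "\<And>i. i < k \<Longrightarrow> P i \<in> polynomials" "\<And>i. i < k \<Longrightarrow> exchangeable (G i)"
    by (auto simp: rational_exchangeable_def)
  have "hom_part n S = (\<lambda>w. \<Sum>i<k. hom_part n (shuffle (P i) (G i)) w)" for n
    by (auto simp: S hom_part_def)
  then have eq: "\<zeta> (hom_part n S) = (\<Sum>i<k. \<zeta> (hom_part n (shuffle (P i) (G i))))" for n
    using character_sum[OF ch, of "{..<k}" "\<lambda>i. hom_part n (shuffle (P i) (G i))"] by simp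
  have "\<exists>N. \<forall>n\<ge>N. \<zeta> (hom_part n (P i)) = 0" if "i < k" for i
    using zeta_poly_parts[OF PG(1)[OF that]] by metis
  then obtain M where M: "\<And>i n. i < k \<Longrightarrow> n \<ge> M i \<Longrightarrow> \<zeta> (hom_part n (P i)) = 0" by metis
  have part: "\<zeta> (hom_part n (shuffle (P i) (G i))) = \<zeta> (hom_part n (P i)) * G i []" if "i < k" for i n
  proof -
    have "\<zeta> (hom_part n (shuffle (P i) (G i))) = (\<Sum>j\<le>n. if j = n then \<zeta> (hom_part n (P i)) * G i [] else 0)"
      unfolding zeta_part_shuffle by (intro sum.cong refl) (auto simp: zeta_exchangeable_part[OF PG(2)[OF that]])
    then show ?thesis by simp
  qed
  have "\<zeta> (hom_part n S) = 0" if "n \<ge> Max (insert 0 (M ` {..<k}))" for n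
  proof -
    have "n \<ge> M i" if "i < k" for i
      using that \<open>n \<ge> _\<close> by (meson Max_ge finite_imageI finite_insert finite_lessThan imageI insertI2 lessThan_iff order_trans)
    then show ?thesis unfolding eq using M part by (intro sum.neutral) auto
  qed
  then show ?thesis using that by blast
qed

theorem zeta_extension:
  "character_on (product_span shuffle polynomials rational_exchangeable) shuffle zeta_ext"
  "\<And>P. P \<in> polynomials \<Longrightarrow> zeta_ext P = \<zeta> P"
  "\<And>t x. zeta_ext (star (scale_series t (word_series [x]))) = 1"
  "\<And>t x. (\<lambda>n. \<zeta> (hom_part n (star (scale_series t (word_series [x])))))
    sums zeta_ext (star (scale_series t (word_series [x])))"
proof -
  let ?A = "product_span shuffle polynomials rational_exchangeable"
  have poly: "zeta_ext P = \<zeta> P" if P: "P \<in> polynomials" for P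
  proof -
    obtain N where N: "\<And>n. n \<ge> N \<Longrightarrow> \<zeta> (hom_part n P) = 0" "(\<Sum>n<N. \<zeta> (hom_part n P)) = \<zeta> P"
      using zeta_poly_parts[OF P] by blast
    show ?thesis unfolding zeta_ext_def using N by (subst suminf_finite[of "{..<N}"]) auto
  qed
  then show "\<And>P. P \<in> polynomials \<Longrightarrow> zeta_ext P = \<zeta> P" .
  have summ: "summable (\<lambda>n. \<zeta> (hom_part n S))" "summable (\<lambda>n. norm (\<zeta> (hom_part n S)))" if S: "S \<in> ?A" for S
  proof -
    obtain N where N: "\<And>n. n \<ge> N \<Longrightarrow> \<zeta> (hom_part n S) = 0" using zeta_parts_finite[OF S] by blast
    show "summable (\<lambda>n. \<zeta> (hom_part n S))" "summable (\<lambda>n. norm (\<zeta> (hom_part n S)))"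
      by (rule summable_finite[of "{..<N}"]; use N in auto)+
  qed
  show "character_on ?A shuffle zeta_ext"
    unfolding character_on_def
  proof (intro conjI ballI allI)
    show "zeta_ext (word_series []) = 1" using poly[of "word_series []"] character_one[OF ch] by simp
    fix S T :: "xletter series" assume S: "S \<in> ?A" and T: "T \<in> ?A"
    show "zeta_ext (add_series S T) = zeta_ext S + zeta_ext T"
      unfolding zeta_ext_def zeta_part_add using summ S T by (simp add: suminf_add)
    \<comment> \<open>Both sequences of values have finitely many nonzero terms, and by the grading
      the values on the product form their Cauchy product.\<close>
    show "zeta_ext (shuffle S T) = zeta_ext S * zeta_ext T"
      unfolding zeta_ext_def zeta_part_shuffle
      using Cauchy_product[OF summ(2)[OF S] summ(2)[OF T]] by simp
  next
    fix c and S :: "xletter series" assume "S \<in> ?A"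
    then show "zeta_ext (scale_series c S) = c * zeta_ext S"
      unfolding zeta_ext_def zeta_part_scale using summ by (simp add: suminf_mult)
  qed
  fix t :: complex and x :: xletter
  have ex: "exchangeable (star (scale_series t (word_series [x])))"
    unfolding star_letter by (rule exchangeable_mult_series)
  have "(\<lambda>n. \<zeta> (hom_part n (star (scale_series t (word_series [x]))))) = (\<lambda>n. if n = 0 then 1 else 0)"
    using zeta_exchangeable_part[OF ex] by (auto simp: star_letter)
  then have s: "(\<lambda>n. \<zeta> (hom_part n (star (scale_series t (word_series [x]))))) sums 1"
    using sums_single[of 0 "\<lambda>_. 1 :: complex"] by simp
  then show "zeta_ext (star (scale_series t (word_series [x]))) = 1" by (simp add: zeta_ext_def sums_iff)
  then show "(\<lambda>n. \<zeta> (hom_part n (star (scale_series t (word_series [x])))))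
    sums zeta_ext (star (scale_series t (word_series [x])))" using s by simp
qed

end

subsection \<open>The morphism to Eulerian functions\<close>

text \<open>Dedekind's argument for the independence of characters.\<close>

lemma mult_series_independent:
  fixes e :: "'k \<Rightarrow> 'a \<Rightarrow> complex"
  assumes "finite K" "inj_on e K" and "\<And>w. (\<Sum>k\<in>K. c k * mult_series (e k) w) = 0" and "k \<in> K"
  shows "c k = 0"
  using assms
proof (induction K arbitrary: c k rule: finite_induct)
  case (insert x K)
  have K: "c k = 0" if k: "k \<in> K" for k
  proof -
    have "c k * (e k a - e x a) = 0" for a
    proof (rule insert.IH[of "\<lambda>k. c k * (e k a - e x a)"])
      fix w
      have "(\<Sum>k\<in>insert x K. c k * mult_series (e k) (a # w)) - e x a * (\<Sum>k\<in>insert x K. c k * mult_series (e k) w) = 0"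
        by (simp only: insert.prems(2) mult_zero_right diff_0_right)
      then show "(\<Sum>k\<in>K. c k * (e k a - e x a) * mult_series (e k) w) = 0"
        using insert.hyps by (simp add: sum_distrib_left algebra_simps sum_subtractf)
    qed (use insert.prems k in auto)
    moreover have "e k \<noteq> e x" using insert.prems(1) insert.hyps k by (metis inj_on_insert insert_Diff_single Diff_iff imageI singletonD Diff_insert_absorb)
    then obtain a where "e k a \<noteq> e x a" by blast
    ultimately show ?thesis by (metis mult_eq_0_iff right_minus_eq)
  qed
  then have "c x = 0" using insert.prems(2)[of "[]"] insert.hyps by simp
  then show ?case using K insert.prems(3) by auto
qed simp

section \<open>Formal combinations of monomials\<close>

definition exponents :: "(nat \<Rightarrow> nat) set" where
  "exponents = {k. finite {r. k r \<noteq> 0} \<and> k 0 = 0}"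

text \<open>The shuffle product of k r copies of the star of each letter y r, since shuffling stars
  of linear forms adds their coefficients.\<close>

definition star_monomial :: "(nat \<Rightarrow> nat) \<Rightarrow> yletter series" where
  "star_monomial k = mult_series (\<lambda>a. of_nat (k (index_of a)))"

definition ell_monomial :: "complex \<Rightarrow> (nat \<Rightarrow> nat) \<Rightarrow> complex" where
  "ell_monomial z k = (\<Prod>r | k r \<noteq> 0. exp (ell r z) ^ k r)"

text \<open>Lists are not kept reduced, so that sums and products are simple list operations;
  \<open>coefficient\<close> collects the entries with equal exponents.\<close>

type_synonym combination = "(complex \<times> (nat \<Rightarrow> nat)) list"

definition combine :: "((nat \<Rightarrow> nat) \<Rightarrow> complex) \<Rightarrow> combination \<Rightarrow> complex" where
  "combine f xs = (\<Sum>(c, k)\<leftarrow>xs. c * f k)"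

lemma combine_simps [simp]: "combine f [] = 0" "combine f ((c, k) # xs) = c * f k + combine f xs"
  "combine f (xs @ ys) = combine f xs + combine f ys"
  by (simp_all add: combine_def)

definition coefficient :: "combination \<Rightarrow> (nat \<Rightarrow> nat) \<Rightarrow> complex" where
  "coefficient xs k = combine (\<lambda>l. if l = k then 1 else 0) xs"

lemma combine_coefficient:
  assumes "finite K" "snd ` set xs \<subseteq> K"
  shows "combine f xs = (\<Sum>k\<in>K. coefficient xs k * f k)"
  using assms(2)
proof (induction xs)
  case (Cons x xs)
  obtain c k where x: "x = (c, k)" by force
  have "(\<Sum>l\<in>K. coefficient (x # xs) l * f l) = (\<Sum>l\<in>K. (if l = k then c * f k else 0)) + (\<Sum>l\<in>K. coefficient xs l * f l)"
    unfolding sum.distrib[symmetric] by (intro sum.cong) (auto simp: coefficient_def x distrib_right)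
  then show ?case using Cons assms(1) by (auto simp: x)
qed (simp add: coefficient_def)

definition scale_combination :: "complex \<Rightarrow> combination \<Rightarrow> combination" where
  "scale_combination c = map (\<lambda>(d, k). (c * d, k))"

lemma combine_scale: "combine f (scale_combination c xs) = c * combine f xs"
  by (induction xs) (auto simp: scale_combination_def distrib_left)

definition shift_combination :: "complex \<times> (nat \<Rightarrow> nat) \<Rightarrow> combination \<Rightarrow> combination" where
  "shift_combination x = map (\<lambda>(d, l). (fst x * d, \<lambda>r. snd x r + l r))"

definition mult_combination :: "combination \<Rightarrow> combination \<Rightarrow> combination" where
  "mult_combination xs ys = concat (map (\<lambda>x. shift_combination x ys) xs)"

definition keys_in :: "combination \<Rightarrow> bool" where
  "keys_in xs \<longleftrightarrow> snd ` set xs \<subseteq> exponents"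

lemma exponents_add: "k \<in> exponents \<Longrightarrow> l \<in> exponents \<Longrightarrow> (\<lambda>r. k r + l r) \<in> exponents"
  unfolding exponents_def by (auto intro: finite_subset[of _ "{r. k r \<noteq> 0} \<union> {r. l r \<noteq> 0}"])

lemma keys_in_simps: "keys_in xs \<Longrightarrow> keys_in (scale_combination c xs)"
  "keys_in xs \<Longrightarrow> keys_in ys \<Longrightarrow> keys_in (xs @ ys)"
  by (force simp: keys_in_def scale_combination_def)+

lemma keys_in_mult:
  assumes "keys_in xs" "keys_in ys" shows "keys_in (mult_combination xs ys)"
  using assms unfolding keys_in_def mult_combination_def shift_combination_def
  by (fastforce intro!: exponents_add)

definition series_of :: "combination \<Rightarrow> yletter series" where
  "series_of xs = (\<lambda>w. combine (\<lambda>k. star_monomial k w) xs)"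

lemma exp_index_inj: "inj_on (\<lambda>k a. complex_of_nat (k (index_of a))) exponents"
proof (rule inj_onI)
  fix k l :: "nat \<Rightarrow> nat"
  assume kl: "k \<in> exponents" "l \<in> exponents" and eq: "(\<lambda>a. complex_of_nat (k (index_of a))) = (\<lambda>a. complex_of_nat (l (index_of a)))"
  show "k = l"
  proof
    fix r show "k r = l r"
    proof (cases "r = 0")
      case False
      then show ?thesis using fun_cong[OF eq, of "y r"] by (simp add: y_inverse)
    qed (use kl in \<open>auto simp: exponents_def\<close>)
  qed
qed

lemma series_of_eq_0_iff:
  assumes "keys_in xs"
  shows "(\<forall>w. series_of xs w = 0) \<longleftrightarrow> (\<forall>k\<in>snd ` set xs. coefficient xs k = 0)"
proof -
  let ?K = "snd ` set xs"
  have *: "series_of xs w = (\<Sum>k\<in>?K. coefficient xs k * star_monomial k w)" for w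
    unfolding series_of_def by (rule combine_coefficient) auto
  have "inj_on (\<lambda>k a. complex_of_nat (k (index_of a))) ?K"
    using exp_index_inj assms inj_on_subset unfolding keys_in_def by blast
  then have "\<forall>k\<in>?K. coefficient xs k = 0" if "\<forall>w. series_of xs w = 0"
    using mult_series_independent[of ?K "\<lambda>k a. complex_of_nat (k (index_of a))" "coefficient xs"] that
    unfolding * star_monomial_def by blast
  moreover have "series_of xs w = 0" if "\<forall>k\<in>?K. coefficient xs k = 0" for w
    unfolding * using that by (simp add: sum.neutral)
  ultimately show ?thesis by blast
qed

lemma ell_monomial_eq_0_iff:
  assumes "keys_in xs"
  shows "(\<forall>z\<in>disc. combine (ell_monomial z) xs = 0) \<longleftrightarrow> (\<forall>k\<in>snd ` set xs. coefficient xs k = 0)"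
proof -
  let ?K = "snd ` set xs"
  have *: "combine (ell_monomial z) xs = (\<Sum>k\<in>?K. coefficient xs k * ell_monomial z k)" for z
    by (rule combine_coefficient) auto
  have "finite {r. k r \<noteq> 0} \<and> k 0 = 0" if "k \<in> ?K" for k
    using that assms by (auto simp: keys_in_def exponents_def)
  then have "\<forall>k\<in>?K. coefficient xs k = 0" if "\<forall>z\<in>disc. combine (ell_monomial z) xs = 0"
    using exp_ell_independent[of ?K "coefficient xs"] that
    unfolding * ell_monomial_def by (simp only: finite_imageI finite_set mem_ball_0 ball_simps) blast
  moreover have "combine (ell_monomial z) xs = 0" if "\<forall>k\<in>?K. coefficient xs k = 0" for z
    unfolding * using that by (simp add: sum.neutral)
  ultimately show ?thesis by blast
qed

text \<open>Both families of monomials are linearly independent, so either side means that all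
  coefficients of the difference vanish. From left to right this makes the morphism well defined,
  from right to left it makes it injective.\<close>

lemma combination_eq_iff:
  assumes "keys_in xs" "keys_in ys"
  shows "series_of xs = series_of ys \<longleftrightarrow> (\<forall>z\<in>disc. combine (ell_monomial z) xs = combine (ell_monomial z) ys)"
proof -
  let ?zs = "xs @ scale_combination (-1) ys"
  have keys: "keys_in ?zs" using assms by (simp add: keys_in_simps)
  have "series_of xs = series_of ys \<longleftrightarrow> (\<forall>w. series_of ?zs w = 0)"
    by (auto simp: series_of_def combine_scale fun_eq_iff)
  also have "\<dots> \<longleftrightarrow> (\<forall>z\<in>disc. combine (ell_monomial z) ?zs = 0)"
    using series_of_eq_0_iff[OF keys] ell_monomial_eq_0_iff[OF keys] by simp
  finally show ?thesis by (auto simp: combine_scale)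
qed

lemma shuffle_add_left: "shuffle (\<lambda>x. S x + S' x) T w = shuffle S T w + shuffle S' T w"
  by (simp add: shuffle_def distrib_right sum.distrib case_prod_unfold)

lemma shuffle_add_right: "shuffle S (\<lambda>x. T x + T' x) w = shuffle S T w + shuffle S T' w"
  by (simp add: shuffle_def distrib_right distrib_left sum.distrib case_prod_unfold)

lemma shuffle_star_monomial: "shuffle (star_monomial k) (star_monomial l) = star_monomial (\<lambda>r. k r + l r)"
  by (simp add: star_monomial_def shuffle_mult_series)

lemma shuffle_series_of: "shuffle (series_of xs) (series_of ys) = series_of (mult_combination xs ys)"
proof
  fix w
  have one: "shuffle (star_monomial k) (series_of ys) w = combine (\<lambda>l. star_monomial (\<lambda>r. k r + l r) w) ys" for k
  proof (induction ys)
    case (Cons x ys)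
    then show ?case
      by (cases x) (simp add: series_of_def shuffle_add_right shuffle_scale_right shuffle_star_monomial)
  qed (simp add: series_of_def)
  have two: "combine (\<lambda>k. star_monomial k w) (shift_combination x ys)
      = fst x * combine (\<lambda>l. star_monomial (\<lambda>r. snd x r + l r) w) ys" for x
    by (induction ys) (auto simp: shift_combination_def distrib_left)
  show "shuffle (series_of xs) (series_of ys) w = series_of (mult_combination xs ys) w"
  proof (induction xs)
    case (Cons x xs)
    then show ?case
      by (cases x) (simp add: series_of_def mult_combination_def shuffle_add_left shuffle_scale_left two one[unfolded series_of_def])
  qed (simp add: series_of_def mult_combination_def)
qed

lemma ell_monomial_add:
  assumes "k \<in> exponents" "l \<in> exponents"
  shows "ell_monomial z (\<lambda>r. k r + l r) = ell_monomial z k * ell_monomial z l"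
proof -
  let ?R = "{r. k r \<noteq> 0} \<union> {r. l r \<noteq> 0}"
  have fin: "finite ?R" using assms by (simp add: exponents_def)
  have *: "ell_monomial z m = (\<Prod>r\<in>?R. exp (ell r z) ^ m r)" if "{r. m r \<noteq> 0} \<subseteq> ?R" for m
    unfolding ell_monomial_def by (rule prod.mono_neutral_left) (use fin that in auto)
  have "{r. k r + l r \<noteq> 0} \<subseteq> ?R" by auto
  then show ?thesis by (subst (1 2 3) *) (auto simp: power_add prod.distrib)
qed

lemma ell_monomial_mult:
  assumes "keys_in xs" "keys_in ys"
  shows "combine (ell_monomial z) (mult_combination xs ys) = combine (ell_monomial z) xs * combine (ell_monomial z) ys"
proof -
  have one: "combine (ell_monomial z) (shift_combination x ys) = fst x * ell_monomial z (snd x) * combine (ell_monomial z) ys"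
    if "snd x \<in> exponents" for x
    using assms(2)
  proof (induction ys)
    case (Cons p ys)
    then show ?case
      using that by (cases p) (auto simp: shift_combination_def keys_in_def ell_monomial_add distrib_left mult_ac)
  qed (simp add: shift_combination_def)
  show ?thesis using assms(1)
  proof (induction xs)
    case (Cons p xs)
    then show ?case
      using one[of p] by (cases p) (auto simp: mult_combination_def keys_in_def distrib_right)
  qed (simp add: mult_combination_def)
qed

abbreviation star_algebra :: "yletter series set" where
  "star_algebra \<equiv> generated_algebra shuffle {star (word_series [y r]) | r. 1 \<le> r}"

definition letter_exp :: "nat \<Rightarrow> nat \<Rightarrow> nat" where
  "letter_exp r = (\<lambda>s. if s = r then 1 else 0)"

lemma star_letter_series: "1 \<le> r \<Longrightarrow> star (word_series [y r]) = series_of [(1, letter_exp r)]"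
proof -
  assume "1 \<le> r"
  then have "(a = y r) = (index_of a = r)" for a by (metis index_of_inverse mem_Collect_eq y_inverse)
  moreover have "star (word_series [y r]) = mult_series (\<lambda>a. if a = y r then 1 else 0)"
    using star_letter[of 1 "y r"] by (simp add: scale_series_def)
  ultimately show ?thesis
    by (auto simp: series_of_def star_monomial_def letter_exp_def fun_eq_iff intro!: arg_cong2[of _ _ _ _ mult_series])
qed

lemma keys_in_letter: "1 \<le> r \<Longrightarrow> keys_in [(1, letter_exp r)]"
  by (simp add: keys_in_def exponents_def letter_exp_def)

lemma one_series_of: "word_series [] = series_of [(1, \<lambda>r. 0)]"
proof
  fix w show "word_series [] w = series_of [(1, \<lambda>r. 0)] w"
    by (cases w) (simp_all add: series_of_def star_monomial_def word_series_def)
qed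

lemma star_algebra_series_of:
  assumes "S \<in> star_algebra" obtains xs where "keys_in xs" "S = series_of xs"
  using assms
proof (induction arbitrary: thesis rule: generated_algebra.induct)
  case one
  show ?case by (rule one[OF _ one_series_of]) (simp add: keys_in_def exponents_def)
next
  case (gen S)
  then show ?case using star_letter_series keys_in_letter by blast
next
  case (scale S c)
  then obtain xs where "keys_in xs" "S = series_of xs" by blast
  then show ?case
    by (intro scale.prems[of "scale_combination c xs"]) (auto simp: keys_in_simps scale_series_def series_of_def combine_scale)
next
  case (add S T)
  obtain xs ys where "keys_in xs" "S = series_of xs" "keys_in ys" "T = series_of ys"
    using add.IH by metis
  then show ?case
    by (intro add.prems[of "xs @ ys"]) (auto simp: keys_in_simps add_series_def series_of_def)
next
  case (mult S T)
  obtain xs ys where "keys_in xs" "S = series_of xs" "keys_in ys" "T = series_of ys"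
    using mult.IH by metis
  then show ?case
    by (intro mult.prems[of "mult_combination xs ys"]) (auto simp: keys_in_mult shuffle_series_of)
qed

definition function_of :: "yletter series \<Rightarrow> complex \<Rightarrow> complex" where
  "function_of S = (\<lambda>z\<in>disc. combine (ell_monomial z) (SOME xs. keys_in xs \<and> S = series_of xs))"

lemma function_of_series_of:
  assumes "keys_in xs" shows "function_of (series_of xs) = (\<lambda>z\<in>disc. combine (ell_monomial z) xs)"
proof -
  have "keys_in (SOME ys. keys_in ys \<and> series_of xs = series_of ys) \<and>
      series_of xs = series_of (SOME ys. keys_in ys \<and> series_of xs = series_of ys)"
    by (rule someI[of _ xs]) (use assms in auto)
  then have "\<forall>z\<in>disc. combine (ell_monomial z) xs = combine (ell_monomial z) (SOME ys. keys_in ys \<and> series_of xs = series_of ys)"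
    using combination_eq_iff[OF assms] by blast
  then show ?thesis unfolding function_of_def by (intro restrict_ext) simp
qed

lemma eulerian_algebra_add:
  "(\<lambda>z\<in>disc. f z) \<in> eulerian_algebra \<Longrightarrow> (\<lambda>z\<in>disc. g z) \<in> eulerian_algebra \<Longrightarrow> (\<lambda>z\<in>disc. f z + g z) \<in> eulerian_algebra"
  using eulerian_algebra.add[of "restrict f disc" "restrict g disc"] by (simp cong: restrict_cong)

lemma eulerian_algebra_mult:
  "(\<lambda>z\<in>disc. f z) \<in> eulerian_algebra \<Longrightarrow> (\<lambda>z\<in>disc. g z) \<in> eulerian_algebra \<Longrightarrow> (\<lambda>z\<in>disc. f z * g z) \<in> eulerian_algebra"
  using eulerian_algebra.mult[of "restrict f disc" "restrict g disc"] by (simp cong: restrict_cong)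

lemma eulerian_algebra_power:
  "(\<lambda>z\<in>disc. f z) \<in> eulerian_algebra \<Longrightarrow> (\<lambda>z\<in>disc. f z ^ n) \<in> eulerian_algebra"
  by (induction n) (auto intro: eulerian_algebra_mult eulerian_algebra.const)

lemma eulerian_algebra_prod:
  "finite I \<Longrightarrow> (\<And>i. i \<in> I \<Longrightarrow> (\<lambda>z\<in>disc. f i z) \<in> eulerian_algebra) \<Longrightarrow> (\<lambda>z\<in>disc. \<Prod>i\<in>I. f i z) \<in> eulerian_algebra"
  by (induction I rule: finite_induct) (auto intro: eulerian_algebra_mult eulerian_algebra.const)

lemma exp_ell_eulerian: "1 \<le> r \<Longrightarrow> (\<lambda>z\<in>disc. exp (ell r z)) \<in> eulerian_algebra"
  by (rule eulerian_algebra.span, unfold eulerian_span_def, intro CollectI exI[of _ "{r}"] exI[of _ "\<lambda>_. 1"]) auto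

lemma combine_eulerian:
  assumes "keys_in xs" shows "(\<lambda>z\<in>disc. combine (ell_monomial z) xs) \<in> eulerian_algebra"
  using assms
proof (induction xs)
  case (Cons x xs)
  obtain c k where x: "x = (c, k)" by force
  have k: "k \<in> exponents" "keys_in xs" using Cons.prems by (auto simp: keys_in_def x)
  have "(\<lambda>z\<in>disc. ell_monomial z k) \<in> eulerian_algebra"
    unfolding ell_monomial_def
  proof (intro eulerian_algebra_prod eulerian_algebra_power exp_ell_eulerian)
    show "finite {r. k r \<noteq> 0}" using k by (simp add: exponents_def)
    show "1 \<le> r" if "r \<in> {r. k r \<noteq> 0}" for r using that k by (cases r) (auto simp: exponents_def)
  qed
  then show ?case using Cons.IH[OF k(2)] unfolding x combine_simps
    by (intro eulerian_algebra_add eulerian_algebra_mult eulerian_algebra.const)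
qed (auto intro: eulerian_algebra.const)

lemma ell_monomial_letter: "ell_monomial z (letter_exp r) = exp (ell r z)"
proof -
  have "{s. letter_exp r s \<noteq> 0} = {r}" by (auto simp: letter_exp_def)
  then show ?thesis unfolding ell_monomial_def by (simp add: letter_exp_def)
qed

theorem eulerian_morphism:
  "function_of \<in> star_algebra \<rightarrow> eulerian_algebra"
  "morphism_to_functions star_algebra shuffle function_of"
  "\<forall>r\<ge>1. function_of (star (word_series [y r])) = (\<lambda>z\<in>disc. inverse (Gamma_y r (1 + z)))"
  "inj_on function_of star_algebra"
proof -
  show "function_of \<in> star_algebra \<rightarrow> eulerian_algebra"
  proof (rule Pi_I)
    fix S assume "S \<in> star_algebra"
    then obtain xs where "keys_in xs" "S = series_of xs" by (rule star_algebra_series_of)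
    then show "function_of S \<in> eulerian_algebra" by (simp add: function_of_series_of combine_eulerian)
  qed
  show "\<forall>r\<ge>1. function_of (star (word_series [y r])) = (\<lambda>z\<in>disc. inverse (Gamma_y r (1 + z)))"
    by (auto simp: star_letter_series function_of_series_of keys_in_letter ell_monomial_letter Gamma_y_def exp_minus
        intro!: restrict_ext)
  show "inj_on function_of star_algebra"
  proof (rule inj_onI)
    fix S T assume S: "S \<in> star_algebra" and T: "T \<in> star_algebra" and eq: "function_of S = function_of T"
    obtain xs where xs: "keys_in xs" "S = series_of xs" using S by (rule star_algebra_series_of)
    obtain ys where ys: "keys_in ys" "T = series_of ys" using T by (rule star_algebra_series_of)
    have eq': "(\<lambda>z\<in>disc. combine (ell_monomial z) xs) = (\<lambda>z\<in>disc. combine (ell_monomial z) ys)"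
      using eq xs ys by (simp add: function_of_series_of)
    have "combine (ell_monomial z) xs = combine (ell_monomial z) ys" if "z \<in> disc" for z
      using fun_cong[OF eq', of z] that by simp
    then show "S = T" using combination_eq_iff[OF xs(1) ys(1)] xs ys by blast
  qed
  show "morphism_to_functions star_algebra shuffle function_of"
    unfolding morphism_to_functions_def
  proof (intro conjI allI ballI)
    show "function_of (word_series []) = (\<lambda>z\<in>disc. 1)"
      unfolding one_series_of by (subst function_of_series_of) (simp_all add: keys_in_def exponents_def ell_monomial_def)
  next
    fix c S assume "S \<in> star_algebra"
    then obtain xs where xs: "keys_in xs" "S = series_of xs" by (rule star_algebra_series_of)
    have "scale_series c S = series_of (scale_combination c xs)"
      by (simp add: xs scale_series_def series_of_def combine_scale)
    then show "function_of (scale_series c S) = (\<lambda>z\<in>disc. c * function_of S z)"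
      using xs by (auto simp: function_of_series_of keys_in_simps combine_scale)
  next
    fix S T assume S: "S \<in> star_algebra" and T: "T \<in> star_algebra"
    obtain xs where xs: "keys_in xs" "S = series_of xs" using S by (rule star_algebra_series_of)
    obtain ys where ys: "keys_in ys" "T = series_of ys" using T by (rule star_algebra_series_of)
    have "add_series S T = series_of (xs @ ys)" by (simp add: xs ys add_series_def series_of_def)
    then show "function_of (add_series S T) = (\<lambda>z\<in>disc. function_of S z + function_of T z)"
      using xs ys by (auto simp: function_of_series_of keys_in_simps)
    show "function_of (shuffle S T) = (\<lambda>z\<in>disc. function_of S z * function_of T z)"
      using xs ys by (auto simp: shuffle_series_of function_of_series_of keys_in_mult ell_monomial_mult)
  qed
qed

subsection \<open>The stuffle product and its derivations\<close>

text \<open>The grading respected by the stuffle product, which does not preserve length. There are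
  finitely many words of each weight although the alphabet is infinite.\<close>

definition weight :: "yletter list \<Rightarrow> nat" where
  "weight w = sum_list (map index_of w)"

lemma weight_simps [simp]: "weight [] = 0" "weight (a # w) = index_of a + weight w" "weight (u @ v) = weight u + weight v"
  by (simp_all add: weight_def)

lemma weight_eq_0 [simp]: "weight w = 0 \<longleftrightarrow> w = []"
  by (cases w) (use index_of_pos in \<open>auto simp: Suc_le_eq\<close>)

lemma length_le_weight: "length w \<le> weight w"
proof (induction w)
  case (Cons a w)
  then show ?case using index_of_pos[of a] by simp
qed simp

lemma index_le_weight: "a \<in> set w \<Longrightarrow> index_of a \<le> weight w"
  by (induction w) auto

lemma finite_weight_le: "finite {w. weight w \<le> n}"
proof (rule finite_subset)
  show "{w. weight w \<le> n} \<subseteq> {w. set w \<subseteq> y ` {..n} \<and> length w \<le> n}"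
  proof clarify
    fix w assume w: "weight w \<le> n"
    have "a \<in> y ` {..n}" if "a \<in> set w" for a
      using index_le_weight[OF that] w index_of_inverse[of a] by (metis atMost_iff image_eqI le_trans)
    then show "set w \<subseteq> y ` {..n} \<and> length w \<le> n" using length_le_weight[of w] w by auto
  qed
  show "finite {w. set w \<subseteq> y ` {..n} \<and> length w \<le> n}" by (intro finite_lists_length_le) simp
qed

lemma finite_weight: "finite {w. weight w = n}"
  using finite_weight_le[of n] by (rule rev_finite_subset) auto

lemma stuffle_words_weight: "stuffle_words u v w \<noteq> 0 \<Longrightarrow> weight u + weight v = weight w"
  using stuffle_words_support[of u v w] by (simp add: weight_def)

lemma stuffle_words_Nil_right: "stuffle_words u [] = word_series u"
  by (cases u) simp_all

lemma stuffle_words_at_Nil: "stuffle_words u v [] = (if u = [] \<and> v = [] then 1 else 0)"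
  by (cases "(u, v)" rule: stuffle_words.cases) (auto simp: word_series_def add_series_def lcons_def)

definition splittings :: "yletter \<Rightarrow> (yletter \<times> yletter) set" where
  "splittings c = {(a, b). index_of a + index_of b = index_of c}"

lemma finite_splittings: "finite (splittings c)"
proof (rule finite_subset)
  show "splittings c \<subseteq> y ` {..index_of c} \<times> y ` {..index_of c}"
    unfolding splittings_def using index_of_inverse by (auto simp: image_iff) (metis atMost_iff le_add1, metis atMost_iff le_add2)
qed simp

lemma splittings_le: "(a, b) \<in> splittings c \<Longrightarrow> index_of a \<le> index_of c \<and> index_of b \<le> index_of c"
  by (auto simp: splittings_def)

lemma card_splittings: "card (splittings c) \<le> index_of c"
proof -
  have "card (splittings c) \<le> card {1..index_of c}"
  proof (rule card_inj_on_le[of "\<lambda>(a, b). index_of a"])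
    show "inj_on (\<lambda>(a, b). index_of a) (splittings c)"
      by (auto simp: inj_on_def splittings_def index_of_inject) (metis add_left_cancel index_of_inject)
    show "(\<lambda>(a, b). index_of a) ` splittings c \<subseteq> {1..index_of c}"
      using index_of_pos by (auto simp: splittings_def)
  qed simp
  then show ?thesis by simp
qed

lemma y_eq_iff: "y (index_of a + index_of b) = c \<longleftrightarrow> (a, b) \<in> splittings c"
proof -
  have "index_of (y (index_of a + index_of b)) = index_of a + index_of b"
    using index_of_pos[of a] by (simp add: y_inverse)
  then show ?thesis unfolding splittings_def by (metis (mono_tags, lifting) case_prodI index_of_inject mem_Collect_eq case_prodD)
qed

lemma stuffle_words_at_Cons:
  "stuffle_words u v (c # w) =
    (case u of [] \<Rightarrow> 0 | a # u' \<Rightarrow> if a = c then stuffle_words u' v w else 0) +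
    (case v of [] \<Rightarrow> 0 | b # v' \<Rightarrow> if b = c then stuffle_words u v' w else 0) +
    (case (u, v) of (a # u', b # v') \<Rightarrow> if (a, b) \<in> splittings c then stuffle_words u' v' w else 0 | _ \<Rightarrow> 0)"
  by (cases u; cases v)
     (auto simp: word_series_def add_series_def lcons_def stuffle_words_Nil_right y_eq_iff[symmetric])

text \<open>The stuffle product is the case \<open>F u v = S u * T v\<close>. General \<open>F\<close> are needed to iterate the
  construction in \<open>stuffle_form_append\<close>, which is the compatibility of the stuffle product with
  deconcatenation.\<close>

definition stuffle_form :: "(yletter list \<Rightarrow> yletter list \<Rightarrow> complex) \<Rightarrow> yletter list \<Rightarrow> complex" where
  "stuffle_form F w = (\<Sum>(u, v) | stuffle_words u v w \<noteq> 0. F u v * stuffle_words u v w)"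

lemma stuffle_eq_form: "stuffle S T = stuffle_form (\<lambda>u v. S u * T v)"
  by (simp add: stuffle_def stuffle_form_def fun_eq_iff)

lemma stuffle_form_superset:
  assumes "finite U" "{(u, v). stuffle_words u v w \<noteq> 0} \<subseteq> U"
  shows "stuffle_form F w = (\<Sum>(u, v)\<in>U. F u v * stuffle_words u v w)"
  unfolding stuffle_form_def by (rule sum.mono_neutral_left) (use assms in auto)

lemma stuffle_form_Nil [simp]: "stuffle_form F [] = F [] []"
proof -
  have "{(u, v). stuffle_words u v [] \<noteq> (0::complex)} = {([], [])}"
    by (auto simp: stuffle_words_at_Nil)
  then show ?thesis by (simp add: stuffle_form_def stuffle_words_at_Nil)
qed

text \<open>The first letter of a word in a stuffle product comes from the left factor, from the
  right factor, or from merging their first letters; the last source is a sum over the finitely many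
  splittings of c.\<close>

lemma stuffle_form_Cons:
  "stuffle_form F (c # w) = stuffle_form (\<lambda>u v. F (c # u) v) w + stuffle_form (\<lambda>u v. F u (c # v)) w
    + (\<Sum>(a, b)\<in>splittings c. stuffle_form (\<lambda>u v. F (a # u) (b # v)) w)"
proof -
  define A where "A = {(u, v). stuffle_words u v w \<noteq> 0}"
  define U1 where "U1 = (\<lambda>(u, v). (c # u, v)) ` A"
  define U2 where "U2 = (\<lambda>(u, v). (u, c # v)) ` A"
  define U3 where "U3 = (\<lambda>((a, b), (u, v)). (a # u, b # v)) ` (splittings c \<times> A)"
  define X where "X u v = (case u of [] \<Rightarrow> 0 | a # u' \<Rightarrow> if a = c then stuffle_words u' v w else 0)" for u v
  define Y where "Y u v = (case v of [] \<Rightarrow> 0 | b # v' \<Rightarrow> if b = c then stuffle_words u v' w else 0)" for u v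
  define Z where "Z u v = (case (u, v) of (a # u', b # v') \<Rightarrow> if (a, b) \<in> splittings c then stuffle_words u' v' w else 0 | _ \<Rightarrow> 0)" for u v
  let ?U = "U1 \<union> U2 \<union> U3"
  have fin: "finite A" "finite U1" "finite U2" "finite U3"
    unfolding A_def U1_def U2_def U3_def using finite_stuffle_words finite_splittings by auto
  have X: "(u, v) \<in> U1" if "X u v \<noteq> 0" for u v
    using that by (auto simp: X_def U1_def A_def image_iff split: list.splits if_splits)
  have Y: "(u, v) \<in> U2" if "Y u v \<noteq> 0" for u v
    using that by (auto simp: Y_def U2_def A_def image_iff split: list.splits if_splits)
  have Z: "(u, v) \<in> U3" if "Z u v \<noteq> 0" for u v
    using that by (force simp: Z_def U3_def A_def image_iff split: list.splits if_splits)
  have split: "stuffle_words u v (c # w) = X u v + Y u v + Z u v" for u v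
    by (simp add: stuffle_words_at_Cons X_def Y_def Z_def)
  have "stuffle_form F (c # w) = (\<Sum>(u, v)\<in>?U. F u v * stuffle_words u v (c # w))"
  proof (rule stuffle_form_superset)
    show "{(u, v). stuffle_words u v (c # w) \<noteq> 0} \<subseteq> ?U"
      using X Y Z split by (auto, metis add.right_neutral)
  qed (use fin in auto)
  also have "\<dots> = (\<Sum>(u, v)\<in>?U. F u v * X u v) + (\<Sum>(u, v)\<in>?U. F u v * Y u v) + (\<Sum>(u, v)\<in>?U. F u v * Z u v)"
    by (simp add: split distrib_left sum.distrib case_prod_unfold)
  also have "(\<Sum>(u, v)\<in>?U. F u v * X u v) = (\<Sum>(u, v)\<in>U1. F u v * X u v)"
    by (rule sum.mono_neutral_right) (use fin X in auto)
  also have "\<dots> = stuffle_form (\<lambda>u v. F (c # u) v) w"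
    unfolding U1_def stuffle_form_def A_def[symmetric]
    by (subst sum.reindex) (auto simp: inj_on_def X_def case_prod_unfold intro!: sum.cong)
  also have "(\<Sum>(u, v)\<in>?U. F u v * Y u v) = (\<Sum>(u, v)\<in>U2. F u v * Y u v)"
    by (rule sum.mono_neutral_right) (use fin Y in auto)
  also have "\<dots> = stuffle_form (\<lambda>u v. F u (c # v)) w"
    unfolding U2_def stuffle_form_def A_def[symmetric]
    by (subst sum.reindex) (auto simp: inj_on_def Y_def case_prod_unfold intro!: sum.cong)
  also have "(\<Sum>(u, v)\<in>?U. F u v * Z u v) = (\<Sum>(u, v)\<in>U3. F u v * Z u v)"
    by (rule sum.mono_neutral_right) (use fin Z in auto)
  also have "\<dots> = (\<Sum>((a, b), (u, v))\<in>splittings c \<times> A. F (a # u) (b # v) * stuffle_words u v w)"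
    unfolding U3_def
    by (subst sum.reindex) (auto simp: inj_on_def Z_def intro!: sum.cong)
  also have "\<dots> = (\<Sum>(a, b)\<in>splittings c. stuffle_form (\<lambda>u v. F (a # u) (b # v)) w)"
    unfolding stuffle_form_def A_def[symmetric]
    by (simp add: sum.cartesian_product case_prod_unfold)
  finally show ?thesis .
qed

lemma stuffle_form_append:
  "stuffle_form F (u @ v) = stuffle_form (\<lambda>p q. stuffle_form (\<lambda>p' q'. F (p @ p') (q @ q')) v) u"
proof (induction u arbitrary: F)
  case (Cons c u)
  show ?case
    by (simp add: stuffle_form_Cons Cons.IH case_prod_unfold)
qed simp

lemma stuffle_append:
  "stuffle S T (u @ v) = stuffle_form (\<lambda>p q. stuffle (\<lambda>x. S (p @ x)) (\<lambda>x. T (q @ x)) v) u"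
  by (simp add: stuffle_eq_form stuffle_form_append[of _ u v])

lemma stuffle_Nil [simp]: "stuffle S T [] = S [] * T []"
  by (simp add: stuffle_eq_form)

lemma stuffle_Cons:
  "stuffle S T (c # w) = stuffle (\<lambda>x. S (c # x)) T w + stuffle S (\<lambda>x. T (c # x)) w
    + (\<Sum>(a, b)\<in>splittings c. stuffle (\<lambda>x. S (a # x)) (\<lambda>x. T (b # x)) w)"
  by (simp add: stuffle_eq_form stuffle_form_Cons)

lemma stuffle_scale_left: "stuffle (\<lambda>x. c * S x) T w = c * stuffle S T w"
  by (simp add: stuffle_def sum_distrib_left case_prod_unfold mult.assoc)

lemma stuffle_scale_right: "stuffle S (\<lambda>x. c * T x) w = c * stuffle S T w"
  by (simp add: stuffle_def sum_distrib_left case_prod_unfold mult.assoc mult.left_commute)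

lemma stuffle_sum_left: "stuffle (\<lambda>x. \<Sum>i\<in>I. f i x) T w = (\<Sum>i\<in>I. stuffle (f i) T w)"
  unfolding stuffle_def case_prod_unfold sum_distrib_right by (rule sum.swap)

lemma stuffle_sum_right: "stuffle S (\<lambda>x. \<Sum>i\<in>I. f i x) w = (\<Sum>i\<in>I. stuffle S (f i) w)"
  unfolding stuffle_def case_prod_unfold sum_distrib_right sum_distrib_left by (rule sum.swap)

lemma stuffle_word_series: "stuffle (word_series u) (word_series v) = stuffle_words u v"
proof
  fix w
  have "stuffle (word_series u) (word_series v) w
      = (\<Sum>p\<in>{(u, v). stuffle_words u v w \<noteq> 0}. if p = (u, v) then stuffle_words u v w else 0)"
    unfolding stuffle_def by (intro sum.cong refl) (auto simp: word_series_def split: if_splits)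
  then show "stuffle (word_series u) (word_series v) w = stuffle_words u v w"
    using finite_stuffle_words[of w] by (simp add: sum.delta')
qed

section \<open>Primitive elements and derivations of the stuffle product\<close>

definition der :: "yletter series \<Rightarrow> yletter series \<Rightarrow> yletter series" where
  "der \<xi> S = (\<lambda>v. \<Sum>u | \<xi> u \<noteq> 0. \<xi> u * S (u @ v))"

text \<open>The pairing of f with the stuffle product of two words. Fixing the weight keeps the sum
  finite for f of infinite support.\<close>

definition stuffle_pairing :: "yletter series \<Rightarrow> yletter list \<Rightarrow> yletter list \<Rightarrow> complex" where
  "stuffle_pairing f u v = (\<Sum>w | weight w = weight u + weight v. f w * stuffle_words u v w)"

text \<open>Primitivity for the coproduct dual to the stuffle product. The finite support allows
  \<open>der \<xi>\<close> to act on arbitrary series without convergence questions.\<close>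

definition primitive :: "yletter series \<Rightarrow> bool" where
  "primitive \<xi> \<longleftrightarrow> finite {u. \<xi> u \<noteq> 0} \<and> \<xi> [] = 0 \<and>
     (\<forall>u v. u \<noteq> [] \<longrightarrow> v \<noteq> [] \<longrightarrow> stuffle_pairing \<xi> u v = 0)"

lemma stuffle_pairing_eq:
  assumes "finite {u. f u \<noteq> 0}"
  shows "(\<Sum>w | f w \<noteq> 0. f w * stuffle_words u v w) = stuffle_pairing f u v"
proof -
  have "(\<Sum>w | f w \<noteq> 0. f w * stuffle_words u v w) = (\<Sum>w\<in>{w. f w \<noteq> 0} \<union> {w. weight w = weight u + weight v}. f w * stuffle_words u v w)"
    by (rule sum.mono_neutral_left) (use assms finite_weight in auto)
  also have "\<dots> = stuffle_pairing f u v"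
    unfolding stuffle_pairing_def
    by (rule sum.mono_neutral_right) (use assms finite_weight stuffle_words_weight in fastforce)+
  finally show ?thesis .
qed

lemma stuffle_pairing_Nil: "stuffle_pairing f [] v = f v" "stuffle_pairing f u [] = f u"
  unfolding stuffle_pairing_def stuffle_words_Nil_right
  using finite_weight by (simp_all add: word_series_def if_distrib sum.delta cong: if_cong)

text \<open>The derivation property is the coproduct formula \<open>stuffle_append\<close> paired with a primitive element.\<close>

lemma der_stuffle:
  assumes p: "primitive \<xi>"
  shows "der \<xi> (stuffle S T) = (\<lambda>v. stuffle (der \<xi> S) T v + stuffle S (der \<xi> T) v)"
proof
  fix v
  define U where "U = {u. \<xi> u \<noteq> 0}"
  have fin: "finite U" and x0: "\<xi> [] = 0" using p by (simp_all add: primitive_def U_def)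
  define F where "F p q = stuffle (\<lambda>x. S (p @ x)) (\<lambda>x. T (q @ x)) v" for p q
  define P where "P = (\<Union>u\<in>U. {(p, q). stuffle_words p q u \<noteq> 0}) \<union> (\<lambda>u. (u, [])) ` U \<union> (\<lambda>u. ([], u)) ` U"
  have finP: "finite P" unfolding P_def using fin finite_stuffle_words by auto
  have "der \<xi> (stuffle S T) v = (\<Sum>u\<in>U. \<xi> u * stuffle_form F u)"
    by (simp add: der_def U_def F_def[abs_def] stuffle_append[of S T])
  also have "\<dots> = (\<Sum>u\<in>U. \<Sum>(p, q)\<in>P. F p q * (\<xi> u * stuffle_words p q u))"
  proof (intro sum.cong refl)
    fix u assume "u \<in> U"
    then have "stuffle_form F u = (\<Sum>(p, q)\<in>P. F p q * stuffle_words p q u)"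
      by (intro stuffle_form_superset finP) (auto simp: P_def)
    then show "\<xi> u * stuffle_form F u = (\<Sum>(p, q)\<in>P. F p q * (\<xi> u * stuffle_words p q u))"
      by (simp add: sum_distrib_left case_prod_unfold mult_ac)
  qed
  also have "\<dots> = (\<Sum>(p, q)\<in>P. F p q * stuffle_pairing \<xi> p q)"
    unfolding case_prod_unfold
    by (subst sum.swap) (use fin in \<open>simp add: sum_distrib_left[symmetric] U_def stuffle_pairing_eq\<close>)
  also have "\<dots> = (\<Sum>(p, q)\<in>(\<lambda>u. (u, [])) ` U \<union> (\<lambda>u. ([], u)) ` U. F p q * stuffle_pairing \<xi> p q)"
  proof (rule sum.mono_neutral_right[OF finP])
    show "\<forall>pq\<in>P - ((\<lambda>u. (u, [])) ` U \<union> (\<lambda>u. ([], u)) ` U). (case pq of (p, q) \<Rightarrow> F p q * stuffle_pairing \<xi> p q) = 0"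
    proof
      fix pq assume pq: "pq \<in> P - ((\<lambda>u. (u, [])) ` U \<union> (\<lambda>u. ([], u)) ` U)"
      obtain p q where e: "pq = (p, q)" by force
      have "stuffle_pairing \<xi> p q = 0"
      proof (cases "p = [] \<or> q = []")
        case True
        then show ?thesis using pq by (auto simp: e U_def stuffle_pairing_Nil)
      next
        case False
        then show ?thesis using \<open>primitive \<xi>\<close> by (simp add: primitive_def)
      qed
      then show "(case pq of (p, q) \<Rightarrow> F p q * stuffle_pairing \<xi> p q) = 0" by (simp add: e)
    qed
  qed (auto simp: P_def)
  also have "\<dots> = (\<Sum>(p, q)\<in>(\<lambda>u. (u, [])) ` U. F p q * stuffle_pairing \<xi> p q) + (\<Sum>(p, q)\<in>(\<lambda>u. ([], u)) ` U. F p q * stuffle_pairing \<xi> p q)"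
    by (rule sum.union_disjoint) (use fin x0 in \<open>auto simp: U_def\<close>)
  also have "\<dots> = (\<Sum>u\<in>U. \<xi> u * F u []) + (\<Sum>u\<in>U. \<xi> u * F [] u)"
    by (subst (1 2) sum.reindex) (auto simp: inj_on_def stuffle_pairing_Nil mult.commute)
  also have "(\<Sum>u\<in>U. \<xi> u * F u []) = stuffle (der \<xi> S) T v"
    by (simp add: F_def der_def U_def stuffle_sum_left stuffle_scale_left)
  also have "(\<Sum>u\<in>U. \<xi> u * F [] u) = stuffle S (der \<xi> T) v"
    by (simp add: F_def der_def U_def stuffle_sum_right stuffle_scale_right)
  finally show "der \<xi> (stuffle S T) v = stuffle (der \<xi> S) T v + stuffle S (der \<xi> T) v" .
qed

lemma der_superset:
  assumes "finite U" "{u. \<xi> u \<noteq> 0} \<subseteq> U" shows "der \<xi> S v = (\<Sum>u\<in>U. \<xi> u * S (u @ v))"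
  unfolding der_def by (rule sum.mono_neutral_left) (use assms in auto)

lemma der_add: "der \<xi> (\<lambda>w. S w + T w) = (\<lambda>v. der \<xi> S v + der \<xi> T v)"
  by (simp add: der_def distrib_left sum.distrib)

lemma der_scale: "der \<xi> (\<lambda>w. c * S w) = (\<lambda>v. c * der \<xi> S v)"
  by (simp add: der_def sum_distrib_left mult.left_commute)

lemma der_zero [simp]: "der \<xi> (\<lambda>w. 0) = (\<lambda>w. 0)"
  by (simp add: der_def)

lemma der_sum: "der \<xi> (\<lambda>w. \<Sum>i\<in>I. S i w) v = (\<Sum>i\<in>I. der \<xi> (S i) v)"
  unfolding der_def sum_distrib_left by (rule sum.swap)

lemma der_suminf:
  assumes "\<And>v. summable (\<lambda>n. S n v)"
  shows "der \<xi> (\<lambda>w. \<Sum>n. S n w) v = (\<Sum>n. der \<xi> (S n) v)" "summable (\<lambda>n. der \<xi> (S n) v)"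
proof -
  have "(\<lambda>n. \<Sum>u | \<xi> u \<noteq> 0. \<xi> u * S n (u @ v)) sums (\<Sum>u | \<xi> u \<noteq> 0. \<xi> u * (\<Sum>n. S n (u @ v)))"
    by (intro sums_sum sums_mult summable_sums assms)
  then show "der \<xi> (\<lambda>w. \<Sum>n. S n w) v = (\<Sum>n. der \<xi> (S n) v)" "summable (\<lambda>n. der \<xi> (S n) v)"
    unfolding der_def by (auto simp: sums_iff)
qed

text \<open>Divided powers of the derivation, so that the Leibniz rule \<open>dpow_stuffle\<close>
  has no binomial coefficients.\<close>

primrec dpow :: "yletter series \<Rightarrow> nat \<Rightarrow> yletter series \<Rightarrow> yletter series" where
  "dpow \<xi> 0 S = S"
| "dpow \<xi> (Suc n) S = (\<lambda>v. der \<xi> (dpow \<xi> n S) v / of_nat (Suc n))"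

definition expd :: "yletter series \<Rightarrow> yletter series \<Rightarrow> yletter series" where
  "expd \<xi> S = (\<lambda>v. \<Sum>n. dpow \<xi> n S v)"

lemma der_divide: "der \<xi> (\<lambda>w. S w / c) = (\<lambda>v. der \<xi> S v / c)"
  using der_scale[of \<xi> "1 / c" S] by simp

lemma dpow_add: "dpow \<xi> n (\<lambda>w. S w + T w) = (\<lambda>v. dpow \<xi> n S v + dpow \<xi> n T v)"
  by (induction n) (simp_all add: der_add add_divide_distrib)

lemma dpow_scale: "dpow \<xi> n (\<lambda>w. c * S w) = (\<lambda>v. c * dpow \<xi> n S v)"
  by (induction n) (simp_all add: der_scale)

lemma der_dpow: "der \<xi> (dpow \<xi> n S) v = of_nat (Suc n) * dpow \<xi> (Suc n) S v"
  by (simp del: of_nat_Suc)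

text \<open>The induction step for Leibniz and binomial rules with divided powers: the pair (i, j)
  with i + j = n + 1 is reached from its two neighbours with total multiplicity i + j.\<close>

lemma sum_diagonal_Suc:
  fixes f :: "nat \<Rightarrow> nat \<Rightarrow> complex"
  shows "(\<Sum>i\<le>n. of_nat (Suc i) * f (Suc i) (n - i) + of_nat (Suc (n - i)) * f i (Suc (n - i)))
    = of_nat (Suc n) * (\<Sum>i\<le>Suc n. f i (Suc n - i))"
proof -
  have a: "(\<Sum>i\<le>n. of_nat (Suc i) * f (Suc i) (n - i)) = (\<Sum>i\<le>Suc n. of_nat i * f i (Suc n - i))"
    by (subst sum.atMost_Suc_shift) simp
  have b: "(\<Sum>i\<le>n. of_nat (Suc (n - i)) * f i (Suc (n - i))) = (\<Sum>i\<le>Suc n. of_nat (Suc n - i) * f i (Suc n - i))"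
    by (auto intro!: sum.cong simp: Suc_diff_le)
  have "(\<Sum>i\<le>n. of_nat (Suc i) * f (Suc i) (n - i) + of_nat (Suc (n - i)) * f i (Suc (n - i)))
      = (\<Sum>i\<le>Suc n. of_nat i * f i (Suc n - i) + of_nat (Suc n - i) * f i (Suc n - i))"
    unfolding sum.distrib a b ..
  also have "\<dots> = (\<Sum>i\<le>Suc n. of_nat (Suc n) * f i (Suc n - i))"
  proof (intro sum.cong refl)
    fix i assume "i \<in> {..Suc n}"
    then have "of_nat i + of_nat (Suc n - i) = (of_nat (Suc n) :: complex)" by (metis atMost_iff le_add_diff_inverse of_nat_add)
    then show "of_nat i * f i (Suc n - i) + of_nat (Suc n - i) * f i (Suc n - i) = of_nat (Suc n) * f i (Suc n - i)"
      by (metis distrib_right)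
  qed
  finally show ?thesis by (simp only: sum_distrib_left)
qed

lemma dpow_stuffle:
  assumes p: "primitive \<xi>"
  shows "dpow \<xi> n (stuffle S T) v = (\<Sum>i\<le>n. stuffle (dpow \<xi> i S) (dpow \<xi> (n - i) T) v)"
proof (induction n arbitrary: v)
  case (Suc n)
  have "der \<xi> (dpow \<xi> n (stuffle S T)) v = der \<xi> (\<lambda>v. \<Sum>i\<le>n. stuffle (dpow \<xi> i S) (dpow \<xi> (n - i) T) v) v"
    by (simp add: Suc.IH[abs_def])
  also have "\<dots> = (\<Sum>i\<le>n. stuffle (der \<xi> (dpow \<xi> i S)) (dpow \<xi> (n - i) T) v + stuffle (dpow \<xi> i S) (der \<xi> (dpow \<xi> (n - i) T)) v)"
    by (simp add: der_sum der_stuffle[OF p])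
  also have "\<dots> = (\<Sum>i\<le>n. of_nat (Suc i) * stuffle (dpow \<xi> (Suc i) S) (dpow \<xi> (n - i) T) v
      + of_nat (Suc (n - i)) * stuffle (dpow \<xi> i S) (dpow \<xi> (Suc (n - i)) T) v)"
    unfolding der_dpow[abs_def] stuffle_scale_left stuffle_scale_right ..
  also have "\<dots> = of_nat (Suc n) * (\<Sum>i\<le>Suc n. stuffle (dpow \<xi> i S) (dpow \<xi> (Suc n - i) T) v)"
    by (rule sum_diagonal_Suc)
  finally show ?case by (simp del: of_nat_Suc sum.atMost_Suc)
qed simp

section \<open>Series of exponential growth\<close>

definition bounded_by :: "nat \<Rightarrow> real \<Rightarrow> real \<Rightarrow> yletter series \<Rightarrow> bool" where
  "bounded_by M B C S \<longleftrightarrow> (\<forall>w. (\<forall>a\<in>set w. index_of a \<le> M) \<longrightarrow> norm (S w) \<le> B * C ^ length w)"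

text \<open>A common domain for all exponentials \<open>expd\<close>: it contains the polynomials
  and the rational series, and it is stable under \<open>stuffle\<close> and \<open>expd\<close>.
  The bound may depend on M, as the coefficients of a rational series at the infinitely many letters
  are arbitrary.\<close>

definition growth :: "yletter series \<Rightarrow> bool" where
  "growth S \<longleftrightarrow> (\<forall>M. \<exists>B C. 0 \<le> B \<and> 1 \<le> C \<and> bounded_by M B C S)"

lemma bounded_by_mono:
  assumes "bounded_by M B C S" "M' \<le> M" "B \<le> B'" "C \<le> C'" "0 \<le> B" "1 \<le> C"
  shows "bounded_by M' B' C' S"
  unfolding bounded_by_def
proof (intro allI impI)
  fix w assume "\<forall>a\<in>set w. index_of a \<le> M'"
  then have "norm (S w) \<le> B * C ^ length w" using assms(1,2) by (force simp: bounded_by_def)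
  also have "\<dots> \<le> B' * C' ^ length w" using assms by (intro mult_mono power_mono) auto
  finally show "norm (S w) \<le> B' * C' ^ length w" .
qed

lemma growth_pair:
  assumes "growth S" "growth T"
  obtains B C where "0 \<le> B" "1 \<le> C" "bounded_by M B C S" "bounded_by M B C T"
proof -
  obtain B1 C1 where 1: "0 \<le> B1" "1 \<le> C1" "bounded_by M B1 C1 S" using assms(1) growth_def by blast
  obtain B2 C2 where 2: "0 \<le> B2" "1 \<le> C2" "bounded_by M B2 C2 T" using assms(2) growth_def by blast
  show ?thesis
    using that[of "max B1 B2" "max C1 C2"] bounded_by_mono[OF 1(3), of M "max B1 B2" "max C1 C2"]
      bounded_by_mono[OF 2(3), of M "max B1 B2" "max C1 C2"] 1 2 by auto
qed

lemma growth_add: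
  assumes "growth S" "growth T" shows "growth (\<lambda>w. S w + T w)"
  unfolding growth_def
proof
  fix M
  obtain B C where BC: "0 \<le> B" "1 \<le> C" "bounded_by M B C S" "bounded_by M B C T" using assms by (rule growth_pair)
  have "bounded_by M (B + B) C (\<lambda>w. S w + T w)"
    unfolding bounded_by_def
  proof (intro allI impI)
    fix w assume "\<forall>a\<in>set w. index_of a \<le> M"
    then have "norm (S w) \<le> B * C ^ length w" "norm (T w) \<le> B * C ^ length w"
      using BC(3,4) by (auto simp: bounded_by_def)
    then show "norm (S w + T w) \<le> (B + B) * C ^ length w"
      using norm_triangle_ineq[of "S w" "T w"] by (simp add: distrib_right)
  qed
  then show "\<exists>B C. 0 \<le> B \<and> 1 \<le> C \<and> bounded_by M B C (\<lambda>w. S w + T w)" using BC by (intro exI[of _ "B + B"] exI[of _ C]) auto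
qed

lemma growth_scale:
  assumes "growth S" shows "growth (\<lambda>w. c * S w)"
  unfolding growth_def
proof
  fix M
  obtain B C where BC: "0 \<le> B" "1 \<le> C" "bounded_by M B C S" using assms growth_def by blast
  have "bounded_by M (norm c * B) C (\<lambda>w. c * S w)"
    using BC(3) by (auto simp: bounded_by_def norm_mult mult.assoc intro!: mult_left_mono)
  then show "\<exists>B C. 0 \<le> B \<and> 1 \<le> C \<and> bounded_by M B C (\<lambda>w. c * S w)" using BC by (intro exI[of _ "norm c * B"] exI[of _ C]) auto
qed

lemma growth_word: "growth (word_series u)"
  unfolding growth_def bounded_by_def word_series_def by (auto intro!: exI[of _ 1])

lemma growth_zero: "growth (\<lambda>w. 0)"
  using growth_scale[OF growth_word, of 0] by simp

lemma growth_sum: "(\<And>i. i \<in> I \<Longrightarrow> growth (S i)) \<Longrightarrow> growth (\<lambda>w. \<Sum>i\<in>I. S i w)"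
  by (induction I rule: infinite_finite_induct) (auto intro: growth_zero growth_add)

text \<open>The ratio counts the origins of a letter: it is taken from one of the two factors, each
  at the cost C, or merged from two letters in at most M ways, at the cost C ^ 2.\<close>

lemma bounded_by_stuffle:
  assumes C: "1 \<le> C"
  shows "bounded_by M B C S \<Longrightarrow> bounded_by M B' C T \<Longrightarrow> 0 \<le> B \<Longrightarrow> 0 \<le> B' \<Longrightarrow>
    (\<forall>a\<in>set w. index_of a \<le> M) \<Longrightarrow> norm (stuffle S T w) \<le> B * B' * (2 * C + real M * C\<^sup>2) ^ length w"
proof (induction w arbitrary: S T B B')
  case Nil
  have "norm (S []) \<le> B" using Nil(1) by (auto simp: bounded_by_def dest: spec[of _ "[]"])
  moreover have "norm (T []) \<le> B'" using Nil(2) by (auto simp: bounded_by_def dest: spec[of _ "[]"])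
  ultimately show ?case using Nil by (auto simp: norm_mult intro!: mult_mono)
next
  case (Cons c w)
  define D where "D = (2 * C + real M * C\<^sup>2) ^ length w"
  have c: "index_of c \<le> M" and w: "\<forall>a\<in>set w. index_of a \<le> M" using Cons.prems by auto
  have D: "0 \<le> D" using C by (simp add: D_def)
  have shift: "bounded_by M (A * C) C (\<lambda>x. R (a # x))" if "bounded_by M A C R" "index_of a \<le> M" for A R a
    unfolding bounded_by_def
  proof (intro allI impI)
    fix w assume "\<forall>a\<in>set w. index_of a \<le> M"
    then show "norm (R (a # w)) \<le> A * C * C ^ length w"
      using that(1)[unfolded bounded_by_def, rule_format, of "a # w"] that(2) by (auto simp: mult.assoc)
  qed
  have n1: "norm (stuffle (\<lambda>x. S (c # x)) T w) \<le> (B * C) * B' * D"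
    unfolding D_def using Cons.prems C c w by (intro Cons.IH shift) auto
  have n2: "norm (stuffle S (\<lambda>x. T (c # x)) w) \<le> B * (B' * C) * D"
    unfolding D_def using Cons.prems C c w by (intro Cons.IH shift) auto
  have n3: "norm (stuffle (\<lambda>x. S (a # x)) (\<lambda>x. T (b # x)) w) \<le> (B * C) * (B' * C) * D" if "(a, b) \<in> splittings c" for a b
    unfolding D_def using Cons.prems C c w splittings_le[OF that] by (intro Cons.IH shift) auto
  have "norm (\<Sum>(a, b)\<in>splittings c. stuffle (\<lambda>x. S (a # x)) (\<lambda>x. T (b # x)) w)
      \<le> (\<Sum>(a, b)\<in>splittings c. (B * C) * (B' * C) * D)"
    by (rule sum_norm_le) (use n3 in auto)
  also have "\<dots> = real (card (splittings c)) * ((B * C) * (B' * C) * D)" by (simp add: case_prod_unfold)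
  also have "\<dots> \<le> real M * ((B * C) * (B' * C) * D)"
    using card_splittings[of c] c Cons.prems C D by (intro mult_right_mono mult_nonneg_nonneg) auto
  finally have "norm (stuffle S T (c # w)) \<le> (B * C) * B' * D + B * (B' * C) * D + real M * ((B * C) * (B' * C) * D)"
    unfolding stuffle_Cons using n1 n2 by (intro order_trans[OF norm_triangle_ineq] add_mono) auto
  also have "\<dots> = B * B' * (2 * C + real M * C\<^sup>2) ^ length (c # w)"
  proof -
    have e: "(2 * C + real M * C\<^sup>2) ^ length (c # w) = (2 * C + real M * C\<^sup>2) * D" by (simp add: D_def)
    show ?thesis unfolding e by (simp add: algebra_simps power2_eq_square)
  qed
  finally show ?case .
qed

lemma growth_stuffle:
  assumes "growth S" "growth T" shows "growth (stuffle S T)"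
  unfolding growth_def
proof
  fix M
  obtain B C where BC: "0 \<le> B" "1 \<le> C" "bounded_by M B C S" "bounded_by M B C T" using assms by (rule growth_pair)
  have "bounded_by M (B * B) (2 * C + real M * C\<^sup>2) (stuffle S T)"
    unfolding bounded_by_def using bounded_by_stuffle[OF BC(2,3,4) BC(1) BC(1)] by blast
  moreover have "1 \<le> 2 * C + real M * C\<^sup>2" using BC(2) by (simp add: add_increasing2)
  ultimately show "\<exists>B C. 0 \<le> B \<and> 1 \<le> C \<and> bounded_by M B C (stuffle S T)" using BC
    by (intro exI[of _ "B * B"] exI[of _ "2 * C + real M * C\<^sup>2"]) auto
qed

text \<open>Operator bound of \<open>der \<xi>\<close> on series of ratio C. The ratio itself is
  unchanged by the derivation, so iterates are controlled by powers of this number and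
  \<open>expd\<close> by its exponential.\<close>

definition der_norm :: "real \<Rightarrow> yletter series \<Rightarrow> real" where
  "der_norm C \<xi> = (\<Sum>u | \<xi> u \<noteq> 0. norm (\<xi> u) * C ^ length u)"

lemma der_norm_nonneg: "0 \<le> C \<Longrightarrow> 0 \<le> der_norm C \<xi>"
  by (simp add: der_norm_def sum_nonneg)

lemma bounded_by_der:
  assumes "bounded_by M B C S" "\<And>u. \<xi> u \<noteq> 0 \<Longrightarrow> weight u \<le> M"
  shows "bounded_by M (B * der_norm C \<xi>) C (der \<xi> S)"
  unfolding bounded_by_def
proof (intro allI impI)
  fix w assume w: "\<forall>a\<in>set w. index_of a \<le> M"
  have "norm (der \<xi> S w) \<le> (\<Sum>u | \<xi> u \<noteq> 0. norm (\<xi> u) * (B * C ^ length (u @ w)))"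
    unfolding der_def
  proof (rule sum_norm_le)
    fix u assume u: "u \<in> {u. \<xi> u \<noteq> 0}"
    have "index_of a \<le> M" if "a \<in> set u" for a using index_le_weight[OF that] assms(2)[of u] u by simp
    then have "\<forall>a\<in>set (u @ w). index_of a \<le> M" using w by auto
    then show "norm (\<xi> u * S (u @ w)) \<le> norm (\<xi> u) * (B * C ^ length (u @ w))"
      using assms(1)[unfolded bounded_by_def, rule_format, of "u @ w"] by (auto simp: norm_mult intro!: mult_left_mono)
  qed
  also have "\<dots> = B * der_norm C \<xi> * C ^ length w"
    by (simp add: der_norm_def sum_distrib_left sum_distrib_right power_add mult_ac)
  finally show "norm (der \<xi> S w) \<le> B * der_norm C \<xi> * C ^ length w" .
qed

lemma bounded_by_dpow:
  assumes "bounded_by M B C S" "\<And>u. \<xi> u \<noteq> 0 \<Longrightarrow> weight u \<le> M"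
  shows "bounded_by M (B * (der_norm C \<xi> ^ n / fact n)) C (dpow \<xi> n S)"
proof (induction n)
  case (Suc n)
  from bounded_by_der[OF Suc assms(2)] show ?case
    by (auto simp: bounded_by_def norm_divide field_simps simp del: of_nat_Suc)
qed (use assms in simp)

lemma support_bound:
  assumes "finite {u. \<xi> u \<noteq> 0}" obtains M where "\<And>u. \<xi> u \<noteq> 0 \<Longrightarrow> weight u \<le> M" "N \<le> M"
proof -
  have "finite (insert N (weight ` {u. \<xi> u \<noteq> 0}))" using assms by simp
  then show ?thesis by (intro that[of "Max (insert N (weight ` {u. \<xi> u \<noteq> 0}))"] Max_ge) auto
qed

lemma exp_series_real: "(\<lambda>n. x ^ n / fact n) sums exp (x::real)"
  using exp_converges[of x] by (simp add: divide_inverse mult.commute)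

lemma growth_letters:
  assumes "growth S" "finite {u. \<xi> u \<noteq> 0}"
  obtains B C M where "0 \<le> B" "1 \<le> C" "bounded_by M B C S" "\<forall>u. \<xi> u \<noteq> 0 \<longrightarrow> weight u \<le> M" "N \<le> M"
  using assms unfolding growth_def by (metis support_bound)

lemma expd_bound:
  assumes BC: "0 \<le> B" "1 \<le> C" "bounded_by M B C S" and M: "\<And>u. \<xi> u \<noteq> 0 \<Longrightarrow> weight u \<le> M"
  shows "bounded_by M (B * exp (der_norm C \<xi>)) C (expd \<xi> S)"
    and "(\<forall>a\<in>set v. index_of a \<le> M) \<Longrightarrow> summable (\<lambda>n. norm (dpow \<xi> n S v))"
proof -
  define X where "X = der_norm C \<xi>"
  have le: "norm (dpow \<xi> n S v) \<le> (B * C ^ length v) * (X ^ n / fact n)" if v: "\<forall>a\<in>set v. index_of a \<le> M" for v n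
  proof -
    have "bounded_by M (B * (X ^ n / fact n)) C (dpow \<xi> n S)"
      unfolding X_def by (rule bounded_by_dpow[OF BC(3)]) (use M in auto)
    then show ?thesis using v by (simp add: bounded_by_def mult_ac)
  qed
  have sums: "(\<lambda>n. (B * C ^ length v) * (X ^ n / fact n)) sums ((B * C ^ length v) * exp X)" for v :: "yletter list"
    by (intro sums_mult exp_series_real)
  show summ: "summable (\<lambda>n. norm (dpow \<xi> n S v))" if "\<forall>a\<in>set v. index_of a \<le> M" for v
    by (rule summable_comparison_test[OF _ sums_summable[OF sums[of v]]]) (use le[OF that] in auto)
  show "bounded_by M (B * exp (der_norm C \<xi>)) C (expd \<xi> S)"
    unfolding bounded_by_def
  proof (intro allI impI)
    fix v assume v: "\<forall>a\<in>set v. index_of a \<le> M"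
    have "norm (expd \<xi> S v) \<le> (\<Sum>n. norm (dpow \<xi> n S v))"
      unfolding expd_def by (rule summable_norm[OF summ[OF v]])
    also have "\<dots> \<le> (\<Sum>n. (B * C ^ length v) * (X ^ n / fact n))"
      by (intro suminf_le le v summ sums_summable[OF sums])
    also have "\<dots> = B * exp (der_norm C \<xi>) * C ^ length v" using sums_unique[OF sums[of v]] by (simp add: X_def mult_ac)
    finally show "norm (expd \<xi> S v) \<le> B * exp (der_norm C \<xi>) * C ^ length v" .
  qed
qed

lemma growth_expd:
  assumes "growth S" "finite {u. \<xi> u \<noteq> 0}" shows "growth (expd \<xi> S)"
  unfolding growth_def
proof
  fix N
  obtain B C M where *: "0 \<le> B" "1 \<le> C" "bounded_by M B C S" "\<forall>u. \<xi> u \<noteq> 0 \<longrightarrow> weight u \<le> M" "N \<le> M"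
    using assms by (rule growth_letters[where N = N])
  have "bounded_by M (B * exp (der_norm C \<xi>)) C (expd \<xi> S)" by (rule expd_bound) (use * in auto)
  then have "bounded_by N (B * exp (der_norm C \<xi>)) C (expd \<xi> S)" using * by (elim bounded_by_mono) auto
  then show "\<exists>B C. 0 \<le> B \<and> 1 \<le> C \<and> bounded_by N B C (expd \<xi> S)" using * by (metis exp_ge_zero mult_nonneg_nonneg)
qed

lemma summable_dpow:
  assumes "growth S" "finite {u. \<xi> u \<noteq> 0}"
  shows "summable (\<lambda>n. norm (dpow \<xi> n S v))" "summable (\<lambda>n. dpow \<xi> n S v)"
proof -
  obtain B C M where *: "0 \<le> B" "1 \<le> C" "bounded_by M B C S" "\<forall>u. \<xi> u \<noteq> 0 \<longrightarrow> weight u \<le> M" "weight v \<le> M"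
    using assms by (rule growth_letters[where N = "weight v"])
  show "summable (\<lambda>n. norm (dpow \<xi> n S v))"
    by (rule expd_bound(2)[of B C M]) (use * index_le_weight in \<open>auto intro: order_trans\<close>)
  then show "summable (\<lambda>n. dpow \<xi> n S v)" by (rule summable_norm_cancel)
qed

lemma expd_add:
  assumes "growth S" "growth T" "finite {u. \<xi> u \<noteq> 0}"
  shows "expd \<xi> (\<lambda>w. S w + T w) = (\<lambda>w. expd \<xi> S w + expd \<xi> T w)"
  using summable_dpow[OF assms(1,3)] summable_dpow[OF assms(2,3)] by (simp add: expd_def dpow_add suminf_add)

lemma expd_scale:
  assumes "growth S" "finite {u. \<xi> u \<noteq> 0}"
  shows "expd \<xi> (\<lambda>w. c * S w) = (\<lambda>w. c * expd \<xi> S w)"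
  using suminf_mult[OF summable_dpow(2)[OF assms]] by (simp add: expd_def dpow_scale)

text \<open>The exponential of a derivation is multiplicative: absolute convergence turns the
  Leibniz rule for divided powers into a Cauchy product, and a coefficient of the stuffle product
  involves only finitely many pairs of words.\<close>

lemma expd_stuffle:
  assumes "growth S" "growth T" and p: "primitive \<xi>"
  shows "expd \<xi> (stuffle S T) = stuffle (expd \<xi> S) (expd \<xi> T)"
proof
  fix w
  have fin: "finite {u. \<xi> u \<noteq> 0}" using p by (simp add: primitive_def)
  define A where "A = {(u, v). stuffle_words u v w \<noteq> 0}"
  have "(\<lambda>n. \<Sum>i\<le>n. dpow \<xi> i S u * dpow \<xi> (n - i) T v) sums (expd \<xi> S u * expd \<xi> T v)" for u v
    unfolding expd_def by (intro Cauchy_product_sums summable_dpow assms fin)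
  then have "(\<lambda>n. \<Sum>(u, v)\<in>A. (\<Sum>i\<le>n. dpow \<xi> i S u * dpow \<xi> (n - i) T v) * stuffle_words u v w)
      sums (\<Sum>(u, v)\<in>A. expd \<xi> S u * expd \<xi> T v * stuffle_words u v w)"
    unfolding case_prod_unfold by (intro sums_sum sums_mult2)
  moreover have "(\<Sum>(u, v)\<in>A. (\<Sum>i\<le>n. dpow \<xi> i S u * dpow \<xi> (n - i) T v) * stuffle_words u v w) = dpow \<xi> n (stuffle S T) w" for n
  proof -
    have "dpow \<xi> n (stuffle S T) w = (\<Sum>i\<le>n. \<Sum>(u, v)\<in>A. dpow \<xi> i S u * dpow \<xi> (n - i) T v * stuffle_words u v w)"
      unfolding dpow_stuffle[OF p] by (simp only: stuffle_def A_def)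
    then show ?thesis unfolding case_prod_unfold sum_distrib_right by (simp only: sum.swap[of _ A])
  qed
  ultimately have "(\<lambda>n. dpow \<xi> n (stuffle S T) w) sums stuffle (expd \<xi> S) (expd \<xi> T) w"
    by (simp add: stuffle_def A_def)
  then show "expd \<xi> (stuffle S T) w = stuffle (expd \<xi> S) (expd \<xi> T) w"
    unfolding expd_def by (rule sums_unique[symmetric])
qed

lemma expd_nilpotent:
  assumes "der \<xi> (der \<xi> S) = (\<lambda>w. 0)"
  shows "expd \<xi> S = (\<lambda>v. S v + der \<xi> S v)"
proof -
  have "dpow \<xi> (Suc (Suc n)) S = (\<lambda>w. 0)" for n
    by (induction n) (simp_all add: assms der_divide)
  then have z: "dpow \<xi> n S = (\<lambda>w. 0)" if "n \<notin> {0, 1}" for n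
    using that by (metis One_nat_def insertI1 insertI2 not0_implies_Suc)
  have "(\<lambda>n. dpow \<xi> n S v) sums (\<Sum>n\<in>{0, 1}. dpow \<xi> n S v)" for v
    by (rule sums_finite) (use z in auto)
  then show ?thesis by (auto simp: expd_def fun_eq_iff sums_iff)
qed

subsection \<open>Rational series and regularised summation\<close>

definition lspan :: "'a series set \<Rightarrow> 'a series set" where
  "lspan B = {S. \<exists>c. S = (\<lambda>w. \<Sum>V\<in>B. c V * V w)}"

lemma lspan_base: "finite B \<Longrightarrow> V \<in> B \<Longrightarrow> V \<in> lspan B"
  unfolding lspan_def by (rule CollectI, rule exI[of _ "\<lambda>W. if W = V then 1 else 0"]) (auto simp: if_distrib[of "\<lambda>x. x * _"] cong: if_cong)

lemma lspan_zero: "(\<lambda>w. 0) \<in> lspan B"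
  unfolding lspan_def by (rule CollectI, rule exI[of _ "\<lambda>W. 0"]) auto

lemma lspan_add: "S \<in> lspan B \<Longrightarrow> T \<in> lspan B \<Longrightarrow> (\<lambda>w. S w + T w) \<in> lspan B"
proof -
  assume "S \<in> lspan B" "T \<in> lspan B"
  then obtain c d where "S = (\<lambda>w. \<Sum>V\<in>B. c V * V w)" "T = (\<lambda>w. \<Sum>V\<in>B. d V * V w)" by (auto simp: lspan_def)
  then have "(\<lambda>w. S w + T w) = (\<lambda>w. \<Sum>V\<in>B. (c V + d V) * V w)" by (simp add: distrib_right sum.distrib)
  then show ?thesis by (auto simp: lspan_def)
qed

lemma lspan_scale: "S \<in> lspan B \<Longrightarrow> (\<lambda>w. c * S w) \<in> lspan B"
proof -
  assume "S \<in> lspan B"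
  then obtain d where "S = (\<lambda>w. \<Sum>V\<in>B. d V * V w)" by (auto simp: lspan_def)
  then have "(\<lambda>w. c * S w) = (\<lambda>w. \<Sum>V\<in>B. (c * d V) * V w)" by (simp add: sum_distrib_left mult.assoc)
  then show ?thesis by (auto simp: lspan_def)
qed

lemma lspan_sum: "(\<And>i. i \<in> I \<Longrightarrow> S i \<in> lspan B) \<Longrightarrow> (\<lambda>w. \<Sum>i\<in>I. S i w) \<in> lspan B"
  by (induction I rule: infinite_finite_induct) (auto intro: lspan_zero lspan_add)

lemma lspan_lspan:
  assumes "S \<in> lspan B" "\<And>V. V \<in> B \<Longrightarrow> F V \<in> lspan B'"
    "\<And>c. F (\<lambda>w. \<Sum>V\<in>B. c V * V w) = (\<lambda>w. \<Sum>V\<in>B. c V * F V w)"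
  shows "F S \<in> lspan B'"
proof -
  obtain c where "S = (\<lambda>w. \<Sum>V\<in>B. c V * V w)" using assms(1) by (auto simp: lspan_def)
  then have eq: "F S = (\<lambda>w. \<Sum>V\<in>B. c V * F V w)" by (simp only: assms(3))
  show ?thesis unfolding eq by (intro lspan_sum lspan_scale assms(2))
qed

lemma lspan_mono: "finite B' \<Longrightarrow> B \<subseteq> B' \<Longrightarrow> S \<in> lspan B \<Longrightarrow> S \<in> lspan B'"
  by (rule lspan_lspan[of S B "\<lambda>S. S"]) (auto intro: lspan_base)

text \<open>Finitely many generators of a space stable under removing first letters, that is the
  states of a linear automaton.\<close>

definition closed_space :: "'a series set \<Rightarrow> bool" where
  "closed_space B \<longleftrightarrow> finite B \<and> (\<forall>V\<in>B. \<forall>a. (\<lambda>w. V (a # w)) \<in> lspan B)"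

lemma closed_space_quotient: "closed_space B \<Longrightarrow> S \<in> lspan B \<Longrightarrow> (\<lambda>w. S (a # w)) \<in> lspan B"
  by (rule lspan_lspan[of S B "\<lambda>S w. S (a # w)"]) (auto simp: closed_space_def)

lemma closed_space_quotients: "closed_space B \<Longrightarrow> S \<in> lspan B \<Longrightarrow> (\<lambda>w. S (u @ w)) \<in> lspan B"
  by (induction u arbitrary: S) (auto dest: closed_space_quotient)

lemma conc_sum_left: "conc (\<lambda>x. \<Sum>i\<in>I. c i * S i x) T w = (\<Sum>i\<in>I. c i * conc (S i) T w)"
  unfolding conc_def sum_distrib_right sum_distrib_left mult.assoc by (rule sum.swap)

lemma conc_sum_right: "conc S (\<lambda>x. \<Sum>i\<in>I. T i x) w = (\<Sum>i\<in>I. conc S (T i) w)"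
  unfolding conc_def sum_distrib_left by (rule sum.swap)

lemma conc_power_short:
  assumes "S [] = 0" "length w < n" shows "conc_power S n w = 0"
  using assms(2)
proof (induction n arbitrary: w)
  case (Suc n)
  show ?case
  proof (cases w)
    case (Cons a w')
    have "conc_power S n (drop i w') = 0" for i using Suc Cons by (intro Suc.IH) auto
    then have "conc (\<lambda>x. S (a # x)) (conc_power S n) w' = 0" by (simp add: conc_def)
    then show ?thesis by (simp add: Cons conc_Cons assms(1))
  qed (simp add: assms(1))
qed simp

lemma star_eq_sum:
  assumes "S [] = 0" "length w \<le> N" shows "star S w = (\<Sum>n\<le>N. conc_power S n w)"
  unfolding star_def by (rule suminf_finite) (use assms in \<open>auto intro!: conc_power_short\<close>)

lemma star_Cons:
  assumes "S [] = 0" shows "star S (a # w) = conc (\<lambda>x. S (a # x)) (star S) w"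
proof -
  have "star S (a # w) = (\<Sum>n\<le>Suc (length w). conc_power S n (a # w))"
    by (rule star_eq_sum) (use assms in auto)
  also have "\<dots> = (\<Sum>n\<le>length w. conc (\<lambda>x. S (a # x)) (conc_power S n) w)"
    by (subst sum.atMost_Suc_shift) (simp add: conc_Cons assms word_series_def)
  also have "\<dots> = conc (\<lambda>x. S (a # x)) (\<lambda>x. \<Sum>n\<le>length w. conc_power S n x) w"
    by (rule conc_sum_right[symmetric])
  also have "\<dots> = conc (\<lambda>x. S (a # x)) (star S) w"
    unfolding conc_def by (intro sum.cong refl) (use star_eq_sum[of S _ "length w"] assms in auto)
  finally show ?thesis .
qed

text \<open>One half of the Kleene-Schuetzenberger theorem. For a product, removing a letter acts on
  the left factor, or on the right one if the left contributes its constant term; for a star, the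
  letter is removed from the first factor. So adjoining the products of the old generators with the
  right factor, or with the star, suffices.\<close>

lemma rational_closed_space:
  assumes "S \<in> rational_series" shows "\<exists>B. closed_space B \<and> S \<in> lspan B"
  using assms
proof induction
  case (degree_one S)
  let ?B = "{S, word_series []}"
  have "(\<lambda>w. S (a # w)) \<in> lspan ?B" for a
  proof -
    have "(\<lambda>w. S (a # w)) = (\<lambda>w. S [a] * word_series [] w)"
      using degree_one by (auto simp: word_series_def fun_eq_iff)
    then show ?thesis by (simp add: lspan_scale lspan_base)
  qed
  moreover have "(\<lambda>w. word_series [] (a # w)) \<in> lspan ?B" for a by (simp add: lspan_zero)
  ultimately show ?case by (intro exI[of _ ?B]) (auto simp: closed_space_def intro: lspan_base)
next
  case (scale S c)
  then show ?case by (auto simp: scale_series_def intro: lspan_scale)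
next
  case (add S T)
  then obtain B B' where B: "closed_space B" "S \<in> lspan B" "closed_space B'" "T \<in> lspan B'" by auto
  then have fin: "finite (B \<union> B')" by (simp add: closed_space_def)
  have "closed_space (B \<union> B')"
    using B lspan_mono[OF fin, of B] lspan_mono[OF fin, of B'] by (auto simp: closed_space_def)
  moreover have "add_series S T \<in> lspan (B \<union> B')"
    unfolding add_series_def by (intro lspan_add) (use B lspan_mono[OF fin] in auto)
  ultimately show ?case by blast
next
  case (conc S T)
  then obtain B B' where B: "closed_space B" "S \<in> lspan B" "closed_space B'" "T \<in> lspan B'" by auto
  define C where "C = (\<lambda>V. conc V T) ` B \<union> B'"
  have fin: "finite C" using B by (simp add: closed_space_def C_def)
  have lift: "conc R T \<in> lspan C" if "R \<in> lspan B" for R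
    using that by (rule lspan_lspan[where F = "\<lambda>R. conc R T"]) (use fin in \<open>auto simp: C_def conc_sum_left intro: lspan_base\<close>)
  have lift': "R \<in> lspan C" if "R \<in> lspan B'" for R using that by (rule lspan_mono[OF fin, rotated]) (simp add: C_def)
  have "(\<lambda>w. V (a # w)) \<in> lspan C" if VC: "V \<in> C" for V a
  proof (cases "V \<in> B'")
    case True
    then show ?thesis using B by (intro lift') (simp add: closed_space_def)
  next
    case False
    then obtain W where W: "W \<in> B" "V = conc W T" using VC by (auto simp: C_def)
    have "(\<lambda>w. W [] * T (a # w) + conc (\<lambda>x. W (a # x)) T w) \<in> lspan C"
      using B W by (intro lspan_add lspan_scale lift lift' closed_space_quotient) (auto simp: closed_space_def intro: lspan_base)
    then show ?thesis by (simp add: W conc_Cons)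
  qed
  then have "closed_space C" using fin by (simp add: closed_space_def)
  then show ?case using lift B by blast
next
  case (star S)
  then obtain B where B: "closed_space B" "S \<in> lspan B" by auto
  define C where "C = insert (star S) ((\<lambda>V. conc V (star S)) ` B)"
  have fin: "finite C" using B by (simp add: closed_space_def C_def)
  have lift: "conc R (star S) \<in> lspan C" if "R \<in> lspan B" for R
    using that by (rule lspan_lspan[where F = "\<lambda>R. conc R (star S)"]) (use fin in \<open>auto simp: C_def conc_sum_left intro: lspan_base\<close>)
  have st: "(\<lambda>w. star S (a # w)) \<in> lspan C" for a
    using lift[OF closed_space_quotient[OF B, of a]] by (simp add: star_Cons[of S] star.hyps)
  have "(\<lambda>w. V (a # w)) \<in> lspan C" if VC: "V \<in> C" for V a
  proof (cases "V = star S")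
    case True
    then show ?thesis using st by simp
  next
    case False
    then obtain W where W: "W \<in> B" "V = conc W (star S)" using VC by (auto simp: C_def)
    have "(\<lambda>w. W [] * star S (a # w) + conc (\<lambda>x. W (a # x)) (star S) w) \<in> lspan C"
      using B W by (intro lspan_add lspan_scale lift st) (auto simp: closed_space_def)
    then show ?thesis by (simp add: W conc_Cons)
  qed
  then have "closed_space C" using fin by (simp add: closed_space_def)
  moreover have "star S \<in> lspan C" using fin by (intro lspan_base) (auto simp: C_def)
  ultimately show ?case by blast
qed

text \<open>Removing a letter acts by a matrix on the generators, and finitely many letters give
  finitely many matrices with a common bound \<open>D\<close>.\<close>

lemma growth_closed_space:
  assumes B: "closed_space B" "S \<in> lspan B"
  shows "growth S"
proof -
  have fin: "finite B" using B by (simp add: closed_space_def)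
  have "\<forall>V a. \<exists>c. V \<in> B \<longrightarrow> (\<forall>w. V (a # w) = (\<Sum>W\<in>B. c W * W w))"
    using B(1) unfolding closed_space_def lspan_def by (auto simp: fun_eq_iff)
  then obtain c where c: "\<And>V a w. V \<in> B \<Longrightarrow> V (a # w) = (\<Sum>W\<in>B. c V a W * W w)" by metis
  have "growth V" if "V \<in> B" for V
    unfolding growth_def
  proof
    fix M
    define A where "A = {a. index_of a \<le> M}"
    have "finite A"
    proof (rule finite_subset)
      show "A \<subseteq> y ` {..M}" unfolding A_def using index_of_inverse by (metis atMost_iff image_eqI mem_Collect_eq subsetI)
    qed simp
    define D where "D = 1 + (\<Sum>V\<in>B. \<Sum>a\<in>A. \<Sum>W\<in>B. norm (c V a W))"
    define B0 where "B0 = (\<Sum>V\<in>B. norm (V []))"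
    have D1: "D \<ge> 1" by (simp add: D_def sum_nonneg)
    have Dge: "(\<Sum>W\<in>B. norm (c V a W)) \<le> D" if "V \<in> B" "a \<in> A" for V a
    proof -
      have "(\<Sum>W\<in>B. norm (c V a W)) \<le> (\<Sum>a\<in>A. \<Sum>W\<in>B. norm (c V a W))"
        using that \<open>finite A\<close> by (intro member_le_sum) (auto intro: sum_nonneg)
      also have "\<dots> \<le> (\<Sum>V\<in>B. \<Sum>a\<in>A. \<Sum>W\<in>B. norm (c V a W))"
        using that fin by (intro member_le_sum[of V B "\<lambda>V. \<Sum>a\<in>A. \<Sum>W\<in>B. norm (c V a W)"]) (auto intro!: sum_nonneg)
      finally show ?thesis by (simp add: D_def)
    qed
    have bound: "norm (V w) \<le> B0 * D ^ length w" if "V \<in> B" "\<forall>a\<in>set w. index_of a \<le> M" for V w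
      using that
    proof (induction w arbitrary: V)
      case Nil
      then show ?case using fin by (auto simp: B0_def intro!: member_le_sum)
    next
      case (Cons a w)
      have "norm (V (a # w)) \<le> (\<Sum>W\<in>B. norm (c V a W) * (B0 * D ^ length w))"
        unfolding c[OF Cons.prems(1)]
        by (rule sum_norm_le) (use Cons in \<open>auto simp: norm_mult intro!: mult_left_mono\<close>)
      also have "\<dots> = (\<Sum>W\<in>B. norm (c V a W)) * (B0 * D ^ length w)" by (simp add: sum_distrib_right)
      also have "\<dots> \<le> D * (B0 * D ^ length w)"
        using Cons.prems D1 by (intro mult_right_mono Dge) (auto simp: A_def B0_def sum_nonneg)
      finally show ?case by (simp add: mult_ac)
    qed
    have "bounded_by M B0 D V" using bound \<open>V \<in> B\<close> by (simp add: bounded_by_def)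
    moreover have "0 \<le> B0" by (simp add: B0_def sum_nonneg)
    ultimately show "\<exists>B C. 0 \<le> B \<and> 1 \<le> C \<and> bounded_by M B C V" using D1 by blast
  qed
  moreover obtain d where "S = (\<lambda>w. \<Sum>V\<in>B. d V * V w)" using B(2) by (auto simp: lspan_def)
  ultimately show ?thesis by (simp add: growth_sum growth_scale)
qed

text \<open>A basis of the space of summable sequences is independent among all sequences, so the
  linear functional prescribed by \<open>suminf\<close> on it extends. Compatibility with finite
  sums, in particular, is what \<open>adapted_exists\<close> uses.\<close>

lemma summation_functional:
  obtains \<rho> :: "(nat \<Rightarrow> complex) \<Rightarrow> complex" where
    "\<And>f g. \<rho> (\<lambda>n. f n + g n) = \<rho> f + \<rho> g" "\<And>c f. \<rho> (\<lambda>n. c * f n) = c * \<rho> f"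
    "\<And>f. summable f \<Longrightarrow> \<rho> f = suminf f"
proof -
  define s1 where "s1 = (\<lambda>(c::complex) (f::nat \<Rightarrow> complex) n. c * f n)"
  interpret v1: vector_space s1
    by unfold_locales (auto simp: s1_def fun_eq_iff algebra_simps)
  interpret v2: vector_space "(*) :: complex \<Rightarrow> complex \<Rightarrow> complex"
    by unfold_locales (auto simp: algebra_simps)
  interpret p: vector_space_pair s1 "(*) :: complex \<Rightarrow> complex \<Rightarrow> complex" by unfold_locales
  obtain B where B: "B \<subseteq> {f. summable f}" "v1.independent B" "{f. summable f} \<subseteq> v1.span B"
    using v1.maximal_independent_subset by blast
  obtain \<rho> where lin: "Vector_Spaces.linear s1 (*) \<rho>" and \<rho>: "\<And>f. f \<in> B \<Longrightarrow> \<rho> f = suminf f"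
    using p.linear_independent_extend[OF B(2), of suminf] by auto
  have add: "\<rho> (\<lambda>n. f n + g n) = \<rho> f + \<rho> g" for f g
    using p.linear_add[OF lin, of f g] by (simp add: plus_fun_def)
  have scale: "\<rho> (\<lambda>n. c * f n) = c * \<rho> f" for c f
    using p.linear_scale[OF lin, of c f] by (simp add: s1_def)
  have "summable f \<and> \<rho> f = suminf f" if "f \<in> v1.span B" for f
    using that
  proof (induction rule: v1.span_induct_alt)
    case base
    show ?case using p.linear_0[OF lin] by (simp add: zero_fun_def)
  next
    case (step c x y)
    then have "summable x" "\<rho> x = suminf x" "summable y" "\<rho> y = suminf y" using B(1) \<rho> by auto
    then show ?case using add[of "s1 c x" y] scale[of c x]
      by (simp add: plus_fun_def s1_def suminf_add[symmetric] suminf_mult summable_add summable_mult)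
  qed
  then have "\<rho> f = suminf f" if "summable f" for f using that B(3) by blast
  then show ?thesis using that[of \<rho>] add scale by blast
qed

definition pairing :: "(nat \<Rightarrow> complex) \<Rightarrow> (nat \<Rightarrow> complex) \<Rightarrow> complex" where
  "pairing b l = (\<Sum>k | b k \<noteq> 0. b k * l k)"

lemma pairing_superset: "finite U \<Longrightarrow> {k. b k \<noteq> 0} \<subseteq> U \<Longrightarrow> pairing b l = (\<Sum>k\<in>U. b k * l k)"
  unfolding pairing_def by (rule sum.mono_neutral_left) auto

text \<open>Gaussian elimination: a finite system of linear conditions on finitely supported weights
  is solvable as soon as every linear relation between the sequences is respected by the prescribed
  values.\<close>

lemma pairing_exists:
  fixes l :: "'i \<Rightarrow> nat \<Rightarrow> complex"
  assumes "finite I" "\<And>c. (\<And>k. (\<Sum>i\<in>I. c i * l i k) = 0) \<Longrightarrow> (\<Sum>i\<in>I. c i * f i) = 0"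
  shows "\<exists>b. finite {k. b k \<noteq> 0} \<and> (\<forall>i\<in>I. pairing b (l i) = f i)"
  using assms
proof (induction I arbitrary: l f rule: finite_induct)
  case empty
  show ?case by (rule exI[of _ "\<lambda>k. 0"]) simp
next
  case (insert i0 I)
  have ins: "(\<Sum>i\<in>insert i0 I. (if i = i0 then d else c i) * g i) = d * g i0 + (\<Sum>i\<in>I. c i * g i)" for d c and g :: "'i \<Rightarrow> complex"
  proof -
    have "(\<Sum>i\<in>I. (if i = i0 then d else c i) * g i) = (\<Sum>i\<in>I. c i * g i)"
      using insert.hyps by (intro sum.cong) auto
    then show ?thesis using insert.hyps by simp
  qed
  show ?case
  proof (cases "\<forall>k. l i0 k = 0")
    case True
    have f0: "f i0 = 0"
      using insert.prems[of "\<lambda>i. if i = i0 then 1 else 0"] True by (simp only: ins) simp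
    have "\<exists>b. finite {k. b k \<noteq> 0} \<and> (\<forall>i\<in>I. pairing b (l i) = f i)"
    proof (rule insert.IH)
      fix c assume "\<And>k. (\<Sum>i\<in>I. c i * l i k) = 0"
      then show "(\<Sum>i\<in>I. c i * f i) = 0"
        using insert.prems[of "\<lambda>i. if i = i0 then 0 else c i"] by (simp only: ins) simp
    qed
    then show ?thesis using True f0 by (auto simp: pairing_def)
  next
    case False
    then obtain k0 where k0: "l i0 k0 \<noteq> 0" by blast
    \<comment> \<open>Pivot at k0: the remaining sequences are made to vanish there, so the weight
      at k0 stays free to correct the condition for i0.\<close>
    define q where "q i = l i k0 / l i0 k0" for i
    have "\<exists>b. finite {k. b k \<noteq> 0} \<and> (\<forall>i\<in>I. pairing b (\<lambda>k. l i k - q i * l i0 k) = f i - q i * f i0)"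
    proof (rule insert.IH)
      fix c assume z: "\<And>k. (\<Sum>i\<in>I. c i * (l i k - q i * l i0 k)) = 0"
      have *: "- (\<Sum>i\<in>I. c i * q i) * g i0 + (\<Sum>i\<in>I. c i * g i) = (\<Sum>i\<in>I. c i * (g i - q i * g i0))" for g :: "'i \<Rightarrow> complex"
        by (simp add: right_diff_distrib sum_subtractf sum_distrib_right mult.assoc)
      show "(\<Sum>i\<in>I. c i * (f i - q i * f i0)) = 0"
      proof -
        have zz: "- (\<Sum>i\<in>I. c i * q i) * l i0 k + (\<Sum>i\<in>I. c i * l i k) = 0" for k
          using *[of "\<lambda>i. l i k"] z[of k] by simp
        have "- (\<Sum>i\<in>I. c i * q i) * f i0 + (\<Sum>i\<in>I. c i * f i) = 0"
          using insert.prems[of "\<lambda>i. if i = i0 then - (\<Sum>i\<in>I. c i * q i) else c i"] unfolding ins using zz by blast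
        then show ?thesis using *[of f] by simp
      qed
    qed
    then obtain b where b: "finite {k. b k \<noteq> 0}" "\<And>i. i \<in> I \<Longrightarrow> pairing b (\<lambda>k. l i k - q i * l i0 k) = f i - q i * f i0"
      by blast
    define r where "r = (f i0 - pairing b (l i0)) / l i0 k0"
    define b' where "b' k = b k + (if k = k0 then r else 0)" for k
    define U where "U = insert k0 {k. b k \<noteq> 0}"
    have U: "finite U" "{k. b k \<noteq> 0} \<subseteq> U" "{k. b' k \<noteq> 0} \<subseteq> U" using b(1) by (auto simp: U_def b'_def)
    have pb': "pairing b' g = pairing b g + r * g k0" for g
    proof -
      have "(\<Sum>k\<in>U. (if k = k0 then r else 0) * g k) = r * g k0"
        using U(1) by (simp add: if_distrib[of "\<lambda>x. x * _"] sum.delta U_def cong: if_cong)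
      then show ?thesis unfolding pairing_superset[OF U(1,2)] pairing_superset[OF U(1,3)]
        by (simp add: b'_def distrib_right sum.distrib)
    qed
    have p0: "pairing b' (l i0) = f i0" using k0 by (simp add: pb' r_def)
    have "pairing b' (l i) = f i" if "i \<in> I" for i
    proof -
      have "pairing b' (l i) = pairing b' (\<lambda>k. l i k - q i * l i0 k) + q i * pairing b' (l i0)"
        by (simp add: pairing_def right_diff_distrib sum_subtractf sum_distrib_left mult_ac)
      then show ?thesis using k0 b(2)[OF that] by (simp add: p0) (simp add: pb' q_def)
    qed
    moreover have "finite {k. b' k \<noteq> 0}" using U finite_subset by blast
    ultimately show ?thesis using p0 by (intro exI[of _ b']) auto
  qed
qed

text \<open>Here \<open>\<rho>\<close> extends summation to all sequences; an adapted \<open>c\<close> imitates \<open>\<rho>\<close> on \<open>\<Lambda>\<close> by a finite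
  weighted sum.\<close>

definition adapted :: "((nat \<Rightarrow> complex) \<Rightarrow> complex) \<Rightarrow> nat \<Rightarrow> (nat \<Rightarrow> complex) set \<Rightarrow> (nat \<Rightarrow> complex) \<Rightarrow> bool" where
  "adapted \<rho> K \<Lambda> c \<longleftrightarrow> finite {k. c k \<noteq> 0} \<and> (\<forall>k\<le>K. c k = 1) \<and> (\<forall>l\<in>\<Lambda>. pairing c l = \<rho> l)"

text \<open>The weights up to K are fixed to 1, which leaves conditions on the shifted sequences.
  They are consistent: a combination vanishing beyond K has finite support, and there \<rho> is the
  ordinary sum.\<close>

lemma adapted_exists:
  assumes \<rho>: "\<And>f g. \<rho> (\<lambda>n. f n + g n) = \<rho> f + \<rho> g" "\<And>c f. \<rho> (\<lambda>n. c * f n) = c * \<rho> f"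
    "\<And>f. summable f \<Longrightarrow> \<rho> f = suminf f" and fin: "finite \<Lambda>"
  obtains c where "adapted \<rho> K \<Lambda> c"
proof -
  have \<rho>0: "\<rho> (\<lambda>n. 0) = 0" using \<rho>(3)[of "\<lambda>n. 0"] by simp
  have \<rho>sum: "\<rho> (\<lambda>n. \<Sum>i\<in>I. c i * i n) = (\<Sum>i\<in>I. c i * \<rho> i)" for I c
    by (induction I rule: infinite_finite_induct) (simp_all add: \<rho> \<rho>0)
  have "\<exists>b. finite {k. b k \<noteq> 0} \<and> (\<forall>i\<in>\<Lambda>. pairing b (\<lambda>k. i (k + Suc K)) = \<rho> i - (\<Sum>k\<le>K. i k))"
  proof (rule pairing_exists[OF fin])
    fix c assume z: "\<And>k. (\<Sum>i\<in>\<Lambda>. c i * i (k + Suc K)) = 0"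
    define g where "g n = (\<Sum>i\<in>\<Lambda>. c i * i n)" for n
    have "g n = 0" if "n \<notin> {..K}" for n
      using z[of "n - Suc K"] that by (simp add: g_def)
    then have "g sums (\<Sum>k\<le>K. g k)" by (intro sums_finite) auto
    then have "\<rho> g = (\<Sum>k\<le>K. g k)" using \<rho>(3)[of g] by (simp add: sums_iff)
    moreover have "\<rho> g = (\<Sum>i\<in>\<Lambda>. c i * \<rho> i)" unfolding g_def[abs_def] by (rule \<rho>sum)
    moreover have "(\<Sum>k\<le>K. g k) = (\<Sum>i\<in>\<Lambda>. c i * (\<Sum>k\<le>K. i k))"
      unfolding g_def sum_distrib_left by (rule sum.swap)
    ultimately show "(\<Sum>i\<in>\<Lambda>. c i * (\<rho> i - (\<Sum>k\<le>K. i k))) = 0"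
      by (simp add: right_diff_distrib sum_subtractf)
  qed
  then obtain b where b: "finite {k. b k \<noteq> 0}" "\<And>i. i \<in> \<Lambda> \<Longrightarrow> pairing b (\<lambda>k. i (k + Suc K)) = \<rho> i - (\<Sum>k\<le>K. i k)"
    by blast
  define c where "c k = (if k \<le> K then 1 else b (k - Suc K))" for k
  define U where "U = {..K} \<union> (\<lambda>k. k + Suc K) ` {k. b k \<noteq> 0}"
  have U: "finite U" "{k. c k \<noteq> 0} \<subseteq> U"
  proof -
    show "{k. c k \<noteq> 0} \<subseteq> U"
    proof
      fix k assume "k \<in> {k. c k \<noteq> 0}"
      then show "k \<in> U" by (cases "k \<le> K") (auto simp: U_def c_def image_iff intro!: exI[of _ "k - Suc K"])
    qed
  qed (use b(1) in \<open>simp add: U_def\<close>)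
  have "pairing c l = \<rho> l" if "l \<in> \<Lambda>" for l
  proof -
    have "pairing c l = (\<Sum>k\<in>U. c k * l k)" by (rule pairing_superset[OF U])
    also have "\<dots> = (\<Sum>k\<le>K. c k * l k) + (\<Sum>k\<in>(\<lambda>k. k + Suc K) ` {k. b k \<noteq> 0}. c k * l k)"
      unfolding U_def by (rule sum.union_disjoint) (use b(1) in auto)
    also have "(\<Sum>k\<in>(\<lambda>k. k + Suc K) ` {k. b k \<noteq> 0}. c k * l k) = pairing b (\<lambda>k. l (k + Suc K))"
      by (subst sum.reindex) (auto simp: inj_on_def pairing_def c_def)
    also have "(\<Sum>k\<le>K. c k * l k) = (\<Sum>k\<le>K. l k)" by (simp add: c_def)
    finally show ?thesis using b(2)[OF that] by simp
  qed
  moreover have "finite {k. c k \<noteq> 0}" using U finite_subset by blast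
  ultimately show ?thesis by (intro that[of c]) (auto simp: adapted_def c_def)
qed

lemma diagonal_sums:
  fixes f :: "nat \<Rightarrow> nat \<Rightarrow> complex"
  assumes bound: "\<And>j k. norm (f j k) \<le> a j * b k" and a: "summable a" "\<And>j. 0 \<le> a j"
    and b: "summable b" "\<And>k. 0 \<le> b k"
  shows "(\<lambda>n. \<Sum>i\<le>n. f i (n - i)) sums (\<Sum>j. \<Sum>k. f j k)"
proof -
  note D = double_sum_swap[of f a b, OF bound a b]
  obtain s where s: "((\<lambda>p. f (fst p) (snd p)) has_sum s) (UNIV \<times> UNIV)" using D(1) by (auto simp: summable_on_def)
  have row: "(f j has_sum (\<Sum>k. f j k)) UNIV" for j
  proof (rule norm_summable_imp_has_sum)
    show "summable (\<lambda>k. norm (f j k))"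
      by (rule summable_comparison_test[of _ "\<lambda>k. a j * b k"]) (use bound b in \<open>auto intro: summable_mult\<close>)
  qed (use D(2) in \<open>simp add: summable_sums\<close>)
  have "((\<lambda>j. \<Sum>k. f j k) has_sum s) UNIV"
    by (rule has_sum_SigmaD[OF s]) (use row in simp)
  then have s_eq: "s = (\<Sum>j. \<Sum>k. f j k)" using has_sum_imp_sums sums_unique by blast
  define g where "g = (\<lambda>(n, i). (i, n - i) :: nat \<times> nat)"
  have "bij_betw g (Sigma UNIV (\<lambda>n. {..n})) (UNIV \<times> UNIV)"
    by (rule bij_betw_byWitness[where f' = "\<lambda>(i, j). (i + j, i)"]) (auto simp: g_def)
  from has_sum_reindex_bij_betw[OF this, of "\<lambda>p. f (fst p) (snd p)" s] s
  have "((\<lambda>p. f (fst (g p)) (snd (g p))) has_sum s) (Sigma UNIV (\<lambda>n. {..n}))" by blast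
  then have "((\<lambda>n. \<Sum>i\<le>n. f i (n - i)) has_sum s) UNIV"
  proof (rule has_sum_SigmaD)
    show "((\<lambda>i. f (fst (g (n, i))) (snd (g (n, i)))) has_sum (\<Sum>i\<le>n. f i (n - i))) {..n}" for n
      by (rule has_sum_finiteI) (simp_all add: g_def)
  qed
  then show ?thesis unfolding s_eq by (rule has_sum_imp_sums)
qed

section \<open>Commuting derivations on exchangeable series\<close>

lemma der_plus:
  assumes "finite {u. \<xi> u \<noteq> 0}" "finite {u. \<eta> u \<noteq> 0}"
  shows "der (\<lambda>u. \<xi> u + \<eta> u) S v = der \<xi> S v + der \<eta> S v"
proof -
  let ?U = "{u. \<xi> u \<noteq> 0} \<union> {u. \<eta> u \<noteq> 0}"
  have U: "finite ?U" using assms by simp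
  have "{u. \<xi> u + \<eta> u \<noteq> 0} \<subseteq> ?U" by auto
  then have "der (\<lambda>u. \<xi> u + \<eta> u) S v = (\<Sum>u\<in>?U. (\<xi> u + \<eta> u) * S (u @ v))" by (rule der_superset[OF U])
  moreover have "der \<xi> S v = (\<Sum>u\<in>?U. \<xi> u * S (u @ v))" by (rule der_superset[OF U]) blast
  moreover have "der \<eta> S v = (\<Sum>u\<in>?U. \<eta> u * S (u @ v))" by (rule der_superset[OF U]) blast
  ultimately show ?thesis by (simp only: distrib_right sum.distrib)
qed

lemma exchangeable_der: "exchangeable G \<Longrightarrow> exchangeable (der \<xi> G)"
  unfolding exchangeable_def der_def
proof (intro allI impI)
  fix v v' :: "yletter list"
  assume G: "\<forall>u v. mset u = mset v \<longrightarrow> G u = G v" and "mset v = mset v'"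
  then have "mset (u @ v) = mset (u @ v')" for u by simp
  then have "G (u @ v) = G (u @ v')" for u using G by blast
  then show "(\<Sum>u | \<xi> u \<noteq> 0. \<xi> u * G (u @ v)) = (\<Sum>u | \<xi> u \<noteq> 0. \<xi> u * G (u @ v'))" by simp
qed

lemma exchangeable_dpow: "exchangeable G \<Longrightarrow> exchangeable (dpow \<xi> n G)"
proof (induction n)
  case (Suc n)
  then have "exchangeable (der \<xi> (dpow \<xi> n G))" by (simp add: exchangeable_der)
  then have "der \<xi> (dpow \<xi> n G) u = der \<xi> (dpow \<xi> n G) v" if "mset u = mset v" for u v
    using that unfolding exchangeable_def by blast
  then show ?case unfolding exchangeable_def dpow.simps by (metis (no_types, lifting))
qed simp

lemma exchangeable_expd:
  assumes "exchangeable G" shows "exchangeable (expd \<xi> G)"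
  unfolding exchangeable_def expd_def
proof (intro allI impI)
  fix u v :: "yletter list" assume "mset u = mset v"
  then have "dpow \<xi> n G u = dpow \<xi> n G v" for n
    using exchangeable_dpow[OF assms, of \<xi> n] unfolding exchangeable_def by blast
  then show "(\<Sum>n. dpow \<xi> n G u) = (\<Sum>n. dpow \<xi> n G v)" by simp
qed

lemma der_commute:
  assumes "exchangeable G" shows "der \<eta> (der \<xi> G) = der \<xi> (der \<eta> G)"
proof
  fix v
  have sw: "G (u' @ u @ v) = G (u @ u' @ v)" for u u'
  proof -
    have "mset (u' @ u @ v) = mset (u @ u' @ v)" by simp
    then show ?thesis using assms unfolding exchangeable_def by blast
  qed
  have "der \<eta> (der \<xi> G) v = (\<Sum>u | \<eta> u \<noteq> 0. \<Sum>u' | \<xi> u' \<noteq> 0. \<eta> u * (\<xi> u' * G (u @ u' @ v)))"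
    by (simp add: der_def sum_distrib_left sw)
  also have "\<dots> = (\<Sum>u' | \<xi> u' \<noteq> 0. \<Sum>u | \<eta> u \<noteq> 0. \<eta> u * (\<xi> u' * G (u @ u' @ v)))" by (rule sum.swap)
  also have "\<dots> = der \<xi> (der \<eta> G) v" by (simp add: der_def sum_distrib_left mult_ac)
  finally show "der \<eta> (der \<xi> G) v = der \<xi> (der \<eta> G) v" .
qed

lemma der_dpow_commute:
  assumes "exchangeable G" shows "der \<eta> (dpow \<xi> n G) = dpow \<xi> n (der \<eta> G)"
proof (induction n)
  case (Suc n)
  have "der \<eta> (dpow \<xi> (Suc n) G) = (\<lambda>v. der \<eta> (der \<xi> (dpow \<xi> n G)) v / of_nat (Suc n))"
    unfolding dpow.simps by (rule der_divide)
  also have "der \<eta> (der \<xi> (dpow \<xi> n G)) = der \<xi> (der \<eta> (dpow \<xi> n G))"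
    by (rule der_commute[OF exchangeable_dpow[OF assms]])
  also have "der \<eta> (dpow \<xi> n G) = dpow \<xi> n (der \<eta> G)" by (rule Suc)
  finally show ?case by simp
qed simp

lemma dpow_plus:
  assumes fin: "finite {u. \<xi> u \<noteq> 0}" "finite {u. \<eta> u \<noteq> 0}" and G: "exchangeable G"
  shows "dpow (\<lambda>u. \<xi> u + \<eta> u) n G v = (\<Sum>i\<le>n. dpow \<xi> i (dpow \<eta> (n - i) G) v)"
proof (induction n arbitrary: v)
  case (Suc n)
  have eta: "der \<eta> (dpow \<xi> i (dpow \<eta> j G)) v = of_nat (Suc j) * dpow \<xi> i (dpow \<eta> (Suc j) G) v" for i j
  proof -
    have "der \<eta> (dpow \<eta> j G) = (\<lambda>v. of_nat (Suc j) * dpow \<eta> (Suc j) G v)" using der_dpow by blast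
    then have "der \<eta> (dpow \<xi> i (dpow \<eta> j G)) = dpow \<xi> i (\<lambda>v. of_nat (Suc j) * dpow \<eta> (Suc j) G v)"
      using der_dpow_commute[OF exchangeable_dpow[OF G]] by simp
    then show ?thesis unfolding dpow_scale by (rule fun_cong)
  qed
  have "der (\<lambda>u. \<xi> u + \<eta> u) (dpow (\<lambda>u. \<xi> u + \<eta> u) n G) v
      = der (\<lambda>u. \<xi> u + \<eta> u) (\<lambda>v. \<Sum>i\<le>n. dpow \<xi> i (dpow \<eta> (n - i) G) v) v"
    by (simp add: Suc.IH[abs_def])
  also have "\<dots> = (\<Sum>i\<le>n. der \<xi> (dpow \<xi> i (dpow \<eta> (n - i) G)) v + der \<eta> (dpow \<xi> i (dpow \<eta> (n - i) G)) v)"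
    by (simp add: der_sum der_plus[OF fin])
  also have "\<dots> = (\<Sum>i\<le>n. of_nat (Suc i) * dpow \<xi> (Suc i) (dpow \<eta> (n - i) G) v
      + of_nat (Suc (n - i)) * dpow \<xi> i (dpow \<eta> (Suc (n - i)) G) v)"
    unfolding der_dpow eta ..
  also have "\<dots> = of_nat (Suc n) * (\<Sum>i\<le>Suc n. dpow \<xi> i (dpow \<eta> (Suc n - i) G) v)"
    by (rule sum_diagonal_Suc)
  finally show ?case by (simp del: of_nat_Suc sum.atMost_Suc)
qed simp

lemma dpow_suminf:
  assumes "\<And>v. summable (\<lambda>n. S n v)"
  shows "dpow \<xi> i (\<lambda>w. \<Sum>n. S n w) v = (\<Sum>n. dpow \<xi> i (S n) v) \<and> summable (\<lambda>n. dpow \<xi> i (S n) v)"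
proof (induction i arbitrary: v)
  case (Suc i)
  then have "dpow \<xi> i (\<lambda>w. \<Sum>n. S n w) = (\<lambda>w. \<Sum>n. dpow \<xi> i (S n) w)" by blast
  moreover have "summable (\<lambda>n. dpow \<xi> i (S n) v)" for v using Suc by blast
  note der_suminf[where S = "\<lambda>n. dpow \<xi> i (S n)" and \<xi> = \<xi> and v = v, OF this]
  ultimately show ?case by (simp add: suminf_divide summable_divide del: of_nat_Suc)
qed (use assms in simp)

text \<open>The exponential law for commuting derivations: \<open>dpow_plus\<close> is the binomial
  theorem in divided powers, and the dominated double series is rearranged along its
  diagonals.\<close>

lemma expd_plus:
  assumes G: "exchangeable G" "growth G" and fin: "finite {u. \<xi> u \<noteq> 0}" "finite {u. \<eta> u \<noteq> 0}"
  shows "expd \<xi> (expd \<eta> G) = expd (\<lambda>u. \<xi> u + \<eta> u) G"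
proof
  fix v
  \<comment> \<open>The indicator of the union of both supports, introduced to get one bound M on
    the weights.\<close>
  define \<zeta> :: "yletter series" where "\<zeta> u = (if \<xi> u \<noteq> 0 \<or> \<eta> u \<noteq> 0 then 1 else 0)" for u
  have "{u. \<zeta> u \<noteq> 0} = {u. \<xi> u \<noteq> 0} \<union> {u. \<eta> u \<noteq> 0}" by (auto simp: \<zeta>_def)
  then have "finite {u. \<zeta> u \<noteq> 0}" using fin by simp
  then obtain B C M where *: "0 \<le> B" "1 \<le> C" "bounded_by M B C G" "\<forall>u. \<zeta> u \<noteq> 0 \<longrightarrow> weight u \<le> M" "weight v \<le> M"
    using G(2) by (elim growth_letters[where N = "weight v"])
  have M: "weight u \<le> M" if "\<xi> u \<noteq> 0 \<or> \<eta> u \<noteq> 0" for u using *(4) that by (auto simp: \<zeta>_def)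
  define X where "X = der_norm C \<xi>"
  define Y where "Y = der_norm C \<eta>"
  have XY: "0 \<le> X" "0 \<le> Y" using *(2) by (auto simp: X_def Y_def der_norm_nonneg)
  define f where "f i j = dpow \<xi> i (dpow \<eta> j G) v" for i j
  have "norm (f i j) \<le> (X ^ i / fact i) * (B * C ^ length v * (Y ^ j / fact j))" for i j
  proof -
    have "bounded_by M (B * (Y ^ j / fact j)) C (dpow \<eta> j G)"
      unfolding Y_def by (rule bounded_by_dpow[OF *(3)]) (use M in auto)
    then have "bounded_by M (B * (Y ^ j / fact j) * (X ^ i / fact i)) C (dpow \<xi> i (dpow \<eta> j G))"
      unfolding X_def by (rule bounded_by_dpow) (use M in auto)
    moreover have "\<forall>a\<in>set v. index_of a \<le> M" using *(5) index_le_weight le_trans by blast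
    ultimately show ?thesis by (simp add: bounded_by_def f_def mult_ac)
  qed
  moreover have "summable (\<lambda>i. X ^ i / fact i)" using exp_series_real by (rule sums_summable)
  moreover have "summable (\<lambda>j. B * C ^ length v * (Y ^ j / fact j))"
    by (intro summable_mult sums_summable[OF exp_series_real])
  ultimately have "(\<lambda>n. \<Sum>i\<le>n. f i (n - i)) sums (\<Sum>i. \<Sum>j. f i j)"
    using XY * by (intro diagonal_sums[of f "\<lambda>i. X ^ i / fact i" "\<lambda>j. B * C ^ length v * (Y ^ j / fact j)"]) auto
  then have "expd (\<lambda>u. \<xi> u + \<eta> u) G v = (\<Sum>i. \<Sum>j. f i j)"
    unfolding expd_def f_def dpow_plus[OF fin G(1)] by (rule sums_unique[symmetric])
  also have "(\<Sum>j. f i j) = dpow \<xi> i (expd \<eta> G) v" for i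
    using dpow_suminf[of "\<lambda>j. dpow \<eta> j G" \<xi> i v] summable_dpow(2)[OF G(2) fin(2)] by (simp add: f_def expd_def)
  then have "(\<Sum>i. \<Sum>j. f i j) = expd \<xi> (expd \<eta> G) v" by (simp add: expd_def)
  finally show "expd \<xi> (expd \<eta> G) v = expd (\<lambda>u. \<xi> u + \<eta> u) G v" by simp
qed

subsection \<open>Characters of the stuffle algebra as products of exponentials\<close>

text \<open>A character on all series of exponential growth. As this domain is stable under
  \<open>expd\<close>, characters can be composed with exponentials of derivations.\<close>

definition hom_functional :: "(yletter series \<Rightarrow> complex) \<Rightarrow> bool" where
  "hom_functional \<theta> \<longleftrightarrow>
     (\<forall>S T. growth S \<longrightarrow> growth T \<longrightarrow> \<theta> (\<lambda>w. S w + T w) = \<theta> S + \<theta> T) \<and>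
     (\<forall>c S. growth S \<longrightarrow> \<theta> (\<lambda>w. c * S w) = c * \<theta> S) \<and>
     (\<forall>S T. growth S \<longrightarrow> growth T \<longrightarrow> \<theta> (stuffle S T) = \<theta> S * \<theta> T) \<and>
     \<theta> (word_series []) = 1"

lemma hom_functionalD:
  assumes "hom_functional \<theta>"
  shows "growth S \<Longrightarrow> growth T \<Longrightarrow> \<theta> (\<lambda>w. S w + T w) = \<theta> S + \<theta> T"
    "growth S \<Longrightarrow> \<theta> (\<lambda>w. c * S w) = c * \<theta> S"
    "growth S \<Longrightarrow> growth T \<Longrightarrow> \<theta> (stuffle S T) = \<theta> S * \<theta> T" "\<theta> (word_series []) = 1"
  using assms by (simp_all add: hom_functional_def)

lemma hom_functional_sum:
  assumes "hom_functional \<theta>" "\<And>i. i \<in> I \<Longrightarrow> growth (S i)"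
  shows "\<theta> (\<lambda>w. \<Sum>i\<in>I. c i * S i w) = (\<Sum>i\<in>I. c i * \<theta> (S i))"
proof -
  have "\<theta> (\<lambda>w. 0 * word_series [] w) = 0 * \<theta> (word_series [])"
    by (rule hom_functionalD(2)[OF assms(1) growth_word])
  then have z: "\<theta> (\<lambda>w. 0) = 0" by simp
  show ?thesis using assms(2)
  proof (induction I rule: infinite_finite_induct)
    case (insert i I)
    have "growth (\<lambda>w. c i * S i w)" "growth (\<lambda>w. \<Sum>i\<in>I. c i * S i w)"
      using insert.prems by (auto intro!: growth_sum growth_scale)
    then have "\<theta> (\<lambda>w. c i * S i w + (\<Sum>i\<in>I. c i * S i w)) = \<theta> (\<lambda>w. c i * S i w) + \<theta> (\<lambda>w. \<Sum>i\<in>I. c i * S i w)"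
      by (rule hom_functionalD(1)[OF assms(1)])
    also have "\<theta> (\<lambda>w. c i * S i w) = c i * \<theta> (S i)"
      using insert.prems by (intro hom_functionalD(2)[OF assms(1)]) simp
    finally show ?case using insert by simp
  qed (simp_all add: z)
qed

lemma der_one:
  assumes "\<xi> [] = 0" shows "der \<xi> (word_series []) = (\<lambda>v. 0)"
  unfolding der_def word_series_def by (rule ext, rule sum.neutral) (use assms in auto)

lemma expd_one:
  assumes "\<xi> [] = 0" shows "expd \<xi> (word_series []) = word_series []"
  using expd_nilpotent[of \<xi> "word_series []"] by (simp add: der_one[of \<xi>, OF assms])

lemma hom_functional_expd:
  assumes \<theta>: "hom_functional \<theta>" and p: "primitive \<xi>"
  shows "hom_functional (\<lambda>S. \<theta> (expd \<xi> S))"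
proof -
  have fin: "finite {u. \<xi> u \<noteq> 0}" and x0: "\<xi> [] = 0" using p by (simp_all add: primitive_def)
  show ?thesis
    unfolding hom_functional_def
    by (simp add: expd_add[OF _ _ fin] expd_scale[OF _ fin] expd_stuffle[OF _ _ p] expd_one[of \<xi>, OF x0] growth_expd[OF _ fin]
        hom_functionalD[OF \<theta>])
qed

text \<open>Only the whole word can be removed, so the exponential is exact at first order. This is
  how one further weight is corrected while smaller weights remain untouched.\<close>

lemma expd_word:
  assumes fin: "finite {u. \<xi> u \<noteq> 0}" and deg: "\<And>u. \<xi> u \<noteq> 0 \<Longrightarrow> K \<le> weight u" and K: "0 < K" "weight w \<le> K"
  shows "expd \<xi> (word_series w) = (\<lambda>v. word_series w v + \<xi> w * word_series [] v)"
proof -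
  have x0: "\<xi> [] = 0" using deg[of "[]"] K by auto
  have eq: "der \<xi> (word_series w) = (\<lambda>v. \<xi> w * word_series [] v)"
  proof
    fix v
    have "der \<xi> (word_series w) v = (\<Sum>u | \<xi> u \<noteq> 0. if u = w then \<xi> w * word_series [] v else 0)"
      unfolding der_def
    proof (intro sum.cong refl)
      fix u assume "u \<in> {u. \<xi> u \<noteq> 0}"
      then have "K \<le> weight u" using deg by simp
      have "v = []" if e: "u @ v = w"
      proof -
        have "weight w = weight u + weight v" unfolding e[symmetric] by (rule weight_simps)
        then have "weight v = 0" using K \<open>K \<le> weight u\<close> by linarith
        then show ?thesis by (simp only: weight_eq_0)
      qed
      then have "u @ v = w \<longleftrightarrow> u = w \<and> v = []" by auto
      then show "\<xi> u * word_series w (u @ v) = (if u = w then \<xi> w * word_series [] v else 0)"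
        by (auto simp: word_series_def)
    qed
    also have "\<dots> = \<xi> w * word_series [] v" using fin by (simp add: sum.delta)
    finally show "der \<xi> (word_series w) v = \<xi> w * word_series [] v" .
  qed
  have "der \<xi> (der \<xi> (word_series w)) = (\<lambda>v. 0)"
    unfolding eq der_scale der_one[of \<xi>, OF x0] by simp
  then show ?thesis using expd_nilpotent[of \<xi> "word_series w"] by (simp add: eq)
qed

lemma stuffle_words_expansion:
  "stuffle_words u v = (\<lambda>x. \<Sum>w | weight w = weight u + weight v. stuffle_words u v w * word_series w x)"
proof
  fix x
  have "(\<Sum>w | weight w = weight u + weight v. stuffle_words u v w * word_series w x)
      = (\<Sum>w | weight w = weight u + weight v. if w = x then stuffle_words u v x else 0)"
    by (intro sum.cong) (auto simp: word_series_def)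
  also have "\<dots> = stuffle_words u v x" using stuffle_words_weight[of u v x] finite_weight
    by (cases "stuffle_words u v x = 0") (auto simp: sum.delta)
  finally show "stuffle_words u v x = (\<Sum>w | weight w = weight u + weight v. stuffle_words u v w * word_series w x)" by simp
qed

lemma stuffle_pairing_hom:
  assumes "hom_functional \<theta>"
  shows "stuffle_pairing (\<lambda>w. \<theta> (word_series w)) u v = \<theta> (word_series u) * \<theta> (word_series v)"
proof -
  have "\<theta> (word_series u) * \<theta> (word_series v) = \<theta> (stuffle_words u v)"
    using hom_functionalD(3)[OF assms growth_word growth_word, of u v] by (simp add: stuffle_word_series)
  also have "\<dots> = stuffle_pairing (\<lambda>w. \<theta> (word_series w)) u v"
    unfolding stuffle_pairing_def
    by (subst stuffle_words_expansion, subst hom_functional_sum[OF assms]) (simp_all add: growth_word mult.commute)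
  finally show ?thesis ..
qed

lemma stuffle_pairing_character:
  assumes "character_on polynomials stuffle \<theta>"
  shows "stuffle_pairing (\<lambda>w. \<theta> (word_series w)) u v = \<theta> (word_series u) * \<theta> (word_series v)"
proof -
  have "\<theta> (word_series u) * \<theta> (word_series v) = \<theta> (stuffle_words u v)"
    using character_mult[OF assms polynomials_word polynomials_word, of u v] by (simp add: stuffle_word_series)
  also have "\<dots> = (\<Sum>w | weight w = weight u + weight v. \<theta> (\<lambda>x. stuffle_words u v w * word_series w x))"
    by (subst stuffle_words_expansion, rule character_sum[OF assms]) (intro polynomials_scale polynomials_word)
  also have "\<dots> = stuffle_pairing (\<lambda>w. \<theta> (word_series w)) u v"
    unfolding stuffle_pairing_def
    by (intro sum.cong refl) (subst character_scale[OF assms polynomials_word], rule mult.commute)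
  finally show ?thesis ..
qed

lemma stuffle_pairing_cong:
  "(\<And>w. weight w = weight u + weight v \<Longrightarrow> f w = g w) \<Longrightarrow> stuffle_pairing f u v = stuffle_pairing g u v"
  unfolding stuffle_pairing_def by (intro sum.cong) auto

context
  fixes \<gamma> :: "yletter series \<Rightarrow> complex"
  assumes gamma: "character_on polynomials stuffle \<gamma>"
begin

text \<open>The product of exponentials agreeing with \<open>\<gamma>\<close> on words of weight at most \<open>K\<close>.\<close>

primrec truncation :: "nat \<Rightarrow> yletter series \<Rightarrow> complex" where
  "truncation 0 = (\<lambda>S. S [])"
| "truncation (Suc K) = (\<lambda>S. truncation K
     (expd (\<lambda>w. if weight w = Suc K then \<gamma> (word_series w) - truncation K (word_series w) else 0) S))"

definition log_part :: "nat \<Rightarrow> yletter series" where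
  "log_part K w = (if weight w = Suc K then \<gamma> (word_series w) - truncation K (word_series w) else 0)"

lemma truncation_Suc: "truncation (Suc K) S = truncation K (expd (log_part K) S)"
  by (simp add: log_part_def[abs_def])

lemma finite_log_part: "finite {u. log_part K u \<noteq> 0}"
  by (rule finite_subset[OF _ finite_weight[of "Suc K"]]) (auto simp: log_part_def)

text \<open>Two characters that agree up to weight K differ in weight K + 1 by a primitive element:
  on a product of nonempty words both are determined by factors of smaller weight. The exponential
  of this element corrects the next weight.\<close>

lemma truncation_properties:
  "hom_functional (truncation K) \<and> (\<forall>w. weight w \<le> K \<longrightarrow> truncation K (word_series w) = \<gamma> (word_series w))
    \<and> primitive (log_part K)"
proof (induction K)
  have prim: "primitive (log_part K)" if hom: "hom_functional (truncation K)"
    and eq: "\<And>w. weight w \<le> K \<Longrightarrow> truncation K (word_series w) = \<gamma> (word_series w)" for K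
    unfolding primitive_def
  proof (intro conjI allI impI finite_log_part)
    fix u v :: "yletter list" assume uv: "u \<noteq> []" "v \<noteq> []"
    then have pos: "0 < weight u" "0 < weight v" using weight_eq_0 by (metis neq0_conv)+
    show "stuffle_pairing (log_part K) u v = 0"
    proof (cases "weight u + weight v = Suc K")
      case True
      have "stuffle_pairing (log_part K) u v = stuffle_pairing (\<lambda>w. \<gamma> (word_series w) - truncation K (word_series w)) u v"
        using True by (intro stuffle_pairing_cong) (simp add: log_part_def)
      also have "\<dots> = stuffle_pairing (\<lambda>w. \<gamma> (word_series w)) u v - stuffle_pairing (\<lambda>w. truncation K (word_series w)) u v"
        by (simp add: stuffle_pairing_def left_diff_distrib sum_subtractf)
      also have "\<dots> = 0"
        unfolding stuffle_pairing_character[OF gamma] stuffle_pairing_hom[OF hom] using True pos by (simp add: eq)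
      finally show ?thesis .
    next
      case False
      then have "stuffle_pairing (log_part K) u v = stuffle_pairing (\<lambda>w. 0) u v"
        by (intro stuffle_pairing_cong) (simp add: log_part_def)
      then show ?thesis by (simp add: stuffle_pairing_def)
    qed
  qed (simp add: log_part_def)
  {
    case 0
    have h: "hom_functional (truncation 0)" by (simp add: hom_functional_def word_series_def)
    have "truncation 0 (word_series w) = \<gamma> (word_series w)" if "weight w \<le> 0" for w
      using that character_one[OF gamma] by (simp add: word_series_def)
    then show ?case using h prim[OF h] by blast
  next
    case (Suc K)
    have h: "hom_functional (truncation (Suc K))"
      unfolding truncation_Suc[abs_def] using Suc by (intro hom_functional_expd) auto
    have eq: "truncation (Suc K) (word_series w) = \<gamma> (word_series w)" if w: "weight w \<le> Suc K" for w
    proof -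
      have "expd (log_part K) (word_series w) = (\<lambda>v. word_series w v + log_part K w * word_series [] v)"
        by (rule expd_word[of _ "Suc K"]) (use finite_log_part w in \<open>auto simp: log_part_def split: if_splits\<close>)
      then have "truncation (Suc K) (word_series w) = truncation K (\<lambda>v. word_series w v + log_part K w * word_series [] v)"
        by (simp only: truncation_Suc)
      also have "\<dots> = truncation K (word_series w) + log_part K w * truncation K (word_series [])"
      proof -
        have h: "hom_functional (truncation K)" using Suc by blast
        show ?thesis
          by (simp only: hom_functionalD(1)[OF h growth_word growth_scale[OF growth_word]] hom_functionalD(2)[OF h growth_word])
      qed
      also have "truncation K (word_series []) = 1" using Suc hom_functionalD(4) by blast
      finally show ?thesis using Suc w by (cases "weight w = Suc K") (simp_all add: log_part_def)
    qed
    show ?case using h eq prim[OF h eq] by blast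
  }
qed

lemmas hom_truncation = truncation_properties[THEN conjunct1]
lemmas truncation_word = truncation_properties[THEN conjunct2, THEN conjunct1, rule_format]
lemmas primitive_log_part = truncation_properties[THEN conjunct2, THEN conjunct2]

text \<open>All the primitive parts together. The support may be infinite, so it acts on series only
  through \<open>weighted_log\<close>.\<close>

definition log_coeff :: "yletter series" where
  "log_coeff w = (case weight w of 0 \<Rightarrow> 0 | Suc K \<Rightarrow> log_part K w)"

lemma log_coeff_eq: "weight w = Suc K \<Longrightarrow> log_coeff w = log_part K w"
  by (simp add: log_coeff_def)

lemma log_coeff_Nil [simp]: "log_coeff [] = 0"
  by (simp add: log_coeff_def)

lemma stuffle_pairing_log_coeff:
  assumes "u \<noteq> []" "v \<noteq> []" shows "stuffle_pairing log_coeff u v = 0"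
proof -
  have "weight u \<noteq> 0" using assms weight_eq_0 by blast
  then obtain K where K: "weight u + weight v = Suc K" by (cases "weight u + weight v") auto
  have "stuffle_pairing log_coeff u v = stuffle_pairing (log_part K) u v"
    by (rule stuffle_pairing_cong) (simp add: K log_coeff_eq)
  then show ?thesis using primitive_log_part[of K] assms by (simp add: primitive_def)
qed

text \<open>A finitely supported c cuts \<open>log_coeff\<close> off. Since the factor depends on
  the weight only, primitivity is preserved.\<close>

definition weighted_log :: "(nat \<Rightarrow> complex) \<Rightarrow> yletter series" where
  "weighted_log c = (\<lambda>u. c (weight u) * log_coeff u)"

lemma finite_weighted_log:
  assumes "finite {k. c k \<noteq> 0}" shows "finite {u. weighted_log c u \<noteq> 0}"
proof (rule finite_subset)
  show "{u. weighted_log c u \<noteq> 0} \<subseteq> (\<Union>k\<in>{k. c k \<noteq> 0}. {u. weight u = k})" by (auto simp: weighted_log_def)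
qed (use assms finite_weight in auto)

lemma primitive_weighted_log:
  assumes "finite {k. c k \<noteq> 0}" shows "primitive (weighted_log c)"
  unfolding primitive_def
proof (intro conjI allI impI finite_weighted_log assms)
  fix u v :: "yletter list" assume "u \<noteq> []" "v \<noteq> []"
  moreover have "stuffle_pairing (weighted_log c) u v = c (weight u + weight v) * stuffle_pairing log_coeff u v"
    by (simp add: stuffle_pairing_def weighted_log_def sum_distrib_left mult.assoc)
  ultimately show "stuffle_pairing (weighted_log c) u v = 0" by (simp add: stuffle_pairing_log_coeff)
qed (simp add: weighted_log_def)

definition tail :: "nat \<Rightarrow> (nat \<Rightarrow> complex) \<Rightarrow> nat \<Rightarrow> complex" where
  "tail K c = (\<lambda>k. if k \<le> K then 0 else c k)"

text \<open>The weights up to K are treated by \<open>truncation\<close>, which reproduces \<gamma>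
  on polynomials of weight at most K; the others enter through one exponential whose coefficients
  can be adapted to the rational series at hand.\<close>

definition approximation_char :: "nat \<Rightarrow> (nat \<Rightarrow> complex) \<Rightarrow> yletter series \<Rightarrow> complex" where
  "approximation_char K c S = truncation K (expd (weighted_log (tail K c)) S)"

lemma finite_tail: "finite {k. c k \<noteq> 0} \<Longrightarrow> finite {k. tail K c k \<noteq> 0}"
  by (rule finite_subset[of _ "{k. c k \<noteq> 0}"]) (auto simp: tail_def)

lemma hom_approximation: "finite {k. c k \<noteq> 0} \<Longrightarrow> hom_functional (approximation_char K c)"
  unfolding approximation_char_def[abs_def]
  by (intro hom_functional_expd hom_truncation primitive_weighted_log finite_tail)

lemma growth_polynomial: "P \<in> polynomials \<Longrightarrow> growth P"
  by (subst poly_expansion, assumption) (intro growth_sum growth_scale growth_word)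

lemma approximation_polynomial:
  assumes P: "P \<in> polynomials" "\<And>w. P w \<noteq> 0 \<Longrightarrow> weight w \<le> K" and c: "finite {k. c k \<noteq> 0}"
  shows "approximation_char K c P = \<gamma> P"
proof -
  have word: "approximation_char K c (word_series w) = \<gamma> (word_series w)" if w: "weight w \<le> K" for w
  proof -
    have "expd (weighted_log (tail K c)) (word_series w)
        = (\<lambda>v. word_series w v + weighted_log (tail K c) w * word_series [] v)"
      by (rule expd_word[of _ "Suc K"])
        (use finite_weighted_log[OF finite_tail[OF c]] w in \<open>auto simp: weighted_log_def tail_def split: if_splits\<close>)
    also have "\<dots> = word_series w" using w by (simp add: weighted_log_def tail_def)
    finally show ?thesis using truncation_word[OF w] by (simp add: approximation_char_def)
  qed
  have "approximation_char K c P = (\<Sum>u | P u \<noteq> 0. P u * approximation_char K c (word_series u))"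
    by (subst poly_expansion[OF P(1)], rule hom_functional_sum[OF hom_approximation[OF c] growth_word])
  also have "\<dots> = (\<Sum>u | P u \<noteq> 0. P u * \<gamma> (word_series u))"
    using P(2) word by (intro sum.cong) auto
  also have "\<dots> = \<gamma> P" by (rule character_expansion[OF gamma P(1), symmetric])
  finally show ?thesis .
qed

lemma truncation_exchangeable:
  assumes "exchangeable G" "growth G"
  shows "truncation K G = expd (weighted_log (\<lambda>k. if k \<le> K then 1 else 0)) G []"
  using assms
proof (induction K arbitrary: G)
  case 0
  have z: "weighted_log (\<lambda>k. if k \<le> 0 then 1 else 0) = (\<lambda>u. 0)"
    by (auto simp: weighted_log_def fun_eq_iff)
  have "der (\<lambda>u. 0) S = (\<lambda>v. 0)" for S by (simp add: der_def)
  then have "expd (\<lambda>u. 0) G = G" using expd_nilpotent[of "\<lambda>u. 0" G] by simp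
  then show ?case by (simp only: truncation.simps z)
next
  case (Suc K)
  have "truncation (Suc K) G = expd (weighted_log (\<lambda>k. if k \<le> K then 1 else 0)) (expd (log_part K) G) []"
    unfolding truncation_Suc using Suc.prems by (intro Suc.IH exchangeable_expd growth_expd finite_log_part)
  also have "\<dots> = expd (\<lambda>u. weighted_log (\<lambda>k. if k \<le> K then 1 else 0) u + log_part K u) G []"
    using Suc.prems by (subst expd_plus) (auto intro!: finite_weighted_log finite_log_part)
  also have "(\<lambda>u. weighted_log (\<lambda>k. if k \<le> K then 1 else 0) u + log_part K u) = weighted_log (\<lambda>k. if k \<le> Suc K then 1 else 0)"
    by (auto simp: weighted_log_def fun_eq_iff log_coeff_eq log_part_def le_Suc_eq)
  finally show ?case .
qed

text \<open>Here the derivations commute, so the nested exponentials merge into one, and with c = 1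
  up to K the cut-off at K disappears from the result.\<close>

lemma approximation_exchangeable:
  assumes G: "exchangeable G" "growth G" and c: "finite {k. c k \<noteq> 0}" "\<And>k. k \<le> K \<Longrightarrow> c k = 1"
  shows "approximation_char K c G = expd (weighted_log c) G []"
proof -
  have "approximation_char K c G
      = expd (weighted_log (\<lambda>k. if k \<le> K then 1 else 0)) (expd (weighted_log (tail K c)) G) []"
    unfolding approximation_char_def using G c
    by (intro truncation_exchangeable exchangeable_expd growth_expd finite_weighted_log finite_tail)
  also have "\<dots> = expd (\<lambda>u. weighted_log (\<lambda>k. if k \<le> K then 1 else 0) u + weighted_log (tail K c) u) G []"
    using G c by (subst expd_plus) (auto intro!: finite_weighted_log finite_tail)
  also have "(\<lambda>u. weighted_log (\<lambda>k. if k \<le> K then 1 else 0) u + weighted_log (tail K c) u) = weighted_log c"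
    using c by (auto simp: weighted_log_def fun_eq_iff tail_def)
  finally show ?thesis .
qed

lemma der_weighted_log:
  assumes "finite {k. c k \<noteq> 0}"
  shows "der (weighted_log c) S v = pairing c (\<lambda>k. \<Sum>u | weight u = k. log_coeff u * S (u @ v))"
proof -
  define U where "U = {u. c (weight u) \<noteq> 0}"
  have "U = (\<Union>k\<in>{k. c k \<noteq> 0}. {u. weight u = k})" by (auto simp: U_def)
  then have U: "finite U" using assms finite_weight by simp
  have "der (weighted_log c) S v = (\<Sum>u\<in>U. weighted_log c u * S (u @ v))"
    by (rule der_superset[OF U]) (auto simp: U_def weighted_log_def)
  also have "\<dots> = (\<Sum>k | c k \<noteq> 0. \<Sum>u\<in>{u\<in>U. weight u = k}. weighted_log c u * S (u @ v))"
    by (rule sum.group[symmetric]) (use U assms in \<open>auto simp: U_def\<close>)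
  also have "\<dots> = pairing c (\<lambda>k. \<Sum>u | weight u = k. log_coeff u * S (u @ v))"
    unfolding pairing_def sum_distrib_left
    by (intro sum.cong) (auto simp: U_def weighted_log_def mult.assoc)
  finally show ?thesis .
qed

end

subsection \<open>Values of the character on powers of a letter\<close>

text \<open>The recurrence is the differential equation h' = f' * h satisfied by h = exp o f, so the
  numbers a n are the coefficients of h. The boundedness of q makes f converge on the unit
  disc.\<close>

lemma exp_power_series:
  fixes q a :: "nat \<Rightarrow> complex"
  assumes q: "\<And>i. norm (q i) \<le> C" and a0: "a 0 = 1"
    and rec: "\<And>N. of_nat (Suc N) * a (Suc N) = (\<Sum>i\<le>N. q i * a (N - i))"
    and x: "norm x < 1" and L: "(\<lambda>i. q i * x ^ Suc i / of_nat (Suc i)) sums L"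
  shows "(\<lambda>n. a n * x ^ n) sums exp L"
proof -
  define f where "f = Abs_fps (\<lambda>n. if n = 0 then 0 else q (n - 1) / of_nat n)"
  have C: "0 \<le> C" using q[of 0] norm_ge_zero order_trans by blast
  have coeff: "norm (fps_nth f n) \<le> C" for n
  proof (cases n)
    case (Suc m)
    have "norm (q m) / real (Suc m) \<le> norm (q m) / 1" by (intro divide_left_mono) auto
    then show ?thesis using q[of m] by (simp add: f_def Suc norm_divide del: of_nat_Suc)
  qed (simp add: f_def C)
  have "conv_radius (fps_nth f) \<ge> 1"
  proof (rule conv_radius_geI_ex)
    fix r :: real assume r: "0 < r" "ereal r < 1"
    have "summable (\<lambda>n. fps_nth f n * of_real r ^ n)"
    proof (rule summable_comparison_test)
      show "summable (\<lambda>n. C * r ^ n)" using r by (intro summable_mult summable_geometric) auto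
      show "\<exists>N. \<forall>n\<ge>N. norm (fps_nth f n * of_real r ^ n) \<le> C * r ^ n"
        using coeff r by (auto simp: norm_mult norm_power intro!: mult_right_mono)
    qed
    then show "\<exists>z. norm z = r \<and> summable (\<lambda>n. fps_nth f n * z ^ n)"
      using r by (intro exI[of _ "complex_of_real r"]) auto
  qed
  then have R: "fps_conv_radius f \<ge> 1" by (simp add: fps_conv_radius_def)
  then have R0: "0 < fps_conv_radius f" by (rule less_le_trans[rotated]) simp
  have "(\<lambda>n. fps_nth f (Suc n) * x ^ Suc n) sums L" using L by (simp add: f_def)
  then have "(\<lambda>n. fps_nth f n * x ^ n) sums L" by (subst (asm) sums_Suc_iff) (simp add: f_def)
  then have ev: "eval_fps f x = L" unfolding eval_fps_def by (rule sums_unique[symmetric])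
  define h where "h = fps_exp 1 oo f"
  have exp_h: "(exp \<circ> eval_fps f) has_fps_expansion h"
    unfolding h_def by (intro has_fps_expansion_compose has_fps_expansion_exp1 eval_fps_has_fps_expansion R0) (simp add: f_def)
  have "eball 0 1 \<subseteq> eball (0::complex) (fps_conv_radius f)"
    by (rule subsetI) (unfold eball_def mem_Collect_eq, erule less_le_trans, rule R)
  then have "eval_fps f holomorphic_on eball 0 1" by (rule holomorphic_on_eval_fps)
  then have "(\<lambda>z. exp (eval_fps f z)) holomorphic_on eball 0 1" by (intro holomorphic_on_exp')
  then have "(exp \<circ> eval_fps f) holomorphic_on eball 0 1" by (simp add: o_def)
  then have "(\<lambda>n. fps_nth h n * x ^ n) sums (exp \<circ> eval_fps f) x"
    by (rule has_fps_expansion_imp_sums_complex[OF exp_h]) (use x in simp)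
  moreover have "fps_nth h n = a n" for n
  proof (induction n rule: less_induct)
    case (less n)
    show ?case
    proof (cases n)
      case 0
      then show ?thesis by (simp add: h_def a0)
    next
      case (Suc N)
      have "fps_deriv h = fps_deriv f * h"
        unfolding h_def by (subst fps_compose_deriv) (simp_all add: f_def mult.commute)
      then have "fps_nth (fps_deriv h) N = (\<Sum>i\<le>N. fps_nth (fps_deriv f) i * fps_nth h (N - i))"
        by (simp only: fps_mult_nth atLeast0AtMost)
      also have "\<dots> = (\<Sum>i\<le>N. q i * a (N - i))"
      proof (intro sum.cong refl)
        fix i
        have "fps_nth (fps_deriv f) i = q i" by (simp add: f_def del: of_nat_Suc)
        moreover have "fps_nth h (N - i) = a (N - i)" using Suc by (intro less) simp
        ultimately show "fps_nth (fps_deriv f) i * fps_nth h (N - i) = q i * a (N - i)" by (simp only:)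
      qed
      also have "\<dots> = of_nat (Suc N) * a (Suc N)" by (rule rec[symmetric])
      finally have "of_nat (Suc N) * fps_nth h (Suc N) = (of_nat (Suc N) * a (Suc N) :: complex)"
        by (simp only: fps_deriv_nth Suc_eq_plus1)
      then show ?thesis by (simp only: Suc mult_cancel_left of_nat_eq_0_iff) simp
    qed
  qed
  ultimately show ?thesis by (simp add: ev)
qed

lemma multi_zeta_single:
  assumes k: "k \<ge> 2" shows "multi_zeta [k] = zeta_nat k"
proof -
  have "multi_zeta [k] = (\<Sum>\<^sub>\<infinity>m\<in>UNIV. 1 / of_nat (Suc m) ^ k)"
    unfolding multi_zeta_def
  proof (rule infsum_reindex_bij_witness[of _ "\<lambda>m. [Suc m]" "\<lambda>n. n ! 0 - 1"])
    fix n :: "nat list" assume "n \<in> {n. length n = length [k] \<and> sorted_wrt (>) n \<and> (\<forall>k\<in>set n. 0 < k)}"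
    then obtain m where "n = [m]" "0 < m" by (auto simp: length_Suc_conv)
    then show "[Suc (n ! 0 - 1)] = n"
      and "1 / of_nat (Suc (n ! 0 - 1)) ^ k = (\<Prod>i<length [k]. 1 / of_nat (n ! i) ^ ([k] ! i) :: complex)"
      by (simp_all del: of_nat_Suc)
  qed auto
  moreover have "((\<lambda>m. 1 / of_nat (Suc m) ^ k :: complex) has_sum zeta_nat k) UNIV"
  proof (rule norm_summable_imp_has_sum)
    show "(\<lambda>m. 1 / of_nat (Suc m) ^ k) sums zeta_nat k"
      unfolding zeta_nat_def by (rule summable_sums[OF zeta_nat_summable[OF k]])
    have "summable (\<lambda>n. inverse ((real (Suc n)) ^ k))"
      using inverse_power_summable[OF k, where 'a = real] by (subst summable_Suc_iff) simp
    then show "summable (\<lambda>m. norm (1 / of_nat (Suc m) ^ k :: complex))"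
      by (simp add: norm_divide norm_power inverse_eq_divide del: of_nat_Suc)
  qed
  ultimately show ?thesis by (simp add: infsumI)
qed

lemma pi_Y_acc_replicate: "pi_Y_acc n (replicate m X0 @ [X1]) = [y (Suc (n + m))]"
  by (induction m arbitrary: n) auto

text \<open>A proper suffix has fewer leading letters \<open>X0\<close>, so it shows
  \<open>X1\<close> at the first difference. These words are the ones that \<open>pi_Y\<close> turns
  into single letters.\<close>

lemma lyndon_replicate: "replicate m X0 @ [X1] \<in> lyndon_X"
proof -
  have "(replicate m X0 @ [X1], v) \<in> lexord {(X0, X1)}"
    if uv: "replicate m X0 @ [X1] = u @ v" "u \<noteq> []" "v \<noteq> []" for u v
  proof -
    have len: "Suc m = length u + length v" using arg_cong[OF uv(1), of length] by simp
    moreover have "0 < length u" "0 < length v" using uv by auto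
    ultimately have u: "0 < length u" "length u \<le> m" by linarith+
    have "v = drop (length u) (replicate m X0 @ [X1])" by (simp add: uv(1))
    then have v: "v = replicate (m - length u) X0 @ [X1]" using u by simp
    obtain i where i: "length u = Suc i" using u by (cases "length u") auto
    have "replicate m X0 = replicate (m - length u) X0 @ replicate (Suc i) X0"
      using u i by (metis le_add_diff_inverse2 replicate_add)
    then have "replicate m X0 @ [X1] = replicate (m - length u) X0 @ (X0 # replicate i X0 @ [X1])" by simp
    moreover have "(X0 # replicate i X0 @ [X1], [X1]) \<in> lexord {(X0, X1)}" by simp
    ultimately show ?thesis unfolding v by (metis lexord_append_leftI)
  qed
  then show ?thesis unfolding lyndon_X_def by auto
qed

lemma gamma_letter:
  assumes g: "is_gamma_stuffle \<gamma>" and k: "k \<ge> 1"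
  shows "\<gamma> (word_series [y k]) = zeta_gamma k"
proof (cases "k = 1")
  case False
  define l where "l = replicate (k - 1) X0 @ [X1]"
  have "pi_Y l = [y k]" using k by (simp add: l_def pi_Y_def pi_Y_acc_replicate)
  moreover have "l \<in> lyndon_X - {[X0], [X1]}"
  proof -
    have "length l \<noteq> 1" using False k by (simp add: l_def)
    then have "l \<noteq> [X0]" "l \<noteq> [X1]" by auto
    then show ?thesis using lyndon_replicate by (simp add: l_def)
  qed
  ultimately have "\<gamma> (word_series [y k]) = multi_zeta [k]"
    using g k unfolding is_gamma_stuffle_def zeta_lyndon_def by (metis list.map y_inverse mem_Collect_eq)
  then show ?thesis using k False by (simp add: multi_zeta_single zeta_gamma_def)
qed (use g in \<open>simp add: is_gamma_stuffle_def zeta_gamma_def\<close>)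

lemma index_of_y [simp]: "1 \<le> k \<Longrightarrow> index_of (y k) = k"
  by (simp add: y_inverse)

lemma weight_replicate: "1 \<le> r \<Longrightarrow> weight (replicate n (y r)) = n * r"
  by (induction n) simp_all

lemma lcons_word: "lcons a (word_series u) = word_series (a # u)"
  by (auto simp: lcons_def word_series_def fun_eq_iff split: list.split)

lemma lcons_add: "lcons a (\<lambda>x. S x + T x) = (\<lambda>x. lcons a S x + lcons a T x)"
  by (auto simp: lcons_def fun_eq_iff split: list.split)

lemma lcons_sum: "lcons a (\<lambda>x. \<Sum>i\<in>I. S i x) = (\<lambda>x. \<Sum>i\<in>I. lcons a (S i) x)"
  by (auto simp: lcons_def fun_eq_iff split: list.split)

text \<open>The analogue of a monomial symmetric function with one distinguished exponent. For m = r
  the same word is counted l + 1 times, which yields the factor in Newton's identity.\<close>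

definition insertions :: "yletter series \<Rightarrow> nat \<Rightarrow> nat \<Rightarrow> nat \<Rightarrow> complex" where
  "insertions f r m l = (\<Sum>i\<le>l. f (replicate i (y r) @ y m # replicate (l - i) (y r)))"

lemma stuffle_letter_power:
  assumes r: "1 \<le> r" "1 \<le> m"
  shows "stuffle_words [y m] (replicate (Suc l) (y r)) x
    = insertions (\<lambda>u. word_series u x) r m (Suc l) + insertions (\<lambda>u. word_series u x) r (m + r) l"
proof (induction l arbitrary: x)
  case 0
  then show ?case using r by (simp add: insertions_def add_series_def lcons_word)
next
  case (Suc l)
  have shift: "insertions (\<lambda>u. word_series u x) r k (Suc n)
      = word_series (y k # replicate (Suc n) (y r)) x + lcons (y r) (\<lambda>x. insertions (\<lambda>u. word_series u x) r k n) x" for k n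
    unfolding insertions_def lcons_sum lcons_word by (subst sum.atMost_Suc_shift) simp
  have "stuffle_words [y m] (replicate (Suc (Suc l)) (y r)) x
      = word_series (y m # replicate (Suc (Suc l)) (y r)) x
      + (lcons (y r) (stuffle_words [y m] (replicate (Suc l) (y r))) x + word_series (y (m + r) # replicate (Suc l) (y r)) x)"
    using r by (simp add: add_series_def lcons_word)
  also have "stuffle_words [y m] (replicate (Suc l) (y r))
      = (\<lambda>x. insertions (\<lambda>u. word_series u x) r m (Suc l) + insertions (\<lambda>u. word_series u x) r (m + r) l)"
    by (rule ext) (rule Suc)
  finally show ?case unfolding lcons_add shift[of m "Suc l"] shift[of "m + r" l] by (simp only: add_ac)
qed

lemma stuffle_pairing_letter_power:
  assumes r: "1 \<le> r" "1 \<le> m"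
  shows "stuffle_pairing f [y m] (replicate (Suc l) (y r)) = insertions f r m (Suc l) + insertions f r (m + r) l"
proof -
  let ?A = "{w. weight w = weight [y m] + weight (replicate (Suc l) (y r))}"
  have one: "(\<Sum>w\<in>?A. f w * insertions (\<lambda>u. word_series u w) r k n) = insertions f r k n"
    if w: "\<And>i. i \<le> n \<Longrightarrow> replicate i (y r) @ y k # replicate (n - i) (y r) \<in> ?A" for k n
  proof -
    have "(\<Sum>w\<in>?A. f w * insertions (\<lambda>u. word_series u w) r k n)
        = (\<Sum>i\<le>n. \<Sum>w\<in>?A. f w * word_series (replicate i (y r) @ y k # replicate (n - i) (y r)) w)"
      unfolding insertions_def sum_distrib_left by (rule sum.swap)
    also have "\<dots> = insertions f r k n"
      unfolding insertions_def
    proof (intro sum.cong refl)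
      fix i assume "i \<in> {..n}"
      then have "replicate i (y r) @ y k # replicate (n - i) (y r) \<in> ?A" using w by simp
      then show "(\<Sum>w\<in>?A. f w * word_series (replicate i (y r) @ y k # replicate (n - i) (y r)) w)
          = f (replicate i (y r) @ y k # replicate (n - i) (y r))"
        using finite_weight by (simp add: word_series_def if_distrib[of "\<lambda>x. _ * x"] sum.delta cong: if_cong)
    qed
    finally show ?thesis .
  qed
  have wt: "weight (replicate i (y r) @ y k # replicate (n - i) (y r)) = k + n * r" if "i \<le> n" "1 \<le> k" for i n k
  proof -
    have "i * r + (n - i) * r = n * r" using that by (simp flip: distrib_right)
    then show ?thesis using r that by (simp add: weight_replicate)
  qed
  show ?thesis
    unfolding stuffle_pairing_def stuffle_letter_power[OF r] distrib_left sum.distrib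
    by (subst (1 2) one) (use wt r in \<open>auto simp: weight_replicate\<close>)
qed

text \<open>Newton's identity: letters play the role of power sums, and words in one letter that of
  elementary symmetric functions.\<close>

lemma newton_stuffle:
  assumes r: "1 \<le> r"
  shows "(\<Sum>i\<le>N. (-1) ^ i * stuffle_pairing f [y (r * (i + 1))] (replicate (N - i) (y r)))
    = of_nat (Suc N) * f (replicate (Suc N) (y r))"
proof -
  define a where "a i = insertions f r (r * (i + 1)) (N - i)" for i
  have pos: "1 \<le> r * (i + 1)" for i using r by simp
  \<comment> \<open>The letter is either inserted among the copies of \<open>y r\<close> or merged
    with one of them; the merged part has index r * (i + 2) and cancels against the next
    summand.\<close>
  have step: "stuffle_pairing f [y (r * (i + 1))] (replicate (N - i) (y r)) = a i + a (Suc i)" if "i < N" for i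
  proof -
    have "N - i = Suc (N - Suc i)" using that by simp
    moreover have "r * (i + 1) + r = r * (Suc i + 1)" by simp
    ultimately show ?thesis
      using stuffle_pairing_letter_power[OF r pos, of f i "N - Suc i"] by (simp only: a_def)
  qed
  have last: "stuffle_pairing f [y (r * (N + 1))] (replicate (N - N) (y r)) = a N"
    by (simp add: a_def insertions_def stuffle_pairing_Nil)
  have tele: "(\<Sum>i<M. (-1) ^ i * (a i + a (Suc i))) = a 0 - (-1) ^ M * a M" for M
    by (induction M) (simp_all add: algebra_simps)
  have "(\<Sum>i\<le>N. (-1) ^ i * stuffle_pairing f [y (r * (i + 1))] (replicate (N - i) (y r)))
      = (\<Sum>i<N. (-1) ^ i * (a i + a (Suc i))) + (-1) ^ N * a N"
  proof -
    have "(\<Sum>i<N. (-1) ^ i * stuffle_pairing f [y (r * (i + 1))] (replicate (N - i) (y r)))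
        = (\<Sum>i<N. (-1) ^ i * (a i + a (Suc i)))"
      by (intro sum.cong refl) (simp only: lessThan_iff step)
    then show ?thesis unfolding lessThan_Suc_atMost[symmetric] sum.lessThan_Suc last by (simp only:)
  qed
  also have "\<dots> = a 0" by (simp add: tele)
  also have "a 0 = (\<Sum>i\<le>N. f (replicate (Suc N) (y r)))"
    unfolding a_def insertions_def
  proof (intro sum.cong)
    fix i assume "i \<in> {..N}"
    then have "Suc N = i + Suc (N - i)" by simp
    then have "replicate (Suc N) (y r) = replicate i (y r) @ replicate (Suc (N - i)) (y r)" by (metis replicate_add)
    then show "f (replicate i (y r) @ y (r * (0 + 1)) # replicate (N - 0 - i) (y r)) = f (replicate (Suc N) (y r))" by simp
  qed simp
  finally show ?thesis by simp
qed

context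
  fixes \<gamma> :: "yletter series \<Rightarrow> complex"
  assumes g: "is_gamma_stuffle \<gamma>"
begin

lemma gch: "character_on polynomials stuffle \<gamma>"
  using g by (simp add: is_gamma_stuffle_def)

text \<open>For a character, Newton's identity becomes the recurrence of
  \<open>exp_power_series\<close>, and the exponent there is the series of
  \<open>ell r\<close>.\<close>

lemma gamma_letter_powers:
  assumes r: "1 \<le> r" and t: "norm t < 1"
  shows "(\<lambda>n. \<gamma> (word_series (replicate n (y r))) * (t ^ r) ^ n) sums exp (ell r t)"
proof -
  obtain C where C: "\<And>k. k \<ge> 1 \<Longrightarrow> norm (zeta_gamma k) \<le> C" using zeta_gamma_bounded by blast
  show ?thesis
  proof (rule exp_power_series[of "\<lambda>i. (-1) ^ i * zeta_gamma (r * (i + 1))" C])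
    show "norm ((-1) ^ i * zeta_gamma (r * (i + 1))) \<le> C" for i using C r by (simp add: norm_mult norm_power)
    show "\<gamma> (word_series (replicate 0 (y r))) = 1" using character_one[OF gch] by simp
    show "norm (t ^ r) < 1" using t r by (simp add: norm_power power_less_one_iff)
    show "of_nat (Suc N) * \<gamma> (word_series (replicate (Suc N) (y r)))
        = (\<Sum>i\<le>N. (-1) ^ i * zeta_gamma (r * (i + 1)) * \<gamma> (word_series (replicate (N - i) (y r))))" for N
    proof -
      have "(-1) ^ i * stuffle_pairing (\<lambda>w. \<gamma> (word_series w)) [y (r * (i + 1))] (replicate (N - i) (y r))
          = (-1) ^ i * zeta_gamma (r * (i + 1)) * \<gamma> (word_series (replicate (N - i) (y r)))" for i
        using gamma_letter[OF g, of "r * (i + 1)"] r by (simp only: stuffle_pairing_character[OF gch]) simp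
      then show ?thesis using newton_stuffle[OF r, of "\<lambda>w. \<gamma> (word_series w)" N] by (simp only:)
    qed
    show "(\<lambda>i. (-1) ^ i * zeta_gamma (r * (i + 1)) * (t ^ r) ^ Suc i / of_nat (Suc i)) sums ell r t"
      using ell_sums(1)[OF t r] by (simp only: power_mult[symmetric] Suc_eq_plus1)
  qed
qed

text \<open>Exponentials of weight below k cannot remove anything from a single letter of weight k,
  so the whole value of \<gamma> is left for the primitive part of weight k.\<close>

lemma log_coeff_letter:
  assumes k: "1 \<le> k" shows "log_coeff \<gamma> [y k] = zeta_gamma k"
proof -
  have "truncation \<gamma> K (word_series [y k]) = 0" if "K < k" for K
    using that
  proof (induction K)
    case (Suc K)
    have "expd (log_part \<gamma> K) (word_series [y k])
        = (\<lambda>v. word_series [y k] v + der (log_part \<gamma> K) (word_series [y k]) v)"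
    and z: "der (log_part \<gamma> K) (word_series [y k]) = (\<lambda>v. 0)"
    proof -
      show z: "der (log_part \<gamma> K) (word_series [y k]) = (\<lambda>v. 0)"
        unfolding der_def
      proof (rule ext, rule sum.neutral, rule ballI)
        fix v u assume "u \<in> {u. log_part \<gamma> K u \<noteq> 0}"
        then have "weight u = Suc K" by (auto simp: log_part_def[OF gch] split: if_splits)
        then have "u @ v \<noteq> [y k]" using Suc.prems k by (cases u) auto
        then show "log_part \<gamma> K u * word_series [y k] (u @ v) = 0" by (simp add: word_series_def)
      qed
      show "expd (log_part \<gamma> K) (word_series [y k])
        = (\<lambda>v. word_series [y k] v + der (log_part \<gamma> K) (word_series [y k]) v)"
        by (rule expd_nilpotent) (simp add: z)
    qed
    then show ?case using Suc by (simp add: truncation_Suc[OF gch] del: truncation.simps)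
  qed (simp add: truncation.simps(1)[OF gch] word_series_def)
  moreover obtain K where "k = Suc K" using k by (cases k) auto
  ultimately show ?thesis using gamma_letter[OF g k] k
    by (simp add: log_coeff_eq[OF gch] log_part_def[OF gch])
qed

text \<open>Being orthogonal to products of nonempty words, \<open>log_coeff\<close> kills all terms
  of Newton's identity except the last, whose second factor is the empty word.\<close>

lemma log_coeff_power:
  assumes r: "1 \<le> r"
  shows "of_nat (Suc N) * log_coeff \<gamma> (replicate (Suc N) (y r)) = (-1) ^ N * zeta_gamma (r * (N + 1))"
proof -
  have "(\<Sum>i\<le>N. (-1) ^ i * stuffle_pairing (log_coeff \<gamma>) [y (r * (i + 1))] (replicate (N - i) (y r)))
      = (-1) ^ N * stuffle_pairing (log_coeff \<gamma>) [y (r * (N + 1))] (replicate (N - N) (y r))"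
  proof -
    have "stuffle_pairing (log_coeff \<gamma>) [y (r * (i + 1))] (replicate (N - i) (y r)) = 0" if "i < N" for i
      by (rule stuffle_pairing_log_coeff[OF gch]) (use that in auto)
    then show ?thesis unfolding lessThan_Suc_atMost[symmetric] sum.lessThan_Suc by simp
  qed
  then show ?thesis using newton_stuffle[OF r, of "log_coeff \<gamma>" N] log_coeff_letter[of "r * (N + 1)"] r
    by (simp add: stuffle_pairing_Nil)
qed

section \<open>The extended stuffle character\<close>

context
  fixes \<rho> :: "(nat \<Rightarrow> complex) \<Rightarrow> complex"
  assumes rho_add: "\<And>f g. \<rho> (\<lambda>n. f n + g n) = \<rho> f + \<rho> g"
    and rho_scale: "\<And>c f. \<rho> (\<lambda>n. c * f n) = c * \<rho> f"
    and rho_suminf: "\<And>f. summable f \<Longrightarrow> \<rho> f = suminf f"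
begin

text \<open>A limit along the directed set of pairs of a weight bound and a finite set of sequences,
  of a net that is eventually constant. Algebraic operations therefore pass to it without any
  estimate.\<close>

definition eventual_value :: "yletter series \<Rightarrow> complex \<Rightarrow> bool" where
  "eventual_value S v \<longleftrightarrow> (\<exists>K \<Lambda>. finite \<Lambda> \<and>
     (\<forall>K' c. K \<le> K' \<longrightarrow> adapted \<rho> K' \<Lambda> c \<longrightarrow> approximation_char \<gamma> K' c S = v))"

definition gamma_ext :: "yletter series \<Rightarrow> complex" where
  "gamma_ext S = (THE v. eventual_value S v)"

lemma adapted_mono: "adapted \<rho> K \<Lambda>' c \<Longrightarrow> \<Lambda> \<subseteq> \<Lambda>' \<Longrightarrow> adapted \<rho> K \<Lambda> c"
  by (auto simp: adapted_def)

lemma eventual_value_pair: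
  assumes "eventual_value S v" "eventual_value T w"
  obtains K \<Lambda> where "finite \<Lambda>" "\<And>K' c. K \<le> K' \<Longrightarrow> adapted \<rho> K' \<Lambda> c \<Longrightarrow>
    hom_functional (approximation_char \<gamma> K' c) \<and> approximation_char \<gamma> K' c S = v \<and> approximation_char \<gamma> K' c T = w"
proof -
  obtain K1 \<Lambda>1 where 1: "finite \<Lambda>1" "\<And>K' c. K1 \<le> K' \<Longrightarrow> adapted \<rho> K' \<Lambda>1 c \<Longrightarrow> approximation_char \<gamma> K' c S = v"
    using assms(1) unfolding eventual_value_def by blast
  obtain K2 \<Lambda>2 where 2: "finite \<Lambda>2" "\<And>K' c. K2 \<le> K' \<Longrightarrow> adapted \<rho> K' \<Lambda>2 c \<Longrightarrow> approximation_char \<gamma> K' c T = w"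
    using assms(2) unfolding eventual_value_def by blast
  show ?thesis
  proof (rule that[of "\<Lambda>1 \<union> \<Lambda>2" "max K1 K2"])
    fix K' c assume K: "max K1 K2 \<le> K'" and ad: "adapted \<rho> K' (\<Lambda>1 \<union> \<Lambda>2) c"
    have "approximation_char \<gamma> K' c S = v" using K adapted_mono[OF ad] by (intro 1) auto
    moreover have "approximation_char \<gamma> K' c T = w" using K adapted_mono[OF ad] by (intro 2) auto
    moreover have "hom_functional (approximation_char \<gamma> K' c)"
      using ad by (intro hom_approximation[OF gch]) (simp add: adapted_def)
    ultimately show "hom_functional (approximation_char \<gamma> K' c) \<and> approximation_char \<gamma> K' c S = v \<and> approximation_char \<gamma> K' c T = w"
      by blast
  qed (use 1 2 in simp)
qed

text \<open>Two eventual values are attained by one and the same approximation, which exists by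
  \<open>adapted_exists\<close>.\<close>

lemma gamma_ext_eq:
  assumes "eventual_value S v" shows "gamma_ext S = v"
  unfolding gamma_ext_def
proof (rule the_equality)
  fix w assume "eventual_value S w"
  then obtain K \<Lambda> where *: "finite \<Lambda>" "\<And>K' c. K \<le> K' \<Longrightarrow> adapted \<rho> K' \<Lambda> c \<Longrightarrow>
    hom_functional (approximation_char \<gamma> K' c) \<and> approximation_char \<gamma> K' c S = v \<and> approximation_char \<gamma> K' c S = w"
    using eventual_value_pair[OF assms] by metis
  obtain c where "adapted \<rho> K \<Lambda> c" using adapted_exists[OF rho_add rho_scale rho_suminf *(1)] by blast
  then show "w = v" using *(2)[of K c] by (metis order_refl)
qed fact

lemma eventual_value_add:
  assumes "eventual_value S v" "eventual_value T w" "growth S" "growth T"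
  shows "eventual_value (\<lambda>x. S x + T x) (v + w)"
proof -
  obtain K \<Lambda> where *: "finite \<Lambda>" "\<And>K' c. K \<le> K' \<Longrightarrow> adapted \<rho> K' \<Lambda> c \<Longrightarrow>
    hom_functional (approximation_char \<gamma> K' c) \<and> approximation_char \<gamma> K' c S = v \<and> approximation_char \<gamma> K' c T = w"
    using eventual_value_pair[OF assms(1,2)] by metis
  show ?thesis unfolding eventual_value_def
    using *(2) by (intro exI[of _ K] exI[of _ \<Lambda>]) (simp add: *(1) hom_functionalD(1) assms(3,4))
qed

lemma eventual_value_stuffle:
  assumes "eventual_value S v" "eventual_value T w" "growth S" "growth T"
  shows "eventual_value (stuffle S T) (v * w)"
proof -
  obtain K \<Lambda> where *: "finite \<Lambda>" "\<And>K' c. K \<le> K' \<Longrightarrow> adapted \<rho> K' \<Lambda> c \<Longrightarrow>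
    hom_functional (approximation_char \<gamma> K' c) \<and> approximation_char \<gamma> K' c S = v \<and> approximation_char \<gamma> K' c T = w"
    using eventual_value_pair[OF assms(1,2)] by metis
  show ?thesis unfolding eventual_value_def
    using *(2) by (intro exI[of _ K] exI[of _ \<Lambda>]) (simp add: *(1) hom_functionalD(3) assms(3,4))
qed

lemma eventual_value_scale:
  assumes "eventual_value S v" "growth S"
  shows "eventual_value (\<lambda>x. d * S x) (d * v)"
proof -
  obtain K \<Lambda> where *: "finite \<Lambda>" "\<And>K' c. K \<le> K' \<Longrightarrow> adapted \<rho> K' \<Lambda> c \<Longrightarrow>
    hom_functional (approximation_char \<gamma> K' c) \<and> approximation_char \<gamma> K' c S = v \<and> approximation_char \<gamma> K' c S = v"
    using eventual_value_pair[OF assms(1,1)] by metis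
  show ?thesis unfolding eventual_value_def
    using *(2) by (intro exI[of _ K] exI[of _ \<Lambda>]) (simp add: *(1) hom_functionalD(2) assms(2))
qed

lemma eventual_value_polynomial:
  assumes "P \<in> polynomials" shows "eventual_value P (\<gamma> P)"
proof -
  have fin: "finite {w. P w \<noteq> 0}" using assms by (simp add: polynomials_def)
  define K where "K = Max (insert 0 (weight ` {w. P w \<noteq> 0}))"
  have K: "weight w \<le> K" if "P w \<noteq> 0" for w unfolding K_def using fin that by (intro Max_ge) auto
  have "approximation_char \<gamma> K' c P = \<gamma> P" if "K \<le> K'" "adapted \<rho> K' {} c" for K' c
    by (rule approximation_polynomial[OF gch assms]) (use K that in \<open>auto simp: adapted_def intro: le_trans\<close>)
  then show ?thesis unfolding eventual_value_def by (intro exI[of _ K] exI[of _ "{}"]) simp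
qed

text \<open>On a finite-dimensional space of series closed under removing first letters, the derivation of
  \<open>weighted_log \<gamma> c\<close> depends only on the finitely many values \<open>pairing c l\<close>.\<close>

lemma eventual_value_rational:
  assumes G: "G \<in> rational_exchangeable"
  shows "\<exists>v. eventual_value G v" "growth G"
proof -
  have ex: "exchangeable G" and "G \<in> rational_series" using G by (auto simp: rational_exchangeable_def)
  then obtain B where B: "closed_space B" "G \<in> lspan B" using rational_closed_space by blast
  show gr: "growth G" using B by (rule growth_closed_space)
  have fin: "finite B" using B by (simp add: closed_space_def)
  have "\<forall>V u. \<exists>d. V \<in> B \<longrightarrow> (\<forall>w. V (u @ w) = (\<Sum>W\<in>B. d W * W w))"
    using closed_space_quotients[OF B(1) lspan_base[OF fin]] by (force simp: lspan_def fun_eq_iff)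
  then obtain d where d: "\<And>V u w. V \<in> B \<Longrightarrow> V (u @ w) = (\<Sum>W\<in>B. d V u W * W w)" by metis
  \<comment> \<open>Weight by weight, the matrix entries of the derivation on the space spanned by
    \<open>B\<close>; finitely many sequences, which need not be summable.\<close>
  define l where "l V W k = (\<Sum>u | weight u = k. log_coeff \<gamma> u * d V u W)" for V W k
  define \<Lambda> where "\<Lambda> = (\<lambda>(V, W). l V W) ` (B \<times> B)"
  have der_eq: "der (weighted_log \<gamma> c) V = (\<lambda>w. \<Sum>W\<in>B. \<rho> (l V W) * W w)" if c: "adapted \<rho> K \<Lambda> c" and V: "V \<in> B" for K c V
  proof
    fix w
    have fc: "finite {k. c k \<noteq> 0}" using c by (simp add: adapted_def)
    have "(\<Sum>u | weight u = k. log_coeff \<gamma> u * V (u @ w)) = (\<Sum>W\<in>B. l V W k * W w)" for k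
      unfolding d[OF V] l_def sum_distrib_left sum_distrib_right by (subst sum.swap) (simp add: mult.assoc)
    then have "der (weighted_log \<gamma> c) V w = pairing c (\<lambda>k. \<Sum>W\<in>B. l V W k * W w)"
      by (simp add: der_weighted_log[OF gch fc])
    also have "\<dots> = (\<Sum>W\<in>B. pairing c (l V W) * W w)"
      unfolding pairing_def sum_distrib_left sum_distrib_right by (subst sum.swap) (simp add: mult.assoc)
    also have "\<dots> = (\<Sum>W\<in>B. \<rho> (l V W) * W w)"
      using c V by (intro sum.cong) (auto simp: adapted_def \<Lambda>_def)
    finally show "der (weighted_log \<gamma> c) V w = (\<Sum>W\<in>B. \<rho> (l V W) * W w)" .
  qed
  have der_lin: "der \<xi> (\<lambda>w. \<Sum>V\<in>B. e V * V w) = (\<lambda>w. \<Sum>V\<in>B. e V * der \<xi> V w)" for \<xi> e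
    by (rule ext) (simp add: der_sum der_scale)
  have der_span: "der (weighted_log \<gamma> c) S = der (weighted_log \<gamma> c') S \<and> der (weighted_log \<gamma> c) S \<in> lspan B"
    if c: "adapted \<rho> K \<Lambda> c" "adapted \<rho> K' \<Lambda> c'" and S: "S \<in> lspan B" for K K' c c' S
  proof -
    obtain e where e: "S = (\<lambda>w. \<Sum>V\<in>B. e V * V w)" using S by (auto simp: lspan_def)
    have "der (weighted_log \<gamma> c) S = der (weighted_log \<gamma> c') S"
      unfolding e der_lin using der_eq[OF c(1)] der_eq[OF c(2)] by (intro ext sum.cong) auto
    moreover have "der (weighted_log \<gamma> c) S \<in> lspan B"
    proof (rule lspan_lspan[OF S _ der_lin])
      show "der (weighted_log \<gamma> c) V \<in> lspan B" if "V \<in> B" for V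
        unfolding der_eq[OF c(1) that] by (auto simp: lspan_def)
    qed
    ultimately show ?thesis by blast
  qed
  have dpow_eq: "dpow (weighted_log \<gamma> c) n G = dpow (weighted_log \<gamma> c') n G \<and> dpow (weighted_log \<gamma> c) n G \<in> lspan B"
    if c: "adapted \<rho> K \<Lambda> c" "adapted \<rho> K' \<Lambda> c'" for K K' c c' n
  proof (induction n)
    case (Suc n)
    then have eq: "dpow (weighted_log \<gamma> c) n G = dpow (weighted_log \<gamma> c') n G" and mem: "dpow (weighted_log \<gamma> c) n G \<in> lspan B" by auto
    have "(\<lambda>v. (1 / of_nat (Suc n)) * der (weighted_log \<gamma> c) (dpow (weighted_log \<gamma> c) n G) v) \<in> lspan B"
      using der_span[OF c mem] by (intro lspan_scale) blast
    moreover have "der (weighted_log \<gamma> c) (dpow (weighted_log \<gamma> c) n G) = der (weighted_log \<gamma> c') (dpow (weighted_log \<gamma> c') n G)"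
      using der_span[OF c mem] by (simp add: eq)
    ultimately show ?case by (simp del: of_nat_Suc)
  qed (simp add: B)
  have appr: "approximation_char \<gamma> K c G = expd (weighted_log \<gamma> c) G []" if "adapted \<rho> K \<Lambda> c" for K c
    by (rule approximation_exchangeable[OF gch ex gr]) (use that in \<open>auto simp: adapted_def\<close>)
  have "finite \<Lambda>" using fin by (simp add: \<Lambda>_def)
  then obtain c0 where c0: "adapted \<rho> 0 \<Lambda> c0" using adapted_exists[OF rho_add rho_scale rho_suminf] by blast
  have "approximation_char \<gamma> K c G = expd (weighted_log \<gamma> c0) G []" if "adapted \<rho> K \<Lambda> c" for K c
    unfolding appr[OF that] expd_def using dpow_eq[OF that c0] by simp
  then show "\<exists>v. eventual_value G v" unfolding eventual_value_def using \<open>finite \<Lambda>\<close> by blast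
qed

lemma rational_letter_star: "star (scale_series t (word_series [a])) \<in> rational_exchangeable"
proof -
  have "word_series [a] \<in> rational_series" by (rule rational_series.degree_one) (auto simp: word_series_def)
  then have "star (scale_series t (word_series [a])) \<in> rational_series"
    by (intro rational_series.star rational_series.scale) (simp_all add: scale_series_def word_series_def)
  then show ?thesis by (simp add: rational_exchangeable_def star_letter exchangeable_mult_series)
qed

text \<open>The star G is multiplicative on words, hence a common eigenvector of all derivations.
  The eigenvalue is the pairing with one sequence whose ordinary sum is \<open>ell r t\<close>, so
  the choice of \<rho> has no influence on it, and the exponential multiplies G by
  \<open>exp (ell r t)\<close>.\<close>

lemma eventual_value_letter:
  assumes t: "norm t < 1" and r: "1 \<le> r"
  shows "eventual_value (star (scale_series (t ^ r) (word_series [y r]))) (exp (ell r t))"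
proof -
  define G where "G = star (scale_series (t ^ r) (word_series [y r]))"
  have Gm: "G = mult_series (\<lambda>a. if a = y r then t ^ r else 0)" by (simp add: G_def star_letter)
  have gr: "growth G" and ex: "exchangeable G"
    using eventual_value_rational(2)[OF rational_letter_star] rational_letter_star[of "t ^ r" "y r"]
    by (auto simp: G_def rational_exchangeable_def)
  define l where "l k = (\<Sum>u | weight u = k. log_coeff \<gamma> u * G u)" for k
  \<comment> \<open>Among the words of a given weight at most one power of \<open>y r\<close>
    occurs, and G vanishes at all other words; so each multiple of r carries a single term.\<close>
  have lval: "l (r * Suc n) = (-1) ^ n * zeta_gamma (r * (n + 1)) * t ^ (r * (n + 1)) / of_nat (n + 1)" for n
  proof -
    have "l (r * Suc n) = (\<Sum>u\<in>{replicate (Suc n) (y r)}. log_coeff \<gamma> u * G u)"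
      unfolding l_def
    proof (rule sum.mono_neutral_right[OF finite_weight])
      show "{replicate (Suc n) (y r)} \<subseteq> {u. weight u = r * Suc n}" using weight_replicate[OF r, of "Suc n"] by (simp add: mult.commute)
      show "\<forall>u\<in>{u. weight u = r * Suc n} - {replicate (Suc n) (y r)}. log_coeff \<gamma> u * G u = 0"
      proof
        fix u assume u: "u \<in> {u. weight u = r * Suc n} - {replicate (Suc n) (y r)}"
        have "u \<noteq> replicate (length u) (y r)"
        proof
          assume e: "u = replicate (length u) (y r)"
          then have "weight u = length u * r" using weight_replicate[OF r] by metis
          then have "length u * r = Suc n * r" using u by (simp add: mult.commute)
          then have "length u = Suc n" using r by (metis mult_cancel2 not_one_le_zero)
          then show False using u e by simp
        qed
        then show "log_coeff \<gamma> u * G u = 0" by (simp add: Gm mult_series_single)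
      qed
    qed
    also have "\<dots> = log_coeff \<gamma> (replicate (Suc n) (y r)) * (t ^ r) ^ Suc n"
      by (simp add: Gm mult_series_single del: replicate.simps power_Suc)
    also have "(t ^ r) ^ Suc n = t ^ (r * Suc n)" by (rule power_mult[symmetric])
    finally have "l (r * Suc n) = log_coeff \<gamma> (replicate (Suc n) (y r)) * t ^ (r * Suc n)" .
    moreover have "log_coeff \<gamma> (replicate (Suc n) (y r)) = (-1) ^ n * zeta_gamma (r * (n + 1)) / of_nat (Suc n)"
      using log_coeff_power[OF r, of n] by (metis nonzero_mult_div_cancel_left of_nat_neq_0)
    ultimately show ?thesis by (simp only: Suc_eq_plus1 times_divide_eq_left)
  qed
  have "l k = 0" if "k \<notin> range (\<lambda>n. r * Suc n)" for k
    unfolding l_def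
  proof (rule sum.neutral, rule ballI)
    fix u assume u: "u \<in> {u. weight u = k}"
    show "log_coeff \<gamma> u * G u = 0"
    proof (cases "u = replicate (length u) (y r)")
      case True
      then have k: "k = r * length u" using u weight_replicate[OF r, of "length u"] by (simp add: mult.commute)
      have "length u = 0" using that k by (cases "length u") auto
      then show ?thesis by (simp add: log_coeff_Nil[OF gch])
    qed (simp add: Gm mult_series_single)
  qed
  moreover have "strict_mono (\<lambda>n. r * Suc n)" using r by (auto simp: strict_mono_def)
  ultimately have "l sums ell r t" using sums_mono_reindex[of "\<lambda>n. r * Suc n" l "ell r t"] ell_sums(1)[OF t r] lval by simp
  then have rho_l: "\<rho> l = ell r t" using rho_suminf by (simp add: sums_iff)
  have "approximation_char \<gamma> K c G = exp (ell r t)" if c: "adapted \<rho> K {l} c" for K c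
  proof -
    have fc: "finite {k. c k \<noteq> 0}" and p: "pairing c l = ell r t" using c rho_l by (auto simp: adapted_def)
    have "(\<Sum>u | weight u = k. log_coeff \<gamma> u * G (u @ v)) = l k * G v" for k v
      by (simp add: l_def Gm mult_series_append sum_distrib_right mult.assoc)
    then have der: "der (weighted_log \<gamma> c) G = (\<lambda>v. ell r t * G v)"
      by (auto simp: der_weighted_log[OF gch fc] p[symmetric] pairing_def sum_distrib_right mult.assoc)
    have "dpow (weighted_log \<gamma> c) n G = (\<lambda>v. (ell r t ^ n / fact n) * G v)" for n
    proof (induction n)
      case (Suc n)
      have "dpow (weighted_log \<gamma> c) (Suc n) G = (\<lambda>v. (ell r t ^ n / fact n) * (ell r t * G v) / of_nat (Suc n))"
        by (simp only: dpow.simps Suc der_scale der)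
      also have "\<dots> = (\<lambda>v. (ell r t ^ Suc n / fact (Suc n)) * G v)"
        by (rule ext) (simp add: field_simps del: of_nat_Suc)
      finally show ?case .
    qed simp
    then have "expd (weighted_log \<gamma> c) G [] = (\<Sum>n. ell r t ^ n / fact n)"
      by (simp add: expd_def Gm)
    also have "\<dots> = exp (ell r t)"
      by (simp add: exp_def scaleR_conv_of_real divide_inverse mult.commute)
    finally show ?thesis
      using approximation_exchangeable[OF gch ex gr fc, of K] c by (simp add: adapted_def)
  qed
  then show ?thesis unfolding eventual_value_def G_def[symmetric] by (intro exI[of _ 0] exI[of _ "{l}"]) simp
qed

lemma product_span_eventual:
  assumes "S \<in> product_span stuffle polynomials rational_exchangeable"
  shows "growth S" "eventual_value S (gamma_ext S)"
proof -
  obtain k :: nat and P G where S: "S = (\<lambda>w. \<Sum>i<k. stuffle (P i) (G i) w)"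
    and PG: "\<forall>i<k. P i \<in> polynomials \<and> G i \<in> rational_exchangeable"
    using assms unfolding product_span_def by blast
  have gr: "growth (stuffle (P i) (G i))" if "i < k" for i
    using PG that by (intro growth_stuffle growth_polynomial[OF gch] eventual_value_rational(2)) auto
  have grs: "growth (\<lambda>w. \<Sum>i<j. stuffle (P i) (G i) w)" if "j \<le> k" for j using gr that by (intro growth_sum) auto
  then show "growth S" unfolding S by simp
  have "\<exists>v. eventual_value (\<lambda>w. \<Sum>i<j. stuffle (P i) (G i) w) v" if "j \<le> k" for j
    using that
  proof (induction j)
    case 0
    have "eventual_value (\<lambda>w. 0) (\<gamma> (\<lambda>w. 0))" by (rule eventual_value_polynomial[OF polynomials_zero])
    then show ?case by auto
  next
    case (Suc j)
    then have j: "j < k" by simp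
    obtain v where v: "eventual_value (\<lambda>w. \<Sum>i<j. stuffle (P i) (G i) w) v" using Suc by auto
    obtain w where w: "eventual_value (G j) w" using eventual_value_rational(1) PG j by blast
    have "eventual_value (stuffle (P j) (G j)) (\<gamma> (P j) * w)"
      using PG j w by (intro eventual_value_stuffle eventual_value_polynomial growth_polynomial[OF gch] eventual_value_rational(2)) auto
    from eventual_value_add[OF v this grs gr[OF j]] Suc.prems show ?case by auto
  qed
  then obtain v where "eventual_value S v" unfolding S by blast
  then show "eventual_value S (gamma_ext S)" using gamma_ext_eq by metis
qed

lemma gamma_ext_character:
  "character_on (product_span stuffle polynomials rational_exchangeable) stuffle gamma_ext"
  unfolding character_on_def
proof (intro conjI allI ballI)
  show "gamma_ext (word_series []) = 1"
    using gamma_ext_eq[OF eventual_value_polynomial[OF polynomials_word]] character_one[OF gch] by simp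
next
  fix c S assume "S \<in> product_span stuffle polynomials rational_exchangeable"
  then show "gamma_ext (scale_series c S) = c * gamma_ext S"
    unfolding scale_series_def by (intro gamma_ext_eq eventual_value_scale product_span_eventual)
next
  fix S T assume "S \<in> product_span stuffle polynomials rational_exchangeable"
    "T \<in> product_span stuffle polynomials rational_exchangeable"
  note ST = product_span_eventual[OF this(1)] product_span_eventual[OF this(2)]
  show "gamma_ext (add_series S T) = gamma_ext S + gamma_ext T"
    unfolding add_series_def by (intro gamma_ext_eq eventual_value_add ST)
  show "gamma_ext (stuffle S T) = gamma_ext S * gamma_ext T"
    by (intro gamma_ext_eq eventual_value_stuffle ST)
qed

lemma gamma_hom_part:
  assumes t: "norm t < 1" and r: "1 \<le> r"
  shows "(\<lambda>n. \<gamma> (hom_part n (star (scale_series (t ^ r) (word_series [y r]))))) sums exp (ell r t)"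
proof -
  have "hom_part n (star (scale_series (t ^ r) (word_series [y r]))) = (\<lambda>w. (t ^ r) ^ n * word_series (replicate n (y r)) w)" for n
    unfolding star_letter by (auto simp: hom_part_def mult_series_single word_series_def fun_eq_iff)
  then have "\<gamma> (hom_part n (star (scale_series (t ^ r) (word_series [y r])))) = \<gamma> (word_series (replicate n (y r))) * (t ^ r) ^ n" for n
    using character_scale[OF gch polynomials_word] by (simp add: mult.commute)
  then show ?thesis using gamma_letter_powers[OF r t] by simp
qed

end

end

theorem gamma_extension:
  assumes g: "is_gamma_stuffle \<gamma>"
  shows "\<exists>\<phi>. character_on (product_span stuffle polynomials rational_exchangeable) stuffle \<phi> \<and>
    (\<forall>P\<in>polynomials. \<phi> P = \<gamma> P) \<and>
    (\<forall>t r. norm t < 1 \<longrightarrow> 1 \<le> r \<longrightarrow>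
       (let S = star (scale_series (t ^ r) (word_series [y r]))
        in \<phi> S = inverse (Gamma_y r (1 + t)) \<and> (\<lambda>n. \<gamma> (hom_part n S)) sums \<phi> S))"
proof -
  obtain \<rho> :: "(nat \<Rightarrow> complex) \<Rightarrow> complex" where \<rho>:
    "\<And>f g. \<rho> (\<lambda>n. f n + g n) = \<rho> f + \<rho> g" "\<And>c f. \<rho> (\<lambda>n. c * f n) = c * \<rho> f"
    "\<And>f. summable f \<Longrightarrow> \<rho> f = suminf f"
    using summation_functional by blast
  have inv: "inverse (Gamma_y r (1 + t)) = exp (ell r t)" for r t by (simp add: Gamma_y_def exp_minus)
  show ?thesis
    using gamma_ext_character[OF g \<rho>] gamma_ext_eq[OF g \<rho> eventual_value_polynomial[OF g \<rho>]]
      gamma_ext_eq[OF g \<rho> eventual_value_letter[OF g \<rho>]] gamma_hom_part[OF g \<rho>]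
    by (intro exI[of _ "gamma_ext \<gamma> \<rho>"]) (simp add: Let_def inv)
qed

theorem theorem2p22:
  fixes zeta_sh :: "xletter series \<Rightarrow> complex"
    and gamma_st :: "yletter series \<Rightarrow> complex"
  assumes zeta_sh: "is_zeta_shuffle zeta_sh"
    and gamma_st: "is_gamma_stuffle gamma_st"
  shows
    "(\<exists>\<phi>. character_on (product_span shuffle polynomials rational_exchangeable) shuffle \<phi> \<and>
        (\<forall>P\<in>polynomials. \<phi> P = zeta_sh P) \<and>
        (\<forall>t x. norm t < 1 \<longrightarrow>
           (let S = star (scale_series t (word_series [x]))
            in \<phi> S = 1 \<and> (\<lambda>n. zeta_sh (hom_part n S)) sums \<phi> S)))
     \<and>
     (\<exists>\<phi>. character_on (product_span stuffle polynomials rational_exchangeable) stuffle \<phi> \<and>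
        (\<forall>P\<in>polynomials. \<phi> P = gamma_st P) \<and>
        (\<forall>t r. norm t < 1 \<longrightarrow> 1 \<le> r \<longrightarrow>
           (let S = star (scale_series (t ^ r) (word_series [y r]))
            in \<phi> S = inverse (Gamma_y r (1 + t)) \<and> (\<lambda>n. gamma_st (hom_part n S)) sums \<phi> S)))
     \<and>
     (let A = generated_algebra shuffle {star (word_series [y r]) | r. 1 \<le> r}
      in \<exists>\<Phi>. \<Phi> \<in> A \<rightarrow> eulerian_algebra \<and>
           morphism_to_functions A shuffle \<Phi> \<and>
           (\<forall>r\<ge>1. \<Phi> (star (word_series [y r])) = (\<lambda>z\<in>disc. inverse (Gamma_y r (1 + z)))) \<and>
           inj_on \<Phi> A)
     \<and>
     (\<forall>r\<ge>1. \<forall>t \<omega> \<eta> :: complex. norm t < 1 \<longrightarrow> \<omega> ^ (2 * r) = -1 \<longrightarrow> \<eta> ^ r = -1 \<longrightarrow>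
        Gamma_y (2 * r) (1 + \<omega> * t) = Gamma_y r (1 + t) * Gamma_y r (1 + \<eta> * t))"
proof (intro conjI)
  show "\<exists>\<phi>. character_on (product_span shuffle polynomials rational_exchangeable) shuffle \<phi> \<and>
      (\<forall>P\<in>polynomials. \<phi> P = zeta_sh P) \<and>
      (\<forall>t x. norm t < 1 \<longrightarrow>
         (let S = star (scale_series t (word_series [x]))
          in \<phi> S = 1 \<and> (\<lambda>n. zeta_sh (hom_part n S)) sums \<phi> S))"
    using zeta_extension[OF zeta_sh] by (intro exI[of _ "zeta_ext zeta_sh"]) (simp add: Let_def)
  show "\<exists>\<phi>. character_on (product_span stuffle polynomials rational_exchangeable) stuffle \<phi> \<and>
      (\<forall>P\<in>polynomials. \<phi> P = gamma_st P) \<and>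
      (\<forall>t r. norm t < 1 \<longrightarrow> 1 \<le> r \<longrightarrow>
         (let S = star (scale_series (t ^ r) (word_series [y r]))
          in \<phi> S = inverse (Gamma_y r (1 + t)) \<and> (\<lambda>n. gamma_st (hom_part n S)) sums \<phi> S))"
    by (rule gamma_extension[OF gamma_st])
  show "let A = star_algebra
      in \<exists>\<Phi>. \<Phi> \<in> A \<rightarrow> eulerian_algebra \<and> morphism_to_functions A shuffle \<Phi> \<and>
        (\<forall>r\<ge>1. \<Phi> (star (word_series [y r])) = (\<lambda>z\<in>disc. inverse (Gamma_y r (1 + z)))) \<and> inj_on \<Phi> A"
    unfolding Let_def by (intro exI[of _ function_of] conjI eulerian_morphism)
  show "\<forall>r\<ge>1. \<forall>t \<omega> \<eta> :: complex. norm t < 1 \<longrightarrow> \<omega> ^ (2 * r) = -1 \<longrightarrow> \<eta> ^ r = -1 \<longrightarrow>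
      Gamma_y (2 * r) (1 + \<omega> * t) = Gamma_y r (1 + t) * Gamma_y r (1 + \<eta> * t)"
    by (simp add: Gamma_y_def ell_duplication mult_exp_exp)
qed

end
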